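(* Let $\mathfrak R$ be a nc rational function of $x_1,\dots,x_d$ over a field $\mathbb K$. For every nc rational expression $R\in\mathfrak R$, every integer $s\in\mathbb N$, every point $\underline Y\in dom_s(\mathfrak R)$, every minimal nc Fornasini--Marchesini realization $\mathcal R$ centred at $\underline Y$ of $R$, and every unital stably finite $\mathbb K$-algebra $\mathcal A$, the following hold (with $n\in\mathbb N$). 1. If $\underline Z\in dom_n(\mathfrak R)$, then $I_s\otimes\underline Z\in DOM_{sn}(\mathcal R)$ and $I_s\otimes\mathfrak R(\underline Z)=\mathcal R(I_s\otimes\underline Z)$. 2. If $s\mid n$, then $dom_n(\mathfrak R)\subseteq DOM_n(\mathcal R)$ and $\mathfrak R(\underline Z)=\mathcal R(\underline Z)$ for every $\underline Z\in dom_n(\mathfrak R)$. 3. If $\underline{\mathfrak a}\in dom^{\mathcal A}(\mathfrak R)$, then $I_s\otimes\underline{\mathfrak a}\in DOM^{\mathcal A}(\mathcal R)$ and $I_s\otimes\mathfrak R^{\mathcal A}(\underline{\mathfrak a})=\mathcal R^{\mathcal A}(I_s\otimes\underline{\mathfrak a})$.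
   Context: $\mathbb K$ is a field, $\mathbb N=\{1,2,\dots\}$, $d\in\mathbb N$; underlined letters denote tuples, and operations such as $I_s\otimes\underline Z=(I_s\otimes Z_1,\dots,I_s\otimes Z_d)$ act componentwise ($\otimes$ is the Kronecker product). NC rational expressions. A nc rational expression $R$ in $x_1,\dots,x_d$ over $\mathbb K$ is a formal expression obtained from nc polynomials in $\mathbb K\langle x_1,\dots,x_d\rangle$ by successive additions, multiplications and inversions. For a unital $\mathbb K$-algebra $\mathcal A$, its domain $dom^{\mathcal A}(R)\subseteq\mathcal A^d$ and evaluation $R^{\mathcal A}(\underline{\mathfrak a})\in\mathcal A$ are defined recursively: for a nc polynomial the domain is $\mathcal A^d$ and evaluation is substitution; for $R=R_1+R_2$ or $R=R_1R_2$ the domain is $dom^{\mathcal A}(R_1)\cap dom^{\mathcal A}(R_2)$ and the value is the sum, resp. product, of the values; for $R=R_1^{-1}$ the domain is $\{\underline{\mathfrak a}\in dom^{\mathcal A}(R_1): R_1^{\mathcal A}(\underline{\mathfrak a})\text{ invertible in }\mathcal A\}$ and $R^{\mathcal A}(\underline{\mathfrak a})=R_1^{\mathcal A}(\underline{\mathfrak a})^{-1}$. For $\mathcal A=\mathbb K^{n\times n}$ write $dom_n(R)$ and $R(\underline X)$; $dom(R)=\coprod_{n\ge1}dom_n(R)$; $R$ is non-degenerate if $dom(R)\neq\emptyset$. Two expressions $R_1,R_2$ are $(\mathbb K^d)_{nc}$-evaluation equivalent if $R_1(\underline X)=R_2(\underline X)$ for all $\underline X\in dom(R_1)\cap dom(R_2)$.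 NC rational functions. A nc rational function $\mathfrak R$ is an equivalence class of non-degenerate nc rational expressions under $(\mathbb K^d)_{nc}$-evaluation equivalence. $dom_n(\mathfrak R)=\bigcup_{R\in\mathfrak R}dom_n(R)$, and $\mathfrak R(\underline X)=R(\underline X)$ for any $R\in\mathfrak R$ with $\underline X\in dom_n(R)$. Likewise $dom^{\mathcal A}(\mathfrak R)=\bigcup_{R\in\mathfrak R}dom^{\mathcal A}(R)$ and $\mathfrak R^{\mathcal A}(\underline{\mathfrak a})=R^{\mathcal A}(\underline{\mathfrak a})$ for any $R\in\mathfrak R$ with $\underline{\mathfrak a}\in dom^{\mathcal A}(R)$ (independent of the choice of $R$ when $\mathcal A$ is stably finite). A unital $\mathbb K$-algebra $\mathcal A$ is stably finite if for all $m\in\mathbb N$ and $\mathfrak A,\mathfrak B\in\mathcal A^{m\times m}$: $\mathfrak A\mathfrak B=I_m\otimes 1_{\mathcal A}$ iff $\mathfrak B\mathfrak A=I_m\otimes1_{\mathcal A}$. Realizations. Let $\underline Y\in(\mathbb K^{s\times s})^d$. A nc Fornasini--Marchesini realization $\mathcal R$ centred at $\underline Y$, described by $(L,D,C,\underline{\mathbf A},\underline{\mathbf B})$, consists of a dimension $L\in\mathbb N$, linear mappings $\mathbf A_1,\dots,\mathbf A_d:\mathbb K^{s\times s}\to\mathbb K^{L\times L}$, $\mathbf B_1,\dots,\mathbf B_d:\mathbb K^{s\times s}\to\mathbb K^{L\times s}$ and matrices $C\in\mathbb K^{s\times L}$, $D\in\mathbb K^{s\times s}$. A linear mapping $\mathbf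 T$ on $s\times s$ matrices is extended to $X=[X_{ij}]_{i,j=1}^m\in\mathbb K^{sm\times sm}$ ($X_{ij}\in\mathbb K^{s\times s}$) by $(X)\mathbf T=[\mathbf T(X_{ij})]_{i,j=1}^m$. Put $DOM_{sm}(\mathcal R)=\{\underline X\in(\mathbb K^{sm\times sm})^d:\det(I_{Lm}-\sum_k(X_k-I_m\otimes Y_k)\mathbf A_k)\ne0\}$ and for such $\underline X$ $$\mathcal R(\underline X)=I_m\otimes D+(I_m\otimes C)\Big(I_{Lm}-\sum_k(X_k-I_m\otimes Y_k)\mathbf A_k\Big)^{-1}\sum_k(X_k-I_m\otimes Y_k)\mathbf B_k.$$ For a unital $\mathbb K$-algebra $\mathcal A$, identify $\mathcal A^{p\times q}=\mathbb K^{p\times q}\otimes\mathcal A$ and extend $\mathbf T$ by $(\mathfrak A)\mathbf T^{\mathcal A}=\sum_{i,j}\mathbf T(E_{ij})\otimes\mathfrak a_{ij}$ for $\mathfrak A=\sum_{i,j} E_{ij}\otimes\mathfrak a_{ij}$. $DOM^{\mathcal A}(\mathcal R)$ is the set of $\underline{\mathfrak A}\in(\mathcal A^{s\times s})^d$ for which $I_L\otimes1_{\mathcal A}-\sum_k(\mathfrak A_k-Y_k\otimes1_{\mathcal A})\mathbf A_k^{\mathcal A}$ is invertible in $\mathcal A^{L\times L}$, and then $$\mathcal R^{\mathcal A}(\underline{\mathfrak A})=D\otimes1_{\mathcal A}+(C\otimes1_{\mathcal A})\Big(I_L\otimes1_{\mathcal A}-\sum_k(\mathfrak A_k-Y_k\otimes1_{\mathcal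 A})\mathbf A_k^{\mathcal A}\Big)^{-1}\sum_k(\mathfrak A_k-Y_k\otimes1_{\mathcal A})\mathbf B_k^{\mathcal A}.$$ Realization of an expression. For a nc rational expression $R$ and a point $\underline Y\in dom_s(R)$, a nc Fornasini--Marchesini realization $\mathcal R$ centred at $\underline Y$ is a realization of $R$ if for every $m\in\mathbb N$: $dom_{sm}(R)\subseteq DOM_{sm}(\mathcal R)$ and $R(\underline X)=\mathcal R(\underline X)$ for all $\underline X\in dom_{sm}(R)$. It is minimal if its dimension $L$ is the smallest among all nc Fornasini--Marchesini realizations of $R$ centred at $\underline Y$.
   Formalization: Realizations of dimension L = 0 are also allowed when defining minimality; with L ≥ 1 forced, the claim fails for constants, e.g. R = x^{-1}x, Y = 1, L = 1, A(x) = -x, B = C = 0, D = 1. The algebra is taken nonzero. *)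

theory Defs
  imports "Jordan_Normal_Form.Determinant" "HOL-Library.Poly_Mapping"
begin

section \<open>Noncommutative rational expressions\<close>

text \<open>
  The index type \<^typ>\<open>'d\<close> (of class \<^class>\<open>finite\<close>) numbers the variables, so \<open>d = CARD('d)\<close>
  and a \<open>d\<close>-tuple is a function on \<^typ>\<open>'d\<close>. A nc polynomial is a finitely supported function
  from words (lists of letters) to coefficients.
\<close>

type_synonym ('d, 'k) nc_poly = "'d list \<Rightarrow>\<^sub>0 'k"

datatype 'p formal_expr =
    Poly 'p
  | Add "'p formal_expr" "'p formal_expr"
  | Mult "'p formal_expr" "'p formal_expr"
  | Inv "'p formal_expr"

type_synonym ('d, 'k) nc_expr = "('d, 'k) nc_poly formal_expr"

text \<open>
  Evaluation takes place in a \<open>K\<close>-algebra given as a HOL-Algebra \<^type>\<open>module\<close> record, i.e. a ring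
  record together with a scalar multiplication (no axioms are attached to the record itself).
  This covers the algebra of all \<open>n \<times> n\<close> matrices for variable \<open>n\<close>, namely
  \<open>module_mat TYPE('k) n n\<close>, as well as an algebra living on a whole type
  (\<open>type_algebra\<close> below).
\<close>

definition poly_eval :: "('k :: zero, 'a, 'm) module_scheme \<Rightarrow> ('d, 'k) nc_poly \<Rightarrow> ('d \<Rightarrow> 'a) \<Rightarrow> 'a" where
  "poly_eval \<A> p a =
     (\<Oplus>\<^bsub>\<A>\<^esub>w \<in> Poly_Mapping.keys p.
        Poly_Mapping.lookup p w \<odot>\<^bsub>\<A>\<^esub> foldr (\<lambda>k b. a k \<otimes>\<^bsub>\<A>\<^esub> b) w \<one>\<^bsub>\<A>\<^esub>)"

primrec expr_eval :: "('k :: zero, 'a, 'm) module_scheme \<Rightarrow> ('d, 'k) nc_expr \<Rightarrow> ('d \<Rightarrow> 'a) \<Rightarrow> 'a" where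
  "expr_eval \<A> (Poly p) a = poly_eval \<A> p a"
| "expr_eval \<A> (Add R1 R2) a = expr_eval \<A> R1 a \<oplus>\<^bsub>\<A>\<^esub> expr_eval \<A> R2 a"
| "expr_eval \<A> (Mult R1 R2) a = expr_eval \<A> R1 a \<otimes>\<^bsub>\<A>\<^esub> expr_eval \<A> R2 a"
| "expr_eval \<A> (Inv R) a = inv\<^bsub>\<A>\<^esub> (expr_eval \<A> R a)"

primrec expr_dom :: "('k :: zero, 'a, 'm) module_scheme \<Rightarrow> ('d, 'k) nc_expr \<Rightarrow> ('d \<Rightarrow> 'a) set" where
  "expr_dom \<A> (Poly p) = {a. \<forall>k. a k \<in> carrier \<A>}"
| "expr_dom \<A> (Add R1 R2) = expr_dom \<A> R1 \<inter> expr_dom \<A> R2"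
| "expr_dom \<A> (Mult R1 R2) = expr_dom \<A> R1 \<inter> expr_dom \<A> R2"
| "expr_dom \<A> (Inv R) = {a \<in> expr_dom \<A> R. expr_eval \<A> R a \<in> Units \<A>}"

abbreviation matrix_algebra :: "nat \<Rightarrow> ('k :: field, 'k mat) module" where
  "matrix_algebra n \<equiv> module_mat TYPE('k) n n"

definition nondegenerate :: "('d, 'k :: field) nc_expr \<Rightarrow> bool" where
  "nondegenerate R \<longleftrightarrow> (\<exists>n\<ge>1. expr_dom (matrix_algebra n) R \<noteq> {})"

definition evaluation_equivalent :: "('d, 'k :: field) nc_expr \<Rightarrow> ('d, 'k) nc_expr \<Rightarrow> bool" where
  "evaluation_equivalent R1 R2 \<longleftrightarrow>
     (\<forall>n\<ge>1. \<forall>X \<in> expr_dom (matrix_algebra n) R1 \<inter> expr_dom (matrix_algebra n) R2.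
        expr_eval (matrix_algebra n) R1 X = expr_eval (matrix_algebra n) R2 X)"


section \<open>Noncommutative rational functions\<close>

definition nc_rational_functions :: "('d, 'k :: field) nc_expr set set" where
  "nc_rational_functions =
     {R. nondegenerate R} //
     {(R1, R2). nondegenerate R1 \<and> nondegenerate R2 \<and> evaluation_equivalent R1 R2}"

definition fun_dom :: "('k :: field, 'a, 'm) module_scheme \<Rightarrow> ('d, 'k) nc_expr set \<Rightarrow> ('d \<Rightarrow> 'a) set" where
  "fun_dom \<A> \<RR> = (\<Union>R \<in> \<RR>. expr_dom \<A> R)"

text \<open>
  The common value of all representatives that are defined at the given point. The definite
  description is meaningful only if these values coincide.
\<close>

definition fun_eval :: "('k :: field, 'a, 'm) module_scheme \<Rightarrow> ('d, 'k) nc_expr set \<Rightarrow> ('d \<Rightarrow> 'a) \<Rightarrow> 'a" where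
  "fun_eval \<A> \<RR> a = (THE v. \<exists>R \<in> \<RR>. a \<in> expr_dom \<A> R \<and> v = expr_eval \<A> R a)"


section \<open>Unital algebras on a type\<close>

locale unital_algebra = vector_space scale
  for scale :: "'k :: field \<Rightarrow> 'a :: ring_1 \<Rightarrow> 'a" +
  assumes scale_mult_left: "scale c x * y = scale c (x * y)"
    and scale_mult_right: "x * scale c y = scale c (x * y)"

definition type_algebra :: "('k \<Rightarrow> 'a \<Rightarrow> 'a) \<Rightarrow> ('k, 'a :: ring_1) module" where
  "type_algebra scale =
     \<lparr>carrier = UNIV, mult = (*), one = 1, zero = 0, add = (+), module.smult = scale\<rparr>"

definition stably_finite :: "'a :: ring_1 itself \<Rightarrow> bool" where
  "stably_finite ty \<longleftrightarrow>
     (\<forall>m\<ge>1. \<forall>M \<in> carrier_mat m m. \<forall>N \<in> carrier_mat m m.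
        M * N = (1\<^sub>m m :: 'a mat) \<longleftrightarrow> N * M = 1\<^sub>m m)"


section \<open>Matrix operations\<close>

definition kronecker :: "'k :: field mat \<Rightarrow> 'k mat \<Rightarrow> 'k mat" where
  "kronecker P Q =
     mat (dim_row P * dim_row Q) (dim_col P * dim_col Q)
       (\<lambda>(i, j). P $$ (i div dim_row Q, j div dim_col Q) * Q $$ (i mod dim_row Q, j mod dim_col Q))"

text \<open>The elementary tensor \<open>P \<otimes> a\<close> under the identification \<open>\<A>\<^bsup>p\<times>q\<^esup> = K\<^bsup>p\<times>q\<^esup> \<otimes> \<A>\<close>.\<close>

definition tensor_elem :: "('k \<Rightarrow> 'a \<Rightarrow> 'a) \<Rightarrow> 'k mat \<Rightarrow> 'a \<Rightarrow> 'a mat" where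
  "tensor_elem scale P a = map_mat (\<lambda>c. scale c a) P"

text \<open>The sum of the \<open>p \<times> q\<close> matrices \<open>f k\<close>; matrices of a fixed size do not form a type.\<close>

definition sum_mats :: "nat \<Rightarrow> nat \<Rightarrow> ('i \<Rightarrow> 'a :: comm_monoid_add mat) \<Rightarrow> 'i set \<Rightarrow> 'a mat" where
  "sum_mats p q f I = mat p q (\<lambda>ij. \<Sum>k\<in>I. f k $$ ij)"

definition matrix_unit :: "nat \<Rightarrow> nat \<Rightarrow> nat \<Rightarrow> 'k :: field mat" where
  "matrix_unit s i j = mat s s (\<lambda>ij. if ij = (i, j) then 1 else 0)"

definition linear_mat_map :: "nat \<Rightarrow> nat \<Rightarrow> nat \<Rightarrow> ('k :: field mat \<Rightarrow> 'k mat) \<Rightarrow> bool" where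
  "linear_mat_map s p q T \<longleftrightarrow>
     T \<in> carrier_mat s s \<rightarrow> carrier_mat p q \<and>
     (\<forall>M \<in> carrier_mat s s. \<forall>N \<in> carrier_mat s s. T (M + N) = T M + T N) \<and>
     (\<forall>c. \<forall>M \<in> carrier_mat s s. T (c \<cdot>\<^sub>m M) = c \<cdot>\<^sub>m T M)"

definition block :: "nat \<Rightarrow> 'k mat \<Rightarrow> nat \<Rightarrow> nat \<Rightarrow> 'k mat" where
  "block s X i j = mat s s (\<lambda>(a, b). X $$ (i * s + a, j * s + b))"

text \<open>
  The extension of a linear map from \<open>s \<times> s\<close> matrices to \<open>p \<times> q\<close> matrices, first to
  \<open>m \<times> m\<close> block matrices with \<open>s \<times> s\<close> blocks, then to \<open>s \<times> s\<close> matrices over an algebra.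
\<close>

definition ext_block :: "nat \<Rightarrow> nat \<Rightarrow> nat \<Rightarrow> ('k mat \<Rightarrow> 'k mat) \<Rightarrow> nat \<Rightarrow> 'k mat \<Rightarrow> 'k mat" where
  "ext_block s p q T m X =
     mat (m * p) (m * q) (\<lambda>(i, j). T (block s X (i div p) (j div q)) $$ (i mod p, j mod q))"

definition ext_algebra ::
  "('k :: field \<Rightarrow> 'a \<Rightarrow> 'a) \<Rightarrow> nat \<Rightarrow> nat \<Rightarrow> nat \<Rightarrow> ('k mat \<Rightarrow> 'k mat) \<Rightarrow> 'a :: ring_1 mat \<Rightarrow> 'a mat" where
  "ext_algebra scale s p q T M =
     sum_mats p q (\<lambda>(i, j). tensor_elem scale (T (matrix_unit s i j)) (M $$ (i, j)))
       ({..<s} \<times> {..<s})"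


section \<open>Fornasini--Marchesini realizations\<close>

record ('d, 'k) fm =
  fm_dim :: nat
  fm_D :: "'k mat"
  fm_C :: "'k mat"
  fm_A :: "'d \<Rightarrow> 'k mat \<Rightarrow> 'k mat"
  fm_B :: "'d \<Rightarrow> 'k mat \<Rightarrow> 'k mat"

text \<open>
  Dimension \<open>0\<close> (the constant realization \<open>I\<^sub>m \<otimes> D\<close>) is admitted. If all realizations had to
  have positive dimension, a constant function would have minimal realizations with superfluous
  singularities: for \<open>s = 1\<close>, \<open>d = 1\<close>, \<open>Y = 1\<close>, the data \<open>L = 1\<close>, \<open>A(x) = -x\<close>, \<open>B = 0\<close>, \<open>C = 0\<close>,
  \<open>D = 1\<close> realize the expression \<open>x\<^sup>-\<^sup>1 x\<close>, with domain the invertible matrices, whereas the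
  function it represents is the constant \<open>1\<close>, defined everywhere.
\<close>

definition fm_realization :: "nat \<Rightarrow> ('d, 'k :: field) fm \<Rightarrow> bool" where
  "fm_realization s \<R> \<longleftrightarrow>
     fm_D \<R> \<in> carrier_mat s s \<and>
     fm_C \<R> \<in> carrier_mat s (fm_dim \<R>) \<and>
     (\<forall>k. linear_mat_map s (fm_dim \<R>) (fm_dim \<R>) (fm_A \<R> k)) \<and>
     (\<forall>k. linear_mat_map s (fm_dim \<R>) s (fm_B \<R> k))"

text \<open>
  In the following, \<open>s\<close> and \<open>Y\<close> are the size and the matrices of the centre, and \<open>m\<close> is the number
  of blocks, so that the argument \<open>X\<close> consists of \<open>sm \<times> sm\<close> matrices.
\<close>

definition fm_pencil :: "nat \<Rightarrow> ('d :: finite \<Rightarrow> 'k :: field mat) \<Rightarrow> ('d, 'k) fm \<Rightarrow> nat \<Rightarrow> ('d \<Rightarrow> 'k mat) \<Rightarrow> 'k mat" where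
  "fm_pencil s Y \<R> m X =
     (let L = fm_dim \<R> in
      1\<^sub>m (L * m) - sum_mats (L * m) (L * m)
        (\<lambda>k. ext_block s L L (fm_A \<R> k) m (X k - kronecker (1\<^sub>m m) (Y k))) UNIV)"

definition fm_DOM :: "nat \<Rightarrow> ('d :: finite \<Rightarrow> 'k :: field mat) \<Rightarrow> ('d, 'k) fm \<Rightarrow> nat \<Rightarrow> ('d \<Rightarrow> 'k mat) set" where
  "fm_DOM s Y \<R> m =
     {X. (\<forall>k. X k \<in> carrier_mat (s * m) (s * m)) \<and> det (fm_pencil s Y \<R> m X) \<noteq> 0}"

definition fm_eval :: "nat \<Rightarrow> ('d :: finite \<Rightarrow> 'k :: field mat) \<Rightarrow> ('d, 'k) fm \<Rightarrow> nat \<Rightarrow> ('d \<Rightarrow> 'k mat) \<Rightarrow> 'k mat" where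
  "fm_eval s Y \<R> m X =
     (let L = fm_dim \<R> in
      kronecker (1\<^sub>m m) (fm_D \<R>) +
      kronecker (1\<^sub>m m) (fm_C \<R>) *
      inv\<^bsub>matrix_algebra (L * m)\<^esub> (fm_pencil s Y \<R> m X) *
      sum_mats (L * m) (s * m)
        (\<lambda>k. ext_block s L s (fm_B \<R> k) m (X k - kronecker (1\<^sub>m m) (Y k))) UNIV)"

definition fm_pencil_alg ::
  "('k \<Rightarrow> 'a \<Rightarrow> 'a) \<Rightarrow> nat \<Rightarrow> ('d :: finite \<Rightarrow> 'k :: field mat) \<Rightarrow> ('d, 'k) fm \<Rightarrow> ('d \<Rightarrow> 'a :: ring_1 mat) \<Rightarrow> 'a mat" where
  "fm_pencil_alg scale s Y \<R> X =
     (let L = fm_dim \<R> in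
      1\<^sub>m L - sum_mats L L
        (\<lambda>k. ext_algebra scale s L L (fm_A \<R> k) (X k - tensor_elem scale (Y k) 1)) UNIV)"

definition fm_DOM_alg ::
  "('k \<Rightarrow> 'a \<Rightarrow> 'a) \<Rightarrow> nat \<Rightarrow> ('d :: finite \<Rightarrow> 'k :: field mat) \<Rightarrow> ('d, 'k) fm \<Rightarrow> ('d \<Rightarrow> 'a :: ring_1 mat) set" where
  "fm_DOM_alg scale s Y \<R> =
     {X. (\<forall>k. X k \<in> carrier_mat s s) \<and>
         fm_pencil_alg scale s Y \<R> X \<in> Units (module_mat TYPE('a) (fm_dim \<R>) (fm_dim \<R>))}"

definition fm_eval_alg ::
  "('k \<Rightarrow> 'a \<Rightarrow> 'a) \<Rightarrow> nat \<Rightarrow> ('d :: finite \<Rightarrow> 'k :: field mat) \<Rightarrow> ('d, 'k) fm \<Rightarrow> ('d \<Rightarrow> 'a :: ring_1 mat) \<Rightarrow> 'a mat" where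
  "fm_eval_alg scale s Y \<R> X =
     (let L = fm_dim \<R> in
      tensor_elem scale (fm_D \<R>) 1 +
      tensor_elem scale (fm_C \<R>) 1 *
      inv\<^bsub>module_mat TYPE('a) L L\<^esub> (fm_pencil_alg scale s Y \<R> X) *
      sum_mats L s
        (\<lambda>k. ext_algebra scale s L s (fm_B \<R> k) (X k - tensor_elem scale (Y k) 1)) UNIV)"

definition realizes ::
  "nat \<Rightarrow> ('d :: finite \<Rightarrow> 'k :: field mat) \<Rightarrow> ('d, 'k) fm \<Rightarrow> ('d, 'k) nc_expr \<Rightarrow> bool" where
  "realizes s Y \<R> R \<longleftrightarrow>
     fm_realization s \<R> \<and>
     (\<forall>m\<ge>1. expr_dom (matrix_algebra (s * m)) R \<subseteq> fm_DOM s Y \<R> m \<and>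
        (\<forall>X \<in> expr_dom (matrix_algebra (s * m)) R.
           expr_eval (matrix_algebra (s * m)) R X = fm_eval s Y \<R> m X))"

definition minimal_realization ::
  "nat \<Rightarrow> ('d :: finite \<Rightarrow> 'k :: field mat) \<Rightarrow> ('d, 'k) fm \<Rightarrow> ('d, 'k) nc_expr \<Rightarrow> bool" where
  "minimal_realization s Y \<R> R \<longleftrightarrow>
     realizes s Y \<R> R \<and> (\<forall>\<R>'. realizes s Y \<R>' R \<longrightarrow> fm_dim \<R> \<le> fm_dim \<R>')"

end

theory Submission
  imports Defs "HOL-Library.Nat_Bijection"
begin

text \<open>
  Suppose that a representative \<open>Q\<close> is defined at the given point. Its value is given by a linear pencil,
  \<open>Q(X) = c \<Gamma>(X)\<^sup>-\<^sup>1 b\<close>, which has to be compared with the minimal realization \<open>\<R>\<close> of \<open>R\<close>.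
  Minimality makes \<open>\<R>\<close> controllable and observable. These properties survive when the centre is moved to
  a point \<open>I\<^sub>s \<otimes> P\<close> at which \<open>R\<close>, \<open>Q\<close> and an expression equivalent to both are defined; even over a finite
  field such a point exists among matrices of large size. Evaluation at block bidiagonal points
  around the new centre shows that \<open>\<R>\<close> and the pencil of \<open>Q\<close> have the same moments \<open>C A\<^sub>1 \<dots> A\<^sub>n B\<close>, so that
  \<open>\<R>\<close> is a subquotient of the pencil of \<open>Q\<close>. Hence \<open>\<R>\<close> is invertible wherever that pencil is, because
  one-sided inverses of matrices over a stably finite algebra are two-sided.
\<close>

section \<open>Finitely supported infinite matrices\<close>

text \<open>The obstacle that shapes the formalization is size: points, state spaces and block
  perturbations have different dimensions and are tensored with one another and with an arbitrary
  algebra. All of them live in one type of finitely supported matrices over a ring without unit.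
  This is again such a ring, so the type can be nested, and each tensor factor is a nesting level. A
  size is remembered by an idempotent: matrices over a finite index set \<open>J\<close> form the
  corner of \<open>idm J 1\<close>, and inverses are taken relative to that unit. Regrouping of
  tensor factors is done by the isomorphisms \<open>flatten\<close> and \<open>swap_levels\<close>,
  and subspaces appear as one-sided ideals. The centre has to move because \<open>Q\<close> may be
  undefined at \<open>Y\<close>. The third expression at the new centre is the representative
  \<open>R0\<close> that defines the equivalence class: \<open>R\<close> and \<open>Q\<close> are
  each known to be equivalent to \<open>R0\<close>, and this yields equal values only where all
  three are defined. A sum such as \<open>Add R (Add R0 Q)\<close> serves as an expression whose
  domain is the intersection of the domains.\<close>

typedef (overloaded) 'a finmat =
  "{f :: nat \<Rightarrow> nat \<Rightarrow> 'a :: zero. finite {(i, j). f i j \<noteq> 0}}"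
  morphisms entry Abs_finmat
  by (rule exI[of _ "\<lambda>_ _. 0"]) simp

text \<open>Functions of infinite support are sent to zero, which makes \<open>finmat\<close> total.
  Its uses discharge a finiteness condition, mostly through \<open>entry_finmat_subset\<close> with
  index sets taken from the supports of the ingredients.\<close>

definition finmat :: "(nat \<Rightarrow> nat \<Rightarrow> 'a :: zero) \<Rightarrow> 'a finmat" where
  "finmat f = Abs_finmat (if finite {(i, j). f i j \<noteq> 0} then f else (\<lambda>_ _. 0))"

lemma entry_finmat: "finite {(i, j). f i j \<noteq> 0} \<Longrightarrow> entry (finmat f) = f"
  unfolding finmat_def by (simp add: Abs_finmat_inverse)

lemma entry_finmat_subset:
  assumes "finite I" "finite J" "\<And>i j. f i j \<noteq> 0 \<Longrightarrow> i \<in> I \<and> j \<in> J"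
  shows "entry (finmat f) = f"
  by (rule entry_finmat, rule finite_subset[of _ "I \<times> J"]) (use assms in auto)

lemma finmat_eqI: "(\<And>i j. entry M i j = entry N i j) \<Longrightarrow> M = N"
  by (metis entry_inject ext)

text \<open>Row and column indices are pooled, so that one finite set bounds a matrix on both sides
  and can be used as summation range in products.\<close>

definition support :: "'a :: zero finmat \<Rightarrow> nat set" where
  "support M = (\<Union>(i, j) \<in> {(i, j). entry M i j \<noteq> 0}. {i, j})"

lemma finite_support [simp]: "finite (support M)"
  using entry[of M] unfolding support_def by auto

lemma supportD: "entry M i j \<noteq> 0 \<Longrightarrow> i \<in> support M \<and> j \<in> support M"
  unfolding support_def by blast

lemma entry_eq_0: "i \<notin> support M \<or> j \<notin> support M \<Longrightarrow> entry M i j = 0"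
  using supportD by blast

section \<open>The ring of finitely supported matrices\<close>

instantiation finmat :: (ring) ring
begin

definition "0 = finmat (\<lambda>_ _. 0)"
definition "M + N = finmat (\<lambda>i j. entry M i j + entry N i j)"
definition "M - N = finmat (\<lambda>i j. entry M i j - entry N i j)"
definition "- M = finmat (\<lambda>i j. - entry M i j)"
definition "M * N = finmat (\<lambda>i j. \<Sum>l \<in> support M. entry M i l * entry N l j)"

lemma entry_zero [simp]: "entry (0 :: 'a finmat) i j = 0"
  unfolding zero_finmat_def by (subst entry_finmat) auto

lemma entry_plus [simp]: "entry (M + N) i j = entry M i j + (entry N i j :: 'a)"
proof -
  have "entry (M + N) = (\<lambda>i j. entry M i j + entry N i j)" unfolding plus_finmat_def
    by (rule entry_finmat_subset[of "support M \<union> support N" "support M \<union> support N"])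
      (auto, (metis add_0 supportD)+)
  then show ?thesis by simp
qed

lemma entry_uminus [simp]: "entry (- M) i j = - (entry M i j :: 'a)"
proof -
  have "entry (- M) = (\<lambda>i j. - entry M i j)" unfolding uminus_finmat_def
    by (rule entry_finmat_subset[of "support M" "support M"]) (auto simp: supportD)
  then show ?thesis by simp
qed

lemma entry_minus [simp]: "entry (M - N) i j = entry M i j - (entry N i j :: 'a)"
proof -
  have "entry (M - N) = (\<lambda>i j. entry M i j - entry N i j)" unfolding minus_finmat_def
    by (rule entry_finmat_subset[of "support M \<union> support N" "support M \<union> support N"])
      (auto, (metis supportD)+)
  then show ?thesis by simp
qed

lemma entry_times_support: "entry (M * N) i j = (\<Sum>l \<in> support M. entry M i l * (entry N l j :: 'a))"
proof -
  have "entry (M * N) = (\<lambda>i j. \<Sum>l \<in> support M. entry M i l * entry N l j)" unfolding times_finmat_def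
  proof (rule entry_finmat_subset[of "support M" "support N"])
    fix i j assume "(\<Sum>l\<in>support M. entry M i l * entry N l j) \<noteq> 0"
    then obtain l where "entry M i l * entry N l j \<noteq> 0" by (meson sum.not_neutral_contains_not_neutral)
    then have "entry M i l \<noteq> 0" "entry N l j \<noteq> 0" by auto
    then show "i \<in> support M \<and> j \<in> support N" using supportD by blast
  qed auto
  then show ?thesis by simp
qed

text \<open>The definition sums over the support of the left factor. Any finite set outside which
  all summands vanish gives the same result, so several products can be expanded over a common index
  set.\<close>

lemma entry_times:
  assumes "finite J" "\<And>l. l \<notin> J \<Longrightarrow> entry M i l = 0 \<or> entry N l j = 0"
  shows "entry (M * N) i j = (\<Sum>l \<in> J. entry M i l * (entry N l j :: 'a))"
  unfolding entry_times_support
proof (rule sum.mono_neutral_cong)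
  fix l assume "l \<in> support M - J"
  then have "entry M i l = 0 \<or> entry N l j = 0" using assms(2) by blast
  then show "entry M i l * entry N l j = 0" by auto
qed (use assms in \<open>auto simp: entry_eq_0\<close>)

instance
proof
  fix a b c :: "'a finmat"
  show "a + b + c = a + (b + c)" by (rule finmat_eqI) (simp add: add.assoc)
  show "a + b = b + a" by (rule finmat_eqI) (simp add: add.commute)
  show "0 + a = a" by (rule finmat_eqI) simp
  show "- a + a = 0" by (rule finmat_eqI) simp
  show "a - b = a + - b" by (rule finmat_eqI) simp
  let ?J = "support a \<union> support b \<union> support c"
  show "a * b * c = a * (b * c)"
  proof (rule finmat_eqI)
    fix i j
    have "entry (a * b * c) i j = (\<Sum>l\<in>?J. entry (a * b) i l * entry c l j)"
      by (rule entry_times) (auto simp: entry_eq_0)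
    also have "\<dots> = (\<Sum>l\<in>?J. \<Sum>l'\<in>?J. entry a i l' * entry b l' l * entry c l j)"
      by (subst entry_times[of ?J]) (auto simp: entry_eq_0 sum_distrib_right)
    also have "\<dots> = (\<Sum>l'\<in>?J. \<Sum>l\<in>?J. entry a i l' * (entry b l' l * entry c l j))"
      by (subst sum.swap) (simp add: mult.assoc)
    also have "\<dots> = (\<Sum>l'\<in>?J. entry a i l' * entry (b * c) l' j)"
      by (intro sum.cong refl, subst entry_times[of ?J]) (auto simp: entry_eq_0 sum_distrib_left)
    also have "\<dots> = entry (a * (b * c)) i j"
      by (rule entry_times[symmetric]) (auto simp: entry_eq_0)
    finally show "entry (a * b * c) i j = entry (a * (b * c)) i j" .
  qed
  show "(a + b) * c = a * c + b * c"
    by (rule finmat_eqI, simp, (subst entry_times[of ?J]; (auto simp: entry_eq_0)?)+,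
        simp add: distrib_right sum.distrib)
  show "a * (b + c) = a * b + a * c"
    by (rule finmat_eqI, simp, (subst entry_times[of ?J]; (auto simp: entry_eq_0)?)+,
        simp add: distrib_left sum.distrib)
qed

end

lemma entry_sum [simp]: "entry (\<Sum>x\<in>I. f x) i j = (\<Sum>x\<in>I. entry (f x :: 'a :: ring finmat) i j)"
  by (induction I rule: infinite_finite_induct) auto

text \<open>Form of an equation between products that still applies after complete association to
  the right; its instances cancel factors inside long words.\<close>

lemma assoc_left: "a * b = c \<Longrightarrow> a * (b * x) = c * (x :: 'a :: semigroup_mult)"
  by (simp flip: mult.assoc)

text \<open>Membership in \<open>e R e\<close>. For idempotent \<open>e\<close> this is a ring with
  unit \<open>e\<close>; in this way unital matrix rings of a definite size are recovered inside the
  ring of all finite matrices.\<close>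

definition corner :: "'a :: ring \<Rightarrow> 'a \<Rightarrow> bool" where
  "corner e x \<longleftrightarrow> e * x = x \<and> x * e = x"

lemma corner_left: "corner e x \<Longrightarrow> e * x = x"
  and corner_right: "corner e x \<Longrightarrow> x * e = x"
  by (simp_all add: corner_def)

lemma corner_left': "corner e x \<Longrightarrow> e * (x * y) = x * y"
  and corner_right': "corner e x \<Longrightarrow> x * (e * y) = x * y"
  by (simp_all add: corner_def flip: mult.assoc)

lemma corner_zero [simp]: "corner e 0"
  by (simp add: corner_def)

lemma corner_add: "corner e x \<Longrightarrow> corner e y \<Longrightarrow> corner e (x + y)"
  by (simp add: corner_def distrib_left distrib_right)

lemma corner_diff: "corner e x \<Longrightarrow> corner e y \<Longrightarrow> corner e (x - y)"
  by (simp add: corner_def right_diff_distrib left_diff_distrib)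

lemma corner_uminus: "corner e x \<Longrightarrow> corner e (- x)"
  by (simp add: corner_def)

lemma corner_mult: "corner e x \<Longrightarrow> corner e y \<Longrightarrow> corner e (x * y)"
  by (simp add: corner_def mult.assoc) (simp add: corner_def flip: mult.assoc)

lemma corner_sum: "(\<And>i. i \<in> I \<Longrightarrow> corner e (f i)) \<Longrightarrow> corner e (sum f I)"
  by (simp add: corner_def sum_distrib_left sum_distrib_right)

section \<open>Matrix units, diagonal units and entrywise maps\<close>

definition single :: "nat \<Rightarrow> nat \<Rightarrow> 'a :: ring \<Rightarrow> 'a finmat" where
  "single i j x = finmat (\<lambda>a b. if a = i \<and> b = j then x else 0)"

lemma entry_single: "entry (single i j x) a b = (if a = i \<and> b = j then x else 0)"
proof -
  have "entry (single i j x) = (\<lambda>a b. if a = i \<and> b = j then x else 0)" unfolding single_def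
    by (rule entry_finmat_subset[of "{i}" "{j}"]) (auto split: if_splits)
  then show ?thesis by simp
qed

lemma single_zero [simp]: "single i j 0 = 0"
  by (rule finmat_eqI) (simp add: entry_single)

lemma single_add: "single i j (x + y) = single i j x + single i j y"
  by (rule finmat_eqI) (simp add: entry_single)

lemma single_diff: "single i j (x - y) = single i j x - single i j y"
  by (rule finmat_eqI) (simp add: entry_single)

lemma single_sum: "single i j (sum f I) = (\<Sum>x\<in>I. single i j (f x))"
  by (rule finmat_eqI) (auto simp add: entry_single)

lemma single_mult: "single i j x * single a b y = (if j = a then single i b (x * y) else 0)"
  by (rule finmat_eqI, subst entry_times[of "{j}"]) (auto simp: entry_single)

lemma entry_single_mult: "entry (single i j x * M) a b = (if a = i then x * entry M j b else 0)"
  by (subst entry_times[of "{j}"]) (auto simp: entry_single)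

lemma entry_mult_single: "entry (M * single i j x) a b = (if b = j then entry M a i * x else 0)"
  by (subst entry_times[of "{i}"]) (auto simp: entry_single)

text \<open>The tensor product of the unit matrix on \<open>J\<close> with \<open>e\<close>. If
  \<open>e\<close> is the unit of a corner, this is the unit of the \<open>J\<close> by
  \<open>J\<close> matrices over that corner; nested uses give the units of iterated tensor
  products.\<close>

definition idm :: "nat set \<Rightarrow> 'a :: ring \<Rightarrow> 'a finmat" where
  "idm J e = (\<Sum>j\<in>J. single j j e)"

lemma entry_idm: "finite J \<Longrightarrow> entry (idm J e) i j = (if i = j \<and> i \<in> J then e else 0)"
proof -
  assume "finite J"
  moreover have "entry (idm J e) i j = (\<Sum>l\<in>J. if l = i then (if i = j then e else 0) else 0)"
    unfolding idm_def entry_sum entry_single by (rule sum.cong) auto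
  ultimately show ?thesis by simp
qed

lemma entry_idm_mult: "finite J \<Longrightarrow> entry (idm J e * M) i j = (if i \<in> J then e * entry M i j else 0)"
  by (subst entry_times[of "{i}"]) (auto simp: entry_idm)

lemma entry_mult_idm: "finite J \<Longrightarrow> entry (M * idm J e) i j = (if j \<in> J then entry M i j * e else 0)"
  by (subst entry_times[of "{j}"]) (auto simp: entry_idm)

lemma idm_mult: "finite J \<Longrightarrow> idm J x * idm J y = idm J (x * y)"
  by (rule finmat_eqI) (auto simp: entry_idm_mult entry_idm)

lemma idm_mult_eqI:
  assumes "finite J" "\<And>i j. i \<in> J \<Longrightarrow> e * entry M i j = entry M i j"
    "\<And>i j. i \<notin> J \<Longrightarrow> entry M i j = 0"
  shows "idm J e * M = M"
  by (rule finmat_eqI) (use assms in \<open>auto simp: entry_idm_mult\<close>)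

lemma mult_idm_eqI:
  assumes "finite J" "\<And>i j. j \<in> J \<Longrightarrow> entry M i j * e = entry M i j"
    "\<And>i j. j \<notin> J \<Longrightarrow> entry M i j = 0"
  shows "M * idm J e = M"
  by (rule finmat_eqI) (use assms in \<open>auto simp: entry_mult_idm\<close>)

lemma idm_mult_iff:
  assumes "finite J"
  shows "idm J e * M = M \<longleftrightarrow> (\<forall>i j. (i \<in> J \<longrightarrow> e * entry M i j = entry M i j) \<and> (i \<notin> J \<longrightarrow> entry M i j = 0))"
  by (metis assms entry_idm_mult idm_mult_eqI)

lemma mult_idm_iff:
  assumes "finite J"
  shows "M * idm J e = M \<longleftrightarrow> (\<forall>i j. (j \<in> J \<longrightarrow> entry M i j * e = entry M i j) \<and> (j \<notin> J \<longrightarrow> entry M i j = 0))"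
  by (metis assms entry_mult_idm mult_idm_eqI)

lemma corner_idm_iff:
  assumes "finite J"
  shows "corner (idm J e) M \<longleftrightarrow>
    (\<forall>i j. (i \<in> J \<and> j \<in> J \<longrightarrow> corner e (entry M i j)) \<and> (i \<notin> J \<or> j \<notin> J \<longrightarrow> entry M i j = 0))"
proof
  assume "corner (idm J e) M"
  then have "\<forall>i j. (i \<in> J \<longrightarrow> e * entry M i j = entry M i j) \<and> (i \<notin> J \<longrightarrow> entry M i j = 0)"
    "\<forall>i j. (j \<in> J \<longrightarrow> entry M i j * e = entry M i j) \<and> (j \<notin> J \<longrightarrow> entry M i j = 0)"
    unfolding corner_def idm_mult_iff[OF assms] mult_idm_iff[OF assms] by blast+
  then show "\<forall>i j. (i \<in> J \<and> j \<in> J \<longrightarrow> corner e (entry M i j)) \<and> (i \<notin> J \<or> j \<notin> J \<longrightarrow> entry M i j = 0)"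
    unfolding corner_def by blast
next
  assume *: "\<forall>i j. (i \<in> J \<and> j \<in> J \<longrightarrow> corner e (entry M i j)) \<and> (i \<notin> J \<or> j \<notin> J \<longrightarrow> entry M i j = 0)"
  then have "e * entry M i j = entry M i j" "entry M i j * e = entry M i j" for i j
    unfolding corner_def by (cases "i \<in> J \<and> j \<in> J"; auto)+
  then show "corner (idm J e) M"
    unfolding corner_def idm_mult_iff[OF assms] mult_idm_iff[OF assms] using * by blast
qed

lemma idm_idem: "finite J \<Longrightarrow> e * e = e \<Longrightarrow> idm J e * idm J e = idm J e"
  by (simp add: idm_mult)

text \<open>The guard keeps the support finite for arbitrary \<open>f\<close>; it disappears in
  \<open>entry_mapm\<close>, where \<open>f 0 = 0\<close>.\<close>

definition mapm :: "('a :: ring \<Rightarrow> 'b :: ring) \<Rightarrow> 'a finmat \<Rightarrow> 'b finmat" where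
  "mapm f M = finmat (\<lambda>i j. if entry M i j = 0 then 0 else f (entry M i j))"

lemma entry_mapm: "f 0 = 0 \<Longrightarrow> entry (mapm f M) i j = f (entry M i j)"
proof -
  have "entry (mapm f M) = (\<lambda>i j. if entry M i j = 0 then 0 else f (entry M i j))" unfolding mapm_def
    by (rule entry_finmat_subset[of "support M" "support M"]) (auto simp: supportD split: if_splits)
  then show "f 0 = 0 \<Longrightarrow> ?thesis" by auto
qed

text \<open>Rings here need not be unital, so a homomorphism between corners is a plain ring
  homomorphism that maps one idempotent to the other.\<close>

definition ring_map :: "('a :: ring \<Rightarrow> 'b :: ring) \<Rightarrow> bool" where
  "ring_map f \<longleftrightarrow> (\<forall>x y. f (x + y) = f x + f y) \<and> (\<forall>x y. f (x * y) = f x * f y)"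

lemma ring_map_add: "ring_map f \<Longrightarrow> f (x + y) = f x + f y"
  and ring_map_mult: "ring_map f \<Longrightarrow> f (x * y) = f x * f y"
  by (simp_all add: ring_map_def)

lemma additive_zero: "(\<And>x y. f (x + y) = f x + f y) \<Longrightarrow> f (0 :: 'a :: ab_group_add) = (0 :: 'b :: ab_group_add)"
  by (metis add_cancel_right_right)

lemma additive_uminus:
  fixes f :: "'a :: ab_group_add \<Rightarrow> 'b :: ab_group_add"
  assumes "\<And>x y. f (x + y) = f x + f y"
  shows "f (- x) = - f x"
  using assms[of x "- x"] additive_zero[of f, OF assms] by (metis add.right_inverse add_eq_0_iff)

lemma additive_diff:
  fixes f :: "'a :: ab_group_add \<Rightarrow> 'b :: ab_group_add"
  assumes "\<And>x y. f (x + y) = f x + f y"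
  shows "f (x - y) = f x - f y"
  using assms[of x "- y"] additive_uminus[of f, OF assms] by simp

lemma additive_sum:
  fixes f :: "'a :: ab_group_add \<Rightarrow> 'b :: ab_group_add"
  assumes "\<And>x y. f (x + y) = f x + f y"
  shows "f (sum g I) = (\<Sum>i\<in>I. f (g i))"
  by (induction I rule: infinite_finite_induct) (simp_all add: assms additive_zero[of f, OF assms])

lemma ring_map_zero: "ring_map f \<Longrightarrow> f 0 = 0"
  unfolding ring_map_def by (blast intro: additive_zero)

lemma ring_map_diff: "ring_map f \<Longrightarrow> f (x - y) = f x - f y"
  unfolding ring_map_def by (blast intro: additive_diff)

lemma ring_map_sum: "ring_map f \<Longrightarrow> f (sum g I) = (\<Sum>i\<in>I. f (g i))"
  unfolding ring_map_def by (blast intro: additive_sum)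

lemma ring_map_corner: "ring_map f \<Longrightarrow> corner e x \<Longrightarrow> corner (f e) (f x)"
  by (metis corner_def ring_map_mult)

lemma ring_map_comp: "ring_map f \<Longrightarrow> ring_map g \<Longrightarrow> ring_map (\<lambda>x. g (f x))"
  by (simp add: ring_map_def)

lemma entry_mult_big:
  assumes "finite J" "support M \<subseteq> J \<or> support N \<subseteq> J"
  shows "entry (M * N) i j = (\<Sum>l\<in>J. entry M i l * entry N l j)"
proof (rule entry_times[OF assms(1)])
  fix l assume "l \<notin> J"
  then have "l \<notin> support M \<or> l \<notin> support N" using assms(2) by blast
  then show "entry M i l = 0 \<or> entry N l j = 0" using entry_eq_0 by blast
qed

lemma ring_map_mapm: "ring_map f \<Longrightarrow> ring_map (mapm f)"
  unfolding ring_map_def[of "mapm f"]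
proof (intro conjI allI finmat_eqI)
  fix x y i j assume f: "ring_map f"
  note f0 = ring_map_zero[OF f]
  show "entry (mapm f (x + y)) i j = entry (mapm f x + mapm f y) i j"
    by (simp add: entry_mapm f0 ring_map_add[OF f])
  have "support (mapm f x) \<subseteq> support x"
    by (smt (verit) UN_iff case_prodE case_prod_conv entry_mapm f0 insertE mem_Collect_eq singletonD subsetI support_def supportD)
  then show "entry (mapm f (x * y)) i j = entry (mapm f x * mapm f y) i j"
    by (simp add: entry_mapm f0 entry_mult_big[of "support x"] ring_map_sum[OF f] ring_map_mult[OF f])
qed

lemma mapm_idm: "f 0 = 0 \<Longrightarrow> finite J \<Longrightarrow> mapm f (idm J x) = idm J (f x)"
  by (rule finmat_eqI) (auto simp: entry_mapm entry_idm)

lemma idm_add: "finite J \<Longrightarrow> idm J (x + y) = idm J x + idm J y"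
  by (rule finmat_eqI) (auto simp add: entry_idm)

lemma ring_map_idm: "finite J \<Longrightarrow> ring_map (idm J)"
  unfolding ring_map_def by (simp add: idm_mult idm_add)

lemma ring_map_single: "ring_map (single i i)"
  unfolding ring_map_def by (simp add: single_add single_mult)

text \<open>Matrices of matrices become matrices indexed by pairs, encoded as numbers with the outer
  index as first component. Together with \<open>unflatten\<close> this is a ring isomorphism, so
  two levels can always be treated as one.\<close>

definition flatten :: "'a :: ring finmat finmat \<Rightarrow> 'a finmat" where
  "flatten M = finmat (\<lambda>i j. entry (entry M (fst (prod_decode i)) (fst (prod_decode j)))
     (snd (prod_decode i)) (snd (prod_decode j)))"

definition unflatten :: "'a :: ring finmat \<Rightarrow> 'a finmat finmat" where
  "unflatten M = finmat (\<lambda>a b. finmat (\<lambda>i j. entry M (prod_encode (a, i)) (prod_encode (b, j))))"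

lemma entry_flatten: "entry (flatten M) i j =
  entry (entry M (fst (prod_decode i)) (fst (prod_decode j))) (snd (prod_decode i)) (snd (prod_decode j))"
proof -
  \<comment> \<open>All inner indices that occur in any block: one finite bound for the supports of
    the infinitely many entries.\<close>
  define U where "U = (\<Union>a\<in>support M. \<Union>b\<in>support M. support (entry M a b))"
  have *: "finite U" unfolding U_def by simp
  have "entry (flatten M) = (\<lambda>i j. entry (entry M (fst (prod_decode i)) (fst (prod_decode j)))
     (snd (prod_decode i)) (snd (prod_decode j)))" unfolding flatten_def
  proof (rule entry_finmat_subset[of "prod_encode ` (support M \<times> U)" "prod_encode ` (support M \<times> U)"])
    fix i j
    obtain a x b y where ab: "prod_decode i = (a, x)" "prod_decode j = (b, y)"
      by (metis surj_pair)
    assume "entry (entry M (fst (prod_decode i)) (fst (prod_decode j))) (snd (prod_decode i)) (snd (prod_decode j)) \<noteq> 0"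
    then have "entry (entry M a b) x y \<noteq> 0" using ab by simp
    moreover from this have "entry M a b \<noteq> 0" by auto
    ultimately have "a \<in> support M" "b \<in> support M" "x \<in> support (entry M a b)" "y \<in> support (entry M a b)"
      using supportD by blast+
    moreover from this have "x \<in> U" "y \<in> U" unfolding U_def by blast+
    moreover have "i = prod_encode (a, x)" "j = prod_encode (b, y)"
      using ab by (metis prod_decode_inverse)+
    ultimately show "i \<in> prod_encode ` (support M \<times> U) \<and> j \<in> prod_encode ` (support M \<times> U)" by blast
  qed (use * in auto)
  then show ?thesis by simp
qed

lemma entry_unflatten: "entry (entry (unflatten M) a b) i j = entry M (prod_encode (a, i)) (prod_encode (b, j))"
proof -
  define A where "A = fst ` prod_decode ` support M"
  define I where "I = snd ` prod_decode ` support M"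
  have fin: "finite A" "finite I" unfolding A_def I_def by auto
  have *: "entry M (prod_encode (a, i)) (prod_encode (b, j)) \<noteq> 0 \<Longrightarrow> a \<in> A \<and> b \<in> A \<and> i \<in> I \<and> j \<in> I" for a b i j
    unfolding A_def I_def image_image
  proof -
    assume "entry M (prod_encode (a, i)) (prod_encode (b, j)) \<noteq> 0"
    then have "prod_encode (a, i) \<in> support M" "prod_encode (b, j) \<in> support M"
      using supportD by blast+
    then show "a \<in> (\<lambda>x. fst (prod_decode x)) ` support M \<and> b \<in> (\<lambda>x. fst (prod_decode x)) ` support M \<and>
      i \<in> (\<lambda>x. snd (prod_decode x)) ` support M \<and> j \<in> (\<lambda>x. snd (prod_decode x)) ` support M"
      by (auto intro: rev_image_eqI)
  qed
  have 1: "entry (finmat (\<lambda>i j. entry M (prod_encode (a, i)) (prod_encode (b, j)))) =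
      (\<lambda>i j. entry M (prod_encode (a, i)) (prod_encode (b, j)))" for a b
    by (rule entry_finmat_subset[of I I]) (use fin * in auto)
  have "entry (unflatten M) = (\<lambda>a b. finmat (\<lambda>i j. entry M (prod_encode (a, i)) (prod_encode (b, j))))"
    unfolding unflatten_def
  proof (rule entry_finmat_subset[of A A])
    fix a b assume "finmat (\<lambda>i j. entry M (prod_encode (a, i)) (prod_encode (b, j))) \<noteq> 0"
    then obtain i j where "entry M (prod_encode (a, i)) (prod_encode (b, j)) \<noteq> 0"
      using 1[of a b] by (metis entry_zero finmat_eqI)
    then show "a \<in> A \<and> b \<in> A" using * by blast
  qed (use fin in auto)
  then show ?thesis using 1 by simp
qed

lemma flatten_unflatten [simp]: "flatten (unflatten M) = M"
  by (rule finmat_eqI) (simp add: entry_flatten entry_unflatten)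

lemma unflatten_flatten [simp]: "unflatten (flatten M) = M"
  by (intro finmat_eqI) (simp add: entry_flatten entry_unflatten)

lemma ring_map_flatten: "ring_map flatten"
  unfolding ring_map_def
proof (intro conjI allI finmat_eqI)
  fix x y :: "'a finmat finmat" and i j
  show "entry (flatten (x + y)) i j = entry (flatten x + flatten y) i j"
    by (simp add: entry_flatten)
  define A where "A = support x"
  define U where "U = (\<Union>a\<in>support x. \<Union>b\<in>support x. support (entry x a b))"
  have fin: "finite A" "finite U" unfolding A_def U_def by auto
  have U: "entry (entry x a b) i l = 0" if "l \<notin> U" for a b i l
  proof (rule ccontr)
    assume *: "entry (entry x a b) i l \<noteq> 0"
    then have "entry x a b \<noteq> 0" by auto
    then have "a \<in> support x" "b \<in> support x" "l \<in> support (entry x a b)" using supportD * by blast+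
    then show False using that U_def by blast
  qed
  obtain a p b q where i: "i = prod_encode (a, p)" "j = prod_encode (b, q)"
    by (metis prod_decode_inverse surj_pair)
  have "entry (flatten (x * y)) i j = (\<Sum>c\<in>A. entry (entry x a c * entry y c b) p q)"
    by (simp add: entry_flatten i entry_mult_big[of A] fin A_def)
  also have "\<dots> = (\<Sum>c\<in>A. \<Sum>l\<in>U. entry (entry x a c) p l * entry (entry y c b) l q)"
    by (intro sum.cong refl entry_times) (use fin U in auto)
  also have "\<dots> = (\<Sum>(c, l)\<in>A \<times> U. entry (entry x a c) p l * entry (entry y c b) l q)"
    by (simp add: sum.cartesian_product)
  also have "\<dots> = (\<Sum>m\<in>prod_encode ` (A \<times> U). entry (flatten x) i m * entry (flatten y) m j)"
    by (subst sum.reindex) (auto simp: i entry_flatten inj_prod_encode intro!: sum.cong)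
  also have "\<dots> = entry (flatten x * flatten y) i j"
  proof (rule entry_times[symmetric])
    fix m assume m: "m \<notin> prod_encode ` (A \<times> U)"
    obtain c l where cl: "m = prod_encode (c, l)" by (metis prod_decode_inverse surj_pair)
    then have "c \<notin> A \<or> l \<notin> U" using m by auto
    then have "entry (entry x a c) p l = 0" using U entry_eq_0[of a x c] A_def by auto
    then show "entry (flatten x) i m = 0 \<or> entry (flatten y) m j = 0"
      by (simp add: entry_flatten i cl)
  qed (use fin in auto)
  finally show "entry (flatten (x * y)) i j = entry (flatten x * flatten y) i j" .
qed

lemma flatten_inject: "flatten x = flatten y \<longleftrightarrow> x = y"
  by (metis unflatten_flatten)

lemma ring_map_unflatten: "ring_map unflatten"
  unfolding ring_map_def
proof (intro conjI allI)
  fix x y :: "'a finmat"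
  have "unflatten (flatten (unflatten x) + flatten (unflatten y)) = unflatten x + unflatten y"
    by (simp only: ring_map_add[OF ring_map_flatten, symmetric] unflatten_flatten)
  then show "unflatten (x + y) = unflatten x + unflatten y" by simp
  have "unflatten (flatten (unflatten x) * flatten (unflatten y)) = unflatten x * unflatten y"
    by (simp only: ring_map_mult[OF ring_map_flatten, symmetric] unflatten_flatten)
  then show "unflatten (x * y) = unflatten x * unflatten y" by simp
qed

lemma flatten_idm: "finite I \<Longrightarrow> finite J \<Longrightarrow> flatten (idm I (idm J e)) = idm (prod_encode ` (I \<times> J)) e"
proof (rule finmat_eqI)
  fix i j assume fin: "finite I" "finite J"
  obtain a x b y where "i = prod_encode (a, x)" "j = prod_encode (b, y)"
    by (metis prod_decode_inverse surj_pair)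
  then show "entry (flatten (idm I (idm J e))) i j = entry (idm (prod_encode ` (I \<times> J)) e) i j"
    using fin by (auto simp: entry_flatten entry_idm inj_image_mem_iff inj_prod_encode)
qed

lemma flatten_single: "flatten (single a b (single i j x)) = single (prod_encode (a, i)) (prod_encode (b, j)) x"
proof (rule finmat_eqI)
  fix i' j'
  obtain p q r t where "i' = prod_encode (p, q)" "j' = prod_encode (r, t)"
    by (metis prod_decode_inverse surj_pair)
  then show "entry (flatten (single a b (single i j x))) i' j' =
      entry (single (prod_encode (a, i)) (prod_encode (b, j)) x) i' j'"
    by (auto simp: entry_flatten entry_single)
qed

text \<open>The flip from \<open>A \<otimes> B\<close> to \<open>B \<otimes> A\<close> on the two
  outermost levels. It brings a chosen tensor factor to the outside, for instance the block index of
  a bidiagonal point.\<close>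

definition swap_levels :: "'a :: ring finmat finmat \<Rightarrow> 'a finmat finmat" where
  "swap_levels M = unflatten (finmat (\<lambda>i j. entry (entry M (snd (prod_decode i)) (snd (prod_decode j)))
     (fst (prod_decode i)) (fst (prod_decode j))))"

lemma entry_swap_levels: "entry (entry (swap_levels M) i j) a b = entry (entry M a b) i j"
proof -
  define U where "U = (\<Union>a\<in>support M. \<Union>b\<in>support M. support (entry M a b))"
  have *: "finite U" unfolding U_def by simp
  have "entry (finmat (\<lambda>i j. entry (entry M (snd (prod_decode i)) (snd (prod_decode j)))
     (fst (prod_decode i)) (fst (prod_decode j)))) = (\<lambda>i j. entry (entry M (snd (prod_decode i)) (snd (prod_decode j)))
     (fst (prod_decode i)) (fst (prod_decode j)))"
  proof (rule entry_finmat_subset[of "prod_encode ` (U \<times> support M)" "prod_encode ` (U \<times> support M)"])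
    fix i j
    obtain a x b y where ab: "prod_decode i = (x, a)" "prod_decode j = (y, b)"
      by (metis surj_pair)
    assume "entry (entry M (snd (prod_decode i)) (snd (prod_decode j))) (fst (prod_decode i)) (fst (prod_decode j)) \<noteq> 0"
    then have "entry (entry M a b) x y \<noteq> 0" using ab by simp
    moreover from this have "entry M a b \<noteq> 0" by auto
    ultimately have "a \<in> support M" "b \<in> support M" "x \<in> support (entry M a b)" "y \<in> support (entry M a b)"
      using supportD by blast+
    moreover from this have "x \<in> U" "y \<in> U" unfolding U_def by blast+
    moreover have "i = prod_encode (x, a)" "j = prod_encode (y, b)"
      using ab by (metis prod_decode_inverse)+
    ultimately show "i \<in> prod_encode ` (U \<times> support M) \<and> j \<in> prod_encode ` (U \<times> support M)" by blast
  qed (use * in auto)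
  then show ?thesis unfolding swap_levels_def by (simp add: entry_unflatten)
qed

lemma swap_swap [simp]: "swap_levels (swap_levels M) = M"
  by (intro finmat_eqI) (simp add: entry_swap_levels)

lemma ring_map_swap: "ring_map swap_levels"
  unfolding ring_map_def
proof (intro conjI allI finmat_eqI)
  fix x y :: "'a finmat finmat" and i j a b
  show "entry (entry (swap_levels (x + y)) i j) a b = entry (entry (swap_levels x + swap_levels y) i j) a b"
    by (simp add: entry_swap_levels)
  define A where "A = support x"
  define U where "U = (\<Union>a\<in>support x. \<Union>b\<in>support x. support (entry x a b))"
  have fin: "finite A" "finite U" unfolding A_def U_def by auto
  have U: "entry (entry x a b) i l = 0" if "l \<notin> U" for a b i l
  proof (rule ccontr)
    assume *: "entry (entry x a b) i l \<noteq> 0"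
    then have "entry x a b \<noteq> 0" by auto
    then have "a \<in> support x" "b \<in> support x" "l \<in> support (entry x a b)" using supportD * by blast+
    then show False using that U_def by blast
  qed
  have "entry (entry (swap_levels (x * y)) i j) a b = (\<Sum>c\<in>A. entry (entry x a c * entry y c b) i j)"
    by (simp add: entry_swap_levels entry_mult_big[of A] fin A_def)
  also have "\<dots> = (\<Sum>c\<in>A. \<Sum>l\<in>U. entry (entry x a c) i l * entry (entry y c b) l j)"
    by (intro sum.cong refl entry_times) (use fin U in auto)
  also have "\<dots> = (\<Sum>l\<in>U. \<Sum>c\<in>A. entry (entry x a c) i l * entry (entry y c b) l j)"
    by (rule sum.swap)
  also have "\<dots> = (\<Sum>l\<in>U. entry (entry (swap_levels x) i l * entry (swap_levels y) l j) a b)"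
  proof (intro sum.cong refl)
    fix l
    have "entry (entry (swap_levels x) i l * entry (swap_levels y) l j) a b =
        (\<Sum>c\<in>A. entry (entry (swap_levels x) i l) a c * entry (entry (swap_levels y) l j) c b)"
      by (rule entry_times) (use fin in \<open>auto simp: entry_swap_levels A_def entry_eq_0\<close>)
    then show "(\<Sum>c\<in>A. entry (entry x a c) i l * entry (entry y c b) l j) =
        entry (entry (swap_levels x) i l * entry (swap_levels y) l j) a b"
      by (simp add: entry_swap_levels)
  qed
  also have "\<dots> = entry (\<Sum>l\<in>U. entry (swap_levels x) i l * entry (swap_levels y) l j) a b"
    by simp
  also have "(\<Sum>l\<in>U. entry (swap_levels x) i l * entry (swap_levels y) l j) =
      entry (swap_levels x * swap_levels y) i j"
  proof (rule entry_times[symmetric])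
    fix l assume "l \<notin> U"
    then show "entry (swap_levels x) i l = 0 \<or> entry (swap_levels y) l j = 0"
      using U by (intro disjI1 finmat_eqI) (simp add: entry_swap_levels)
  qed (use fin in auto)
  finally show "entry (entry (swap_levels (x * y)) i j) a b =
    entry (entry (swap_levels x * swap_levels y) i j) a b" .
qed

lemma swap_idm: "finite I \<Longrightarrow> finite J \<Longrightarrow> swap_levels (idm I (idm J e)) = idm J (idm I e)"
  by (intro finmat_eqI) (auto simp: entry_swap_levels entry_idm)

section \<open>Evaluation of expressions in corners\<close>

locale kalg =
  fixes scale :: "'k :: field \<Rightarrow> 'b :: ring \<Rightarrow> 'b"
  assumes scale_add_right: "scale c (x + y) = scale c x + scale c y"
    and scale_add_left: "scale (c + d) x = scale c x + scale d x"
    and scale_scale: "scale c (scale d x) = scale (c * d) x"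
    and scale_one: "scale 1 x = x"
    and scale_mult_left: "scale c x * y = scale c (x * y)"
    and scale_mult_right: "x * scale c y = scale c (x * y)"
begin

lemma scale_zero_right [simp]: "scale c 0 = 0"
  by (rule additive_zero) (rule scale_add_right)

lemma scale_zero_left [simp]: "scale 0 x = 0"
  by (rule additive_zero[of "\<lambda>c. scale c x"]) (rule scale_add_left)

lemma scale_uminus_left: "scale (- c) x = - scale c x"
  by (rule additive_uminus[of "\<lambda>c. scale c x"]) (rule scale_add_left)

lemma scale_diff_right: "scale c (x - y) = scale c x - scale c y"
  by (rule additive_diff) (rule scale_add_right)

lemma scale_diff_left: "scale (c - d) x = scale c x - scale d x"
  by (rule additive_diff[of "\<lambda>c. scale c x"]) (rule scale_add_left)

lemma scale_sum_right: "scale c (sum f I) = (\<Sum>i\<in>I. scale c (f i))"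
  by (rule additive_sum) (rule scale_add_right)

lemma scale_sum_left: "scale (sum f I) x = (\<Sum>i\<in>I. scale (f i) x)"
  by (rule additive_sum[of "\<lambda>c. scale c x"]) (rule scale_add_left)

lemma scale_times: "scale c x * scale d y = scale (c * d) (x * y)"
  by (simp add: scale_mult_left scale_mult_right scale_scale mult.commute)

lemma corner_scale: "corner e x \<Longrightarrow> corner e (scale c x)"
  by (simp add: corner_def scale_mult_left scale_mult_right)

end

definition mscale :: "('k \<Rightarrow> 'b :: ring \<Rightarrow> 'b) \<Rightarrow> 'k \<Rightarrow> 'b finmat \<Rightarrow> 'b finmat" where
  "mscale scale c = mapm (scale c)"

lemma (in kalg) entry_mscale: "entry (mscale scale c M) i j = scale c (entry M i j)"
  unfolding mscale_def by (simp add: entry_mapm)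

lemma (in kalg) entry_scale_times:
  "entry (mscale scale c M * N) i j = scale c (entry (M * N) i j)"
  "entry (M * mscale scale c N) i j = scale c (entry (M * N) i j)"
proof -
  let ?J = "support M \<union> support N"
  show "entry (mscale scale c M * N) i j = scale c (entry (M * N) i j)"
    by (subst (1 2) entry_times[of ?J])
      (auto simp: entry_mscale scale_mult_left scale_sum_right entry_eq_0)
  show "entry (M * mscale scale c N) i j = scale c (entry (M * N) i j)"
    by (subst (1 2) entry_times[of ?J])
      (auto simp: entry_mscale scale_mult_right scale_sum_right entry_eq_0)
qed

lemma (in kalg) kalg_mscale: "kalg (mscale scale)"
  by (unfold_locales; rule finmat_eqI)
    (simp_all add: entry_mscale entry_scale_times scale_add_right scale_add_left scale_scale scale_one)

lemma kalg_times: "kalg ((*) :: 'k :: field \<Rightarrow> 'k \<Rightarrow> 'k)"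
  by unfold_locales (simp_all add: algebra_simps)

text \<open>The Kronecker product of a scalar matrix with an algebra element; the scalar matrix
  provides the outer level.\<close>

definition tens :: "('k :: field \<Rightarrow> 'b :: ring \<Rightarrow> 'b) \<Rightarrow> 'k finmat \<Rightarrow> 'b \<Rightarrow> 'b finmat" where
  "tens scale A z = mapm (\<lambda>c. scale c z) A"

context kalg
begin

lemma entry_tens: "entry (tens scale A z) i j = scale (entry A i j) z"
  unfolding tens_def by (simp add: entry_mapm)

lemma tens_mult: "tens scale A y * tens scale B z = tens scale (A * B) (y * z)"
proof (rule finmat_eqI)
  fix i j
  let ?J = "support A"
  have "entry (tens scale A y * tens scale B z) i j =
      (\<Sum>l\<in>?J. entry (tens scale A y) i l * entry (tens scale B z) l j)"
    by (rule entry_times) (auto simp: entry_tens entry_eq_0)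
  also have "\<dots> = entry (tens scale (A * B) (y * z)) i j"
    by (simp add: entry_tens entry_times_support scale_times scale_sum_left)
  finally show "entry (tens scale A y * tens scale B z) i j = entry (tens scale (A * B) (y * z)) i j" .
qed

lemma tens_add_left: "tens scale (A + B) z = tens scale A z + tens scale B z"
  and tens_add_right: "tens scale A (y + z) = tens scale A y + tens scale A z"
  by (rule finmat_eqI, simp add: entry_tens scale_add_left scale_add_right)+

lemma tens_zero [simp]: "tens scale 0 z = 0" "tens scale A 0 = 0"
  by (rule finmat_eqI, simp add: entry_tens)+

lemma tens_uminus_left: "tens scale (- A) z = - tens scale A z"
  by (rule finmat_eqI) (simp add: entry_tens scale_uminus_left)

lemma tens_diff_left: "tens scale (A - B) z = tens scale A z - tens scale B z"
  by (rule finmat_eqI) (simp add: entry_tens scale_diff_left)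

lemma tens_diff_right: "tens scale A (y - z) = tens scale A y - tens scale A z"
  by (rule finmat_eqI) (simp add: entry_tens scale_diff_right)

lemma tens_sum_left: "tens scale (sum f I) z = (\<Sum>i\<in>I. tens scale (f i) z)"
  by (rule finmat_eqI) (simp add: entry_tens scale_sum_left)

lemma tens_sum_right: "tens scale A (sum f I) = (\<Sum>i\<in>I. tens scale A (f i))"
  by (rule finmat_eqI) (simp add: entry_tens scale_sum_right)

lemma tens_single: "tens scale (single i j c) z = single i j (scale c z)"
  by (rule finmat_eqI) (simp add: entry_tens entry_single)

lemma tens_idm: "finite J \<Longrightarrow> tens scale (idm J 1) z = idm J z"
  by (rule finmat_eqI) (auto simp add: entry_tens entry_idm scale_one)

end

text \<open>A single relation for domain and value: the expression is defined at \<open>X\<close>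
  and has value \<open>v\<close> in the corner of \<open>e\<close>. The empty word is evaluated as
  \<open>e\<close> and inverses are relative to \<open>e\<close>, so no global unit enters.\<close>

primrec EV :: "('k :: field \<Rightarrow> 'b :: ring \<Rightarrow> 'b) \<Rightarrow> 'b \<Rightarrow> ('d \<Rightarrow> 'b) \<Rightarrow> ('d, 'k) nc_expr \<Rightarrow> 'b \<Rightarrow> bool" where
  "EV scale e X (Poly p) v \<longleftrightarrow> (\<forall>k. corner e (X k)) \<and>
     v = (\<Sum>w \<in> Poly_Mapping.keys p. scale (Poly_Mapping.lookup p w) (foldr (\<lambda>k b. X k * b) w e))"
| "EV scale e X (Add Q1 Q2) v \<longleftrightarrow> (\<exists>v1 v2. EV scale e X Q1 v1 \<and> EV scale e X Q2 v2 \<and> v = v1 + v2)"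
| "EV scale e X (Mult Q1 Q2) v \<longleftrightarrow> (\<exists>v1 v2. EV scale e X Q1 v1 \<and> EV scale e X Q2 v2 \<and> v = v1 * v2)"
| "EV scale e X (Inv Q) v \<longleftrightarrow> (\<exists>u. EV scale e X Q u \<and> corner e v \<and> u * v = e \<and> v * u = e)"

lemma corner_self: "e * e = e \<Longrightarrow> corner e e"
  by (simp add: corner_def)

lemma corner_foldr:
  assumes "e * e = e" "\<And>k. corner e (X k)"
  shows "corner e (foldr (\<lambda>k b. X k * b) w e)"
  by (induction w) (use assms in \<open>auto intro: corner_mult corner_self\<close>)

context kalg
begin

lemma EV_corner:
  assumes "e * e = e"
  shows "EV scale e X Q v \<Longrightarrow> corner e v"
proof (induction Q arbitrary: v)
  case (Poly p)
  then show ?case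
    by (auto intro!: corner_sum corner_scale corner_foldr assms)
qed (auto intro: corner_add corner_mult)

lemma EV_arg_corner: "EV scale e X Q v \<Longrightarrow> corner e (X k)"
  by (induction Q arbitrary: v) auto

lemma EV_unique: "e * e = e \<Longrightarrow> EV scale e X Q v \<Longrightarrow> EV scale e X Q w \<Longrightarrow> v = w"
proof (induction Q arbitrary: v w)
  case (Inv Q)
  then obtain u where u: "corner e v" "u * v = e" "v * u = e" "corner e w" "u * w = e" "w * u = e"
    by (metis EV.simps(4))
  have "v = v * (u * w)" by (simp only: u corner_right[OF u(1)])
  also have "\<dots> = (v * u) * w" by (simp only: mult.assoc)
  also have "\<dots> = w" by (simp only: u corner_left[OF u(4)])
  finally show ?case .
qed (auto; metis)+

end

text \<open>Words, sums and inverses relative to \<open>e\<close> are carried to those relative to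
  \<open>f e\<close>. Changes of size such as adding a unit tensor factor, regrouping levels or
  specializing a polynomial parameter are instances of this transport.\<close>

lemma EV_hom:
  assumes f: "ring_map f" and sc: "\<And>c x. f (scale c x) = scale' c (f x)"
  shows "EV scale e X Q v \<Longrightarrow> EV scale' (f e) (\<lambda>k. f (X k)) Q (f v)"
proof (induction Q arbitrary: v)
  case (Poly p)
  have "f (foldr (\<lambda>k b. X k * b) w e) = foldr (\<lambda>k b. f (X k) * b) w (f e)" for w
    by (induction w) (simp_all add: ring_map_mult[OF f])
  with Poly show ?case by (auto simp: ring_map_sum[OF f] sc intro: ring_map_corner[OF f])
next
  case (Add Q1 Q2)
  then show ?case by simp (metis ring_map_add[OF f])
next
  case (Mult Q1 Q2)
  then show ?case by simp (metis ring_map_mult[OF f])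
next
  case (Inv Q)
  then show ?case by simp (metis ring_map_mult[OF f] ring_map_corner[OF f])
qed

lemma orth_mult:
  fixes a :: "'b :: ring"
  assumes "a * e = a" "e' * b = b" "e * e' = 0"
  shows "a * b = 0"
proof -
  have "a * b = (a * e) * (e' * b)" using assms by simp
  also have "\<dots> = a * (e * e') * b" by (simp only: mult.assoc)
  finally show ?thesis using assms by simp
qed

text \<open>Upper triangular elements \<open>x + y + w\<close> with respect to orthogonal idempotents.\<close>

lemma tri_mult:
  fixes e1 :: "'b :: ring"
  assumes o: "e1 * e2 = 0" "e2 * e1 = 0"
    and x: "corner e1 x" "corner e1 x'" and y: "corner e2 y" "corner e2 y'"
    and w: "e1 * w = w" "w * e2 = w" "e1 * w' = w'" "w' * e2 = w'"
  shows "(x + y + w) * (x' + y' + w') = x * x' + y * y' + (x * w' + w * y')"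
proof -
  note z = orth_mult
  note c = x[unfolded corner_def] y[unfolded corner_def]
  have "x * y' = 0" by (rule z[of x e1 e2]) (use c o in auto)
  moreover have "y * x' = 0" by (rule z[of y e2 e1]) (use c o in auto)
  moreover have "y * w' = 0" by (rule z[of y e2 e1]) (use c o w in auto)
  moreover have "w * x' = 0" by (rule z[of w e2 e1]) (use c o w in auto)
  moreover have "w * w' = 0" by (rule z[of w e2 e1]) (use c o w in auto)
  ultimately show ?thesis by (simp add: algebra_simps)
qed

lemma tri_corner:
  assumes e: "e1 * e1 = e1" "e2 * e2 = e2" and o: "e1 * e2 = 0" "e2 * e1 = 0"
    and x: "corner e1 x" and y: "corner e2 y" and w: "e1 * w = w" "w * e2 = w"
  shows "corner (e1 + e2) (x + y + w)"
proof -
  note c = x[unfolded corner_def] y[unfolded corner_def]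
  have "e1 * y = 0" by (rule orth_mult[of e1 e1 e2]) (use c o e in auto)
  moreover have "e2 * x = 0" by (rule orth_mult[of e2 e2 e1]) (use c o e in auto)
  moreover have "e2 * w = 0" by (rule orth_mult[of e2 e2 e1]) (use w o e in auto)
  moreover have "x * e2 = 0" by (rule orth_mult[of x e1 e2]) (use c o e in auto)
  moreover have "y * e1 = 0" by (rule orth_mult[of y e2 e1]) (use c o e in auto)
  moreover have "w * e1 = 0" by (rule orth_mult[of w e2 e1]) (use w o e in auto)
  ultimately show ?thesis using c w unfolding corner_def by (simp add: distrib_left distrib_right)
qed

lemma tri_entry_mult:
  fixes e1 :: "'b :: ring"
  assumes "corner e1 x" "corner e2 y'" "e1 * w = w" "w * e2 = w" "e1 * w' = w'" "w' * e2 = w'"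
  shows "e1 * (x * w' + w * y') = x * w' + w * y'" "(x * w' + w * y') * e2 = x * w' + w * y'"
  using assms unfolding corner_def
  by (simp_all add: distrib_left distrib_right mult.assoc) (simp_all flip: mult.assoc)

text \<open>A triangular element with invertible diagonal is invertible, so the expression stays
  defined whatever is put above the diagonal. Only the existence of the upper right part of the
  value is recorded; it is computed later by solving a linear system.\<close>

lemma (in kalg) EV_triangular:
  assumes e: "e1 * e1 = e1" "e2 * e2 = e2" and o: "e1 * e2 = 0" "e2 * e1 = 0"
    and W: "\<And>k. e1 * W k = W k" "\<And>k. W k * e2 = W k"
  shows "EV scale e1 X1 Q v1 \<Longrightarrow> EV scale e2 X2 Q v2 \<Longrightarrow>
    \<exists>w. e1 * w = w \<and> w * e2 = w \<and> EV scale (e1 + e2) (\<lambda>k. X1 k + X2 k + W k) Q (v1 + v2 + w)"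
proof (induction Q arbitrary: v1 v2)
  case (Poly p)
  then have c: "corner e1 (X1 k)" "corner e2 (X2 k)" for k by auto
  have ex: "\<forall>w. \<exists>w'. e1 * w' = w' \<and> w' * e2 = w' \<and> foldr (\<lambda>k b. (X1 k + X2 k + W k) * b) w (e1 + e2) =
      foldr (\<lambda>k b. X1 k * b) w e1 + foldr (\<lambda>k b. X2 k * b) w e2 + w'"
  proof
    fix w
    show "\<exists>w'. e1 * w' = w' \<and> w' * e2 = w' \<and> foldr (\<lambda>k b. (X1 k + X2 k + W k) * b) w (e1 + e2) =
      foldr (\<lambda>k b. X1 k * b) w e1 + foldr (\<lambda>k b. X2 k * b) w e2 + w'"
    proof (induction w)
    case Nil
    show ?case by (rule exI[of _ 0]) simp
  next
    case (Cons k w)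
    then obtain w' where w': "e1 * w' = w'" "w' * e2 = w'" "foldr (\<lambda>k b. (X1 k + X2 k + W k) * b) w (e1 + e2) =
      foldr (\<lambda>k b. X1 k * b) w e1 + foldr (\<lambda>k b. X2 k * b) w e2 + w'" by blast
    note c2 = corner_foldr[of e1 X1 w, OF e(1) c(1)] corner_foldr[of e2 X2 w, OF e(2) c(2)]
    \<comment> \<open>The product rule for triangular elements: the first letter meets the upper
      right part of the rest, and the upper right part of the first letter meets the diagonal of the
      rest.\<close>
    show ?case
    proof (intro exI[of _ "X1 k * w' + W k * foldr (\<lambda>k b. X2 k * b) w e2"] conjI)
      show "foldr (\<lambda>k b. (X1 k + X2 k + W k) * b) (k # w) (e1 + e2) =
        foldr (\<lambda>k b. X1 k * b) (k # w) e1 + foldr (\<lambda>k b. X2 k * b) (k # w) e2 +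
          (X1 k * w' + W k * foldr (\<lambda>k b. X2 k * b) w e2)"
        using tri_mult[OF o c(1)[of k] c2(1) c(2)[of k] c2(2) W[of k] w'(1,2)]
        by (simp only: foldr.simps comp_apply w'(3))
    qed (rule tri_entry_mult[OF c(1)[of k] c2(2) W[of k] w'(1,2)])+
  qed
  qed
  obtain t where t: "\<And>w. e1 * t w = t w" "\<And>w. t w * e2 = t w"
    "\<And>w. foldr (\<lambda>k b. (X1 k + X2 k + W k) * b) w (e1 + e2) =
      foldr (\<lambda>k b. X1 k * b) w e1 + foldr (\<lambda>k b. X2 k * b) w e2 + t w"
    using choice[OF ex] by blast
  have "corner (e1 + e2) (X1 k + X2 k + W k)" for k
    by (rule tri_corner[OF e o c W])
  moreover have "v1 + v2 + (\<Sum>w\<in>Poly_Mapping.keys p. scale (Poly_Mapping.lookup p w) (t w)) =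
      (\<Sum>w\<in>Poly_Mapping.keys p. scale (Poly_Mapping.lookup p w) (foldr (\<lambda>k b. (X1 k + X2 k + W k) * b) w (e1 + e2)))"
    using Poly by (simp only: EV.simps t(3) scale_add_right sum.distrib)
  ultimately show ?case
    by (intro exI[of _ "\<Sum>w\<in>Poly_Mapping.keys p. scale (Poly_Mapping.lookup p w) (t w)"] conjI)
      (simp_all only: EV.simps sum_distrib_left sum_distrib_right scale_mult_left scale_mult_right t(1,2) simp_thms)
next
  case (Add Q1 Q2)
  obtain a1 b1 a2 b2 where ab: "EV scale e1 X1 Q1 a1" "EV scale e1 X1 Q2 b1" "v1 = a1 + b1"
    "EV scale e2 X2 Q1 a2" "EV scale e2 X2 Q2 b2" "v2 = a2 + b2"
    using Add.prems by auto
  obtain w w' where w: "e1 * w = w" "w * e2 = w" "EV scale (e1 + e2) (\<lambda>k. X1 k + X2 k + W k) Q1 (a1 + a2 + w)"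
     "e1 * w' = w'" "w' * e2 = w'" "EV scale (e1 + e2) (\<lambda>k. X1 k + X2 k + W k) Q2 (b1 + b2 + w')"
    using Add.IH ab by blast
  show ?case
  proof (intro exI conjI)
    show "EV scale (e1 + e2) (\<lambda>k. X1 k + X2 k + W k) (Add Q1 Q2) (v1 + v2 + (w + w'))"
      unfolding EV.simps ab(3,6)
      by (intro exI conjI) (rule w, rule w, simp add: algebra_simps)
  qed (simp_all add: w distrib_left distrib_right)
next
  case (Mult Q1 Q2)
  obtain a1 b1 a2 b2 where ab: "EV scale e1 X1 Q1 a1" "EV scale e1 X1 Q2 b1" "v1 = a1 * b1"
    "EV scale e2 X2 Q1 a2" "EV scale e2 X2 Q2 b2" "v2 = a2 * b2"
    using Mult.prems by auto
  obtain w w' where w: "e1 * w = w" "w * e2 = w" "EV scale (e1 + e2) (\<lambda>k. X1 k + X2 k + W k) Q1 (a1 + a2 + w)"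
     "e1 * w' = w'" "w' * e2 = w'" "EV scale (e1 + e2) (\<lambda>k. X1 k + X2 k + W k) Q2 (b1 + b2 + w')"
    using Mult.IH ab by blast
  note c = EV_corner[OF e(1) ab(1)] EV_corner[OF e(1) ab(2)] EV_corner[OF e(2) ab(4)] EV_corner[OF e(2) ab(5)]
  show ?case
  proof (intro exI conjI)
    show "EV scale (e1 + e2) (\<lambda>k. X1 k + X2 k + W k) (Mult Q1 Q2) (v1 + v2 + (a1 * w' + w * b2))"
      unfolding EV.simps ab(3,6)
      by (intro exI conjI) (rule w, rule w, simp only: tri_mult[OF o c w(1,2,4,5)])
  qed (rule tri_entry_mult[OF c(1,4) w(1,2,4,5)])+
next
  case (Inv Q)
  obtain u1 u2 where u: "EV scale e1 X1 Q u1" "corner e1 v1" "u1 * v1 = e1" "v1 * u1 = e1"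
    "EV scale e2 X2 Q u2" "corner e2 v2" "u2 * v2 = e2" "v2 * u2 = e2"
    using Inv.prems by auto
  obtain w where w: "e1 * w = w" "w * e2 = w" "EV scale (e1 + e2) (\<lambda>k. X1 k + X2 k + W k) Q (u1 + u2 + w)"
    using Inv.IH u by blast
  note c = EV_corner[OF e(1) u(1)] EV_corner[OF e(2) u(5)]
  \<comment> \<open>The upper right part of the inverse of a triangular element with diagonal
    \<open>u1\<close>, \<open>u2\<close> and upper right part \<open>w\<close>.\<close>
  define w' where "w' = - (v1 * w * v2)"
  have w': "e1 * w' = w'" "w' * e2 = w'"
    unfolding w'_def using u(2,6) by (simp_all add: corner_def mult.assoc) (simp_all add: corner_def flip: mult.assoc)
  have 1: "u1 * w' + w * v2 = 0"
    unfolding w'_def using u(3) w(1) by (simp flip: mult.assoc)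
  have 2: "v1 * w + w' * u2 = 0"
    unfolding w'_def using u(8) w(2) by (simp add: mult.assoc)
  show ?case
  proof (intro exI conjI)
    show "EV scale (e1 + e2) (\<lambda>k. X1 k + X2 k + W k) (Inv Q) (v1 + v2 + w')"
      unfolding EV.simps
    proof (intro exI conjI)
      show "EV scale (e1 + e2) (\<lambda>k. X1 k + X2 k + W k) Q (u1 + u2 + w)" by fact
      show "(u1 + u2 + w) * (v1 + v2 + w') = e1 + e2"
        using tri_mult[OF o c(1) u(2) c(2) u(6) w(1,2) w'] 1 u by simp
      show "(v1 + v2 + w') * (u1 + u2 + w) = e1 + e2"
        using tri_mult[OF o u(2) c(1) u(6) c(2) w' w(1,2)] 2 u by simp
      show "corner (e1 + e2) (v1 + v2 + w')"
        by (rule tri_corner[OF e o u(2) u(6) w'])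
    qed
  qed (rule w')+
qed

section \<open>Stable finiteness\<close>

text \<open>Rows and columns are renumbered by \<open>\<phi>\<close> and \<open>\<psi>\<close>, so a
  matrix of given dimensions can be placed on any index sets of the right size. For injective
  numberings this is an embedding compatible with products.\<close>

definition of_mat :: "(nat \<Rightarrow> nat) \<Rightarrow> (nat \<Rightarrow> nat) \<Rightarrow> 'a :: ring mat \<Rightarrow> 'a finmat" where
  "of_mat \<phi> \<psi> M = (\<Sum>i<dim_row M. \<Sum>j<dim_col M. single (\<phi> i) (\<psi> j) (M $$ (i, j)))"

definition to_mat :: "nat \<Rightarrow> nat \<Rightarrow> (nat \<Rightarrow> nat) \<Rightarrow> (nat \<Rightarrow> nat) \<Rightarrow> 'a :: ring finmat \<Rightarrow> 'a mat" where
  "to_mat p q \<phi> \<psi> F = mat p q (\<lambda>(i, j). entry F (\<phi> i) (\<psi> j))"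

lemma to_mat_carrier [simp]: "to_mat p q \<phi> \<psi> F \<in> carrier_mat p q"
  by (simp add: to_mat_def)

lemma entry_of_mat:
  assumes M: "M \<in> carrier_mat p q" and inj: "inj_on \<phi> {..<p}" "inj_on \<psi> {..<q}" and ij: "i < p" "j < q"
  shows "entry (of_mat \<phi> \<psi> M) (\<phi> i) (\<psi> j) = M $$ (i, j)"
proof -
  have "entry (of_mat \<phi> \<psi> M) (\<phi> i) (\<psi> j) =
      (\<Sum>i'<p. \<Sum>j'<q. if i' = i \<and> j' = j then M $$ (i', j') else 0)"
    unfolding of_mat_def entry_sum entry_single using M inj ij
    by (intro sum.cong) (auto dest: inj_onD)
  also have "\<dots> = (\<Sum>i'<p. if i' = i then (\<Sum>j'<q. if j' = j then M $$ (i', j') else 0) else 0)"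
    by (intro sum.cong) auto
  also have "\<dots> = M $$ (i, j)" using ij by simp
  finally show ?thesis .
qed

lemma entry_of_mat_outside:
  assumes "M \<in> carrier_mat p q" "a \<notin> \<phi> ` {..<p} \<or> b \<notin> \<psi> ` {..<q}"
  shows "entry (of_mat \<phi> \<psi> M) a b = 0"
  unfolding of_mat_def entry_sum entry_single using assms by (intro sum.neutral ballI) auto

lemma finmat_eq_of_matI:
  assumes M: "M \<in> carrier_mat p q" and inj: "inj_on \<phi> {..<p}" "inj_on \<psi> {..<q}"
    and "\<And>i j. i < p \<Longrightarrow> j < q \<Longrightarrow> entry F (\<phi> i) (\<psi> j) = M $$ (i, j)"
    and "\<And>a b. a \<notin> \<phi> ` {..<p} \<or> b \<notin> \<psi> ` {..<q} \<Longrightarrow> entry F a b = 0"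
  shows "F = of_mat \<phi> \<psi> M"
proof (rule finmat_eqI)
  fix a b
  show "entry F a b = entry (of_mat \<phi> \<psi> M) a b"
    by (cases "a \<in> \<phi> ` {..<p} \<and> b \<in> \<psi> ` {..<q}")
      (use assms entry_of_mat[OF M inj] entry_of_mat_outside[OF M] in auto)
qed

lemma to_mat_of_mat:
  assumes M: "M \<in> carrier_mat p q" and inj: "inj_on \<phi> {..<p}" "inj_on \<psi> {..<q}"
  shows "to_mat p q \<phi> \<psi> (of_mat \<phi> \<psi> M) = M"
  by (rule eq_matI) (use M in \<open>auto simp: to_mat_def entry_of_mat[OF M inj]\<close>)

lemma of_mat_inject:
  assumes "M \<in> carrier_mat p q" "N \<in> carrier_mat p q" "inj_on \<phi> {..<p}" "inj_on \<psi> {..<q}"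
  shows "of_mat \<phi> \<psi> M = of_mat \<phi> \<psi> N \<longleftrightarrow> M = N"
  using assms to_mat_of_mat by metis

lemma of_mat_to_mat:
  assumes inj: "inj_on \<phi> {..<p}" "inj_on \<psi> {..<q}"
    and F: "\<And>a b. a \<notin> \<phi> ` {..<p} \<or> b \<notin> \<psi> ` {..<q} \<Longrightarrow> entry F a b = 0"
  shows "of_mat \<phi> \<psi> (to_mat p q \<phi> \<psi> F) = F"
  by (rule finmat_eq_of_matI[OF to_mat_carrier inj, symmetric]) (use F in \<open>auto simp: to_mat_def\<close>)

lemma of_mat_mult:
  assumes M: "M \<in> carrier_mat p q" and N: "N \<in> carrier_mat q r" and inj: "inj_on \<psi> {..<q}"
  shows "of_mat \<phi> \<psi> M * of_mat \<psi> \<chi> N = of_mat \<phi> \<chi> (M * N)"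
proof -
  have "of_mat \<phi> \<psi> M * of_mat \<psi> \<chi> N = (\<Sum>i<p. \<Sum>j<q. \<Sum>j'<q. \<Sum>l<r.
      single (\<phi> i) (\<psi> j) (M $$ (i, j)) * single (\<psi> j') (\<chi> l) (N $$ (j', l)))"
    unfolding of_mat_def carrier_matD[OF M] carrier_matD[OF N]
    by (simp only: sum_distrib_right, simp only: sum_distrib_left)
  also have "\<dots> = (\<Sum>i<p. \<Sum>j<q. \<Sum>j'<q. if j' = j then (\<Sum>l<r.
      single (\<phi> i) (\<chi> l) (M $$ (i, j) * N $$ (j', l))) else 0)"
  proof (intro sum.cong refl)
    fix i j j' assume "j \<in> {..<q}" "j' \<in> {..<q}"
    then have "\<psi> j = \<psi> j' \<longleftrightarrow> j' = j" using inj by (auto dest: inj_onD)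
    then show "(\<Sum>l<r. single (\<phi> i) (\<psi> j) (M $$ (i, j)) * single (\<psi> j') (\<chi> l) (N $$ (j', l))) =
      (if j' = j then (\<Sum>l<r. single (\<phi> i) (\<chi> l) (M $$ (i, j) * N $$ (j', l))) else 0)"
      by (simp add: single_mult)
  qed
  also have "\<dots> = (\<Sum>i<p. \<Sum>l<r. \<Sum>j<q. single (\<phi> i) (\<chi> l) (M $$ (i, j) * N $$ (j, l)))"
  proof (rule sum.cong[OF refl])
    fix i
    show "(\<Sum>j<q. \<Sum>j'<q. if j' = j then (\<Sum>l<r. single (\<phi> i) (\<chi> l) (M $$ (i, j) * N $$ (j', l))) else 0) =
      (\<Sum>l<r. \<Sum>j<q. single (\<phi> i) (\<chi> l) (M $$ (i, j) * N $$ (j, l)))"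
      by (simp add: sum.swap[of _ "{..<q}" "{..<r}"])
  qed
  also have "\<dots> = of_mat \<phi> \<chi> (M * N)"
    unfolding of_mat_def using M N
    by (auto simp: scalar_prod_def single_sum atLeast0LessThan intro!: sum.cong)
  finally show ?thesis .
qed

lemma of_mat_add:
  "M \<in> carrier_mat p q \<Longrightarrow> N \<in> carrier_mat p q \<Longrightarrow> of_mat \<phi> \<psi> (M + N) = of_mat \<phi> \<psi> M + of_mat \<phi> \<psi> N"
  unfolding of_mat_def by (auto simp: single_add sum.distrib)

lemma of_mat_diff:
  "M \<in> carrier_mat p q \<Longrightarrow> N \<in> carrier_mat p q \<Longrightarrow> of_mat \<phi> \<psi> (M - N) = of_mat \<phi> \<psi> M - of_mat \<phi> \<psi> N"
  unfolding of_mat_def by (auto simp: single_diff sum_subtractf)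

lemma of_mat_one:
  assumes "inj_on \<phi> {..<n}"
  shows "of_mat \<phi> \<phi> (1\<^sub>m n) = idm (\<phi> ` {..<n}) (1 :: 'a :: ring_1)"
  by (rule finmat_eq_of_matI[symmetric, of _ n n])
    (use assms in \<open>auto simp: entry_idm dest: inj_onD\<close>)

lemma of_mat_corner:
  fixes M :: "'a :: ring_1 mat"
  assumes "M \<in> carrier_mat n n"
  shows "corner (idm (\<phi> ` {..<n}) 1) (of_mat \<phi> \<phi> M)"
  by (rule corner_idm_iff[THEN iffD2]) (use entry_of_mat_outside[OF assms] in \<open>auto simp: corner_def\<close>)

text \<open>Direct (Dedekind) finiteness of the corner of \<open>e\<close>.\<close>

definition sfin :: "'a :: ring \<Rightarrow> bool" where
  "sfin e \<longleftrightarrow> (\<forall>x y. corner e x \<longrightarrow> corner e y \<longrightarrow> x * y = e \<longrightarrow> y * x = e)"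

text \<open>Stable finiteness of the corner: all its finite matrix rings are directly finite.
  Arbitrary finite index sets replace initial segments, since direct sums and merged levels produce
  such sets.\<close>

definition sfin_all :: "'a :: ring \<Rightarrow> bool" where
  "sfin_all e \<longleftrightarrow> e * e = e \<and> (\<forall>J. finite J \<longrightarrow> sfin (idm J e))"

lemma sfin_all_idem: "sfin_all e \<Longrightarrow> e * e = e"
  unfolding sfin_all_def by (rule conjunct1)

lemma sfin_allD: "sfin_all e \<Longrightarrow> finite J \<Longrightarrow> sfin (idm J e)"
  unfolding sfin_all_def by blast

lemma sfinD: "sfin e \<Longrightarrow> corner e x \<Longrightarrow> corner e y \<Longrightarrow> x * y = e \<Longrightarrow> y * x = e"
  unfolding sfin_def by blast

lemma sfin_all_one:
  assumes "stably_finite TYPE('a :: ring_1)"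
  shows "sfin_all (1 :: 'a)"
  unfolding sfin_all_def
proof (intro conjI allI impI)
  fix J :: "nat set" assume J: "finite J"
  show "sfin (idm J (1 :: 'a))"
  \<comment> \<open>Stable finiteness is defined through sizes \<open>m \<ge> 1\<close>; over the
    empty index set the matrix ring is zero.\<close>
  proof (cases "J = {}")
    case True
    then show ?thesis by (simp add: sfin_def idm_def corner_def)
  next
    case False
    then have n: "card J \<ge> 1" using J by (simp add: Suc_leI card_gt_0_iff)
    obtain \<phi> where \<phi>: "bij_betw \<phi> {..<card J} J"
      using J ex_bij_betw_nat_finite by (metis atLeast0LessThan)
    then have inj: "inj_on \<phi> {..<card J}" and im: "\<phi> ` {..<card J} = J"
      by (auto simp: bij_betw_def)
    note one = of_mat_one[OF inj, unfolded im, where 'a = 'a]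
    show ?thesis
      unfolding sfin_def
    proof (intro allI impI)
      fix x y assume xy: "corner (idm J (1 :: 'a)) x" "corner (idm J 1) y" "x * y = idm J 1"
      define M where "M = to_mat (card J) (card J) \<phi> \<phi> x"
      define N where "N = to_mat (card J) (card J) \<phi> \<phi> y"
      have c: "M \<in> carrier_mat (card J) (card J)" "N \<in> carrier_mat (card J) (card J)"
        by (simp_all add: M_def N_def)
      have x: "of_mat \<phi> \<phi> M = x" unfolding M_def
        by (rule of_mat_to_mat[OF inj inj]) (use im xy J in \<open>auto simp: corner_idm_iff\<close>)
      have y: "of_mat \<phi> \<phi> N = y" unfolding N_def
        by (rule of_mat_to_mat[OF inj inj]) (use im xy J in \<open>auto simp: corner_idm_iff\<close>)
      have "of_mat \<phi> \<phi> (M * N) = of_mat \<phi> \<phi> (1\<^sub>m (card J))"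
        using of_mat_mult[OF c inj, of \<phi> \<phi>] x y xy one by simp
      then have "M * N = 1\<^sub>m (card J)"
        using of_mat_inject[OF _ _ inj inj, of "M * N" "1\<^sub>m (card J)"] c by auto
      then have "N * M = 1\<^sub>m (card J)"
        using assms[unfolded stably_finite_def, rule_format, OF n c] by simp
      then show "y * x = idm J 1"
        using of_mat_mult[OF c(2,1) inj, of \<phi> \<phi>] x y one by simp
    qed
  qed
qed simp

lemma stably_finite_field: "stably_finite TYPE('k :: field)"
  unfolding stably_finite_def using mat_mult_left_right_inverse by blast

text \<open>Matrices over a matrix ring are matrices over the base ring: \<open>flatten\<close>
  carries the nested unit to a plain diagonal unit over the set of encoded pairs.\<close>

lemma sfin_all_idm:
  assumes e: "sfin_all e" and J: "finite J"
  shows "sfin_all (idm J e)"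
  unfolding sfin_all_def
proof (intro conjI allI impI)
  show "idm J e * idm J e = idm J e"
    by (rule idm_idem[OF J sfin_all_idem[OF e]])
  fix I :: "nat set" assume I: "finite I"
  have "sfin (flatten (idm I (idm J e)))"
    unfolding flatten_idm[OF I J] by (intro sfin_allD[OF e] finite_imageI finite_cartesian_product I J)
  note sf = this
  show "sfin (idm I (idm J e))"
    unfolding sfin_def
  proof (intro allI impI)
    fix x y assume xy: "corner (idm I (idm J e)) x" "corner (idm I (idm J e)) y" "x * y = idm I (idm J e)"
    have "flatten y * flatten x = flatten (idm I (idm J e))"
      by (rule sfinD[OF sf ring_map_corner[OF ring_map_flatten xy(1)] ring_map_corner[OF ring_map_flatten xy(2)]])
        (simp only: xy(3) flip: ring_map_mult[OF ring_map_flatten])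
    then show "y * x = idm I (idm J e)"
      by (simp add: flatten_inject flip: ring_map_mult[OF ring_map_flatten])
  qed
qed

text \<open>With respect to \<open>p\<close> and \<open>q = e - p\<close> the element
  \<open>x\<close> is block triangular. At first \<open>p y p\<close> is only a left inverse of the
  block \<open>x p\<close>. Adding \<open>q\<close> to both moves this relation to the corner of
  \<open>e\<close>, where finiteness makes the inverse two-sided; then
  \<open>y p = y (x p) (p y p) = p y p\<close>.\<close>

lemma invertible_preserves:
  fixes e :: "'a :: ring"
  assumes e: "sfin e" "e * e = e" and x: "corner e x" "corner e y" "x * y = e" "y * x = e"
    and p: "corner e p" "p * p = p" and inv: "x * p = p * x * p"
  shows "y * p = p * y * p"
proof -
  note c = x[unfolded corner_def] p[unfolded corner_def]
  define q where "q = e - p"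
  have q: "p * q = 0" "q * p = 0" "p + q = e" "corner e q" "q * q = q"
    unfolding q_def corner_def using c e by (simp_all add: algebra_simps)
  have yp: "p * y * p * (x * p) = p"
  proof -
    have "p * y * p * (x * p) = p * y * (p * x * p)" by (simp only: mult.assoc)
    also have "\<dots> = p * y * (x * p)" by (simp only: inv)
    also have "\<dots> = p * (y * x) * p" by (simp only: mult.assoc)
    finally show ?thesis using c by simp
  qed
  have xq: "x * p * q = 0" "q * (x * p) = 0" "q * (p * y * p) = 0" "p * y * p * q = 0"
    using q inv by (simp_all add: mult.assoc) (simp_all flip: mult.assoc add: q)
  have "(p * y * p + q) * (x * p + q) = e"
    using yp xq q by (simp add: distrib_left distrib_right)
  moreover have "corner e (p * y * p + q)" "corner e (x * p + q)"
    using q(4) x p by (auto intro!: corner_add corner_mult)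
  ultimately have "(x * p + q) * (p * y * p + q) = e"
    using e unfolding sfin_def by blast
  then have "x * p * (p * y * p) = p"
    using q xq by (simp add: distrib_left distrib_right) (metis add_right_cancel)
  then have "y * p = y * (x * p * (p * y * p))" by simp
  also have "\<dots> = (y * x) * (p * p) * y * p" by (simp only: mult.assoc)
  also have "\<dots> = p * y * p" using c by simp
  finally show ?thesis .
qed

section \<open>One-sided ideals of matrices over a field\<close>

text \<open>Over a field and a finite index set such a right ideal is the same as a subspace, namely
  the set of matrices whose columns all lie in the subspace. Invariant subspaces are handled in this
  form, within the ring itself.\<close>

definition right_ideal :: "'a :: ring \<Rightarrow> 'a set \<Rightarrow> bool" where
  "right_ideal e V \<longleftrightarrow> 0 \<in> V \<and> (\<forall>x\<in>V. e * x = x) \<and> (\<forall>x\<in>V. \<forall>y\<in>V. x + y \<in> V) \<and> (\<forall>x\<in>V. \<forall>r. x * r \<in> V)"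

definition left_ideal :: "'a :: ring \<Rightarrow> 'a set \<Rightarrow> bool" where
  "left_ideal e V \<longleftrightarrow> 0 \<in> V \<and> (\<forall>x\<in>V. x * e = x) \<and> (\<forall>x\<in>V. \<forall>y\<in>V. x + y \<in> V) \<and> (\<forall>x\<in>V. \<forall>r. r * x \<in> V)"

text \<open>Dimension count from direct finiteness. After renumbering \<open>J\<close> as an initial
  segment, suppose that \<open>r\<close> exceeds \<open>card J\<close>; then both factors lie in the
  corner of size \<open>r\<close>, so their product in the other order would be the unit although
  its row with index \<open>card J\<close> vanishes.\<close>

lemma rank_bound:
  fixes u v :: "'k :: field finmat"
  assumes J: "finite J" and v: "idm J 1 * v = v" "v * idm {..<r} 1 = v"
    and u: "idm {..<r} 1 * u = u" "u * idm J 1 = u" and uv: "u * v = idm {..<r} 1"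
  shows "r \<le> card J" "r = card J \<Longrightarrow> v * u = idm J 1"
proof -
  let ?n = "card J"
  obtain \<phi> where "bij_betw \<phi> J {..<?n}"
    using J ex_bij_betw_finite_nat by (metis atLeast0LessThan)
  then have inj: "inj_on \<phi> J" and im: "\<phi> ` J = {..<?n}" by (auto simp: bij_betw_def)
  \<comment> \<open>The relabelling matrices between \<open>J\<close> and the initial segment of the
    same size.\<close>
  define w where "w = (\<Sum>j\<in>J. single (\<phi> j) j (1 :: 'k))"
  define w' where "w' = (\<Sum>j\<in>J. single j (\<phi> j) (1 :: 'k))"
  have w'w: "w' * w = idm J 1"
  proof -
    have "w' * w = (\<Sum>j\<in>J. \<Sum>i\<in>J. if i = j then single j j 1 else 0)"
      unfolding w_def w'_def sum_distrib_left sum_distrib_right single_mult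
      using inj by (subst sum.swap) (auto intro!: sum.cong dest: inj_onD)
    then show ?thesis using J by (simp add: idm_def)
  qed
  have ww': "w * w' = idm {..<?n} 1"
  proof -
    have "w * w' = (\<Sum>j\<in>J. \<Sum>i\<in>J. if i = j then single (\<phi> j) (\<phi> j) 1 else 0)"
      unfolding w_def w'_def sum_distrib_left sum_distrib_right single_mult
      by (subst sum.swap) (auto intro!: sum.cong)
    also have "\<dots> = (\<Sum>j\<in>J. single (\<phi> j) (\<phi> j) 1)" using J by simp
    also have "\<dots> = (\<Sum>j\<in>\<phi> ` J. single j j 1)" by (simp add: sum.reindex[OF inj])
    finally show ?thesis by (simp add: idm_def im)
  qed
  have sf: "sfin (idm I (1 :: 'k))" if "finite I" for I
    by (rule sfin_allD[OF sfin_all_one[OF stably_finite_field] that])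
  define v1 where "v1 = w * v"
  define u1 where "u1 = u * w'"
  have 1: "idm {..<?n} 1 * v1 = v1"
    by (simp only: v1_def flip: ww') (simp only: mult.assoc assoc_left[OF w'w] v(1))
  have 2: "u1 * idm {..<?n} 1 = u1"
    by (simp only: u1_def flip: ww') (simp only: mult.assoc assoc_left[OF w'w] assoc_left[OF u(2)])
  have 3: "v1 * idm {..<r} 1 = v1" "idm {..<r} 1 * u1 = u1"
    by (simp_all only: v1_def u1_def mult.assoc v(2) assoc_left[OF u(1)])
  have 4: "u1 * v1 = idm {..<r} 1"
    by (simp only: v1_def u1_def mult.assoc assoc_left[OF w'w] v(1) uv)
  show le: "r \<le> ?n"
  proof (rule ccontr)
    assume "\<not> r \<le> ?n"
    then have r: "?n < r" by simp
    have sub: "idm {..<r} 1 * idm {..<?n} 1 = idm {..<?n} (1 :: 'k)" "idm {..<?n} 1 * idm {..<r} 1 = idm {..<?n} (1 :: 'k)"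
      by (rule finmat_eqI, use r in \<open>auto simp: entry_idm_mult entry_idm\<close>)+
    have "idm {..<r} 1 * v1 = v1" "u1 * idm {..<r} 1 = u1"
      using assoc_left[OF sub(1), of v1] 1 arg_cong[OF sub(2), of "\<lambda>x. u1 * x"] 2 by (simp_all flip: mult.assoc)
    then have "corner (idm {..<r} 1) v1" "corner (idm {..<r} 1) u1"
      using 3 by (auto simp: corner_def)
    then have "v1 * u1 = idm {..<r} 1"
      using sfinD[OF sf[of "{..<r}"]] 4 by blast
    then have "idm {..<?n} 1 * idm {..<r} 1 = idm {..<r} (1 :: 'k)"
      using assoc_left[OF 1, of u1] by simp
    then have "entry (idm {..<?n} (1 :: 'k)) ?n ?n = entry (idm {..<r} (1 :: 'k)) ?n ?n"
      using sub by simp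
    then show False using r by (simp add: entry_idm)
  qed
  assume r: "r = ?n"
  then have "corner (idm {..<r} 1) v1" "corner (idm {..<r} 1) u1"
    using 1 2 3 by (auto simp: corner_def)
  then have "v1 * u1 = idm {..<r} 1"
    using sfinD[OF sf[of "{..<r}"]] 4 by blast
  then have "w' * (w * v * (u * w')) * w = w' * (w * w') * w"
    using ww' r unfolding v1_def u1_def by simp
  then have "(w' * w) * v * (u * (w' * w)) = (w' * w) * (w' * w)" by (simp only: mult.assoc)
  then show "v * u = idm J 1" using u v J by (simp add: w'w idm_mult)
qed

text \<open>The columns of \<open>v\<close> form a basis of the subspace, \<open>r\<close> is its
  dimension, and \<open>u\<close> is a dual family of rows, so \<open>v u\<close> is a projection
  onto the subspace. A maximal \<open>r\<close> replaces elimination: an element \<open>x\<close>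
  with \<open>v u x \<noteq> x\<close> leaves the remainder \<open>x - v u x\<close>, which
  \<open>u\<close> kills and from which a further column is made.\<close>

lemma right_ideal_basis:
  fixes V :: "'k :: field finmat set"
  assumes J: "finite J" and V: "right_ideal (idm J 1) V"
  obtains r v u where "v \<in> V" "v * idm {..<r} 1 = v" "idm {..<r} 1 * u = u" "u * idm J 1 = u"
    "u * v = idm {..<r} 1" "\<And>x. x \<in> V \<Longrightarrow> v * u * x = x" "r \<le> card J" "r = card J \<Longrightarrow> v * u = idm J 1"
proof -
  define P where "P r \<longleftrightarrow> (\<exists>v u. v \<in> V \<and> v * idm {..<r} 1 = v \<and> idm {..<r} 1 * u = u \<and> u * idm J 1 = u \<and>
    u * v = idm {..<r} 1)" for r
  have lV: "idm J 1 * x = x" if "x \<in> V" for x using V that by (simp add: right_ideal_def)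
  have "P 0" unfolding P_def
    by (rule exI[of _ 0], rule exI[of _ 0]) (use V in \<open>simp add: right_ideal_def idm_def\<close>)
  moreover have "\<forall>r. P r \<longrightarrow> r < Suc (card J)"
    unfolding P_def using rank_bound(1)[OF J lV] by (metis less_Suc_eq_le)
  ultimately obtain r where r: "P r" "\<And>r'. P r' \<Longrightarrow> r' \<le> r"
    using ex_has_greatest_nat[of P 0 id "Suc (card J)"] by auto
  then obtain v u where vu: "v \<in> V" "v * idm {..<r} 1 = v" "idm {..<r} 1 * u = u" "u * idm J 1 = u"
    "u * v = idm {..<r} 1" unfolding P_def by blast
  have "v * u * x = x" if x: "x \<in> V" for x
  proof (rule ccontr)
    assume "v * u * x \<noteq> x"
    define y where "y = x + v * (- (u * x))"
    have yV: "y \<in> V" using V x vu(1) unfolding y_def right_ideal_def by blast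
    have "y \<noteq> 0" using \<open>v * u * x \<noteq> x\<close> unfolding y_def by (simp add: mult.assoc)
    then obtain i j where y0: "entry y i j \<noteq> 0" by (metis entry_zero finmat_eqI)
    have "u * (v * (u * x)) = idm {..<r} 1 * u * x" unfolding vu(5)[symmetric] by (simp only: mult.assoc)
    then have uy: "u * y = 0" unfolding y_def using vu(3) by (simp add: right_diff_distrib)
    have iJ: "i \<in> J"
      using lV[OF yV] y0 entry_idm_mult[OF J, of 1 y i j] by (metis)
    \<comment> \<open>Column \<open>j\<close> of the remainder, scaled so that its entry in row
      \<open>i\<close> is 1, becomes the new basis column \<open>r\<close>. The new dual row reads
      off row \<open>i\<close> after the old components are removed.\<close>
    define y' where "y' = y * single j r (1 / entry y i j)"
    define u' where "u' = single r i 1 - single r i 1 * (v * u)"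
    have y'V: "y' \<in> V" using V yV unfolding y'_def right_ideal_def by blast
    have r0: "idm {..<r} 1 * single r i c = 0" "single i r c * idm {..<r} 1 = 0" for i c
      by (rule finmat_eqI, auto simp: entry_idm_mult entry_mult_idm entry_single)+
    have uv': "u * y' = 0" unfolding y'_def using uy by (simp flip: mult.assoc)
    have u'v: "u' * v = 0"
    proof -
      have "u' * v = single r i 1 * v - single r i 1 * (v * (u * v))"
        unfolding u'_def by (simp add: left_diff_distrib mult.assoc)
      then show ?thesis using vu by simp
    qed
    have u'y': "u' * y' = single r r 1"
    proof -
      have "u' * y' = single r i 1 * y'" unfolding u'_def
        using uv' by (simp add: left_diff_distrib mult.assoc)
      also have "\<dots> = single r r 1"
        unfolding y'_def
        by (rule finmat_eqI) (use y0 in \<open>auto simp: entry_single_mult entry_mult_single entry_single\<close>)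
      finally show ?thesis .
    qed
    have S: "idm {..<Suc r} 1 = idm {..<r} 1 + single r r (1 :: 'k)"
      unfolding idm_def by simp
    have "P (Suc r)" unfolding P_def
    proof (intro exI conjI)
      show "v + y' \<in> V" using V vu(1) y'V unfolding right_ideal_def by blast
      have 1: "v * single r r 1 = 0"
        using vu(2) r0(1)[of r 1] by (metis mult.assoc mult_zero_right)
      have 2: "y' * idm {..<r} 1 = 0" unfolding y'_def by (simp add: mult.assoc r0)
      have 3: "y' * single r r 1 = y'" unfolding y'_def by (simp add: mult.assoc single_mult)
      show "(v + y') * idm {..<Suc r} 1 = v + y'"
        unfolding S by (simp add: distrib_left distrib_right vu 1 2 3)
      have 4: "single r r 1 * u = 0"
        using vu(3) r0(2)[of r 1] by (metis mult.assoc mult_zero_left)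
      have 5: "idm {..<r} 1 * u' = 0" unfolding u'_def by (simp add: right_diff_distrib r0 flip: mult.assoc)
      have 6: "single r r 1 * u' = u'" unfolding u'_def
        by (simp add: right_diff_distrib single_mult flip: mult.assoc)
      show "idm {..<Suc r} 1 * (u + u') = u + u'"
        unfolding S by (simp add: distrib_left distrib_right vu 4 5 6)
      have "single r i 1 * idm J 1 = single r i (1 :: 'k)"
        by (rule finmat_eqI) (use J iJ in \<open>auto simp: entry_mult_idm entry_single\<close>)
      then have "u' * idm J 1 = u'" unfolding u'_def by (simp add: left_diff_distrib mult.assoc vu)
      then show "(u + u') * idm J 1 = u + u'" by (simp add: distrib_right vu)
      show "(u + u') * (v + y') = idm {..<Suc r} 1"
        unfolding S by (simp add: distrib_left distrib_right vu uv' u'v u'y')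
    qed
    then show False using r(2) by fastforce
  qed
  moreover note rank_bound[OF J lV[OF vu(1)] vu(2-5)]
  ultimately show thesis using that vu by blast
qed

section \<open>Left ideals by transposition, and projections on two levels\<close>

definition mtransp :: "'a :: zero finmat \<Rightarrow> 'a finmat" where
  "mtransp M = finmat (\<lambda>i j. entry M j i)"

lemma entry_mtransp: "entry (mtransp M) i j = entry M j i"
proof -
  have "entry (mtransp M) = (\<lambda>i j. entry M j i)" unfolding mtransp_def
    by (rule entry_finmat_subset[of "support M" "support M"]) (auto dest: supportD)
  then show ?thesis by simp
qed

lemma mtransp_mtransp [simp]: "mtransp (mtransp M) = M"
  and mtransp_add: "mtransp (A + B) = mtransp A + mtransp (B :: 'a :: ring finmat)"
  and mtransp_zero [simp]: "mtransp (0 :: 'a finmat) = 0"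
  by (rule finmat_eqI, simp add: entry_mtransp)+

lemma mtransp_mult: "mtransp (A * B) = mtransp B * mtransp (A :: 'a :: comm_ring finmat)"
proof (rule finmat_eqI)
  fix i j
  let ?J = "support A"
  have "entry (mtransp B * mtransp A) i j = (\<Sum>l\<in>?J. entry (mtransp B) i l * entry (mtransp A) l j)"
    by (rule entry_times) (auto simp: entry_mtransp entry_eq_0)
  then show "entry (mtransp (A * B)) i j = entry (mtransp B * mtransp A) i j"
    by (simp add: entry_mtransp entry_times_support mult.commute)
qed

lemma mtransp_idm [simp]: "finite J \<Longrightarrow> mtransp (idm J e) = idm J e"
  by (rule finmat_eqI) (auto simp: entry_mtransp entry_idm)

lemma left_ideal_basis:
  fixes V :: "'k :: field finmat set"
  assumes J: "finite J" and V: "left_ideal (idm J 1) V"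
  obtains r v u where "v \<in> V" "idm {..<r} 1 * v = v" "u * idm {..<r} 1 = u" "idm J 1 * u = u"
    "v * u = idm {..<r} 1" "\<And>x. x \<in> V \<Longrightarrow> x * (u * v) = x" "r \<le> card J" "r = card J \<Longrightarrow> u * v = idm J 1"
proof -
  have "right_ideal (idm J 1) (mtransp ` V)"
    unfolding right_ideal_def
  proof (intro conjI ballI allI)
    show "0 \<in> mtransp ` V" using V unfolding left_ideal_def by (metis imageI mtransp_zero)
    fix x assume "x \<in> mtransp ` V"
    then obtain x' where x: "x = mtransp x'" "x' \<in> V" by blast
    have "idm J 1 * x = mtransp (x' * idm J 1)" using J by (simp add: x mtransp_mult)
    then show "idm J 1 * x = x" using V x by (simp add: left_ideal_def)
    show "x + y \<in> mtransp ` V" if "y \<in> mtransp ` V" for y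
      using that x V unfolding left_ideal_def by (auto simp flip: mtransp_add)
    have "x * r = mtransp (mtransp r * x')" for r by (simp add: mtransp_mult x)
    then show "x * r \<in> mtransp ` V" for r
      using x V unfolding left_ideal_def by blast
  qed
  note ri = this
  obtain r v u where vu: "v \<in> mtransp ` V"
    "v * idm {..<r} 1 = v" "idm {..<r} 1 * u = u" "u * idm J 1 = u"
    "u * v = idm {..<r} 1" "\<And>x. x \<in> mtransp ` V \<Longrightarrow> v * u * x = x" "r \<le> card J" "r = card J \<Longrightarrow> v * u = idm J 1"
    by (rule right_ideal_basis[OF J ri], rule that)
  show thesis
  proof (rule that[of "mtransp v" r "mtransp u"])
    show "mtransp v \<in> V" using vu(1) by auto
    show "idm {..<r} 1 * mtransp v = mtransp v"
      using arg_cong[OF vu(2), of mtransp] by (simp add: mtransp_mult)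
    show "mtransp u * idm {..<r} 1 = mtransp u"
      using arg_cong[OF vu(3), of mtransp] by (simp add: mtransp_mult)
    show "idm J 1 * mtransp u = mtransp u"
      using arg_cong[OF vu(4), of mtransp] J by (simp add: mtransp_mult)
    show "mtransp v * mtransp u = idm {..<r} 1"
      using arg_cong[OF vu(5), of mtransp] by (simp add: mtransp_mult)
    show "x * (mtransp u * mtransp v) = x" if "x \<in> V" for x
      using arg_cong[OF vu(6)[of "mtransp x"], of mtransp] that by (simp add: mtransp_mult)
    show "mtransp u * mtransp v = idm J 1" if "r = card J"
      using arg_cong[OF vu(8)[OF that], of mtransp] J by (simp add: mtransp_mult)
  qed fact
qed

text \<open>Flattening reduces the two levels to one. The projection is a basis times its dual; it
  belongs to the ideal because the basis does.\<close>

lemma right_ideal_projection: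
  fixes V :: "'k :: field finmat finmat set"
  assumes fin: "finite I" "finite J" and V: "right_ideal (idm I (idm J 1)) V"
  obtains p where "p \<in> V" "\<And>x. x \<in> V \<Longrightarrow> p * x = x"
proof -
  have "right_ideal (idm (prod_encode ` (I \<times> J)) 1) (flatten ` V)"
    unfolding right_ideal_def
  proof (intro conjI ballI allI)
    show "0 \<in> flatten ` V" using V ring_map_zero[OF ring_map_flatten] unfolding right_ideal_def
      by (metis imageI)
    fix x assume "x \<in> flatten ` V"
    then obtain x' where x: "x = flatten x'" "x' \<in> V" by blast
    show "idm (prod_encode ` (I \<times> J)) 1 * x = x"
      using V x fin by (simp add: right_ideal_def flip: flatten_idm ring_map_mult[OF ring_map_flatten])
    show "x + y \<in> flatten ` V" if "y \<in> flatten ` V" for y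
      using that x V unfolding right_ideal_def by (auto simp flip: ring_map_add[OF ring_map_flatten])
    have "x * r = flatten (x' * unflatten r)" for r by (simp add: ring_map_mult[OF ring_map_flatten] x)
    then show "x * r \<in> flatten ` V" for r
      using x V unfolding right_ideal_def by blast
  qed
  note id = this
  have "finite (prod_encode ` (I \<times> J))" using fin by simp
  note fi = this
  obtain v u where
    vu: "v \<in> flatten ` V" "\<And>x. x \<in> flatten ` V \<Longrightarrow> v * u * x = x"
    by (rule right_ideal_basis[OF fi id], rule that)
  then obtain v' where v': "v = flatten v'" "v' \<in> V" by blast
  have eq: "v * u = flatten (v' * unflatten u)" by (simp add: ring_map_mult[OF ring_map_flatten] v')
  show thesis
  proof (rule that[of "v' * unflatten u"])
    show "v' * unflatten u \<in> V" using v' V by (simp add: right_ideal_def)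
    show "v' * unflatten u * x = x" if "x \<in> V" for x
      using vu(2)[of "flatten x"] that unfolding eq
      by (simp flip: ring_map_mult[OF ring_map_flatten] add: flatten_inject)
  qed
qed

lemma left_ideal_projection:
  fixes V :: "'k :: field finmat finmat set"
  assumes fin: "finite I" "finite J" and V: "left_ideal (idm I (idm J 1)) V"
  obtains p where "p \<in> V" "\<And>x. x \<in> V \<Longrightarrow> x * p = x"
proof -
  have "left_ideal (idm (prod_encode ` (I \<times> J)) 1) (flatten ` V)"
    unfolding left_ideal_def
  proof (intro conjI ballI allI)
    show "0 \<in> flatten ` V" using V ring_map_zero[OF ring_map_flatten] unfolding left_ideal_def
      by (metis imageI)
    fix x assume "x \<in> flatten ` V"
    then obtain x' where x: "x = flatten x'" "x' \<in> V" by blast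
    show "x * idm (prod_encode ` (I \<times> J)) 1 = x"
      using V x fin by (simp add: left_ideal_def flip: flatten_idm ring_map_mult[OF ring_map_flatten])
    show "x + y \<in> flatten ` V" if "y \<in> flatten ` V" for y
      using that x V unfolding left_ideal_def by (auto simp flip: ring_map_add[OF ring_map_flatten])
    have "r * x = flatten (unflatten r * x')" for r by (simp add: ring_map_mult[OF ring_map_flatten] x)
    then show "r * x \<in> flatten ` V" for r
      using x V unfolding left_ideal_def by blast
  qed
  note id = this
  have "finite (prod_encode ` (I \<times> J))" using fin by simp
  note fi = this
  obtain v u where
    vu: "v \<in> flatten ` V" "\<And>x. x \<in> flatten ` V \<Longrightarrow> x * (u * v) = x"
    by (rule left_ideal_basis[OF fi id], rule that)
  then obtain v' where v': "v = flatten v'" "v' \<in> V" by blast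
  have eq: "u * v = flatten (unflatten u * v')" by (simp add: ring_map_mult[OF ring_map_flatten] v')
  show thesis
  proof (rule that[of "unflatten u * v'"])
    show "unflatten u * v' \<in> V" using v' V by (simp add: left_ideal_def)
    show "x * (unflatten u * v') = x" if "x \<in> V" for x
      using vu(2)[of "flatten x"] that unfolding eq
      by (simp flip: ring_map_mult[OF ring_map_flatten] add: flatten_inject)
  qed
qed

section \<open>Controllability and observability\<close>

text \<open>The controllable subspace in the form of a right ideal, generated by all words in the
  \<open>A g\<close> applied to the columns of the \<open>B g\<close>. A realization whose state
  space has unit \<open>E\<close> is controllable if \<open>E\<close> belongs to this set.\<close>

inductive_set ctr :: "'g set \<Rightarrow> ('g \<Rightarrow> 'a :: ring) \<Rightarrow> ('g \<Rightarrow> 'a) \<Rightarrow> 'a set" for G A B where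
  ctr_zero: "0 \<in> ctr G A B"
| ctr_gen: "g \<in> G \<Longrightarrow> B g \<in> ctr G A B"
| ctr_add: "x \<in> ctr G A B \<Longrightarrow> y \<in> ctr G A B \<Longrightarrow> x + y \<in> ctr G A B"
| ctr_right: "x \<in> ctr G A B \<Longrightarrow> x * r \<in> ctr G A B"
| ctr_step: "g \<in> G \<Longrightarrow> x \<in> ctr G A B \<Longrightarrow> A g * x \<in> ctr G A B"

text \<open>Dually, the left ideal of observations, generated by \<open>C\<close> followed by words
  in the \<open>A g\<close>. Observability again means that the unit of the state space is a
  member.\<close>

inductive_set obs :: "'g set \<Rightarrow> ('g \<Rightarrow> 'a :: ring) \<Rightarrow> 'a \<Rightarrow> 'a set" for G A C where
  obs_zero: "0 \<in> obs G A C"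
| obs_gen: "C \<in> obs G A C"
| obs_add: "x \<in> obs G A C \<Longrightarrow> y \<in> obs G A C \<Longrightarrow> x + y \<in> obs G A C"
| obs_left: "x \<in> obs G A C \<Longrightarrow> r * x \<in> obs G A C"
| obs_step: "g \<in> G \<Longrightarrow> x \<in> obs G A C \<Longrightarrow> x * A g \<in> obs G A C"

lemma right_ideal_ctr:
  assumes "\<And>g. g \<in> G \<Longrightarrow> e * A g = A g" "\<And>g. g \<in> G \<Longrightarrow> e * B g = B g"
  shows "right_ideal e (ctr G A B)"
proof -
  have "e * x = x" if "x \<in> ctr G A B" for x
    using that by induction (simp_all add: assms distrib_left flip: mult.assoc)
  then show ?thesis unfolding right_ideal_def by (auto intro: ctr.intros)
qed

lemma left_ideal_obs:
  assumes "\<And>g. g \<in> G \<Longrightarrow> A g * e = A g" "C * e = C"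
  shows "left_ideal e (obs G A C)"
proof -
  have "x * e = x" if "x \<in> obs G A C" for x
    using that by induction (simp_all add: assms distrib_right mult.assoc)
  then show ?thesis unfolding left_ideal_def by (auto intro: obs.intros)
qed

lemma right_ideal_sum: "right_ideal e V \<Longrightarrow> (\<And>i. i \<in> I \<Longrightarrow> f i \<in> V) \<Longrightarrow> sum f I \<in> V"
  by (induction I rule: infinite_finite_induct) (auto simp: right_ideal_def)

lemma right_idealD:
  assumes "right_ideal e V"
  shows "0 \<in> V" "x \<in> V \<Longrightarrow> e * x = x" "x \<in> V \<Longrightarrow> y \<in> V \<Longrightarrow> x + y \<in> V" "x \<in> V \<Longrightarrow> x * r \<in> V"
  using assms unfolding right_ideal_def by blast+

lemma left_idealD:
  assumes "left_ideal e V"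
  shows "0 \<in> V" "x \<in> V \<Longrightarrow> x * e = x" "x \<in> V \<Longrightarrow> y \<in> V \<Longrightarrow> x + y \<in> V" "x \<in> V \<Longrightarrow> r * x \<in> V"
  using assms unfolding left_ideal_def by blast+

text \<open>The tensor product with \<open>z\<close> for scalar matrices that already have two
  levels; \<open>z\<close> becomes the innermost factor.\<close>

definition tens2 :: "('k :: field \<Rightarrow> 'b :: ring \<Rightarrow> 'b) \<Rightarrow> 'k finmat finmat \<Rightarrow> 'b \<Rightarrow> 'b finmat finmat" where
  "tens2 scale x z = mapm (\<lambda>y. tens scale y z) x"

context kalg
begin

lemma entry_tens2: "entry (tens2 scale x z) a b = tens scale (entry x a b) z"
  unfolding tens2_def by (rule entry_mapm) simp

lemma tens2_mult: "tens2 scale x y * tens2 scale x' z = tens2 scale (x * x') (y * z)"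
proof (rule finmat_eqI)
  fix i j
  let ?J = "support x"
  have "entry (tens2 scale x y * tens2 scale x' z) i j =
      (\<Sum>l\<in>?J. entry (tens2 scale x y) i l * entry (tens2 scale x' z) l j)"
    by (rule entry_times) (auto simp: entry_tens2 entry_eq_0)
  also have "\<dots> = entry (tens2 scale (x * x') (y * z)) i j"
    by (simp add: entry_tens2 entry_times_support tens_mult tens_sum_left)
  finally show "entry (tens2 scale x y * tens2 scale x' z) i j = entry (tens2 scale (x * x') (y * z)) i j" .
qed

lemma tens2_add_left: "tens2 scale (x + x') z = tens2 scale x z + tens2 scale x' z"
  by (rule finmat_eqI) (simp add: entry_tens2 tens_add_left)

lemma tens2_diff_left: "tens2 scale (x - x') z = tens2 scale x z - tens2 scale x' z"
  by (rule finmat_eqI) (simp add: entry_tens2 tens_diff_left)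

lemma tens2_uminus_left: "tens2 scale (- x) z = - tens2 scale x z"
  by (rule finmat_eqI) (simp add: entry_tens2 tens_uminus_left)

lemma tens2_zero [simp]: "tens2 scale 0 z = 0" "tens2 scale x 0 = 0"
  by (rule finmat_eqI, simp add: entry_tens2)+

lemma tens2_sum_left: "tens2 scale (sum f I) z = (\<Sum>i\<in>I. tens2 scale (f i) z)"
  by (rule additive_sum[of "\<lambda>x. tens2 scale x z"]) (rule tens2_add_left)

lemma tens2_single: "tens2 scale (single a b x) z = single a b (tens scale x z)"
  by (rule finmat_eqI) (simp add: entry_tens2 entry_single)

lemma tens2_idm: "finite I \<Longrightarrow> tens2 scale (idm I x) z = idm I (tens scale x z)"
  by (rule finmat_eqI) (auto simp add: entry_tens2 entry_idm)

end

section \<open>Comparing two realizations\<close>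

text \<open>Generates the controllable subspaces of two realizations in parallel. A first component
  may have several partners; what is determined by it is their pairing with observations.\<close>

inductive ctr2 :: "'g set \<Rightarrow> ('g \<Rightarrow> 'a :: ring) \<Rightarrow> ('g \<Rightarrow> 'a) \<Rightarrow> ('g \<Rightarrow> 'a) \<Rightarrow> ('g \<Rightarrow> 'a) \<Rightarrow> 'a \<Rightarrow> 'a \<Rightarrow> bool"
  for G A B a b where
  "ctr2 G A B a b 0 0"
| "g \<in> G \<Longrightarrow> ctr2 G A B a b (B g) (b g)"
| "ctr2 G A B a b x x' \<Longrightarrow> ctr2 G A B a b y y' \<Longrightarrow> ctr2 G A B a b (x + y) (x' + y')"
| "ctr2 G A B a b x x' \<Longrightarrow> ctr2 G A B a b (x * r) (x' * r)"
| "g \<in> G \<Longrightarrow> ctr2 G A B a b x x' \<Longrightarrow> ctr2 G A B a b (A g * x) (a g * x')"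

inductive obs2 :: "'g set \<Rightarrow> ('g \<Rightarrow> 'a :: ring) \<Rightarrow> 'a \<Rightarrow> ('g \<Rightarrow> 'a) \<Rightarrow> 'a \<Rightarrow> 'a \<Rightarrow> 'a \<Rightarrow> bool"
  for G A C a c where
  "obs2 G A C a c 0 0"
| "obs2 G A C a c C c"
| "obs2 G A C a c x x' \<Longrightarrow> obs2 G A C a c y y' \<Longrightarrow> obs2 G A C a c (x + y) (x' + y')"
| "obs2 G A C a c x x' \<Longrightarrow> obs2 G A C a c (r * x) (r * x')"
| "g \<in> G \<Longrightarrow> obs2 G A C a c x x' \<Longrightarrow> obs2 G A C a c (x * A g) (x' * a g)"

lemma ctr_ctr2: "x \<in> ctr G A B \<Longrightarrow> \<exists>x'. ctr2 G A B a b x x'"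
  by (induction rule: ctr.induct) (blast intro: ctr2.intros)+

lemma obs_obs2: "x \<in> obs G A C \<Longrightarrow> \<exists>x'. obs2 G A C a c x x'"
  by (induction rule: obs.induct) (blast intro: obs2.intros)+

lemma foldr_mult_right: "foldr (\<lambda>g x. A g * x) ws (x * r) = foldr (\<lambda>g x. A g * x) ws x * (r :: 'a :: ring)"
  by (induction ws) (simp_all add: mult.assoc)

lemma foldr_mult_add: "foldr (\<lambda>g x. A g * x) ws (x + y) =
  foldr (\<lambda>g x. A g * x) ws x + foldr (\<lambda>g x. A g * x) ws (y :: 'a :: ring)"
  by (induction ws) (simp_all add: distrib_left)

lemma foldr_mult_zero: "foldr (\<lambda>g x. A g * x) ws 0 = (0 :: 'a :: ring)"
  by (induction ws) simp_all

text \<open>Equality of moments propagates along the parallel generation because a step by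
  \<open>A g\<close> only appends a letter to the word \<open>ws\<close>.\<close>

lemma ctr2_pairing:
  fixes C :: "'a :: ring"
  assumes mom: "\<And>ws g. set ws \<subseteq> G \<Longrightarrow> g \<in> G \<Longrightarrow>
    C * foldr (\<lambda>g x. A g * x) ws (B g) = c * foldr (\<lambda>g x. a g * x) ws (b g)"
  shows "ctr2 G A B a b x x' \<Longrightarrow> set ws \<subseteq> G \<Longrightarrow>
    C * foldr (\<lambda>g x. A g * x) ws x = c * foldr (\<lambda>g x. a g * x) ws x'"
proof (induction arbitrary: ws rule: ctr2.induct)
  case (5 g x x')
  then show ?case using "5.IH"[of "ws @ [g]"] by simp
qed (simp_all add: mom foldr_mult_add foldr_mult_zero foldr_mult_right distrib_left flip: mult.assoc)

lemma obs2_pairing: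
  fixes C :: "'a :: ring"
  assumes "\<And>ws. set ws \<subseteq> G \<Longrightarrow> C * foldr (\<lambda>g x. A g * x) ws y = c * foldr (\<lambda>g x. a g * x) ws y'"
  shows "obs2 G A C a c x x' \<Longrightarrow> set ws \<subseteq> G \<Longrightarrow>
    x * foldr (\<lambda>g x. A g * x) ws y = x' * foldr (\<lambda>g x. a g * x) ws y'"
proof (induction arbitrary: ws rule: obs2.induct)
  case (5 g x x')
  then show ?case using "5.IH"[of "g # ws"] by (simp add: mult.assoc)
qed (simp_all add: assms distrib_right mult.assoc)

text \<open>A controllable and observable realization \<open>(A, B, C)\<close> is a subquotient of every
  realization \<open>(a, b, c)\<close> with the same moments: the pencil of the former is a quotient (via \<open>p\<close>)
  of the restriction of the pencil of the latter to an invariant subspace (the image of \<open>\<epsilon>\<close>).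
  Stable finiteness turns the resulting one-sided inverses into inverses.\<close>

lemma (in kalg) subquotient:
  fixes A a :: "'g \<Rightarrow> 'k finmat finmat" and I1 I2 J1 J2 :: "nat set"
  defines "E1 \<equiv> idm I1 (idm I2 1)" and "E2 \<equiv> idm J1 (idm J2 1)"
  assumes fin: "finite I1" "finite I2" "finite J1" "finite J2"
    and A: "\<And>g. g \<in> G \<Longrightarrow> corner E1 (A g)" and B: "\<And>g. g \<in> G \<Longrightarrow> E1 * B g = B g" and C: "C * E1 = C"
    and a: "\<And>g. g \<in> G \<Longrightarrow> corner E2 (a g)" and b: "\<And>g. g \<in> G \<Longrightarrow> E2 * b g = b g" and c: "c * E2 = c"
    and ctr: "E1 \<in> ctr G A B" and obs: "E1 \<in> obs G A C"
    and mom: "\<And>ws g. set ws \<subseteq> G \<Longrightarrow> g \<in> G \<Longrightarrow>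
      C * foldr (\<lambda>g x. A g * x) ws (B g) = c * foldr (\<lambda>g x. a g * x) ws (b g)"
    and e: "sfin_all e" and z: "\<And>g. g \<in> G \<Longrightarrow> corner e (z g)"
    and R: "corner (tens2 scale E2 e) R"
      "(tens2 scale E2 e - (\<Sum>g\<in>G. tens2 scale (a g) (z g))) * R = tens2 scale E2 e"
      "R * (tens2 scale E2 e - (\<Sum>g\<in>G. tens2 scale (a g) (z g))) = tens2 scale E2 e"
  shows "\<exists>S. corner (tens2 scale E1 e) S \<and>
    (tens2 scale E1 e - (\<Sum>g\<in>G. tens2 scale (A g) (z g))) * S = tens2 scale E1 e \<and>
    S * (tens2 scale E1 e - (\<Sum>g\<in>G. tens2 scale (A g) (z g))) = tens2 scale E1 e \<and>
    tens2 scale C e * (S * (\<Sum>g\<in>G. tens2 scale (B g) (z g))) =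
      tens2 scale c e * (R * (\<Sum>g\<in>G. tens2 scale (b g) (z g)))"
proof -
  let ?t = "tens2 scale"
  note ee = sfin_all_idem[OF e]
  have EE: "E1 * E1 = E1" "E2 * E2 = E2"
    unfolding E1_def E2_def using fin by (simp_all add: idm_mult)
  have ze: "z g * e = z g" "e * z g = z g" if "g \<in> G" for g
    using z[OF that] by (simp_all add: corner_def)
  \<comment> \<open>The second components fill the controllable subspace of \<open>(a, b)\<close>,
    which every \<open>a g\<close> preserves; \<open>\<epsilon>\<close> will be a projection onto
    it.\<close>
  define V where "V = {y. \<exists>x. ctr2 G A B a b x y}"
  have E2V: "E2 * y = y" if "ctr2 G A B a b x y" for x y
    using that by induction (use a b in \<open>simp_all add: distrib_left corner_def flip: mult.assoc\<close>)
  have V: "right_ideal E2 V"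
    unfolding right_ideal_def V_def using E2V by (blast intro: ctr2.intros)
  obtain \<epsilon>' where eps': "\<epsilon>' \<in> V" "\<And>x. x \<in> V \<Longrightarrow> \<epsilon>' * x = x"
    using right_ideal_projection[OF fin(3,4) V[unfolded E2_def]] by metis
  define \<epsilon> where "\<epsilon> = \<epsilon>' * E2"
  have eps: "\<epsilon> \<in> V" "\<And>x. x \<in> V \<Longrightarrow> \<epsilon> * x = x"
    unfolding \<epsilon>_def using eps' V by (simp_all add: right_ideal_def mult.assoc)
  have epsc: "corner E2 \<epsilon>" unfolding corner_def
    using right_idealD(2)[OF V eps(1)] EE by (simp add: \<epsilon>_def mult.assoc)
  have epse: "\<epsilon> * \<epsilon> = \<epsilon>" using eps by blast
  \<comment> \<open>Controllability and observability of the first realization give the unit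
    \<open>E1\<close> a partner on either side. The observation partner \<open>p\<close> is the
    quotient map, and the control partner \<open>q\<close> will turn out to be a section of
    it.\<close>
  obtain q' where q': "ctr2 G A B a b E1 q'" using ctr_ctr2[OF ctr] by blast
  define q where "q = q' * E1"
  have q: "ctr2 G A B a b E1 q"
    using ctr2.intros(4)[OF q', of E1] EE by (simp add: q_def)
  have qE: "q * E1 = q" by (simp add: q_def mult.assoc EE)
  obtain p' where p': "obs2 G A C a c E1 p'" using obs_obs2[OF obs] by blast
  define p where "p = E1 * p'"
  have p: "obs2 G A C a c E1 p"
    using obs2.intros(4)[OF p', of E1] EE by (simp add: p_def)
  have Ep: "E1 * p = p" by (simp add: p_def EE flip: mult.assoc)
  have pE: "p * E2 = p"
  proof -
    have "y * E2 = y" if "obs2 G A C a c x y" for x y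
      using that by induction (use a c in \<open>simp_all add: distrib_right corner_def mult.assoc\<close>)
    then show ?thesis using p by blast
  qed
  have E1V: "E1 * x = x" if "ctr2 G A B a b x y" for x y
    using that by induction (use A B in \<open>simp_all add: distrib_left corner_def flip: mult.assoc\<close>)
  have pair: "C * foldr (\<lambda>g x. A g * x) ws x = c * foldr (\<lambda>g x. a g * x) ws y"
    if "ctr2 G A B a b x y" "set ws \<subseteq> G" for x y ws
    by (rule ctr2_pairing[of G C A B c a b, OF _ that]) (rule mom)
  \<comment> \<open>The moments turn the pairing of \<open>p\<close> with \<open>y\<close> into that
    of \<open>E1\<close> with \<open>x\<close>, which is \<open>x\<close> itself. So
    \<open>p\<close> recovers the first component of every generated pair.\<close>
  have py: "p * y = x" if "ctr2 G A B a b x y" for x y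
    using obs2_pairing[of G C A x c a y, OF pair[OF that] p, of "[]"] E1V[OF that] by simp
  have pq: "p * q = E1" by (rule py[OF q])
  have eq: "\<epsilon> * q = q" using eps(2) q unfolding V_def by blast
  have eb: "\<epsilon> * b g = b g" "p * b g = B g" if "g \<in> G" for g
  proof -
    have "ctr2 G A B a b (B g) (b g)" using that by (rule ctr2.intros)
    then show "\<epsilon> * b g = b g" "p * b g = B g" using eps(2) py unfolding V_def by blast+
  qed
  obtain xe where xe: "ctr2 G A B a b xe \<epsilon>" using eps(1) unfolding V_def by blast
  have ae: "\<epsilon> * (a g * \<epsilon>) = a g * \<epsilon>" "p * (a g * \<epsilon>) = A g * (p * \<epsilon>)" if "g \<in> G" for g
  proof -
    have "ctr2 G A B a b (A g * xe) (a g * \<epsilon>)" using that xe by (rule ctr2.intros)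
    then show "\<epsilon> * (a g * \<epsilon>) = a g * \<epsilon>" "p * (a g * \<epsilon>) = A g * (p * \<epsilon>)"
      using eps(2) py py[OF xe] unfolding V_def by blast+
  qed
  have Ce: "C * (p * \<epsilon>) = c * \<epsilon>"
    using pair[OF xe, of "[]"] py[OF xe] by simp
  define \<pi> where "\<pi> = ?t E2 e - (\<Sum>g\<in>G. ?t (a g) (z g))"
  define \<Lambda> where "\<Lambda> = ?t E1 e - (\<Sum>g\<in>G. ?t (A g) (z g))"
  define \<beta> where "\<beta> = (\<Sum>g\<in>G. ?t (b g) (z g))"
  have tE: "?t E1 e = idm I1 (idm I2 e)" "?t E2 e = idm J1 (idm J2 e)"
    unfolding E1_def E2_def using fin by (simp_all add: tens2_idm tens_idm)
  have sf: "sfin (?t E1 e)" "sfin (?t E2 e)"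
    unfolding tE using fin by (auto intro!: sfin_allD sfin_all_idm e)
  have \<pi>c: "corner (?t E2 e) \<pi>"
    unfolding \<pi>_def using a z EE ee
    by (intro corner_diff corner_sum) (simp_all add: corner_def tens2_mult)
  have \<Lambda>c: "corner (?t E1 e) \<Lambda>"
    unfolding \<Lambda>_def using A z EE ee
    by (intro corner_diff corner_sum) (simp_all add: corner_def tens2_mult)
  have \<pi>e: "\<pi> * ?t \<epsilon> e = ?t \<epsilon> e - (\<Sum>g\<in>G. ?t (a g * \<epsilon>) (z g))"
    unfolding \<pi>_def using epsc ze ee
    by (simp add: left_diff_distrib sum_distrib_right tens2_mult corner_def)
  have inv: "\<pi> * ?t \<epsilon> e = ?t \<epsilon> e * \<pi> * ?t \<epsilon> e"
    unfolding mult.assoc \<pi>e using ze ee ae epse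
    by (simp add: right_diff_distrib sum_distrib_left tens2_mult)
  have teps: "corner (?t E2 e) (?t \<epsilon> e)" "?t \<epsilon> e * ?t \<epsilon> e = ?t \<epsilon> e"
    using epsc epse ee by (simp_all add: corner_def tens2_mult)
  have \<pi>R: "\<pi> * R = ?t E2 e" "R * \<pi> = ?t E2 e" using R unfolding \<pi>_def by simp_all
  \<comment> \<open>The large pencil preserves the image of \<open>\<epsilon>\<close>; that its
    inverse does so as well is the first use of finiteness of the target.\<close>
  have Re: "R * ?t \<epsilon> e = ?t \<epsilon> e * R * ?t \<epsilon> e"
    by (rule invertible_preserves[OF sf(2) _ \<pi>c R(1) \<pi>R teps inv]) (simp add: tens2_mult EE ee)
  have \<Lambda>p: "\<Lambda> * (?t p e * ?t \<epsilon> e) = ?t p e * (\<pi> * ?t \<epsilon> e)"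
  proof -
    have "\<Lambda> * (?t p e * ?t \<epsilon> e) = ?t (E1 * (p * \<epsilon>)) e - (\<Sum>g\<in>G. ?t (A g * (p * \<epsilon>)) (z g))"
      unfolding \<Lambda>_def using ze ee by (simp add: left_diff_distrib sum_distrib_right tens2_mult)
    also have "\<dots> = ?t (p * \<epsilon>) e - (\<Sum>g\<in>G. ?t (p * (a g * \<epsilon>)) (z g))"
      using ae Ep by (simp flip: mult.assoc)
    also have "\<dots> = ?t p e * (\<pi> * ?t \<epsilon> e)"
      unfolding \<pi>e using ze ee by (simp add: right_diff_distrib sum_distrib_left tens2_mult)
    finally show ?thesis .
  qed
  have Ry: "R * y = ?t \<epsilon> e * (R * y)" if y: "?t \<epsilon> e * y = y" for y
  proof -
    have "R * y = (R * ?t \<epsilon> e) * y" by (simp only: mult.assoc y)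
    also have "\<dots> = (?t \<epsilon> e * R * ?t \<epsilon> e) * y" by (rule arg_cong[OF Re])
    also have "\<dots> = ?t \<epsilon> e * (R * y)" by (simp only: mult.assoc y)
    finally show ?thesis .
  qed
  have key: "\<Lambda> * (?t p e * (R * y)) = ?t p e * y" if y: "?t \<epsilon> e * y = y" for y
  proof -
    note Ry = Ry[OF y]
    have "\<Lambda> * (?t p e * (R * y)) = \<Lambda> * (?t p e * ?t \<epsilon> e) * (R * y)"
      by (subst Ry) (simp only: mult.assoc)
    also have "\<dots> = ?t p e * (\<pi> * (?t \<epsilon> e * (R * y)))"
      unfolding \<Lambda>p by (simp only: mult.assoc)
    also have "\<dots> = ?t p e * ((\<pi> * R) * y)"
      by (simp only: Ry[symmetric] mult.assoc)
    also have "\<dots> = ?t p e * y"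
      using assoc_left[OF corner_left[OF teps(1)], of y] y by (simp only: \<pi>R)
    finally show ?thesis .
  qed
  \<comment> \<open>Lift by the section, solve the large system within the invariant subspace, and
    project. This gives a right inverse of the small pencil; the second use of finiteness makes it
    two-sided.\<close>
  define S where "S = ?t p e * (R * ?t q e)"
  have S1: "\<Lambda> * S = ?t E1 e"
    unfolding S_def by (subst key) (simp_all add: tens2_mult eq pq ee)
  have Et: "?t E1 e * ?t p e = ?t p e" "?t q e * ?t E1 e = ?t q e"
    by (simp_all add: tens2_mult Ep qE ee)
  have Sc: "corner (?t E1 e) S"
    by (simp only: S_def corner_def mult.assoc assoc_left[OF Et(1)] Et(2) simp_thms)
  have S2: "S * \<Lambda> = ?t E1 e" by (rule sfinD[OF sf(1) \<Lambda>c Sc S1])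
  have e\<beta>: "?t \<epsilon> e * \<beta> = \<beta>" "?t p e * \<beta> = (\<Sum>g\<in>G. ?t (B g) (z g))"
    unfolding \<beta>_def using ze eb by (simp_all add: sum_distrib_left tens2_mult)
  have "S * (\<Sum>g\<in>G. ?t (B g) (z g)) = S * \<Lambda> * (?t p e * (R * \<beta>))"
    using key[OF e\<beta>(1)] e\<beta>(2) by (simp only: mult.assoc)
  also have "\<dots> = ?t p e * (R * \<beta>)"
    by (simp only: S2 assoc_left[OF Et(1)])
  finally have SB: "S * (\<Sum>g\<in>G. ?t (B g) (z g)) = ?t p e * (R * \<beta>)" .
  note Rb = Ry[OF e\<beta>(1)]
  have "?t C e * (?t p e * (R * \<beta>)) = ?t C e * (?t p e * (?t \<epsilon> e * (R * \<beta>)))"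
    by (rule arg_cong[OF Rb])
  also have "\<dots> = (?t C e * (?t p e * ?t \<epsilon> e)) * (R * \<beta>)" by (simp only: mult.assoc)
  also have "\<dots> = (?t c e * ?t \<epsilon> e) * (R * \<beta>)"
    using Ce ee by (simp add: tens2_mult)
  also have "\<dots> = ?t c e * (?t \<epsilon> e * (R * \<beta>))" by (simp only: mult.assoc)
  also have "\<dots> = ?t c e * (R * \<beta>)" by (simp only: Rb[symmetric])
  finally have "?t C e * (S * (\<Sum>g\<in>G. ?t (B g) (z g))) = ?t c e * (R * \<beta>)"
    unfolding SB .
  then show ?thesis
    using Sc S1 S2 unfolding \<Lambda>_def \<beta>_def by blast
qed

section \<open>Change of centre\<close>

text \<open>\<open>\<LL>\<close> is the pencil at a matrix point \<open>x\<close> and \<open>M\<close> its inverse; the realization recentred at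
  \<open>x\<close> has the state matrices \<open>A'\<close>, one for each matrix unit of each variable.\<close>

locale recentring = 
  fixes G :: "'g set" and A B :: "'g \<Rightarrow> 'k :: field finmat" and C :: "'k finmat" and L J :: "nat set"
    and x :: "'g \<Rightarrow> 'k finmat" and M \<LL> E u :: "'k finmat finmat"
    and A' B' :: "'g \<times> nat \<times> nat \<Rightarrow> 'k finmat finmat" and G' :: "('g \<times> nat \<times> nat) set"
  assumes fin: "finite G" "finite L" "finite J"
    and A: "\<And>g. g \<in> G \<Longrightarrow> corner (idm L 1) (A g)"
    and B: "\<And>g. g \<in> G \<Longrightarrow> idm L 1 * B g = B g"
    and C: "C * idm L 1 = C"
    and x: "\<And>g. g \<in> G \<Longrightarrow> corner (idm J 1) (x g)"
    and E_def: "E = idm J (idm L 1)"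
    and LL_def: "\<LL> = E - (\<Sum>g\<in>G. tens (mscale (*)) (x g) (A g))"
    and M: "corner E M" "M * \<LL> = E" "\<LL> * M = E"
    and u_def: "u = M * (\<Sum>g\<in>G. tens (mscale (*)) (x g) (B g))"
    and A'_def: "\<And>g a b. A' (g, a, b) = M * single a b (A g)"
    and B'_def: "\<And>g a b. B' (g, a, b) = M * (single a b (B g) + single a b (A g) * u)"
    and G'_def: "G' = G \<times> J \<times> J"
    and J0: "J \<noteq> {}"
begin

interpretation k: kalg "(*) :: 'k \<Rightarrow> _" by (rule kalg_times)
interpretation m: kalg "mscale (*) :: 'k \<Rightarrow> 'k finmat \<Rightarrow> _" by (rule k.kalg_mscale)

lemma EE: "E * E = E"
  unfolding E_def using fin by (simp add: idm_mult)

lemma LL_corner: "corner E \<LL>"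
proof -
  have "corner E (tens (mscale (*)) (x g) (A g))" if "g \<in> G" for g
    using A[OF that] x[OF that] fin
    unfolding E_def corner_def by (simp flip: m.tens_idm add: m.tens_mult)
  then show ?thesis unfolding LL_def by (intro corner_diff corner_sum) (simp_all add: corner_def EE)
qed

lemma sfin_E: "sfin E"
  unfolding E_def using fin
  by (intro sfin_allD sfin_all_idm sfin_all_one stably_finite_field)

text \<open>The diagonal unit over the supports acts as a common right unit; it takes the place of 1
  when a column is moved to another position.\<close>

lemma local_unit: "\<exists>f. y * f = y \<and> z * f = (z :: 'k finmat)"
proof (intro exI conjI)
  let ?f = "idm (support y \<union> support z) 1"
  show "y * ?f = y" by (rule mult_idm_eqI) (auto simp: entry_eq_0)
  show "z * ?f = z" by (rule mult_idm_eqI) (auto simp: entry_eq_0)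
qed

lemma right_ideal_scale:
  assumes "right_ideal e S" "(y :: 'k finmat) \<in> S"
  shows "mscale (*) c y \<in> S"
proof -
  have "mscale (*) c y = y * idm (support y) c"
    by (rule finmat_eqI) (auto simp: k.entry_mscale entry_mult_idm entry_eq_0)
  then show ?thesis using right_idealD(4)[OF assms] by simp
qed

lemma right_ideal_uminus:
  assumes "right_ideal e S" "(y :: 'k finmat) \<in> S"
  shows "- y \<in> S"
  using right_ideal_scale[OF assms, of "-1"] by (simp add: m.scale_uminus_left m.scale_one)

text \<open>The trace of a subspace \<open>V\<close> of the recentred state space on the original
  one: all \<open>y\<close> for which \<open>M\<close> maps \<open>y\<close>, placed in any position
  \<open>a\<close> of \<open>J\<close>, into \<open>V\<close>.\<close>

definition slices :: "'k finmat finmat set \<Rightarrow> 'k finmat set" where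
  "slices V = {y. idm L 1 * y = y \<and> (\<forall>a\<in>J. \<forall>c. M * single a c y \<in> V)}"

context
  fixes V
  assumes V: "right_ideal E V" and inv: "\<And>g y. g \<in> G' \<Longrightarrow> y \<in> V \<Longrightarrow> A' g * y \<in> V"
begin

lemma slices_ideal: "right_ideal (idm L 1) (slices V)"
  unfolding right_ideal_def
proof (intro conjI ballI allI)
  show "0 \<in> slices V" unfolding slices_def using right_idealD(1)[OF V] by simp
  fix y assume y: "y \<in> slices V"
  then show "idm L 1 * y = y" by (simp add: slices_def)
  show "y + z \<in> slices V" if "z \<in> slices V" for z
    using y that right_idealD(3)[OF V] unfolding slices_def by (simp add: distrib_left single_add)
  fix r
  have "M * single a c (y * r) = M * single a c y * single c c r" for a c
    by (simp add: mult.assoc single_mult)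
  then show "y * r \<in> slices V"
    using y right_idealD(4)[OF V] unfolding slices_def by (simp flip: mult.assoc)
qed

text \<open>The matrix \<open>A' (g, a, b)\<close> picks the component \<open>b\<close> of
  \<open>v\<close>, applies \<open>A g\<close>, puts the result in position \<open>a\<close> and
  applies \<open>M\<close>. Invariance of \<open>V\<close> therefore says exactly that the component
  after \<open>A g\<close> is a slice.\<close>

lemma slices_A_entry:
  assumes v: "v \<in> V" and g: "g \<in> G" and b: "b \<in> J"
  shows "A g * entry v b c \<in> slices V"
proof -
  obtain f where f: "entry v b c * f = entry v b c" using local_unit by blast
  have "M * single a c' (A g * entry v b c) \<in> V" if "a \<in> J" for a c'
  proof -
    have "single a b (A g) * v * single c c' f = single a c' (A g * entry v b c)"
      by (rule finmat_eqI) (auto simp: entry_mult_single entry_single_mult entry_single mult.assoc f)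
    then have "M * single a c' (A g * entry v b c) = A' (g, a, b) * v * single c c' f"
      by (simp only: A'_def mult.assoc)
    then show ?thesis
      using inv[OF _ v, of "(g, a, b)"] g b that right_idealD(4)[OF V] by (simp add: G'_def)
  qed
  then show ?thesis
    using A[OF g] by (simp add: slices_def corner_def flip: mult.assoc)
qed

text \<open>Let \<open>q\<close> be the projection onto the tuples over \<open>J\<close> with
  components among the slices, so that \<open>M q \<in> V\<close>. The equation
  \<open>\<LL> M = E\<close> writes \<open>M q\<close> as \<open>q\<close> plus combinations of
  \<open>A g\<close> applied to components of \<open>M q\<close>; these are slices by
  \<open>slices_A_entry\<close>, whence \<open>q M q = M q\<close>. By finiteness
  \<open>\<LL>\<close> also preserves the image of \<open>q\<close>, and
  \<open>q = (M q) (\<LL> q)\<close> lies in \<open>V\<close>.\<close>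

lemma single_slices:
  assumes y: "y \<in> slices V" and a: "a \<in> J"
  shows "single a c y \<in> V"
proof -
  obtain v w where vw: "v \<in> slices V" "\<And>y. y \<in> slices V \<Longrightarrow> v * w * y = y"
    by (rule right_ideal_basis[OF fin(2) slices_ideal], rule that)
  define p where "p = v * w * idm L 1"
  have p: "p \<in> slices V" unfolding p_def using vw(1) slices_ideal right_idealD(4) by metis
  have py: "p * y = y" if "y \<in> slices V" for y
    unfolding p_def mult.assoc right_idealD(2)[OF slices_ideal that]
    using vw(2)[OF that] by (simp only: mult.assoc)
  define q where "q = idm J p"
  have "idm L 1 * p = p" using right_idealD(2)[OF slices_ideal p] .
  moreover have "p * idm L 1 = p" using fin by (simp add: p_def mult.assoc idm_mult)
  ultimately have qE: "corner E q" unfolding q_def E_def corner_def using fin by (simp add: idm_mult)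
  have qq: "q * q = q" unfolding q_def using fin py[OF p] by (simp add: idm_mult)
  have t: "M * q \<in> V"
  proof -
    have "M * q = (\<Sum>a\<in>J. M * single a a p)" by (simp add: q_def idm_def sum_distrib_left)
    then show ?thesis using p right_ideal_sum[OF V, of J] by (simp add: slices_def)
  qed
  have tq: "M * q = q + (\<Sum>g\<in>G. tens (mscale (*)) (x g) (A g) * (M * q))"
  proof -
    have "\<LL> * (M * q) = q" using M(3) qE by (simp add: corner_def flip: mult.assoc)
    moreover have "E * (M * q) = M * q" using M(1) by (simp add: corner_def flip: mult.assoc)
    ultimately show ?thesis
      unfolding LL_def by (simp add: left_diff_distrib sum_distrib_right algebra_simps)
  qed
  have "entry (M * q) b c \<in> slices V" if "b \<in> J" for b c
  proof -
    have "entry (tens (mscale (*)) (x g) (A g) * (M * q)) b c =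
        (\<Sum>l\<in>J. mscale (*) (entry (x g) b l) (A g * entry (M * q) l c))" if "g \<in> G" for g
      by (subst entry_times[of J])
        (use fin x[OF that] in \<open>auto simp: m.entry_tens m.scale_mult_left corner_idm_iff\<close>)
    then have "entry (M * q) b c = entry q b c +
        (\<Sum>g\<in>G. \<Sum>l\<in>J. mscale (*) (entry (x g) b l) (A g * entry (M * q) l c))"
      using arg_cong[OF tq, of "\<lambda>m. entry m b c"] by simp
    moreover have "entry q b c \<in> slices V"
      using p right_idealD(1)[OF slices_ideal] fin by (simp add: q_def entry_idm)
    moreover have "mscale (*) (entry (x g) b l) (A g * entry (M * q) l c) \<in> slices V" if "g \<in> G" "l \<in> J" for g l
      by (rule right_ideal_scale[OF slices_ideal slices_A_entry[OF t that]])
    ultimately show ?thesis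
      using right_idealD(3)[OF slices_ideal] by (metis (no_types, lifting) right_ideal_sum[OF slices_ideal])
  qed
  then have "q * (M * q) = M * q"
    unfolding q_def[of] using py fin
    by (intro idm_mult_eqI) (auto simp: q_def, metis M(1) E_def corner_left' entry_idm_mult)
  then have "M * q = q * M * q" by (simp add: mult.assoc)
  then have "\<LL> * q = q * \<LL> * q"
    by (rule invertible_preserves[OF sfin_E EE M(1) LL_corner M(2,3) qE qq])
  then have "M * (q * \<LL> * q) = M * (\<LL> * q)" by simp
  also have "\<dots> = q" using M(2) qE by (simp add: corner_def flip: mult.assoc)
  finally have "M * q * (\<LL> * q) = q" by (simp only: mult.assoc)
  with right_idealD(4)[OF V t, of "\<LL> * q"] have "q \<in> V" by simp
  from right_idealD(4)[OF V this] have "q * single a c y \<in> V" .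
  moreover have "q * single a c y = single a c y"
    unfolding q_def using py[OF y] a fin
    by (intro finmat_eqI) (simp add: entry_idm_mult entry_single)
  ultimately show ?thesis by simp
qed

lemma slices_A:
  assumes "g \<in> G" "y \<in> slices V"
  shows "A g * y \<in> slices V"
proof -
  obtain a where a: "a \<in> J" using J0 by blast
  have "A g * entry (single a a y) a a \<in> slices V"
    by (rule slices_A_entry[OF single_slices[OF assms(2) a] assms(1) a])
  then show ?thesis by (simp add: entry_single)
qed

end

lemma A'_corner: "g \<in> G' \<Longrightarrow> corner E (A' g)"
proof -
  assume "g \<in> G'"
  then obtain h a b where g: "g = (h, a, b)" "h \<in> G" "a \<in> J" "b \<in> J" by (auto simp: G'_def)
  have "single a b (A h) * E = single a b (A h)"
    unfolding E_def
    by (rule mult_idm_eqI) (use A[OF g(2)] fin g in \<open>auto simp: entry_single corner_def\<close>)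
  then show ?thesis using M(1) by (simp add: g A'_def corner_def mult.assoc) (simp flip: mult.assoc)
qed

lemma B'_left: "g \<in> G' \<Longrightarrow> E * B' g = B' g"
  using M(1) by (cases g) (simp add: B'_def corner_def flip: mult.assoc)

text \<open>Expanding \<open>B'\<close> shows that the entries of \<open>B g\<close> plus
  \<open>A g u\<close> are slices of the new controllable subspace. The fixed point equation for
  \<open>u\<close> expresses the entries of \<open>u\<close> by these, so they are slices too, and
  subtraction leaves \<open>B g\<close>. As slices are invariant under \<open>A\<close>, the old
  unit is a slice, and the tuples of slices then exhaust the recentred state space.\<close>

lemma controllable_recentred:
  assumes ctr: "idm L 1 \<in> ctr G A B"
  shows "E \<in> ctr G' A' B'"
proof -
  let ?V = "ctr G' A' B'"
  have V: "right_ideal E ?V"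
    by (rule right_ideal_ctr) (use A'_corner B'_left in \<open>auto simp: corner_def\<close>)
  have inv: "A' g * y \<in> ?V" if "g \<in> G'" "y \<in> ?V" for g y using that by (rule ctr_step)
  let ?S = "slices ?V"
  note S = slices_ideal[OF V inv]
  have AS: "A g * y \<in> ?S" if "g \<in> G" "y \<in> ?S" for g y by (rule slices_A[OF V inv that])
  let ?d = "\<lambda>g b c. (if b = c then B g else 0) + A g * entry u b c"
  have d: "?d g b c \<in> ?S" if g: "g \<in> G" and b: "b \<in> J" for g b c
  proof -
    obtain f where f: "B g * f = B g" "entry u b c * f = entry u b c" using local_unit by blast
    have "M * single a c' (?d g b c) \<in> ?V" if "a \<in> J" for a c'
    proof -
      have "(single a b (B g) + single a b (A g) * u) * single c c' f = single a c' (?d g b c)"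
        by (rule finmat_eqI)
          (auto simp: entry_mult_single entry_single_mult entry_single mult.assoc distrib_right f)
      then have "M * single a c' (?d g b c) = B' (g, a, b) * single c c' f"
        by (simp only: B'_def mult.assoc)
      moreover have "B' (g, a, b) \<in> ?V" by (rule ctr_gen) (use g b that in \<open>simp add: G'_def\<close>)
      ultimately show ?thesis using ctr_right by metis
    qed
    then show ?thesis unfolding slices_def
      using A[OF g] B[OF g] by (auto simp: corner_def distrib_left simp flip: mult.assoc)
  qed
  have u: "u = (\<Sum>g\<in>G. tens (mscale (*)) (x g) (B g)) + (\<Sum>g\<in>G. tens (mscale (*)) (x g) (A g) * u)"
  proof -
    have xB: "E * tens (mscale (*)) (x g) (B g) = tens (mscale (*)) (x g) (B g)" if "g \<in> G" for g
      using B[OF that] x[OF that] fin unfolding E_def corner_def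
      by (simp flip: m.tens_idm add: m.tens_mult)
    have "\<LL> * u = E * (\<Sum>g\<in>G. tens (mscale (*)) (x g) (B g))"
      unfolding u_def using M(3) by (simp flip: mult.assoc)
    also have "\<dots> = (\<Sum>g\<in>G. tens (mscale (*)) (x g) (B g))" using xB by (simp add: sum_distrib_left)
    finally have "\<LL> * u = (\<Sum>g\<in>G. tens (mscale (*)) (x g) (B g))" .
    moreover have "E * u = u" using M(1) by (simp add: u_def corner_def flip: mult.assoc)
    ultimately show ?thesis
      unfolding LL_def by (simp add: left_diff_distrib sum_distrib_right algebra_simps)
  qed
  have uS: "entry u b c \<in> ?S" if b: "b \<in> J" for b c
  proof -
    have 1: "entry (tens (mscale (*)) (x g) (B g)) b c =
        (\<Sum>l\<in>J. mscale (*) (entry (x g) b l) (if l = c then B g else 0))" if "g \<in> G" for g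
    proof -
      have "(\<Sum>l\<in>J. mscale (*) (entry (x g) b l) (if l = c then B g else 0)) =
          (\<Sum>l\<in>J. if l = c then mscale (*) (entry (x g) b l) (B g) else 0)"
        by (rule sum.cong) auto
      then show ?thesis using fin x[OF that] by (auto simp: m.entry_tens corner_idm_iff)
    qed
    have 2: "entry (tens (mscale (*)) (x g) (A g) * u) b c =
        (\<Sum>l\<in>J. mscale (*) (entry (x g) b l) (A g * entry u l c))" if "g \<in> G" for g
      by (subst entry_times[of J])
        (use fin x[OF that] in \<open>auto simp: m.entry_tens m.scale_mult_left corner_idm_iff\<close>)
    have "entry u b c = (\<Sum>g\<in>G. entry (tens (mscale (*)) (x g) (B g)) b c) +
        (\<Sum>g\<in>G. entry (tens (mscale (*)) (x g) (A g) * u) b c)"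
      using arg_cong[OF u, of "\<lambda>m. entry m b c"] by simp
    also have "\<dots> = (\<Sum>g\<in>G. \<Sum>l\<in>J. mscale (*) (entry (x g) b l) (?d g l c))"
      by (simp add: 1 2 m.scale_add_right sum.distrib)
    also have "\<dots> \<in> ?S"
      by (intro right_ideal_sum[OF S] right_ideal_scale[OF S] d)
    finally show ?thesis .
  qed
  obtain a where a: "a \<in> J" using J0 by blast
  have BS: "B g \<in> ?S" if g: "g \<in> G" for g
    using right_idealD(3)[OF S d[OF g a, of a] right_ideal_uminus[OF S AS[OF g uS[OF a, of a]]]] by simp
  have "y \<in> ?S" if "y \<in> ctr G A B" for y
    using that by induction (auto intro: BS AS right_idealD[OF S])
  then have 1: "idm L 1 \<in> ?S" using ctr by blast
  have "single a a (idm L 1) \<in> ?V" if "a \<in> J" for a by (rule single_slices[OF V inv 1 that])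
  then show ?thesis unfolding E_def idm_def[of J] by (rule right_ideal_sum[OF V])
qed

text \<open>Let \<open>V\<close> be the unobservable subspace after recentring. Its slices are
  invariant under \<open>A\<close> and killed by \<open>C\<close>, hence zero. So for
  \<open>v \<in> V\<close> every component is killed by all \<open>A g\<close> and by
  \<open>C\<close>, which gives \<open>V = 0\<close>. The complement \<open>E - E p\<close> of a
  projection for the ideal of observations lies in \<open>V\<close>, and \<open>E = E p\<close>
  follows.\<close>

lemma observable_recentred:
  assumes obs: "idm L 1 \<in> obs G A C"
  shows "E \<in> obs G' A' (idm J C)"
proof -
  let ?O = "obs G' A' (idm J C)"
  have O: "left_ideal E ?O"
    by (rule left_ideal_obs) (use A'_corner C fin in \<open>auto simp: corner_def E_def idm_mult\<close>)
  obtain p where p: "p \<in> ?O" "\<And>y. y \<in> ?O \<Longrightarrow> y * p = y"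
    using left_ideal_projection[OF fin(3,2) O[unfolded E_def]] by metis
  define V where "V = {y. E * y = y \<and> (\<forall>o'\<in>?O. o' * y = 0)}"
  have V: "right_ideal E V"
    unfolding right_ideal_def V_def by (auto simp: distrib_left) (simp_all flip: mult.assoc)
  have inv: "A' g * y \<in> V" if "g \<in> G'" "y \<in> V" for g y
  proof -
    have "o' * A' g * y = 0" if "o' \<in> ?O" for o'
      using \<open>y \<in> V\<close> obs_step[OF \<open>g \<in> G'\<close> that] unfolding V_def by blast
    then show ?thesis using A'_corner[OF that(1)] unfolding V_def
      by (simp add: corner_def flip: mult.assoc)
  qed
  \<comment> \<open>An invariant family inside the kernel of \<open>C\<close> is zero: every
    observation kills it, and the unit is an observation.\<close>
  have van: "y = 0" if y: "idm L 1 * y = y" "C * y = 0" "\<And>g. g \<in> G \<Longrightarrow> P (A g * y)" "P y"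
    and P: "\<And>y. P y \<Longrightarrow> C * y = 0" "\<And>g y. g \<in> G \<Longrightarrow> P y \<Longrightarrow> P (A g * y)" for y and P :: "'k finmat \<Rightarrow> bool"
  proof -
    have "\<forall>y. P y \<longrightarrow> o' * y = 0" if "o' \<in> obs G A C" for o'
      using that by induction (auto simp: distrib_right mult.assoc P)
    then show ?thesis using obs y by metis
  qed
  obtain a where a: "a \<in> J" using J0 by blast
  have S0: "y = 0" if y: "y \<in> slices V" for y
  proof (rule van[of _ "\<lambda>y. y \<in> slices V"])
    show C0: "C * y = 0" if "y \<in> slices V" for y
    proof -
      have "idm J C * single a a y = 0"
        using single_slices[OF V inv that a] obs_gen[of "idm J C"] unfolding V_def by blast
      then have "entry (idm J C * single a a y) a a = 0" by simp
      then show ?thesis using a fin by (simp add: entry_idm_mult entry_single)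
    qed
    show "C * y = 0" using C0[OF y] .
    show "A g * y \<in> slices V" if "g \<in> G" "y \<in> slices V" for g y
      by (rule slices_A[OF V inv that])
    show "A g * y \<in> slices V" if "g \<in> G" for g
      by (rule slices_A[OF V inv that y])
    show "idm L 1 * y = y" by (rule right_idealD(2)[OF slices_ideal[OF V inv] y])
  qed (rule y)
  have V0: "v = 0" if v: "v \<in> V" for v
  proof (rule finmat_eqI)
    fix b c
    have Ev: "idm J (idm L 1) * v = v" using v unfolding V_def E_def by blast
    have Ev': "b \<in> J \<Longrightarrow> idm L 1 * entry v b c = entry v b c" "b \<notin> J \<Longrightarrow> entry v b c = 0" for b c
      using idm_mult_iff[OF fin(3), THEN iffD1, OF Ev] by blast+
    \<comment> \<open>The component together with 0 is already an invariant family, since every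
      \<open>A g\<close> kills it.\<close>
    have "entry v b c = 0" if b: "b \<in> J"
    proof (rule van[of _ "\<lambda>y. y = 0 \<or> y = entry v b c"])
      have A0: "A g * entry v b c = 0" if "g \<in> G" for g
        by (rule S0[OF slices_A_entry[OF V inv v that b]])
      have "idm J C * v = 0" using v obs_gen[of "idm J C"] unfolding V_def by blast
      then have "entry (idm J C * v) b c = 0" by simp
      then show C0: "C * entry v b c = 0" using b fin by (simp add: entry_idm_mult)
      show "A g * entry v b c = 0 \<or> A g * entry v b c = entry v b c" if "g \<in> G" for g
        using A0[OF that] by blast
      show "C * y = 0" if "y = 0 \<or> y = entry v b c" for y using that C0 by auto
      show "A g * y = 0 \<or> A g * y = entry v b c" if "g \<in> G" "y = 0 \<or> y = entry v b c" for g y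
        using that A0 by auto
      show "idm L 1 * entry v b c = entry v b c" using Ev'(1) b .
    qed simp
    then show "entry v b c = entry 0 b c" using Ev'(2) by (cases "b \<in> J") simp_all
  qed
  have "E - E * p \<in> V"
    unfolding V_def using p(2) left_idealD(2)[OF O]
    by (auto simp: right_diff_distrib EE simp flip: mult.assoc)
  then have "E - E * p = 0" by (rule V0)
  then have "E = E * p" by simp
  then show ?thesis using obs_left[OF p(1), of E] by simp
qed

end

section \<open>Linearization of expressions\<close>

text \<open>Data of a linear representation of a value as output times inverse pencil times input.
  Rows and columns are indexed by a finite set of numbers rather than by a dimension, so that direct
  sums require only disjoint relabellings.\<close>

record (overloaded) ('d, 'k :: zero) pencil =
  pc_set :: "nat set"
  pc_const :: "'k finmat"
  pc_lin :: "'d \<Rightarrow> 'k finmat"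
  pc_out :: "'k finmat"
  pc_in :: "'k finmat"

definition pencil_wf :: "('d, 'k :: field) pencil \<Rightarrow> bool" where
  "pencil_wf P \<longleftrightarrow> finite (pc_set P) \<and> corner (idm (pc_set P) 1) (pc_const P) \<and>
     (\<forall>k. corner (idm (pc_set P) 1) (pc_lin P k)) \<and>
     pc_out P * idm (pc_set P) 1 = pc_out P \<and> idm (pc_set P) 1 * pc_in P = pc_in P"

definition pencil_at :: "('k :: field \<Rightarrow> 'b :: ring \<Rightarrow> 'b) \<Rightarrow> 'b \<Rightarrow> ('d :: finite \<Rightarrow> 'b) \<Rightarrow> ('d, 'k) pencil \<Rightarrow> 'b finmat" where
  "pencil_at scale e X P = tens scale (pc_const P) e + (\<Sum>k\<in>UNIV. tens scale (pc_lin P k) (X k))"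

text \<open>The value is read off as the only entry of a one by one matrix on the outer level.
  Invertibility of the pencil is part of the statement, relative to the unit
  \<open>idm (pc_set P) e\<close>.\<close>

definition linearizes :: "('k :: field \<Rightarrow> 'b :: ring \<Rightarrow> 'b) \<Rightarrow> 'b \<Rightarrow> ('d :: finite \<Rightarrow> 'b) \<Rightarrow> ('d, 'k) pencil \<Rightarrow> 'b \<Rightarrow> bool" where
  "linearizes scale e X P v \<longleftrightarrow> (\<exists>S. corner (idm (pc_set P) e) S \<and>
     pencil_at scale e X P * S = idm (pc_set P) e \<and> S * pencil_at scale e X P = idm (pc_set P) e \<and>
     tens scale (pc_out P) e * (S * tens scale (pc_in P) e) = single 0 0 v)"

text \<open>Direct sums of index sets are formed by the even and the odd numbers; \<open>emb f J\<close> and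
  \<open>coemb f J\<close> are the matrices of the corresponding inclusion and its left inverse.\<close>

definition emb :: "(nat \<Rightarrow> nat) \<Rightarrow> nat set \<Rightarrow> 'k :: field finmat" where
  "emb f J = (\<Sum>j\<in>J. single (f j) j 1)"

definition coemb :: "(nat \<Rightarrow> nat) \<Rightarrow> nat set \<Rightarrow> 'k :: field finmat" where
  "coemb f J = (\<Sum>j\<in>J. single j (f j) 1)"

lemma coemb_emb:
  assumes "finite J" "inj f"
  shows "coemb f J * emb f J = idm J (1 :: 'k :: field)"
proof -
  have "coemb f J * emb f J = (\<Sum>i\<in>J. \<Sum>j\<in>J. if j = i then single i i (1 :: 'k) else 0)"
    unfolding coemb_def emb_def sum_distrib_right
  proof (rule sum.cong[OF refl])
    fix i assume "i \<in> J"
    show "single i (f i) (1 :: 'k) * (\<Sum>j\<in>J. single (f j) j (1 :: 'k)) = (\<Sum>j\<in>J. if j = i then single i i 1 else 0)"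
      unfolding sum_distrib_left by (rule sum.cong) (simp_all add: single_mult inj_eq[OF assms(2)])
  qed
  then show ?thesis using assms by (simp add: idm_def)
qed

lemma emb_coemb:
  assumes "finite J" "inj f"
  shows "emb f J * coemb f J = idm (f ` J) (1 :: 'k :: field)"
proof -
  have "emb f J * coemb f J = (\<Sum>i\<in>J. \<Sum>j\<in>J. if j = i then single (f i) (f i) (1 :: 'k) else 0)"
    unfolding coemb_def emb_def sum_distrib_right
  proof (rule sum.cong[OF refl])
    fix i assume "i \<in> J"
    show "single (f i) i (1 :: 'k) * (\<Sum>j\<in>J. single j (f j) (1 :: 'k)) = (\<Sum>j\<in>J. if j = i then single (f i) (f i) 1 else 0)"
      unfolding sum_distrib_left by (rule sum.cong) (simp_all add: single_mult)
  qed
  also have "\<dots> = (\<Sum>i\<in>J. single (f i) (f i) 1)" using assms by simp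
  also have "\<dots> = idm (f ` J) 1" unfolding idm_def using assms by (subst sum.reindex) (auto intro: inj_on_subset)
  finally show ?thesis .
qed

lemma coemb_emb_disjoint: "range f \<inter> range g = {} \<Longrightarrow> coemb f J * emb g K = (0 :: 'a :: field finmat)"
  unfolding coemb_def emb_def sum_distrib_left sum_distrib_right
proof (intro sum.neutral ballI)
  fix i j assume "range f \<inter> range g = {}"
  then have "f i \<noteq> g j" by blast
  then show "single i (f i) 1 * single (g j) j 1 = (0 :: 'a finmat)" by (simp add: single_mult)
qed

definition ev :: "nat \<Rightarrow> nat" where "ev n = 2 * n"
definition od :: "nat \<Rightarrow> nat" where "od n = 2 * n + 1"

lemma ev_od: "inj ev" "inj od" "range ev \<inter> range od = {}" "range od \<inter> range ev = {}"
proof -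
  have "ev i \<noteq> od j" for i j unfolding ev_def od_def by presburger
  then show "range ev \<inter> range od = {}" "range od \<inter> range ev = {}" by (auto, metis)
qed (auto simp: inj_def ev_def od_def)

definition psum :: "nat set \<Rightarrow> nat set \<Rightarrow> nat set" where
  "psum J K = ev ` J \<union> od ` K"

lemma idm_psum:
  assumes "finite J" "finite K"
  shows "idm (psum J K) e = idm (ev ` J) e + idm (od ` K) (e :: 'a :: ring)"
  unfolding idm_def psum_def using assms ev_od(3) by (intro sum.union_disjoint) auto

text \<open>Inclusions \<open>p1\<close>, \<open>p2\<close> and projections \<open>q1\<close>,
  \<open>q2\<close> of a direct sum, as abstract ring elements. Block matrix identities can then be
  verified by rewriting, uniformly in the target algebra.\<close>

locale two_blocks =
  fixes E1 E2 E p1 p2 q1 q2 :: "'a :: ring"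
  assumes qp: "q1 * p1 = E1" "q2 * p2 = E2" "q1 * p2 = 0" "q2 * p1 = 0"
    and pq: "p1 * q1 + p2 * q2 = E"
    and Ep: "E1 * q1 = q1" "E2 * q2 = q2" "p1 * E1 = p1" "p2 * E2 = p2"
begin

lemma qp': "q1 * (p1 * x) = E1 * x" "q2 * (p2 * x) = E2 * x" "q1 * (p2 * x) = 0" "q2 * (p1 * x) = 0"
  by (simp_all add: qp flip: mult.assoc)

lemma left_mult_E: "E * (p1 * y) = p1 * (E1 * y)" "E * (p2 * y) = p2 * (E2 * y)"
  unfolding pq[symmetric] by (simp_all add: distrib_right mult.assoc qp')

lemma right_mult_E: "q1 * E = q1" "q2 * E = q2"
  unfolding pq[symmetric] by (simp_all add: distrib_left qp Ep flip: mult.assoc)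

lemma left_mult_E': "E * p1 = p1" "E * p2 = p2"
  unfolding pq[symmetric] by (simp_all add: distrib_right mult.assoc qp Ep)

lemma corner_E:
  assumes "e * x = x" "x * e' = x" "(e = E1 \<and> p = p1) \<or> (e = E2 \<and> p = p2)" "(e' = E1 \<and> q = q1) \<or> (e' = E2 \<and> q = q2)"
  shows "corner E (p * (x * q))"
proof -
  have "e * (x * q) = x * q" using assms(1) by (simp flip: mult.assoc)
  then show ?thesis
    using assms(3,4) unfolding corner_def by (auto simp: left_mult_E mult.assoc right_mult_E)
qed

lemma corner_E11: "E1 * x = x \<Longrightarrow> x * E1 = x \<Longrightarrow> corner E (p1 * (x * q1))"
  by (rule corner_E[of E1 x E1]) simp_all

lemma corner_E12: "E1 * x = x \<Longrightarrow> x * E2 = x \<Longrightarrow> corner E (p1 * (x * q2))"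
  by (rule corner_E[of E1 x E2]) simp_all

lemma corner_E21: "E2 * x = x \<Longrightarrow> x * E1 = x \<Longrightarrow> corner E (p2 * (x * q1))"
  by (rule corner_E[of E2 x E1]) simp_all

lemma corner_E22: "E2 * x = x \<Longrightarrow> x * E2 = x \<Longrightarrow> corner E (p2 * (x * q2))"
  by (rule corner_E[of E2 x E2]) simp_all

lemma sum_inverse:
  assumes "corner E1 l1" "corner E1 S1" "l1 * S1 = E1" "corner E2 l2" "corner E2 S2" "l2 * S2 = E2"
  shows "(p1 * (l1 * q1) + p2 * (l2 * q2)) * (p1 * (S1 * q1) + p2 * (S2 * q2)) = E"
  using assms
  by (simp add: distrib_left distrib_right mult.assoc qp' corner_left' assoc_left[OF assms(3)] assoc_left[OF assms(6)] Ep pq)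

text \<open>The block triangular matrix with diagonal \<open>l1\<close>, \<open>l2\<close> and upper
  right block \<open>- d\<close> has the upper right block \<open>S1 d S2\<close> in its inverse.
  With \<open>d\<close> equal to input times output this produces the product of two values.\<close>

lemma mult_inverse:
  assumes l: "corner E1 l1" "corner E1 S1" "l1 * S1 = E1" "S1 * l1 = E1"
      "corner E2 l2" "corner E2 S2" "l2 * S2 = E2" "S2 * l2 = E2"
    and d: "E1 * d = d" "d * E2 = d"
  shows "(p1 * (l1 * q1) + p2 * (l2 * q2) - p1 * (d * q2)) * (p1 * (S1 * q1) + p2 * (S2 * q2) + p1 * (S1 * (d * (S2 * q2)))) = E"
    "(p1 * (S1 * q1) + p2 * (S2 * q2) + p1 * (S1 * (d * (S2 * q2)))) * (p1 * (l1 * q1) + p2 * (l2 * q2) - p1 * (d * q2)) = E"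
proof -
  note a = corner_left'[OF l(1)] corner_left'[OF l(2)] corner_left'[OF l(5)] corner_left'[OF l(6)]
    assoc_left[OF l(3)] assoc_left[OF l(4)] assoc_left[OF l(7)] assoc_left[OF l(8)] assoc_left[OF d(1)] assoc_left[OF d(2)]
  show "(p1 * (l1 * q1) + p2 * (l2 * q2) - p1 * (d * q2)) * (p1 * (S1 * q1) + p2 * (S2 * q2) + p1 * (S1 * (d * (S2 * q2)))) = E"
    by (simp add: distrib_left distrib_right left_diff_distrib right_diff_distrib mult.assoc qp' a Ep pq)
  show "(p1 * (S1 * q1) + p2 * (S2 * q2) + p1 * (S1 * (d * (S2 * q2)))) * (p1 * (l1 * q1) + p2 * (l2 * q2) - p1 * (d * q2)) = E"
    by (simp add: distrib_left distrib_right left_diff_distrib right_diff_distrib mult.assoc qp' a Ep pq)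
qed

text \<open>Inversion by the Schur complement of \<open>l1\<close>, which is minus
  \<open>f S1 d\<close>. As \<open>s\<close> inverts \<open>f S1 d\<close>, the lower right block of
  the inverse is \<open>- s\<close>.\<close>

lemma bordered_inverse:
  assumes l: "corner E1 l1" "corner E1 S1" "l1 * S1 = E1" "S1 * l1 = E1"
    and d: "E1 * d = d" "d * E2 = d" and f: "E2 * f = f" "f * E1 = f"
    and s: "corner E2 s" "f * (S1 * d) * s = E2" "s * (f * (S1 * d)) = E2"
  shows "(p1 * (l1 * q1) + p1 * (d * q2) + p2 * (f * q1)) *
      (p1 * (S1 * q1) - p1 * (S1 * (d * (s * (f * (S1 * q1))))) + p1 * (S1 * (d * (s * q2))) +
       p2 * (s * (f * (S1 * q1))) - p2 * (s * q2)) = E"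
    "(p1 * (S1 * q1) - p1 * (S1 * (d * (s * (f * (S1 * q1))))) + p1 * (S1 * (d * (s * q2))) +
       p2 * (s * (f * (S1 * q1))) - p2 * (s * q2)) *
     (p1 * (l1 * q1) + p1 * (d * q2) + p2 * (f * q1)) = E"
proof -
  have s2: "f * (S1 * (d * (s * y))) = E2 * y" "s * (f * (S1 * (d * y))) = E2 * y" for y
    using s(2,3) by (simp_all flip: mult.assoc)
  note a = corner_left'[OF l(1)] corner_left'[OF l(2)] corner_left'[OF s(1)]
    assoc_left[OF l(3)] assoc_left[OF l(4)] assoc_left[OF d(1)] assoc_left[OF d(2)] assoc_left[OF f(1)] assoc_left[OF f(2)] s2
  show "(p1 * (l1 * q1) + p1 * (d * q2) + p2 * (f * q1)) *
      (p1 * (S1 * q1) - p1 * (S1 * (d * (s * (f * (S1 * q1))))) + p1 * (S1 * (d * (s * q2))) +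
       p2 * (s * (f * (S1 * q1))) - p2 * (s * q2)) = E"
    by (simp add: distrib_left distrib_right left_diff_distrib right_diff_distrib mult.assoc qp' a Ep pq)
  show "(p1 * (S1 * q1) - p1 * (S1 * (d * (s * (f * (S1 * q1))))) + p1 * (S1 * (d * (s * q2))) +
       p2 * (s * (f * (S1 * q1))) - p2 * (s * q2)) *
     (p1 * (l1 * q1) + p1 * (d * q2) + p2 * (f * q1)) = E"
    by (simp add: distrib_left distrib_right left_diff_distrib right_diff_distrib mult.assoc qp' a Ep pq)
qed

end

context kalg
begin

lemma two_blocks_psum:
  assumes fin: "finite J" "finite K" and ee: "e * e = e"
  shows "two_blocks (idm J e) (idm K e) (idm (psum J K) e) (tens scale (emb ev J) e) (tens scale (emb od K) e)
     (tens scale (coemb ev J) e) (tens scale (coemb od K) e)"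
proof
  have 1: "emb f J * idm J 1 = (emb f J :: 'k finmat)" "idm J 1 * coemb f J = (coemb f J :: 'k finmat)"
    if "finite J" for f and J :: "nat set"
    unfolding emb_def coemb_def sum_distrib_left sum_distrib_right
    by (intro sum.cong refl finmat_eqI; use that in \<open>auto simp: entry_mult_idm entry_idm_mult entry_single\<close>)+
  show "tens scale (coemb ev J) e * tens scale (emb ev J) e = idm J e"
    "tens scale (coemb od K) e * tens scale (emb od K) e = idm K e"
    "tens scale (coemb ev J) e * tens scale (emb od K) e = 0"
    "tens scale (coemb od K) e * tens scale (emb ev J) e = 0"
    using fin by (simp_all add: tens_mult coemb_emb coemb_emb_disjoint ev_od tens_idm ee)
  show "tens scale (emb ev J) e * tens scale (coemb ev J) e + tens scale (emb od K) e * tens scale (coemb od K) e =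
      idm (psum J K) e"
    using fin by (simp add: tens_mult emb_coemb ev_od tens_idm ee idm_psum)
  show "idm J e * tens scale (coemb ev J) e = tens scale (coemb ev J) e"
    "idm K e * tens scale (coemb od K) e = tens scale (coemb od K) e"
    "tens scale (emb ev J) e * idm J e = tens scale (emb ev J) e"
    "tens scale (emb od K) e * idm K e = tens scale (emb od K) e"
    using fin by (simp_all add: tens_mult ee 1 flip: tens_idm)
qed

end

section \<open>Pencils for the constructors of expressions\<close>

definition pc_scalar :: "'k :: field \<Rightarrow> ('d, 'k) pencil" where
  "pc_scalar c = \<lparr>pc_set = {0}, pc_const = single 0 0 1, pc_lin = (\<lambda>_. 0),
     pc_out = single 0 0 c, pc_in = single 0 0 1\<rparr>"

text \<open>A unipotent matrix with minus the variable in position (0, 1); its inverse has the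
  variable itself there, and output and input select this entry.\<close>

definition pc_var :: "'d \<Rightarrow> ('d, 'k :: field) pencil" where
  "pc_var k = \<lparr>pc_set = {0, 1}, pc_const = idm {0, 1} 1, pc_lin = (\<lambda>l. if l = k then - single 0 1 1 else 0),
     pc_out = single 0 0 1, pc_in = single 1 0 1\<rparr>"

definition pc_add :: "('d, 'k :: field) pencil \<Rightarrow> ('d, 'k) pencil \<Rightarrow> ('d, 'k) pencil" where
  "pc_add P Q = (let J = pc_set P; K = pc_set Q; p1 = emb ev J; q1 = coemb ev J; p2 = emb od K; q2 = coemb od K in
    \<lparr>pc_set = psum J K,
     pc_const = p1 * (pc_const P * q1) + p2 * (pc_const Q * q2),
     pc_lin = (\<lambda>k. p1 * (pc_lin P k * q1) + p2 * (pc_lin Q k * q2)),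
     pc_out = pc_out P * q1 + pc_out Q * q2,
     pc_in = p1 * pc_in P + p2 * pc_in Q\<rparr>)"

definition pc_mult :: "('d, 'k :: field) pencil \<Rightarrow> ('d, 'k) pencil \<Rightarrow> ('d, 'k) pencil" where
  "pc_mult P Q = (let J = pc_set P; K = pc_set Q; p1 = emb ev J; q1 = coemb ev J; p2 = emb od K; q2 = coemb od K in
    \<lparr>pc_set = psum J K,
     pc_const = p1 * (pc_const P * q1) + p2 * (pc_const Q * q2) - p1 * ((pc_in P * pc_out Q) * q2),
     pc_lin = (\<lambda>k. p1 * (pc_lin P k * q1) + p2 * (pc_lin Q k * q2)),
     pc_out = pc_out P * q1,
     pc_in = p2 * pc_in Q\<rparr>)"

text \<open>The inverse of the value is minus the lower right entry of the inverse of the bordered pencil.\<close>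

definition pc_inv :: "('d, 'k :: field) pencil \<Rightarrow> ('d, 'k) pencil" where
  "pc_inv P = (let J = pc_set P; p1 = emb ev J; q1 = coemb ev J; p2 = emb od {0}; q2 = coemb od {0} in
    \<lparr>pc_set = psum J {0},
     pc_const = p1 * (pc_const P * q1) + p1 * ((pc_in P * single 0 0 1) * q2) + p2 * ((single 0 0 1 * pc_out P) * q1),
     pc_lin = (\<lambda>k. p1 * (pc_lin P k * q1)),
     pc_out = - q2,
     pc_in = p2\<rparr>)"

definition pc_word :: "'d list \<Rightarrow> ('d, 'k :: field) pencil" where
  "pc_word w = foldr (\<lambda>k P. pc_mult (pc_var k) P) w (pc_scalar 1)"

text \<open>The words are taken in an unspecified order; the pencil may depend on it, the value does
  not.\<close>

definition pc_poly :: "('d, 'k :: field) nc_poly \<Rightarrow> ('d, 'k) pencil" where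
  "pc_poly p = foldr (\<lambda>w P. pc_add (pc_mult (pc_scalar (Poly_Mapping.lookup p w)) (pc_word w)) P)
     (SOME ws. set ws = Poly_Mapping.keys p \<and> distinct ws) (pc_scalar 0)"

primrec pc_expr :: "('d, 'k :: field) nc_expr \<Rightarrow> ('d, 'k) pencil" where
  "pc_expr (Poly p) = pc_poly p"
| "pc_expr (Add Q R) = pc_add (pc_expr Q) (pc_expr R)"
| "pc_expr (Mult Q R) = pc_mult (pc_expr Q) (pc_expr R)"
| "pc_expr (Inv Q) = pc_inv (pc_expr Q)"

lemma pencil_wf_scalar: "pencil_wf (pc_scalar c)"
  unfolding pencil_wf_def pc_scalar_def corner_def idm_def by (simp add: single_mult)

lemma pencil_wf_var: "pencil_wf (pc_var k)"
  unfolding pencil_wf_def pc_var_def corner_def idm_def by (simp add: single_mult distrib_left distrib_right)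

lemma two_blocks_field:
  assumes "finite J" "finite K"
  shows "two_blocks (idm J 1) (idm K 1) (idm (psum J K) (1 :: 'k :: field)) (emb ev J) (emb od K) (coemb ev J) (coemb od K)"
proof -
  interpret kalg "(*) :: 'k \<Rightarrow> _" by (rule kalg_times)
  have "tens (*) A (1 :: 'k) = A" for A by (rule finmat_eqI) (simp add: entry_tens)
  then show ?thesis using two_blocks_psum[OF assms, of 1] by simp
qed

lemma pencil_wf_add:
  assumes "pencil_wf P" "pencil_wf Q"
  shows "pencil_wf (pc_add P Q :: ('d, 'k :: field) pencil)"
proof -
  have fin: "finite (pc_set P)" "finite (pc_set Q)" using assms by (auto simp: pencil_wf_def)
  interpret two_blocks "idm (pc_set P) 1" "idm (pc_set Q) 1" "idm (psum (pc_set P) (pc_set Q)) (1 :: 'k)"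
    "emb ev (pc_set P)" "emb od (pc_set Q)" "coemb ev (pc_set P)" "coemb od (pc_set Q)"
    by (rule two_blocks_field[OF fin])
  show ?thesis
    unfolding pencil_wf_def
  proof (intro conjI allI)
    note w = assms[unfolded pencil_wf_def corner_def]
    show "finite (pc_set (pc_add P Q))" using fin by (simp add: pc_add_def Let_def psum_def)
    show "corner (idm (pc_set (pc_add P Q)) 1) (pc_const (pc_add P Q))"
      "corner (idm (pc_set (pc_add P Q)) 1) (pc_lin (pc_add P Q) k)" for k
      using w by (auto simp: pc_add_def Let_def intro!: corner_add corner_E)
    show "pc_out (pc_add P Q) * idm (pc_set (pc_add P Q)) 1 = pc_out (pc_add P Q)"
      by (simp add: pc_add_def Let_def distrib_right mult.assoc right_mult_E)
    show "idm (pc_set (pc_add P Q)) 1 * pc_in (pc_add P Q) = pc_in (pc_add P Q)"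
      using w by (simp add: pc_add_def Let_def distrib_left left_mult_E)
  qed
qed

lemma pencil_wf_mult:
  assumes "pencil_wf P" "pencil_wf Q"
  shows "pencil_wf (pc_mult P Q :: ('d, 'k :: field) pencil)"
proof -
  have fin: "finite (pc_set P)" "finite (pc_set Q)" using assms by (auto simp: pencil_wf_def)
  interpret two_blocks "idm (pc_set P) 1" "idm (pc_set Q) 1" "idm (psum (pc_set P) (pc_set Q)) (1 :: 'k)"
    "emb ev (pc_set P)" "emb od (pc_set Q)" "coemb ev (pc_set P)" "coemb od (pc_set Q)"
    by (rule two_blocks_field[OF fin])
  show ?thesis
    unfolding pencil_wf_def
  proof (intro conjI allI)
    note w = assms[unfolded pencil_wf_def corner_def]
    have bc: "idm (pc_set P) 1 * (pc_in P * pc_out Q) = pc_in P * pc_out Q"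
      "(pc_in P * pc_out Q) * idm (pc_set Q) 1 = pc_in P * pc_out Q"
      using w by (simp_all add: assoc_left[of _ "pc_in P" "pc_in P"] mult.assoc)
    show "finite (pc_set (pc_mult P Q))" using fin by (simp add: pc_mult_def Let_def psum_def)
    show "corner (idm (pc_set (pc_mult P Q)) 1) (pc_const (pc_mult P Q))"
      "corner (idm (pc_set (pc_mult P Q)) 1) (pc_lin (pc_mult P Q) k)" for k
      unfolding pc_mult_def Let_def pencil.simps
      by (intro corner_add corner_diff; rule corner_E; use w bc in blast)+
    show "pc_out (pc_mult P Q) * idm (pc_set (pc_mult P Q)) 1 = pc_out (pc_mult P Q)"
      by (simp add: pc_mult_def Let_def distrib_right mult.assoc right_mult_E)
    show "idm (pc_set (pc_mult P Q)) 1 * pc_in (pc_mult P Q) = pc_in (pc_mult P Q)"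
      using w by (simp add: pc_mult_def Let_def distrib_left left_mult_E)
  qed
qed

lemma pencil_wf_inv:
  assumes "pencil_wf P"
  shows "pencil_wf (pc_inv P :: ('d, 'k :: field) pencil)"
proof -
  have fin: "finite (pc_set P)" using assms by (auto simp: pencil_wf_def)
  interpret two_blocks "idm (pc_set P) 1" "idm {0} 1" "idm (psum (pc_set P) {0}) (1 :: 'k)"
    "emb ev (pc_set P)" "emb od {0}" "coemb ev (pc_set P)" "coemb od {0}"
    by (rule two_blocks_field) (simp_all add: fin)
  have 1: "idm {0} 1 = single 0 0 (1 :: 'k)" by (simp add: idm_def)
  show ?thesis
    unfolding pencil_wf_def
  proof (intro conjI allI)
    note w = assms[unfolded pencil_wf_def corner_def]
    have bc: "idm (pc_set P) 1 * (pc_in P * single 0 0 1) = pc_in P * single 0 0 1"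
      "(pc_in P * single 0 0 1) * idm {0} 1 = pc_in P * single 0 0 1"
      "(single 0 0 1 * pc_out P) * idm (pc_set P) 1 = single 0 0 1 * pc_out P"
      "idm {0} 1 * (single 0 0 1 * pc_out P) = single 0 0 1 * pc_out P"
      using w by (simp_all add: assoc_left[of _ "pc_in P" "pc_in P"] mult.assoc 1 single_mult)
        (simp add: single_mult flip: mult.assoc)
    show "finite (pc_set (pc_inv P))" using fin by (simp add: pc_inv_def Let_def psum_def)
    show "corner (idm (pc_set (pc_inv P)) 1) (pc_const (pc_inv P))"
      unfolding pc_inv_def Let_def pencil.simps
      by (intro corner_add; rule corner_E; use w bc in blast)
    show "corner (idm (pc_set (pc_inv P)) 1) (pc_lin (pc_inv P) k)" for k
      unfolding pc_inv_def Let_def pencil.simps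
      by (rule corner_E) (use w in blast)+
    show "pc_out (pc_inv P) * idm (pc_set (pc_inv P)) 1 = pc_out (pc_inv P)"
      by (simp add: pc_inv_def Let_def right_mult_E)
    show "idm (pc_set (pc_inv P)) 1 * pc_in (pc_inv P) = pc_in (pc_inv P)"
      by (simp add: pc_inv_def Let_def left_mult_E')
  qed
qed

section \<open>Correctness of the pencils over an arbitrary algebra\<close>

context kalg
begin

lemma pencil_at_corner:
  assumes P: "pencil_wf P" and ee: "e * e = e" and X: "\<And>k. corner e (X k)"
  shows "corner (idm (pc_set P) e) (pencil_at scale e X P)"
proof -
  have "finite (pc_set P)" using P by (simp add: pencil_wf_def)
  moreover have "corner (idm (pc_set P) e) (tens scale A x)" if "corner (idm (pc_set P) 1) A" "corner e x" for A x
    using that \<open>finite (pc_set P)\<close> unfolding corner_def by (simp flip: tens_idm add: tens_mult)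
  ultimately show ?thesis
    unfolding pencil_at_def using P X by (intro corner_add corner_sum) (auto simp: pencil_wf_def corner_self ee)
qed

lemma tens_sandwich:
  assumes "corner e z" "e * e = e"
  shows "tens scale (A * (B * C)) z = tens scale A e * (tens scale B z * tens scale C e)"
  using assms by (simp add: tens_mult corner_def)

lemma linearizes_scalar: "e * e = e \<Longrightarrow> linearizes scale e X (pc_scalar c) (scale c e)"
  unfolding linearizes_def pencil_at_def pc_scalar_def
  by (rule exI[of _ "single 0 0 e"])
    (simp add: tens_single scale_one idm_def single_mult corner_def scale_mult_left)

lemma linearizes_var:
  assumes ee: "e * e = e" and X: "corner e (X k)"
  shows "linearizes scale e X (pc_var k) (X k)"
proof -
  have "(\<Sum>l\<in>UNIV. tens scale (if l = k then - single 0 1 1 else 0) (X l)) =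
      (\<Sum>l\<in>UNIV. if l = k then - single 0 1 (X k) else 0)"
    by (rule sum.cong) (auto simp: tens_uminus_left tens_single scale_one)
  then have *: "pencil_at scale e X (pc_var k) = idm {0, 1} e - single 0 1 (X k)"
    unfolding pencil_at_def pc_var_def by (simp add: tens_idm)
  show ?thesis
    unfolding linearizes_def * using ee X
    by (intro exI[of _ "idm {0, 1} e + single 0 1 (X k)"])
      (simp add: pc_var_def idm_def single_mult corner_def distrib_left distrib_right
        left_diff_distrib right_diff_distrib tens_single scale_one algebra_simps)
qed

lemma linearizes_add:
  assumes ee: "e * e = e" and X: "\<And>k. corner e (X k)" and w: "pencil_wf P" "pencil_wf Q"
    and v: "linearizes scale e X P v" "linearizes scale e X Q w"
  shows "linearizes scale e X (pc_add P Q) (v + w)"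
proof -
  have fin: "finite (pc_set P)" "finite (pc_set Q)" using w by (auto simp: pencil_wf_def)
  interpret two_blocks "idm (pc_set P) e" "idm (pc_set Q) e" "idm (psum (pc_set P) (pc_set Q)) e"
    "tens scale (emb ev (pc_set P)) e" "tens scale (emb od (pc_set Q)) e"
    "tens scale (coemb ev (pc_set P)) e" "tens scale (coemb od (pc_set Q)) e"
    by (rule two_blocks_psum[OF fin ee])
  obtain S T where S: "corner (idm (pc_set P) e) S" "pencil_at scale e X P * S = idm (pc_set P) e"
     "S * pencil_at scale e X P = idm (pc_set P) e" "tens scale (pc_out P) e * (S * tens scale (pc_in P) e) = single 0 0 v"
    and T: "corner (idm (pc_set Q) e) T" "pencil_at scale e X Q * T = idm (pc_set Q) e"
     "T * pencil_at scale e X Q = idm (pc_set Q) e" "tens scale (pc_out Q) e * (T * tens scale (pc_in Q) e) = single 0 0 w"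
    using v unfolding linearizes_def by blast
  note l = pencil_at_corner[OF w(1) ee X] pencil_at_corner[OF w(2) ee X]
  note sandwich = tens_sandwich[OF X ee] tens_sandwich[OF corner_self[OF ee] ee]
  have at: "pencil_at scale e X (pc_add P Q) =
    tens scale (emb ev (pc_set P)) e * (pencil_at scale e X P * tens scale (coemb ev (pc_set P)) e) +
    tens scale (emb od (pc_set Q)) e * (pencil_at scale e X Q * tens scale (coemb od (pc_set Q)) e)"
    unfolding pencil_at_def pc_add_def Let_def pencil.simps
    by (simp add: tens_add_left sandwich distrib_left distrib_right sum_distrib_left sum_distrib_right sum.distrib)
  show ?thesis
    unfolding linearizes_def
  proof (intro exI conjI)
    let ?S = "tens scale (emb ev (pc_set P)) e * (S * tens scale (coemb ev (pc_set P)) e) +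
      tens scale (emb od (pc_set Q)) e * (T * tens scale (coemb od (pc_set Q)) e)"
    have J: "pc_set (pc_add P Q) = psum (pc_set P) (pc_set Q)" by (simp add: pc_add_def Let_def)
    show "corner (idm (pc_set (pc_add P Q)) e) ?S"
      unfolding J using S(1) T(1) by (intro corner_add; intro corner_E) (auto simp: corner_def)
    show "pencil_at scale e X (pc_add P Q) * ?S = idm (pc_set (pc_add P Q)) e"
      unfolding J at by (rule sum_inverse) fact+
    show "?S * pencil_at scale e X (pc_add P Q) = idm (pc_set (pc_add P Q)) e"
      unfolding J at by (rule sum_inverse) fact+
    have out: "tens scale (pc_out (pc_add P Q)) e = tens scale (pc_out P) e * tens scale (coemb ev (pc_set P)) e +
        tens scale (pc_out Q) e * tens scale (coemb od (pc_set Q)) e"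
      and "in": "tens scale (pc_in (pc_add P Q)) e = tens scale (emb ev (pc_set P)) e * tens scale (pc_in P) e +
        tens scale (emb od (pc_set Q)) e * tens scale (pc_in Q) e"
      by (simp_all add: pc_add_def Let_def tens_add_left tens_mult ee)
    show "tens scale (pc_out (pc_add P Q)) e * (?S * tens scale (pc_in (pc_add P Q)) e) = single 0 0 (v + w)"
      unfolding out "in"
      by (simp add: distrib_left distrib_right mult.assoc qp' corner_left'[OF S(1)] corner_left'[OF T(1)]
          corner_right'[OF S(1)] corner_right'[OF T(1)] S(4) T(4) single_add)
  qed
qed

lemma linearizes_mult:
  assumes ee: "e * e = e" and X: "\<And>k. corner e (X k)" and w: "pencil_wf P" "pencil_wf Q"
    and v: "linearizes scale e X P v" "linearizes scale e X Q w"
  shows "linearizes scale e X (pc_mult P Q) (v * w)"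
proof -
  have fin: "finite (pc_set P)" "finite (pc_set Q)" using w by (auto simp: pencil_wf_def)
  interpret two_blocks "idm (pc_set P) e" "idm (pc_set Q) e" "idm (psum (pc_set P) (pc_set Q)) e"
    "tens scale (emb ev (pc_set P)) e" "tens scale (emb od (pc_set Q)) e"
    "tens scale (coemb ev (pc_set P)) e" "tens scale (coemb od (pc_set Q)) e"
    by (rule two_blocks_psum[OF fin ee])
  obtain S T where S: "corner (idm (pc_set P) e) S" "pencil_at scale e X P * S = idm (pc_set P) e"
     "S * pencil_at scale e X P = idm (pc_set P) e" "tens scale (pc_out P) e * (S * tens scale (pc_in P) e) = single 0 0 v"
    and T: "corner (idm (pc_set Q) e) T" "pencil_at scale e X Q * T = idm (pc_set Q) e"
     "T * pencil_at scale e X Q = idm (pc_set Q) e" "tens scale (pc_out Q) e * (T * tens scale (pc_in Q) e) = single 0 0 w"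
    using v unfolding linearizes_def by blast
  note l = pencil_at_corner[OF w(1) ee X] pencil_at_corner[OF w(2) ee X]
  let ?d = "tens scale (pc_in P * pc_out Q) e"
  have d: "idm (pc_set P) e * ?d = ?d" "?d * idm (pc_set Q) e = ?d"
    using w fin ee unfolding pencil_wf_def
    by (simp_all flip: tens_idm add: tens_mult) (simp_all add: mult.assoc flip: mult.assoc[of "idm _ _"])
  note sandwich = tens_sandwich[OF X ee] tens_sandwich[OF corner_self[OF ee] ee]
  have at: "pencil_at scale e X (pc_mult P Q) =
    tens scale (emb ev (pc_set P)) e * (pencil_at scale e X P * tens scale (coemb ev (pc_set P)) e) +
    tens scale (emb od (pc_set Q)) e * (pencil_at scale e X Q * tens scale (coemb od (pc_set Q)) e) -
    tens scale (emb ev (pc_set P)) e * (?d * tens scale (coemb od (pc_set Q)) e)"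
    unfolding pencil_at_def pc_mult_def Let_def pencil.simps
    by (simp add: tens_add_left tens_diff_left sandwich distrib_left distrib_right
        sum_distrib_left sum_distrib_right sum.distrib)
  have J: "pc_set (pc_mult P Q) = psum (pc_set P) (pc_set Q)" by (simp add: pc_mult_def Let_def)
  show ?thesis
    unfolding linearizes_def
  proof (intro exI conjI)
    let ?S = "tens scale (emb ev (pc_set P)) e * (S * tens scale (coemb ev (pc_set P)) e) +
      tens scale (emb od (pc_set Q)) e * (T * tens scale (coemb od (pc_set Q)) e) +
      tens scale (emb ev (pc_set P)) e * (S * (?d * (T * tens scale (coemb od (pc_set Q)) e)))"
    have "corner (idm (psum (pc_set P) (pc_set Q)) e)
        (tens scale (emb ev (pc_set P)) e * ((S * (?d * T)) * tens scale (coemb od (pc_set Q)) e))"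
      by (rule corner_E12) (use S(1) T(1) in \<open>simp_all add: corner_left' mult.assoc corner_right\<close>)
    moreover have "corner (idm (psum (pc_set P) (pc_set Q)) e)
        (tens scale (emb ev (pc_set P)) e * (S * tens scale (coemb ev (pc_set P)) e))"
      by (rule corner_E11) (simp_all add: corner_left[OF S(1)] corner_right[OF S(1)])
    moreover have "corner (idm (psum (pc_set P) (pc_set Q)) e)
        (tens scale (emb od (pc_set Q)) e * (T * tens scale (coemb od (pc_set Q)) e))"
      by (rule corner_E22) (simp_all add: corner_left[OF T(1)] corner_right[OF T(1)])
    ultimately show "corner (idm (pc_set (pc_mult P Q)) e) ?S"
      unfolding J by (intro corner_add) (simp_all add: mult.assoc)
    show "pencil_at scale e X (pc_mult P Q) * ?S = idm (pc_set (pc_mult P Q)) e"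
      unfolding J at by (rule mult_inverse) fact+
    show "?S * pencil_at scale e X (pc_mult P Q) = idm (pc_set (pc_mult P Q)) e"
      unfolding J at by (rule mult_inverse) fact+
    have out: "tens scale (pc_out (pc_mult P Q)) e = tens scale (pc_out P) e * tens scale (coemb ev (pc_set P)) e"
      and "in": "tens scale (pc_in (pc_mult P Q)) e = tens scale (emb od (pc_set Q)) e * tens scale (pc_in Q) e"
      and dd: "?d = tens scale (pc_in P) e * tens scale (pc_out Q) e"
      by (simp_all add: pc_mult_def Let_def tens_mult ee)
    have "tens scale (pc_out (pc_mult P Q)) e * (?S * tens scale (pc_in (pc_mult P Q)) e) =
        (tens scale (pc_out P) e * (S * tens scale (pc_in P) e)) * (tens scale (pc_out Q) e * (T * tens scale (pc_in Q) e))"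
      unfolding out "in" dd
      by (simp add: distrib_left distrib_right mult.assoc qp' corner_left'[OF S(1)] corner_left'[OF T(1)]
          corner_right'[OF S(1)] corner_right'[OF T(1)])
    then show "tens scale (pc_out (pc_mult P Q)) e * (?S * tens scale (pc_in (pc_mult P Q)) e) = single 0 0 (v * w)"
      unfolding S(4) T(4) by (simp add: single_mult)
  qed
qed

lemma linearizes_inv:
  assumes ee: "e * e = e" and X: "\<And>k. corner e (X k)" and w: "pencil_wf P"
    and v: "linearizes scale e X P v" and v0: "corner e v" and v': "corner e v'" "v * v' = e" "v' * v = e"
  shows "linearizes scale e X (pc_inv P) v'"
proof -
  have fin: "finite (pc_set P)" using w by (auto simp: pencil_wf_def)
  interpret two_blocks "idm (pc_set P) e" "idm {0} e" "idm (psum (pc_set P) {0}) e"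
    "tens scale (emb ev (pc_set P)) e" "tens scale (emb od {0}) e"
    "tens scale (coemb ev (pc_set P)) e" "tens scale (coemb od {0}) e"
    by (rule two_blocks_psum[OF fin _ ee]) simp
  obtain S where S: "corner (idm (pc_set P) e) S" "pencil_at scale e X P * S = idm (pc_set P) e"
     "S * pencil_at scale e X P = idm (pc_set P) e" "tens scale (pc_out P) e * (S * tens scale (pc_in P) e) = single 0 0 v"
    using v unfolding linearizes_def by blast
  note l = pencil_at_corner[OF w ee X]
  have i0: "idm {0} e = single 0 0 e" by (simp add: idm_def)
  let ?d = "tens scale (pc_in P * single 0 0 1) e" and ?f = "tens scale (single 0 0 1 * pc_out P) e"
  have dd: "?d = tens scale (pc_in P) e * single 0 0 e" and ff: "?f = single 0 0 e * tens scale (pc_out P) e"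
    using tens_mult[of "pc_in P" e "single 0 0 1" e] tens_mult[of "single 0 0 1" e "pc_out P" e] ee
    by (simp_all add: tens_single scale_one)
  have Eb: "idm (pc_set P) e * tens scale (pc_in P) e = tens scale (pc_in P) e"
    and cE: "tens scale (pc_out P) e * idm (pc_set P) e = tens scale (pc_out P) e"
    using w fin ee unfolding pencil_wf_def by (simp_all flip: tens_idm add: tens_mult)
  have d: "idm (pc_set P) e * ?d = ?d" "?d * idm {0} e = ?d"
    unfolding dd i0 by (simp_all add: mult.assoc single_mult assoc_left[OF Eb] ee)
  have f: "idm {0} e * ?f = ?f" "?f * idm (pc_set P) e = ?f"
    unfolding ff i0 by (simp_all only: mult.assoc cE) (simp add: single_mult ee flip: mult.assoc)
  \<comment> \<open>Up to sign the Schur complement is the value of the given pencil, so inverting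
    the bordered pencil inverts this value. The sign in \<open>pc_out\<close> compensates that of
    the lower right block.\<close>
  have fSd: "?f * (S * ?d) = single 0 0 v"
  proof -
    have "?f * (S * ?d) = single 0 0 e * (tens scale (pc_out P) e * (S * tens scale (pc_in P) e)) * single 0 0 e"
      unfolding dd ff by (simp only: mult.assoc)
    also have "\<dots> = single 0 0 (e * v * e)" unfolding S(4) by (simp add: single_mult)
    also have "e * v * e = v" using v0 by (simp add: corner_def)
    finally show ?thesis .
  qed
  let ?s = "single 0 0 v'"
  have s: "corner (idm {0} e) ?s" "?f * (S * ?d) * ?s = idm {0} e" "?s * (?f * (S * ?d)) = idm {0} e"
    unfolding fSd i0 using v' by (simp_all add: corner_def single_mult)
  note sandwich = tens_sandwich[OF X ee] tens_sandwich[OF corner_self[OF ee] ee]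
  have at: "pencil_at scale e X (pc_inv P) =
    tens scale (emb ev (pc_set P)) e * (pencil_at scale e X P * tens scale (coemb ev (pc_set P)) e) +
    tens scale (emb ev (pc_set P)) e * (?d * tens scale (coemb od {0}) e) +
    tens scale (emb od {0}) e * (?f * tens scale (coemb ev (pc_set P)) e)"
    unfolding pencil_at_def pc_inv_def Let_def pencil.simps
    by (simp add: tens_add_left sandwich distrib_left distrib_right
        sum_distrib_left sum_distrib_right sum.distrib)
  have J: "pc_set (pc_inv P) = psum (pc_set P) {0}" by (simp add: pc_inv_def Let_def)
  show ?thesis
    unfolding linearizes_def
  proof (intro exI conjI)
    let ?p1 = "tens scale (emb ev (pc_set P)) e" and ?p2 = "tens scale (emb od {0}) e"
    let ?q1 = "tens scale (coemb ev (pc_set P)) e" and ?q2 = "tens scale (coemb od {0}) e"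
    let ?S = "?p1 * (S * ?q1) - ?p1 * (S * (?d * (?s * (?f * (S * ?q1))))) + ?p1 * (S * (?d * (?s * ?q2))) +
       ?p2 * (?s * (?f * (S * ?q1))) - ?p2 * (?s * ?q2)"
    note cs = corner_left'[OF S(1)] corner_right[OF S(1)] corner_left'[OF s(1)] corner_right[OF s(1)]
      corner_left[OF S(1)] corner_left[OF s(1)]
    have c: "corner (idm (psum (pc_set P) {0}) e) (?p1 * ((S * (?d * (?s * (?f * S)))) * ?q1))"
      by (rule corner_E11) (simp_all add: mult.assoc cs)
    moreover have "corner (idm (psum (pc_set P) {0}) e) (?p1 * ((S * (?d * ?s)) * ?q2))"
      by (rule corner_E12) (simp_all add: mult.assoc cs)
    moreover have "corner (idm (psum (pc_set P) {0}) e) (?p2 * ((?s * (?f * S)) * ?q1))"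
      by (rule corner_E21) (simp_all add: mult.assoc cs)
    moreover have "corner (idm (psum (pc_set P) {0}) e) (?p1 * (S * ?q1))"
      by (rule corner_E11) (simp_all add: cs)
    moreover have "corner (idm (psum (pc_set P) {0}) e) (?p2 * (?s * ?q2))"
      by (rule corner_E22) (simp_all add: cs)
    ultimately
    show "corner (idm (pc_set (pc_inv P)) e) ?S"
      unfolding J by (intro corner_add corner_diff) (simp_all add: mult.assoc)
    show "pencil_at scale e X (pc_inv P) * ?S = idm (pc_set (pc_inv P)) e"
      unfolding J at by (rule bordered_inverse) fact+
    show "?S * pencil_at scale e X (pc_inv P) = idm (pc_set (pc_inv P)) e"
      unfolding J at by (rule bordered_inverse) fact+
    have out: "tens scale (pc_out (pc_inv P)) e = - ?q2" and "in": "tens scale (pc_in (pc_inv P)) e = ?p2"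
      by (simp_all add: pc_inv_def Let_def tens_uminus_left)
    show "tens scale (pc_out (pc_inv P)) e * (?S * tens scale (pc_in (pc_inv P)) e) = single 0 0 v'"
      unfolding out "in" using s(1)
      by (simp add: distrib_left distrib_right left_diff_distrib right_diff_distrib mult.assoc qp qp' corner_def)
  qed
qed

lemma pencil_wf_word: "pencil_wf (pc_word w)"
  unfolding pc_word_def by (induction w) (simp_all add: pencil_wf_scalar pencil_wf_mult pencil_wf_var)

lemma linearizes_word:
  assumes ee: "e * e = e" and X: "\<And>k. corner e (X k)"
  shows "linearizes scale e X (pc_word w) (foldr (\<lambda>k b. X k * b) w e)"
proof (induction w)
  case Nil
  show ?case using linearizes_scalar[OF ee, of X 1] by (simp add: pc_word_def scale_one)
next
  case (Cons k w)
  show ?case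
    using linearizes_mult[OF ee X pencil_wf_var pencil_wf_word linearizes_var[OF ee X] Cons]
    by (simp add: pc_word_def)
qed

lemma poly_list_ex: "\<exists>ws. set ws = Poly_Mapping.keys p \<and> distinct ws"
  by (simp add: finite_distinct_list)

lemma pencil_wf_sum:
  "pencil_wf (foldr (\<lambda>w P. pc_add (pc_mult (pc_scalar (f w)) (pc_word w)) P) ws (pc_scalar 0))"
  by (induction ws) (simp_all add: pencil_wf_scalar pencil_wf_mult pencil_wf_add pencil_wf_word)

lemma pencil_wf_poly: "pencil_wf (pc_poly p)"
  unfolding pc_poly_def by (rule pencil_wf_sum)

lemma linearizes_poly:
  assumes ee: "e * e = e" and X: "\<And>k. corner e (X k)"
  shows "linearizes scale e X (pc_poly p)
    (\<Sum>w \<in> Poly_Mapping.keys p. scale (Poly_Mapping.lookup p w) (foldr (\<lambda>k b. X k * b) w e))"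
proof -
  let ?ws = "SOME ws. set ws = Poly_Mapping.keys p \<and> distinct ws"
  have ws: "set ?ws = Poly_Mapping.keys p" "distinct ?ws" using someI_ex[OF poly_list_ex[of p]] by auto
  have "linearizes scale e X (foldr (\<lambda>w P. pc_add (pc_mult (pc_scalar (f w)) (pc_word w)) P) ws (pc_scalar 0))
      (\<Sum>w \<in> set ws. scale (f w) (foldr (\<lambda>k b. X k * b) w e))" if "distinct ws" for ws and f :: "_ \<Rightarrow> 'k"
    using that
  proof (induction ws)
    case Nil
    show ?case using linearizes_scalar[OF ee, of X 0] by simp
  next
    case (Cons w ws)
    have 1: "scale (f w) e * foldr (\<lambda>k b. X k * b) w e = scale (f w) (foldr (\<lambda>k b. X k * b) w e)"
      using corner_foldr[of e X w, OF ee X] by (simp add: scale_mult_left corner_def)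
    show ?case
      using linearizes_add[OF ee X pencil_wf_mult[OF pencil_wf_scalar pencil_wf_word] pencil_wf_sum
          linearizes_mult[OF ee X pencil_wf_scalar pencil_wf_word linearizes_scalar[OF ee, of X "f w"]
            linearizes_word[where w = w, OF ee X]] Cons.IH] Cons.prems
      by (simp add: 1)
  qed
  from this[OF ws(2)] show ?thesis unfolding pc_poly_def ws(1) .
qed

lemma pencil_wf_expr: "pencil_wf (pc_expr Q)"
  by (induction Q) (simp_all add: pencil_wf_poly pencil_wf_add pencil_wf_mult pencil_wf_inv)

text \<open>The same scalar data serve every algebra and every point of the domain. Relations
  between these data that are established at scalar points can therefore be used over the target
  algebra.\<close>

lemma linearizes_expr:
  assumes ee: "e * e = e"
  shows "EV scale e X Q v \<Longrightarrow> linearizes scale e X (pc_expr Q) v"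
proof (induction Q arbitrary: v)
  case (Poly p)
  then show ?case using linearizes_poly[OF ee, of X p] by auto
next
  case (Add Q1 Q2)
  then obtain v1 v2 where v: "EV scale e X Q1 v1" "EV scale e X Q2 v2" "v = v1 + v2" by auto
  show ?case unfolding v(3) pc_expr.simps
    by (rule linearizes_add[OF ee EV_arg_corner[OF v(1)] pencil_wf_expr pencil_wf_expr]) (use Add.IH v in auto)
next
  case (Mult Q1 Q2)
  then obtain v1 v2 where v: "EV scale e X Q1 v1" "EV scale e X Q2 v2" "v = v1 * v2" by auto
  show ?case unfolding v(3) pc_expr.simps
    by (rule linearizes_mult[OF ee EV_arg_corner[OF v(1)] pencil_wf_expr pencil_wf_expr]) (use Mult.IH v in auto)
next
  case (Inv Q)
  then obtain u where u: "EV scale e X Q u" "corner e v" "u * v = e" "v * u = e" by auto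
  show ?case unfolding pc_expr.simps
    by (rule linearizes_inv[OF ee EV_arg_corner[OF u(1)] pencil_wf_expr Inv.IH[OF u(1)] EV_corner[OF ee u(1)] u(2-4)])
qed

end

section \<open>A common point of two domains\<close>

text \<open>Substitution of the matrix \<open>T\<close> into a polynomial, constants being multiples
  of \<open>e\<close>. For idempotent \<open>e\<close> and \<open>T\<close> in its corner this is a
  ring homomorphism from polynomials to commuting matrices.\<close>

definition poly_fm :: "'k :: field finmat \<Rightarrow> 'k finmat \<Rightarrow> 'k poly \<Rightarrow> 'k finmat" where
  "poly_fm e T p = fold_coeffs (\<lambda>c y. mscale (*) c e + T * y) p 0"

interpretation field_alg: kalg "(*) :: 'k :: field \<Rightarrow> 'k \<Rightarrow> 'k"
  by (rule kalg_times)

interpretation field_alg1: kalg "mscale (*) :: 'k :: field \<Rightarrow> 'k finmat \<Rightarrow> 'k finmat"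
  by (rule field_alg.kalg_mscale)

interpretation field_alg2: kalg "mscale (mscale (*)) :: 'k :: field \<Rightarrow> 'k finmat finmat \<Rightarrow> 'k finmat finmat"
  by (rule field_alg1.kalg_mscale)

interpretation poly_alg: kalg "smult :: 'k :: field \<Rightarrow> 'k poly \<Rightarrow> 'k poly"
  by unfold_locales (simp_all add: smult_add_right smult_add_left)

lemma poly_fm_0 [simp]: "poly_fm e T 0 = 0"
  by (simp add: poly_fm_def)

lemma poly_fm_pCons: "poly_fm e T (pCons a p) = mscale (*) a e + T * poly_fm e T p"
  by (cases "p = 0 \<and> a = 0") (auto simp: poly_fm_def)

lemma poly_fm_add: "poly_fm e T (p + q) = poly_fm e T p + poly_fm e T q"
  by (induction p q rule: poly_induct2)
    (simp_all add: poly_fm_pCons field_alg1.scale_add_left distrib_left)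

lemma poly_fm_smult: "poly_fm e T (smult c p) = mscale (*) c (poly_fm e T p)"
  by (induction p) (simp_all add: poly_fm_pCons field_alg1.scale_add_right field_alg1.scale_scale field_alg1.scale_mult_right)

context
  fixes e T :: "'k :: field finmat"
  assumes ee: "e * e = e" and T: "corner e T"
begin

lemma poly_fm_corner: "corner e (poly_fm e T p)"
  by (induction p)
    (auto simp: poly_fm_pCons intro!: corner_add corner_mult T field_alg1.corner_scale corner_self ee)

lemma poly_fm_mult: "poly_fm e T (p * q) = poly_fm e T p * poly_fm e T q"
  by (induction p)
    (use corner_left[OF poly_fm_corner, of q] in
      \<open>simp_all add: poly_fm_pCons mult_pCons_left poly_fm_add poly_fm_smult distrib_right
        field_alg1.scale_mult_left mult.assoc\<close>)

lemma ring_map_poly_fm: "ring_map (poly_fm e T)"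
  by (simp add: ring_map_def poly_fm_add poly_fm_mult)

lemma poly_fm_one: "poly_fm e T 1 = e"
  by (simp add: one_pCons poly_fm_pCons field_alg1.scale_one)

end

lemma ring_map_poly: "ring_map (\<lambda>p. poly p a :: 'k :: field)"
  by (simp add: ring_map_def)

text \<open>\<open>M\<close> is the adjugate and \<open>d\<close> the determinant of
  \<open>N\<close>; a one-sided inverse at the parameter \<open>a\<close> shows that the determinant
  does not vanish there.\<close>

lemma adjugate:
  fixes N :: "'k :: field poly finmat"
  assumes J: "finite J" and N: "corner (idm J 1) N"
    and w: "corner (idm J 1) w" "mapm (\<lambda>p. poly p a) N * w = idm J 1"
  obtains M d where "corner (idm J 1) M" "N * M = idm J d" "M * N = idm J d" "poly d a \<noteq> 0"
proof -
  let ?n = "card J"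
  obtain \<phi> where "bij_betw \<phi> {..<?n} J"
    using J ex_bij_betw_nat_finite by (metis atLeast0LessThan)
  then have inj: "inj_on \<phi> {..<?n}" and im: "\<phi> ` {..<?n} = J" by (auto simp: bij_betw_def)
  define A where "A = to_mat ?n ?n \<phi> \<phi> N"
  define W where "W = to_mat ?n ?n \<phi> \<phi> w"
  have c: "A \<in> carrier_mat ?n ?n" "W \<in> carrier_mat ?n ?n" by (simp_all add: A_def W_def)
  have N': "of_mat \<phi> \<phi> A = N" unfolding A_def
    by (rule of_mat_to_mat[OF inj inj]) (use im N J in \<open>auto simp: corner_idm_iff\<close>)
  have w': "of_mat \<phi> \<phi> W = w" unfolding W_def
    by (rule of_mat_to_mat[OF inj inj]) (use im w J in \<open>auto simp: corner_idm_iff\<close>)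
  interpret h: comm_ring_hom "\<lambda>p. poly p a" by unfold_locales auto
  note adj = adj_mat[OF c(1)]
  let ?M = "of_mat \<phi> \<phi> (adj_mat A)"
  have d: "of_mat \<phi> \<phi> (det A \<cdot>\<^sub>m 1\<^sub>m ?n) = idm J (det A)"
    by (rule finmat_eq_of_matI[symmetric, of _ ?n ?n]) (use inj im J in \<open>auto simp: entry_idm dest: inj_onD\<close>)
  have "map_mat (\<lambda>p. poly p a) A * W = 1\<^sub>m ?n"
  proof -
    have mA: "map_mat (\<lambda>p. poly p a) A \<in> carrier_mat ?n ?n" using c by simp
    have "of_mat \<phi> \<phi> (map_mat (\<lambda>p. poly p a) A) = mapm (\<lambda>p. poly p a) N"
      by (rule finmat_eq_of_matI[OF mA inj inj, symmetric])
        (use c N J im in \<open>auto simp: entry_mapm A_def to_mat_def corner_idm_iff\<close>)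
    then have "of_mat \<phi> \<phi> (map_mat (\<lambda>p. poly p a) A * W) = of_mat \<phi> \<phi> (1\<^sub>m ?n)"
      using of_mat_mult[OF mA c(2) inj, of \<phi> \<phi>] w w' of_mat_one[OF inj, where 'a = 'k] im by simp
    then show ?thesis
      using of_mat_inject[OF _ _ inj inj, of "map_mat (\<lambda>p. poly p a) A * W" "1\<^sub>m ?n"] mA c by auto
  qed
  then have "det (map_mat (\<lambda>p. poly p a) A) * det W = 1"
    using det_mult[of "map_mat (\<lambda>p. poly p a) A" ?n W] c by simp
  then have "poly (det A) a \<noteq> 0" by (auto simp: h.hom_det)
  moreover have "N * ?M = idm J (det A)" "?M * N = idm J (det A)"
    using of_mat_mult[OF c(1) adj(1) inj, of \<phi> \<phi>] of_mat_mult[OF adj(1) c(1) inj, of \<phi> \<phi>] adj d N' by simp_all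
  moreover have "corner (idm J 1) ?M" using of_mat_corner[OF adj(1), of \<phi>] im by simp
  ultimately show thesis using that by blast
qed

lemma idm_commute:
  assumes "finite J" "\<And>i j. s * entry N i j = entry N i j * s" "corner (idm J e) N"
  shows "idm J s * N = N * idm J s"
proof (rule finmat_eqI)
  fix i j
  show "entry (idm J s * N) i j = entry (N * idm J s) i j"
    using assms(2)[of i j] assms(1,3) by (cases "i \<in> J \<and> j \<in> J") (auto simp: entry_idm_mult entry_mult_idm corner_idm_iff)
qed

lemma poly_fm_inverse_commute:
  assumes ee: "e * e = e" and T: "corner e T" and g: "corner e g"
    and fg: "poly_fm e T f * g = e" "g * poly_fm e T f = e"
  shows "g * poly_fm e T p = poly_fm e T p * g"
proof -
  let ?t = "poly_fm e T"
  have "g * ?t p = g * ?t p * (?t f * g)"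
    using corner_right[OF poly_fm_corner[OF ee T]] by (simp only: fg mult.assoc)
  also have "\<dots> = g * (?t (p * f)) * g" by (simp only: poly_fm_mult[OF ee T] mult.assoc)
  also have "\<dots> = (g * ?t f) * (?t p * g)" by (simp only: mult.commute[of p f] poly_fm_mult[OF ee T] mult.assoc)
  also have "\<dots> = ?t p * g"
    unfolding fg using corner_left'[OF poly_fm_corner[OF ee T]] by simp
  finally show ?thesis .
qed

text \<open>Polynomials in \<open>T\<close> commute with one another and with the inverse
  \<open>g\<close>. Hence invertibility of a common denominator at \<open>T\<close> passes to its
  factors, which are the denominators of the subexpressions.\<close>

lemma poly_fm_split:
  assumes ee: "e * e = e" and T: "corner e T" and g: "corner e g"
    and fg: "poly_fm e T (f1 * f2) * g = e" "g * poly_fm e T (f1 * f2) = e"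
  shows "corner e (poly_fm e T f2 * g)" "poly_fm e T f1 * (poly_fm e T f2 * g) = e"
    "poly_fm e T f2 * g * poly_fm e T f1 = e"
proof -
  show "corner e (poly_fm e T f2 * g)" by (intro corner_mult poly_fm_corner[OF ee T] g)
  show "poly_fm e T f1 * (poly_fm e T f2 * g) = e"
    using fg(1) by (simp only: poly_fm_mult[OF ee T] mult.assoc)
  show "poly_fm e T f2 * g * poly_fm e T f1 = e"
    using fg(1) poly_fm_inverse_commute[OF ee T g fg, of f1]
    by (simp only: mult.assoc mult.commute[of f1 f2] poly_fm_mult[OF ee T])
qed

section \<open>Expressions along polynomial curves of matrix points\<close>

lemma curve_scalar:
  fixes N :: "'k :: field poly finmat"
  assumes J: "finite J" and ee: "e * e = e" and T: "corner e T" and N: "corner (idm J 1) N"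
  shows "idm J (poly_fm e T f) * mapm (poly_fm e T) N = mapm (poly_fm e T) N * idm J (poly_fm e T f)"
proof (rule idm_commute[OF J])
  have "corner (mapm (poly_fm e T) (idm J 1)) (mapm (poly_fm e T) N)"
    by (rule ring_map_corner[OF ring_map_mapm[OF ring_map_poly_fm[OF ee T]] N])
  then show "corner (idm J (poly_fm e T 1)) (mapm (poly_fm e T) N)"
    using J by (simp add: mapm_idm)
  show "poly_fm e T f * entry (mapm (poly_fm e T) N) i j = entry (mapm (poly_fm e T) N) i j * poly_fm e T f" for i j
    by (simp add: entry_mapm mult.commute flip: poly_fm_mult[OF ee T])
qed

lemma curve_scalar_inverse:
  fixes N :: "'k :: field poly finmat"
  assumes J: "finite J" and ee: "e * e = e" and T: "corner e T" and g: "corner e g"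
    and fg: "poly_fm e T f * g = e" "g * poly_fm e T f = e" and N: "corner (idm J 1) N"
  shows "idm J g * mapm (poly_fm e T) N = mapm (poly_fm e T) N * idm J g"
proof (rule idm_commute[OF J])
  have "corner (mapm (poly_fm e T) (idm J 1)) (mapm (poly_fm e T) N)"
    by (rule ring_map_corner[OF ring_map_mapm[OF ring_map_poly_fm[OF ee T]] N])
  then show "corner (idm J (poly_fm e T 1)) (mapm (poly_fm e T) N)"
    using J by (simp add: mapm_idm)
  show "g * entry (mapm (poly_fm e T) N) i j = entry (mapm (poly_fm e T) N) i j * g" for i j
    by (simp add: entry_mapm poly_fm_inverse_commute[OF ee T g fg])
qed

lemma curve_scalar_both:
  fixes N :: "'k :: field poly finmat"
  assumes J: "finite J" and ee: "e * e = e" and T: "corner e T" and g: "corner e g"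
    and fg: "poly_fm e T f * g = e" "g * poly_fm e T f = e" and N: "corner (idm J 1) N"
  shows "idm J (poly_fm e T p * g) * mapm (poly_fm e T) N = mapm (poly_fm e T) N * idm J (poly_fm e T p * g)"
proof -
  have "idm J (poly_fm e T p * g) * mapm (poly_fm e T) N = idm J (poly_fm e T p) * (idm J g * mapm (poly_fm e T) N)"
    using J by (simp only: mult.assoc flip: idm_mult)
  also have "\<dots> = idm J (poly_fm e T p) * mapm (poly_fm e T) N * idm J g"
    by (simp only: curve_scalar_inverse[OF J ee T g fg N] mult.assoc)
  also have "\<dots> = mapm (poly_fm e T) N * (idm J (poly_fm e T p) * idm J g)"
    by (simp only: curve_scalar[OF J ee T N] mult.assoc)
  finally show ?thesis using J by (simp add: idm_mult)
qed

text \<open>Along a polynomial curve \<open>X\<close> whose point at \<open>t0\<close> belongs to the domain, the values are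
  \<open>N / f\<close> for a polynomial matrix \<open>N\<close> and a polynomial \<open>f\<close> not vanishing at \<open>t0\<close>; the parameter
  may be replaced by any square matrix \<open>T\<close> for which \<open>f(T)\<close> is invertible.\<close>

definition curve_value ::
  "nat set \<Rightarrow> ('d \<Rightarrow> 'k :: field poly finmat) \<Rightarrow> 'k \<Rightarrow> ('d, 'k) nc_expr \<Rightarrow> 'k finmat \<Rightarrow> 'k poly \<Rightarrow> 'k poly finmat \<Rightarrow> bool" where
  "curve_value J X t0 Q v0 f N \<longleftrightarrow>
    poly f t0 \<noteq> 0 \<and> corner (idm J 1) N \<and> mapm (\<lambda>p. poly p t0) N = idm J (poly f t0) * v0 \<and>
    (\<forall>I T g. finite I \<longrightarrow> corner (idm I 1) T \<longrightarrow> corner (idm I 1) g \<longrightarrow>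
        poly_fm (idm I 1) T f * g = idm I 1 \<longrightarrow> g * poly_fm (idm I 1) T f = idm I 1 \<longrightarrow>
        EV (mscale (mscale (*))) (idm J (idm I 1)) (\<lambda>k. mapm (poly_fm (idm I 1) T) (X k)) Q
          (mapm (poly_fm (idm I 1) T) N * idm J g))"

lemma curve_valueD:
  assumes "curve_value J X t0 Q v0 f N"
  shows "poly f t0 \<noteq> 0" "corner (idm J 1) N" "mapm (\<lambda>p. poly p t0) N = idm J (poly f t0) * v0"
    "finite I \<Longrightarrow> corner (idm I 1) T \<Longrightarrow> corner (idm I 1) g \<Longrightarrow>
        poly_fm (idm I 1) T f * g = idm I 1 \<Longrightarrow> g * poly_fm (idm I 1) T f = idm I 1 \<Longrightarrow>
        EV (mscale (mscale (*))) (idm J (idm I 1)) (\<lambda>k. mapm (poly_fm (idm I 1) T) (X k)) Q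
          (mapm (poly_fm (idm I 1) T) N * idm J g)"
  using assms unfolding curve_value_def by blast+

text \<open>Along the curve the values are matrices of rational functions whose denominators do not
  vanish at \<open>t0\<close>. Keeping numerator and denominator polynomial permits substitution of
  a matrix for the parameter. Sums and products take the product of the denominators; for inverses
  the adjugate keeps the form.\<close>

lemma EV_curve:
  fixes X :: "'d \<Rightarrow> 'k :: field poly finmat"
  assumes J: "finite J" and X: "\<And>k. corner (idm J 1) (X k)"
  shows "EV (mscale (*)) (idm J 1) (\<lambda>k. mapm (\<lambda>p. poly p t0) (X k)) Q v0 \<Longrightarrow>
    \<exists>f N. curve_value J X t0 Q v0 f N"
proof (induction Q arbitrary: v0)
  case (Poly p)
  define V where "V = (\<Sum>w \<in> Poly_Mapping.keys p. mscale smult (Poly_Mapping.lookup p w) (foldr (\<lambda>k b. X k * b) w (idm J 1)))"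
  have EVV: "EV (mscale smult) (idm J 1) X (Poly p) V" using X by (simp add: V_def)
  have idem: "idm J 1 * idm J 1 = idm J (1 :: 'k poly)" "idm J 1 * idm J 1 = idm J (1 :: 'k)" using J by (simp_all add: idm_mult)
  have Vc: "corner (idm J 1) V" by (rule kalg.EV_corner[OF poly_alg.kalg_mscale idem(1) EVV])
  have "EV (mscale (*)) (mapm (\<lambda>p. poly p t0) (idm J 1)) (\<lambda>k. mapm (\<lambda>p. poly p t0) (X k)) (Poly p) (mapm (\<lambda>p. poly p t0) V)"
    by (rule EV_hom[OF ring_map_mapm[OF ring_map_poly] _ EVV])
      (rule finmat_eqI, simp add: entry_mapm poly_alg.entry_mscale field_alg.entry_mscale)
  then have "EV (mscale (*)) (idm J 1) (\<lambda>k. mapm (\<lambda>p. poly p t0) (X k)) (Poly p) (mapm (\<lambda>p. poly p t0) V)"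
    using J by (simp add: mapm_idm del: EV.simps)
  then have V0: "mapm (\<lambda>p. poly p t0) V = v0"
    using Poly field_alg1.EV_unique[OF idem(2)] by blast
  have "corner (idm J 1) v0" by (rule field_alg1.EV_corner[OF idem(2) Poly])
  then have "curve_value J X t0 (Poly p) v0 1 V"
    unfolding curve_value_def
  proof (intro conjI allI impI)
    show "poly 1 t0 \<noteq> 0" by simp
    show "mapm (\<lambda>p. poly p t0) V = idm J (poly 1 t0) * v0"
      using V0 \<open>corner (idm J 1) v0\<close> by (simp add: corner_def)
    fix I :: "nat set" and T g :: "'k finmat"
    assume I: "finite I" and T: "corner (idm I 1) T" and g: "corner (idm I 1) g" and fg: "poly_fm (idm I 1) T 1 * g = idm I 1"
    have ee: "idm I 1 * idm I 1 = idm I (1 :: 'k)" using I by (simp add: idm_mult)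
    have g1: "g = idm I 1" using fg g poly_fm_one[OF ee T] by (simp add: corner_def)
    note r = ring_map_mapm[OF ring_map_poly_fm[OF ee T]]
    have "EV (mscale (mscale (*))) (mapm (poly_fm (idm I 1) T) (idm J 1)) (\<lambda>k. mapm (poly_fm (idm I 1) T) (X k)) (Poly p) (mapm (poly_fm (idm I 1) T) V)"
      by (rule EV_hom[OF r _ EVV])
        (rule finmat_eqI, simp add: entry_mapm poly_alg.entry_mscale field_alg1.entry_mscale poly_fm_smult)
    moreover have i1: "mapm (poly_fm (idm I 1) T) (idm J 1) = idm J (idm I 1)"
      using J by (simp add: mapm_idm poly_fm_one[OF ee T])
    moreover have "mapm (poly_fm (idm I 1) T) V * idm J (idm I 1) = mapm (poly_fm (idm I 1) T) V"
      using ring_map_corner[OF r Vc] i1 by (simp add: corner_def)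
    ultimately show "EV (mscale (mscale (*))) (idm J (idm I 1)) (\<lambda>k. mapm (poly_fm (idm I 1) T) (X k)) (Poly p)
        (mapm (poly_fm (idm I 1) T) V * idm J g)" by (simp add: g1 del: EV.simps)
  qed (use Vc in simp)
  then show ?case by blast
next
  case (Add Q1 Q2)
  obtain v1 v2 where v: "EV (mscale (*)) (idm J 1) (\<lambda>k. mapm (\<lambda>p. poly p t0) (X k)) Q1 v1"
    "EV (mscale (*)) (idm J 1) (\<lambda>k. mapm (\<lambda>p. poly p t0) (X k)) Q2 v2" "v0 = v1 + v2"
    using Add.prems by auto
  obtain f1 N1 where 1: "curve_value J X t0 Q1 v1 f1 N1" using Add.IH(1)[OF v(1)] by blast
  obtain f2 N2 where 2: "curve_value J X t0 Q2 v2 f2 N2" using Add.IH(2)[OF v(2)] by blast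
  let ?N = "idm J f2 * N1 + idm J f1 * N2"
  have "curve_value J X t0 (Add Q1 Q2) v0 (f1 * f2) ?N"
    unfolding curve_value_def
  proof (intro conjI allI impI)
    show "poly (f1 * f2) t0 \<noteq> 0" using curve_valueD(1)[OF 1] curve_valueD(1)[OF 2] by simp
    have "corner (idm J 1) (idm J f1)" "corner (idm J 1) (idm J f2)" using J by (simp_all add: corner_def idm_mult)
    then show "corner (idm J 1) ?N" by (intro corner_add corner_mult curve_valueD(2)[OF 1] curve_valueD(2)[OF 2])
    show "mapm (\<lambda>p. poly p t0) ?N = idm J (poly (f1 * f2) t0) * v0"
      using curve_valueD(3)[OF 1] curve_valueD(3)[OF 2] J ring_map_mapm[OF ring_map_poly, of t0]
      by (simp add: ring_map_add ring_map_mult mapm_idm v(3) distrib_left idm_mult mult.commute flip: mult.assoc)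
    fix I :: "nat set" and T g :: "'k finmat"
    assume I: "finite I" and T: "corner (idm I 1) T" and g: "corner (idm I 1) g"
      and fg: "poly_fm (idm I 1) T (f1 * f2) * g = idm I 1" "g * poly_fm (idm I 1) T (f1 * f2) = idm I 1"
    have ee: "idm I 1 * idm I 1 = idm I (1 :: 'k)" using I by (simp add: idm_mult)
    note r = ring_map_mapm[OF ring_map_poly_fm[OF ee T]]
    note s1 = poly_fm_split[OF ee T g fg] and s2 = poly_fm_split[OF ee T g fg[unfolded mult.commute[of f1 f2]]]
    have ev: "EV (mscale (mscale (*))) (idm J (idm I 1)) (\<lambda>k. mapm (poly_fm (idm I 1) T) (X k)) Q1
          (mapm (poly_fm (idm I 1) T) N1 * idm J (poly_fm (idm I 1) T f2 * g))"
      "EV (mscale (mscale (*))) (idm J (idm I 1)) (\<lambda>k. mapm (poly_fm (idm I 1) T) (X k)) Q2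
          (mapm (poly_fm (idm I 1) T) N2 * idm J (poly_fm (idm I 1) T f1 * g))"
      by (rule curve_valueD(4)[OF 1 I T s1]) (rule curve_valueD(4)[OF 2 I T s2])
    have "mapm (poly_fm (idm I 1) T) ?N * idm J g =
        mapm (poly_fm (idm I 1) T) N1 * idm J (poly_fm (idm I 1) T f2 * g) +
        mapm (poly_fm (idm I 1) T) N2 * idm J (poly_fm (idm I 1) T f1 * g)"
      using curve_scalar[OF J ee T curve_valueD(2)[OF 1], of f2] curve_scalar[OF J ee T curve_valueD(2)[OF 2], of f1] J
      by (simp add: ring_map_add[OF r] ring_map_mult[OF r] mapm_idm distrib_right mult.assoc idm_mult)
    then show "EV (mscale (mscale (*))) (idm J (idm I 1)) (\<lambda>k. mapm (poly_fm (idm I 1) T) (X k)) (Add Q1 Q2)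
        (mapm (poly_fm (idm I 1) T) ?N * idm J g)" using ev by auto
  qed
  then show ?case by blast
next
  case (Mult Q1 Q2)
  obtain v1 v2 where v: "EV (mscale (*)) (idm J 1) (\<lambda>k. mapm (\<lambda>p. poly p t0) (X k)) Q1 v1"
    "EV (mscale (*)) (idm J 1) (\<lambda>k. mapm (\<lambda>p. poly p t0) (X k)) Q2 v2" "v0 = v1 * v2"
    using Mult.prems by auto
  obtain f1 N1 where 1: "curve_value J X t0 Q1 v1 f1 N1" using Mult.IH(1)[OF v(1)] by blast
  obtain f2 N2 where 2: "curve_value J X t0 Q2 v2 f2 N2" using Mult.IH(2)[OF v(2)] by blast
  have idem: "idm J 1 * idm J 1 = idm J (1 :: 'k)" using J by (simp add: idm_mult)
  have "curve_value J X t0 (Mult Q1 Q2) v0 (f1 * f2) (N1 * N2)"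
    unfolding curve_value_def
  proof (intro conjI allI impI)
    show "poly (f1 * f2) t0 \<noteq> 0" using curve_valueD(1)[OF 1] curve_valueD(1)[OF 2] by simp
    show "corner (idm J 1) (N1 * N2)" by (intro corner_mult curve_valueD(2)[OF 1] curve_valueD(2)[OF 2])
    have "idm J (poly f2 t0) * v1 = v1 * idm J (poly f2 t0)"
      by (rule idm_commute[OF J _ field_alg1.EV_corner[OF idem v(1)]]) (simp add: mult.commute)
    then have c: "v1 * idm J (poly f2 t0) = idm J (poly f2 t0) * v1" by simp
    have "mapm (\<lambda>p. poly p t0) (N1 * N2) = idm J (poly f1 t0) * v1 * (idm J (poly f2 t0) * v2)"
      by (simp only: ring_map_mult[OF ring_map_mapm[OF ring_map_poly]] curve_valueD(3)[OF 1] curve_valueD(3)[OF 2])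
    also have "\<dots> = idm J (poly f1 t0) * idm J (poly f2 t0) * (v1 * v2)"
      by (simp only: mult.assoc assoc_left[OF c])
    also have "\<dots> = idm J (poly (f1 * f2) t0) * v0" using J by (simp add: idm_mult v(3))
    finally show "mapm (\<lambda>p. poly p t0) (N1 * N2) = idm J (poly (f1 * f2) t0) * v0" .
    fix I :: "nat set" and T g :: "'k finmat"
    assume I: "finite I" and T: "corner (idm I 1) T" and g: "corner (idm I 1) g"
      and fg: "poly_fm (idm I 1) T (f1 * f2) * g = idm I 1" "g * poly_fm (idm I 1) T (f1 * f2) = idm I 1"
    have ee: "idm I 1 * idm I 1 = idm I (1 :: 'k)" using I by (simp add: idm_mult)
    note r = ring_map_mapm[OF ring_map_poly_fm[OF ee T]]
    note s1 = poly_fm_split[OF ee T g fg] and s2 = poly_fm_split[OF ee T g fg[unfolded mult.commute[of f1 f2]]]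
    have ev: "EV (mscale (mscale (*))) (idm J (idm I 1)) (\<lambda>k. mapm (poly_fm (idm I 1) T) (X k)) Q1
          (mapm (poly_fm (idm I 1) T) N1 * idm J (poly_fm (idm I 1) T f2 * g))"
      "EV (mscale (mscale (*))) (idm J (idm I 1)) (\<lambda>k. mapm (poly_fm (idm I 1) T) (X k)) Q2
          (mapm (poly_fm (idm I 1) T) N2 * idm J (poly_fm (idm I 1) T f1 * g))"
      by (rule curve_valueD(4)[OF 1 I T s1]) (rule curve_valueD(4)[OF 2 I T s2])
    have gg: "poly_fm (idm I 1) T f2 * g * (poly_fm (idm I 1) T f1 * g) = g"
      using s1(2) poly_fm_inverse_commute[OF ee T g fg, of f2] g
      by (metis corner_def mult.assoc s1(3) s2(2))
    have com: "idm J (poly_fm (idm I 1) T f2 * g) * mapm (poly_fm (idm I 1) T) N2 =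
        mapm (poly_fm (idm I 1) T) N2 * idm J (poly_fm (idm I 1) T f2 * g)"
      by (rule curve_scalar_both[OF J ee T g fg curve_valueD(2)[OF 2]])
    have "mapm (poly_fm (idm I 1) T) (N1 * N2) * idm J g =
        (mapm (poly_fm (idm I 1) T) N1 * idm J (poly_fm (idm I 1) T f2 * g)) *
        (mapm (poly_fm (idm I 1) T) N2 * idm J (poly_fm (idm I 1) T f1 * g))"
      using J gg by (simp add: ring_map_mult[OF r] mult.assoc assoc_left[OF com] idm_mult)
    then show "EV (mscale (mscale (*))) (idm J (idm I 1)) (\<lambda>k. mapm (poly_fm (idm I 1) T) (X k)) (Mult Q1 Q2)
        (mapm (poly_fm (idm I 1) T) (N1 * N2) * idm J g)" using ev by auto
  qed
  then show ?case by blast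
next
  case (Inv Q)
  obtain u0 where u0: "EV (mscale (*)) (idm J 1) (\<lambda>k. mapm (\<lambda>p. poly p t0) (X k)) Q u0"
    "corner (idm J 1) v0" "u0 * v0 = idm J 1" "v0 * u0 = idm J 1"
    using Inv.prems by auto
  obtain f N where fN: "curve_value J X t0 Q u0 f N" using Inv.IH[OF u0(1)] by blast
  then have f0: "poly f t0 \<noteq> 0" and Nc: "corner (idm J 1) N"
    and N0: "mapm (\<lambda>p. poly p t0) N = idm J (poly f t0) * u0" by (auto dest: curve_valueD)
  have idem: "idm J 1 * idm J 1 = idm J (1 :: 'k)" using J by (simp add: idm_mult)
  note uc = field_alg1.EV_corner[OF idem u0(1)]
  let ?w = "idm J (1 / poly f t0) * v0"
  have "idm J (1 / poly f t0) * u0 = u0 * idm J (1 / poly f t0)"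
    by (rule idm_commute[OF J _ uc]) (simp add: mult.commute)
  then have c: "u0 * idm J (1 / poly f t0) = idm J (1 / poly f t0) * u0" by simp
  have "mapm (\<lambda>p. poly p t0) N * ?w = idm J (poly f t0) * (idm J (1 / poly f t0) * (u0 * v0))"
    by (simp only: N0 mult.assoc assoc_left[OF c])
  also have "\<dots> = idm J 1" using f0 by (simp add: u0(3) idm_mult[OF J])
  finally have "mapm (\<lambda>p. poly p t0) N * ?w = idm J 1" .
  moreover have "corner (idm J 1) ?w"
    using u0(2) J by (intro corner_mult) (simp_all add: corner_def idm_mult)
  ultimately obtain M d where M: "corner (idm J 1) M" "N * M = idm J d" "M * N = idm J d" "poly d t0 \<noteq> 0"
    using adjugate[OF J Nc, of ?w t0] by blast
  \<comment> \<open>From \<open>N M = d\<close> the inverse of \<open>N / f\<close> is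
    \<open>f M / d\<close>. Numerator and denominator are multiplied by \<open>f\<close> once more,
    so that invertibility of the denominator at \<open>T\<close> includes that of \<open>f\<close>,
    which the domain of \<open>Q\<close> demands.\<close>
  have "curve_value J X t0 (Inv Q) v0 (f * d) (idm J (f * f) * M)"
    unfolding curve_value_def
  proof (intro conjI allI impI)
    show "poly (f * d) t0 \<noteq> 0" using f0 M by simp
    show "corner (idm J 1) (idm J (f * f) * M)"
      using M J by (intro corner_mult) (simp_all add: corner_def idm_mult)
    note rp = ring_map_mapm[OF ring_map_poly]
    let ?M0 = "mapm (\<lambda>p. poly p t0) M"
    have M0c: "corner (idm J 1) ?M0" using ring_map_corner[OF rp M(1)] J by (simp add: mapm_idm)
    have "?M0 * (idm J (poly f t0) * u0) = idm J (poly d t0)"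
      using arg_cong[OF M(3), of "mapm (\<lambda>p. poly p t0)"] J by (simp add: ring_map_mult[OF rp] N0 mapm_idm)
    then have "?M0 * (idm J (poly f t0) * u0) * v0 = idm J (poly d t0) * v0" by simp
    then have "?M0 * (idm J (poly f t0) * idm J 1) = idm J (poly d t0) * v0" by (simp add: mult.assoc u0(3))
    then have "?M0 * idm J (poly f t0) = idm J (poly d t0) * v0" using J by (simp add: idm_mult)
    moreover have "idm J (poly f t0) * ?M0 = ?M0 * idm J (poly f t0)"
      by (rule idm_commute[OF J _ M0c]) (simp add: mult.commute)
    ultimately have "idm J (poly f t0) * (idm J (poly f t0) * ?M0) = idm J (poly f t0) * (idm J (poly d t0) * v0)" by simp
    then show "mapm (\<lambda>p. poly p t0) (idm J (f * f) * M) = idm J (poly (f * d) t0) * v0"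
      using J by (simp add: ring_map_mult[OF rp] mapm_idm idm_mult flip: mult.assoc)
    fix I :: "nat set" and T g :: "'k finmat"
    assume I: "finite I" and T: "corner (idm I 1) T" and g: "corner (idm I 1) g"
      and fg: "poly_fm (idm I 1) T (f * d) * g = idm I 1" "g * poly_fm (idm I 1) T (f * d) = idm I 1"
    have ee: "idm I 1 * idm I 1 = idm I (1 :: 'k)" using I by (simp add: idm_mult)
    let ?t = "poly_fm (idm I 1) T" and ?h = "mapm (poly_fm (idm I 1) T)"
    note r = ring_map_mapm[OF ring_map_poly_fm[OF ee T]]
    note s1 = poly_fm_split[OF ee T g fg]
    have i1: "?h (idm J 1) = idm J (idm I 1)" using J by (simp add: mapm_idm poly_fm_one[OF ee T])
    have ev: "EV (mscale (mscale (*))) (idm J (idm I 1)) (\<lambda>k. ?h (X k)) Q (?h N * idm J (?t d * g))"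
      by (rule curve_valueD(4)[OF fN I T s1])
    have val: "?h (idm J (f * f) * M) * idm J g = ?h M * idm J (?t (f * f) * g)"
      using curve_scalar[OF J ee T, of M "f * f"] M(1) J
      by (simp add: ring_map_mult[OF r] mapm_idm mult.assoc idm_mult)
    note com = curve_scalar_both[OF J ee T g fg]
    \<comment> \<open>The denominators cancel: \<open>d p q\<close> is the square of
      \<open>f d\<close>, and \<open>g\<close> inverts \<open>f d\<close> at
      \<open>T\<close>.\<close>
    have sc: "?t d * (?t p * g * (?t q * g)) = idm I 1" if "p * q = d * (f * f)" for p q
    proof -
      have "?t d * (?t p * g * (?t q * g)) = ?t d * (?t p * (?t q * (g * g)))"
        by (simp only: mult.assoc assoc_left[OF poly_fm_inverse_commute[OF ee T g fg, of q]])
      also have "\<dots> = ?t (d * (p * q)) * (g * g)" by (simp only: poly_fm_mult[OF ee T] mult.assoc)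
      also have "d * (p * q) = (f * d) * (f * d)" unfolding that by (simp only: ac_simps)
      also have "?t ((f * d) * (f * d)) * (g * g) = ?t (f * d) * ((?t (f * d) * g) * g)"
        by (simp only: poly_fm_mult[OF ee T] mult.assoc)
      also have "\<dots> = idm I 1" using fg g by (simp add: corner_left)
      finally show ?thesis .
    qed
    have ddr: "?h N * ?h M = idm J (?t d)" "?h M * ?h N = idm J (?t d)"
      using M(2,3) J by (simp_all add: mapm_idm flip: ring_map_mult[OF r])
    have prod: "?h K * idm J (?t p * g) * (?h K' * idm J (?t q * g)) = ?h K * ?h K' * idm J (?t p * g * (?t q * g))"
      if "corner (idm J 1) K'" for p q K K'
      using J by (simp only: mult.assoc assoc_left[OF com[OF that]] idm_mult)
    show "EV (mscale (mscale (*))) (idm J (idm I 1)) (\<lambda>k. ?h (X k)) (Inv Q) (?h (idm J (f * f) * M) * idm J g)"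
      unfolding val EV.simps
    proof (intro exI conjI)
      show "EV (mscale (mscale (*))) (idm J (idm I 1)) (\<lambda>k. ?h (X k)) Q (?h N * idm J (?t d * g))" by (rule ev)
      show "?h N * idm J (?t d * g) * (?h M * idm J (?t (f * f) * g)) = idm J (idm I 1)"
        unfolding prod[OF M(1)] ddr idm_mult[OF J] by (simp only: sc[OF refl])
      show "?h M * idm J (?t (f * f) * g) * (?h N * idm J (?t d * g)) = idm J (idm I 1)"
        unfolding prod[OF Nc] ddr idm_mult[OF J] by (subst sc) (simp_all add: mult.commute)
      show "corner (idm J (idm I 1)) (?h M * idm J (?t (f * f) * g))"
      proof (rule corner_mult)
        show "corner (idm J (idm I 1)) (?h M)" using ring_map_corner[OF r M(1)] unfolding i1 .
        have "corner (idm I 1) (?t (f * f) * g)" by (intro corner_mult poly_fm_corner[OF ee T] g)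
        then show "corner (idm J (idm I 1)) (idm J (?t (f * f) * g))"
          using ring_map_corner[OF ring_map_idm[OF J]] by blast
      qed
    qed
  qed
  then show ?case by blast
qed

text \<open>If \<open>T\<close> is the companion matrix of \<open>1 + t h(t)\<close>, then \<open>T h(T) = -1\<close>; this replaces the choice
  of a scalar \<open>t\<close> with \<open>h(t) \<noteq> 0\<close>, which may not exist over a finite field.\<close>

lemma companion_invertible:
  fixes h :: "'k :: field poly"
  assumes h: "h \<noteq> 0"
  obtains I T g where "finite I" "I \<noteq> {}" "corner (idm I 1) T" "corner (idm I 1) g"
    "poly_fm (idm I 1) T h * g = idm I 1" "g * poly_fm (idm I 1) T h = idm I 1"
proof -
  define q where "q = pCons 1 h"
  define D where "D = degree q"
  have D: "D = Suc (degree h)" using h by (simp add: D_def q_def)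
  define I where "I = {..<D}"
  have I: "finite I" "I \<noteq> {}" by (auto simp: I_def D)
  \<comment> \<open>Companion matrix of \<open>q = 1 + t h\<close>, normalized by the leading
    coefficient of \<open>q\<close>, which is that of \<open>h\<close>. The size is
    \<open>degree h + 1\<close>, so the index set is never empty.\<close>
  define T :: "'k finmat" where "T = finmat (\<lambda>i j. if i < D \<and> j < D then
    (if i = Suc j then 1 else 0) - (if Suc j = D then coeff q i / lead_coeff h else 0) else 0)"
  have T: "entry T i j = (if i < D \<and> j < D then
    (if i = Suc j then 1 else 0) - (if Suc j = D then coeff q i / lead_coeff h else 0) else 0)" for i j
  proof -
    have "entry T = (\<lambda>i j. if i < D \<and> j < D then
    (if i = Suc j then 1 else 0) - (if Suc j = D then coeff q i / lead_coeff h else 0) else 0)"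
      unfolding T_def by (rule entry_finmat_subset[of "{..<D}" "{..<D}"]) (auto split: if_splits)
    then show ?thesis by simp
  qed
  have ee: "idm I 1 * idm I 1 = idm I (1 :: 'k)" using I by (simp add: idm_mult)
  have Tc: "corner (idm I 1) T" by (rule corner_idm_iff[OF I(1), THEN iffD2]) (auto simp: corner_def T I_def)
  let ?t = "poly_fm (idm I 1) T"
  \<comment> \<open>Columns of coefficients: on them \<open>T\<close> acts as multiplication by
    \<open>t\<close> modulo \<open>q\<close>. Consequently a polynomial of degree below
    \<open>D\<close>, evaluated at \<open>T\<close> and applied to the first basis vector, gives its
    own column, while \<open>q\<close> gives zero.\<close>
  define pcol where "pcol p = (\<Sum>i<D. single i 0 (coeff p i :: 'k))" for p
  have pcol: "entry (pcol p) i j = (if i < D \<and> j = 0 then coeff p i else 0)" for p i j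
  proof -
    have "entry (pcol p) i j = (\<Sum>l<D. if l = i then (if j = 0 then coeff p i else 0) else 0)"
      unfolding pcol_def entry_sum entry_single by (rule sum.cong) auto
    then show ?thesis by simp
  qed
  have Tcol: "entry (T * pcol p) i 0 = (if i < D then (if i = 0 then 0 else coeff p (i - 1)) -
      coeff q i / lead_coeff h * coeff p (degree h) else 0)" for p i
  proof -
    have "entry (T * pcol p) i 0 = (\<Sum>l<D. entry T i l * entry (pcol p) l 0)"
      by (rule entry_times) (auto simp: T)
    also have "\<dots> = (\<Sum>l<D. (if Suc l = i \<and> i < D then coeff p l else 0) -
        (if l = degree h \<and> i < D then coeff q i / lead_coeff h * coeff p (degree h) else 0))"
      by (rule sum.cong) (auto simp: T pcol D left_diff_distrib)
    also have "\<dots> = (\<Sum>l<D. if Suc l = i \<and> i < D then coeff p l else 0) -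
        (\<Sum>l<D. if l = degree h then (if i < D then coeff q i / lead_coeff h * coeff p (degree h) else 0) else 0)"
      unfolding sum_subtractf by (intro arg_cong2[of _ _ _ _ minus] sum.cong) auto
    also have "(\<Sum>l<D. if l = degree h then (if i < D then coeff q i / lead_coeff h * coeff p (degree h) else 0) else 0) =
        (if i < D then coeff q i / lead_coeff h * coeff p (degree h) else 0)"
      by (simp add: D)
    also have "(\<Sum>l<D. if Suc l = i \<and> i < D then coeff p l else 0) =
        (if i < D then (if i = 0 then 0 else coeff p (i - 1)) else 0)"
    proof (cases "i < D \<and> i \<noteq> 0")
      case True
      then have "(\<Sum>l<D. if Suc l = i \<and> i < D then coeff p l else 0) = (\<Sum>l<D. if l = i - 1 then coeff p l else 0)"
        by (intro sum.cong) auto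
      moreover have "i - 1 < D" using True by linarith
      ultimately show ?thesis using True by simp
    next
      case False
      then have "(\<Sum>l<D. if Suc l = i \<and> i < D then coeff p l else 0) = 0" by (intro sum.neutral) auto
      then show ?thesis using False by auto
    qed
    finally show ?thesis by auto
  qed
  have Tcol': "entry (T * pcol p) i j = 0" if "j \<noteq> 0" for p i j
    using that by (subst entry_times[of "{..<D}"]) (auto simp: pcol T)
  have e0: "entry (idm I 1 * single 0 0 1) i j = (if i = 0 \<and> j = 0 then 1 else (0 :: 'k))" for i j
    using I by (auto simp: entry_idm_mult entry_single I_def D)
  have step: "?t (pCons a p) * single 0 0 1 = mscale (*) a (idm I 1 * single 0 0 1) + T * (?t p * single 0 0 1)" for a p
    by (simp add: poly_fm_pCons distrib_right field_alg1.scale_mult_left mult.assoc)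
  have low: "degree p < D \<Longrightarrow> ?t p * single 0 0 1 = pcol p" for p
  proof (induction p)
    case 0
    show ?case by (simp add: pcol_def)
  next
    case (pCons a p)
    have "?t p * single 0 0 1 = pcol p" using pCons by (cases "p = 0") auto
    moreover have "coeff p (degree h) = 0"
      using pCons by (cases "p = 0") (auto simp: D intro!: coeff_eq_0)
    ultimately show ?case unfolding step
      by (intro finmat_eqI, rename_tac i j, case_tac "j = 0")
        (auto simp: field_alg.entry_mscale e0 Tcol Tcol' pcol D coeff_pCons split: nat.splits)
  qed
  have q0: "?t q * single 0 0 1 = 0"
  proof (rule finmat_eqI)
    fix i j
    have "?t h * single 0 0 1 = pcol h" by (rule low) (simp add: D)
    then show "entry (?t q * single 0 0 1) i j = entry 0 i j"
      unfolding q_def step using h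
      by (cases "j = 0") (auto simp: field_alg.entry_mscale e0 Tcol Tcol' D q_def coeff_pCons split: nat.splits)
  qed
  \<comment> \<open>The basis vector \<open>i\<close> is obtained from the first one by the power
    \<open>i\<close> of \<open>T\<close>, which commutes with \<open>q(T)\<close>; so
    \<open>q(T)\<close> kills the whole basis.\<close>
  have qi: "?t q * single i 0 1 = 0" if "i < D" for i
  proof -
    have "?t (monom 1 i) * single 0 0 1 = pcol (monom 1 i)"
      by (rule low) (use that in \<open>simp add: degree_monom_eq\<close>)
    also have "\<dots> = single i 0 1" by (rule finmat_eqI) (use that in \<open>auto simp: pcol entry_single\<close>)
    finally have "?t q * single i 0 1 = ?t q * ?t (monom 1 i) * single 0 0 1" by (simp add: mult.assoc)
    also have "\<dots> = ?t (monom 1 i) * (?t q * single 0 0 1)"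
      by (simp only: mult.commute[of q] mult.assoc flip: poly_fm_mult[OF ee Tc]) (simp only: poly_fm_mult[OF ee Tc] mult.assoc)
    finally show ?thesis by (simp add: q0)
  qed
  have "?t q = ?t q * idm I 1" using poly_fm_corner[OF ee Tc] by (simp add: corner_def)
  also have "\<dots> = (\<Sum>i\<in>I. ?t q * (single i 0 1 * single 0 i 1))"
    by (simp add: idm_def sum_distrib_left single_mult)
  also have "\<dots> = 0" using qi by (intro sum.neutral) (auto simp: I_def simp flip: mult.assoc)
  finally have "?t q = 0" .
  then have "idm I 1 + T * ?t h = 0" by (simp add: q_def poly_fm_pCons field_alg1.scale_one)
  then have *: "- T * ?t h = idm I 1" by (simp add: add_eq_0_iff)
  have t: "T = ?t [:0, 1:]" using Tc by (simp add: poly_fm_pCons field_alg1.scale_one corner_def)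
  have "T * ?t h = ?t h * T"
    by (subst (1 2) t) (simp only: mult.commute[of "[:0, 1:]"] flip: poly_fm_mult[OF ee Tc])
  then have "?t h * (- T) = idm I 1" using * by simp
  then show thesis using that[OF I Tc corner_uminus[OF Tc] _ *] by blast
qed

text \<open>The two points are brought to a common size, one by a unit factor on the right and the
  other by one on the left, and are joined by a line with parameter 0 at the first and 1 at the
  second. The denominators of the two expressions along the line are nonzero at 0 and at 1
  respectively, so their product is a nonzero polynomial. A matrix parameter at which it is
  invertible gives a point in both domains.\<close>

lemma common_point:
  fixes P0 P1 :: "'d \<Rightarrow> 'k :: field finmat"
  assumes fin: "finite J0" "finite J1" and ne: "J0 \<noteq> {}" "J1 \<noteq> {}"
    and ev: "EV (mscale (*)) (idm J0 1) P0 Q v" "EV (mscale (*)) (idm J1 1) P1 R w"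
  obtains J P z where "finite J" "J \<noteq> {}" "EV (mscale (*)) (idm J 1) P (Add Q R) z"
proof -
  let ?K = "prod_encode ` (J0 \<times> J1)"
  have K: "finite ?K" "?K \<noteq> {}" using fin ne by auto
  have r0: "ring_map (\<lambda>x. tens (mscale (*)) x (idm J1 1) :: 'k finmat finmat)"
    unfolding ring_map_def using fin by (simp add: field_alg1.tens_add_left field_alg1.tens_mult idm_mult)
  have s0: "flatten (tens (mscale (*)) (mscale (*) c x) (idm J1 1)) =
      mscale (*) c (flatten (tens (mscale (*)) x (idm J1 1)))" for c and x :: "'k finmat"
    by (rule finmat_eqI) (simp add: entry_flatten field_alg1.entry_tens field_alg.entry_mscale)
  have r0': "ring_map (\<lambda>x. flatten (tens (mscale (*)) x (idm J1 1)) :: 'k finmat)"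
    by (rule ring_map_comp[OF r0 ring_map_flatten])
  have u0: "flatten (tens (mscale (*)) (idm J0 1) (idm J1 (1 :: 'k))) = idm ?K 1"
    using fin by (simp add: field_alg1.tens_idm flatten_idm)
  have r1': "ring_map (\<lambda>x. flatten (idm J0 x) :: 'k finmat)"
    by (rule ring_map_comp[OF ring_map_idm[OF fin(1)] ring_map_flatten])
  have s1: "flatten (idm J0 (mscale (*) c x)) = mscale (*) c (flatten (idm J0 x))" for c and x :: "'k finmat"
    by (rule finmat_eqI) (use fin in \<open>auto simp: entry_flatten entry_idm field_alg.entry_mscale\<close>)
  define X0 where "X0 k = flatten (tens (mscale (*)) (P0 k) (idm J1 1))" for k
  define X1 where "X1 k = flatten (idm J0 (P1 k))" for k
  have e0: "\<exists>v. EV (mscale (*)) (idm ?K 1) X0 Q v"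
    using EV_hom[OF r0' s0 ev(1)] unfolding u0 X0_def by blast
  have e1: "\<exists>w. EV (mscale (*)) (idm ?K 1) X1 R w"
    using EV_hom[OF r1' s1 ev(2)] fin unfolding X1_def by (auto simp: flatten_idm)
  define X where "X k = mapm (\<lambda>c. [:c:]) (X0 k) + mapm (\<lambda>c. [:0, c:]) (X1 k - X0 k)" for k
  have Xat: "mapm (\<lambda>p. poly p 0) (X k) = X0 k" "mapm (\<lambda>p. poly p 1) (X k) = X1 k" for k
    unfolding X_def by (rule finmat_eqI, simp add: entry_mapm)+
  obtain v' w' where vw': "EV (mscale (*)) (idm ?K 1) X0 Q v'" "EV (mscale (*)) (idm ?K 1) X1 R w'"
    using e0 e1 by (elim exE)
  have Xc: "corner (idm ?K 1) (X k)" for k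
  proof -
    have c: "corner (idm ?K 1) (X0 k)" "corner (idm ?K 1) (X1 k)"
      by (rule field_alg1.EV_arg_corner[OF vw'(1)], rule field_alg1.EV_arg_corner[OF vw'(2)])
    have "entry (X k) i j = 0" if "i \<notin> ?K \<or> j \<notin> ?K" for i j
      using c[unfolded corner_idm_iff[OF K(1)]] that by (simp add: X_def entry_mapm)
    then show ?thesis by (intro corner_idm_iff[OF K(1), THEN iffD2]) (simp add: corner_def)
  qed
  have vw: "EV (mscale (*)) (idm ?K 1) (\<lambda>k. mapm (\<lambda>p. poly p 0) (X k)) Q v'"
    "EV (mscale (*)) (idm ?K 1) (\<lambda>k. mapm (\<lambda>p. poly p 1) (X k)) R w'"
    using vw' by (simp_all only: Xat)
  obtain f1 N1 where 1: "curve_value ?K X 0 Q v' f1 N1" using EV_curve[OF K(1) Xc vw(1)] by blast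
  obtain f2 N2 where 2: "curve_value ?K X 1 R w' f2 N2" using EV_curve[OF K(1) Xc vw(2)] by blast
  have "f1 * f2 \<noteq> 0" using curve_valueD(1)[OF 1] curve_valueD(1)[OF 2] by auto
  then obtain I T g where I: "finite I" "I \<noteq> {}" "corner (idm I 1) T" "corner (idm I 1) g"
    "poly_fm (idm I 1) T (f1 * f2) * g = idm I 1" "g * poly_fm (idm I 1) T (f1 * f2) = idm I 1"
    by (rule companion_invertible)
  have ee: "idm I 1 * idm I 1 = idm I (1 :: 'k)" using I by (simp add: idm_mult)
  note s1 = poly_fm_split[OF ee I(3-6)] and s2 = poly_fm_split[OF ee I(3-4) I(5,6)[unfolded mult.commute[of f1 f2]]]
  obtain z where z: "EV (mscale (mscale (*))) (idm ?K (idm I 1)) (\<lambda>k. mapm (poly_fm (idm I 1) T) (X k)) (Add Q R) z"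
    using curve_valueD(4)[OF 1 I(1,3) s1] curve_valueD(4)[OF 2 I(1,3) s2] by auto
  have sf: "flatten (mscale (mscale (*)) c x) = mscale (*) c (flatten x)" for c and x :: "'k finmat finmat"
    by (rule finmat_eqI) (simp add: entry_flatten field_alg.entry_mscale field_alg1.entry_mscale)
  have "EV (mscale (*)) (flatten (idm ?K (idm I 1))) (\<lambda>k. flatten (mapm (poly_fm (idm I 1) T) (X k))) (Add Q R) (flatten z)"
    by (rule EV_hom[OF ring_map_flatten sf z])
  then have "EV (mscale (*)) (idm (prod_encode ` (?K \<times> I)) 1) (\<lambda>k. flatten (mapm (poly_fm (idm I 1) T) (X k))) (Add Q R) (flatten z)"
    by (simp only: flatten_idm[OF K(1) I(1)])
  moreover have "finite (prod_encode ` (?K \<times> I))" "prod_encode ` (?K \<times> I) \<noteq> {}"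
    using K I by (simp_all only: finite_imageI finite_cartesian_product image_is_empty Times_empty simp_thms)
  ultimately show thesis using that by metis
qed

section \<open>Translation from matrix algebras\<close>

text \<open>Identifies an algebra given by a record with the corner of \<open>e\<close>, so that
  domains and values of the record semantics can be exchanged for the relation
  \<open>EV\<close>.\<close>

locale alg_embedding =
  fixes \<A> :: "('k :: field, 'x, 'm) module_scheme" (structure)
    and \<iota> :: "'x \<Rightarrow> 'b :: ring" and scale :: "'k \<Rightarrow> 'b \<Rightarrow> 'b" and e :: 'b
  assumes kalg: "kalg scale" and ee: "e * e = e"
    and abelian: "abelian_monoid \<A>"
    and emb_corner: "x \<in> carrier \<A> \<Longrightarrow> corner e (\<iota> x)"
    and emb_surj: "corner e z \<Longrightarrow> \<exists>x\<in>carrier \<A>. \<iota> x = z"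
    and emb_inj: "inj_on \<iota> (carrier \<A>)"
    and one: "\<one> \<in> carrier \<A>" "\<iota> \<one> = e" and zero: "\<iota> \<zero> = 0"
    and mult: "x \<in> carrier \<A> \<Longrightarrow> y \<in> carrier \<A> \<Longrightarrow> x \<otimes> y \<in> carrier \<A>"
      "x \<in> carrier \<A> \<Longrightarrow> y \<in> carrier \<A> \<Longrightarrow> \<iota> (x \<otimes> y) = \<iota> x * \<iota> y"
    and add: "x \<in> carrier \<A> \<Longrightarrow> y \<in> carrier \<A> \<Longrightarrow> \<iota> (x \<oplus> y) = \<iota> x + \<iota> y"
    and smult: "x \<in> carrier \<A> \<Longrightarrow> c \<odot> x \<in> carrier \<A>" "x \<in> carrier \<A> \<Longrightarrow> \<iota> (c \<odot> x) = scale c (\<iota> x)"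
begin

interpretation abelian_monoid \<A> by (rule abelian)
interpretation kalg scale by (rule kalg)

lemma emb_eq: "x \<in> carrier \<A> \<Longrightarrow> y \<in> carrier \<A> \<Longrightarrow> \<iota> x = \<iota> y \<Longrightarrow> x = y"
  using emb_inj by (rule inj_onD)

lemma emb_foldr:
  assumes "\<And>k. a k \<in> carrier \<A>"
  shows "foldr (\<lambda>k b. a k \<otimes> b) w \<one> \<in> carrier \<A> \<and> \<iota> (foldr (\<lambda>k b. a k \<otimes> b) w \<one>) = foldr (\<lambda>k b. \<iota> (a k) * b) w e"
  by (induction w) (use assms one mult in auto)

lemma emb_finsum:
  assumes "\<And>x. x \<in> A \<Longrightarrow> f x \<in> carrier \<A>" "finite A"
  shows "finsum \<A> f A \<in> carrier \<A> \<and> \<iota> (finsum \<A> f A) = (\<Sum>x\<in>A. \<iota> (f x))"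
  using assms(2,1)
proof (induction A)
  case empty
  show ?case by (simp add: zero)
next
  case (insert x A)
  have IH: "finsum \<A> f A \<in> carrier \<A>" "\<iota> (finsum \<A> f A) = (\<Sum>x\<in>A. \<iota> (f x))"
    using insert.IH insert.prems by blast+
  have fx: "f x \<in> carrier \<A>" using insert.prems by blast
  have "finsum \<A> f (insert x A) = f x \<oplus> finsum \<A> f A"
    by (rule finsum_insert) (use insert in auto)
  then show ?case using add[OF fx IH(1)] a_closed[OF fx IH(1)] IH(2) insert.hyps by simp
qed

lemma emb_poly:
  assumes "\<And>k. a k \<in> carrier \<A>"
  shows "poly_eval \<A> p a \<in> carrier \<A>"
    "\<iota> (poly_eval \<A> p a) = (\<Sum>w \<in> Poly_Mapping.keys p. scale (Poly_Mapping.lookup p w) (foldr (\<lambda>k b. \<iota> (a k) * b) w e))"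
proof -
  let ?m = "\<lambda>w. Poly_Mapping.lookup p w \<odot> foldr (\<lambda>k b. a k \<otimes> b) w \<one>"
  have f: "foldr (\<lambda>k b. a k \<otimes> b) w \<one> \<in> carrier \<A>"
    "\<iota> (foldr (\<lambda>k b. a k \<otimes> b) w \<one>) = foldr (\<lambda>k b. \<iota> (a k) * b) w e" for w
    using emb_foldr[where a = a and w = w, OF assms] by blast+
  have m: "?m w \<in> carrier \<A>" for w by (rule smult(1)[OF f(1)])
  have s: "finsum \<A> ?m (Poly_Mapping.keys p) \<in> carrier \<A> \<and>
      \<iota> (finsum \<A> ?m (Poly_Mapping.keys p)) = (\<Sum>w\<in>Poly_Mapping.keys p. \<iota> (?m w))"
    by (rule emb_finsum[OF m finite_keys])
  then show "poly_eval \<A> p a \<in> carrier \<A>" unfolding poly_eval_def by (rule conjunct1)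
  have "\<iota> (?m w) = scale (Poly_Mapping.lookup p w) (foldr (\<lambda>k b. \<iota> (a k) * b) w e)" for w
    by (simp only: smult(2)[OF f(1)] f(2))
  then show "\<iota> (poly_eval \<A> p a) = (\<Sum>w \<in> Poly_Mapping.keys p. scale (Poly_Mapping.lookup p w) (foldr (\<lambda>k b. \<iota> (a k) * b) w e))"
    unfolding poly_eval_def s[THEN conjunct2] by (rule sum.cong[OF refl])
qed

lemma expr_dom_carrier: "a \<in> expr_dom \<A> Q \<Longrightarrow> a k \<in> carrier \<A>"
  by (induction Q) auto

lemma inv_emb:
  assumes "x \<in> carrier \<A>" "y \<in> carrier \<A>" "\<iota> x * \<iota> y = e" "\<iota> y * \<iota> x = e"
  shows "x \<in> Units \<A>" "inv x = y"
proof -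
  have xy: "x \<otimes> y = \<one>" "y \<otimes> x = \<one>"
    using assms by (auto intro!: emb_eq simp: mult one)
  then show "x \<in> Units \<A>" unfolding Units_def using assms by auto
  show "inv x = y"
    unfolding m_inv_def
  proof (rule the_equality)
    fix z assume z: "z \<in> carrier \<A> \<and> x \<otimes> z = \<one> \<and> z \<otimes> x = \<one>"
    then have xz: "\<iota> x * \<iota> z = e"
      using assms(1) mult(2)[of x z] one(2) by auto
    have "\<iota> z = (\<iota> y * \<iota> x) * \<iota> z"
      using emb_corner z assms(4) by (simp add: corner_def)
    also have "\<dots> = \<iota> y" using xz emb_corner[OF assms(2)] by (simp add: mult.assoc corner_def)
    finally show "z = y" using emb_eq z assms(2) by blast
  qed (use assms xy in blast)
qed

lemma EV_of_dom:
  "a \<in> expr_dom \<A> Q \<Longrightarrow> expr_eval \<A> Q a \<in> carrier \<A> \<and> EV scale e (\<lambda>k. \<iota> (a k)) Q (\<iota> (expr_eval \<A> Q a))"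
proof (induction Q)
  case (Poly p)
  then show ?case using emb_poly[of a p] emb_corner by auto
next
  case (Inv Q)
  then have Q: "expr_eval \<A> Q a \<in> carrier \<A>" "EV scale e (\<lambda>k. \<iota> (a k)) Q (\<iota> (expr_eval \<A> Q a))"
    and u: "expr_eval \<A> Q a \<in> Units \<A>" by auto
  from u obtain y where y: "y \<in> carrier \<A>" "y \<otimes> expr_eval \<A> Q a = \<one>" "expr_eval \<A> Q a \<otimes> y = \<one>"
    unfolding Units_def by auto
  have e: "\<iota> (expr_eval \<A> Q a) * \<iota> y = e" "\<iota> y * \<iota> (expr_eval \<A> Q a) = e"
    using arg_cong[OF y(2), of \<iota>] arg_cong[OF y(3), of \<iota>] mult(2)[OF y(1) Q(1)] mult(2)[OF Q(1) y(1)] one(2)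
    by simp_all
  have "inv (expr_eval \<A> Q a) = y" by (rule inv_emb(2)[OF Q(1) y(1) e])
  then show ?case using Q(2) e y(1) emb_corner by auto
qed (auto simp: mult add intro!: a_closed)

text \<open>An inverse found in the corner comes from the carrier because \<open>\<iota>\<close> is
  onto the corner; hence the relation \<open>EV\<close> yields membership in the domain and not
  merely a value.\<close>

lemma dom_of_EV:
  assumes a: "\<And>k. a k \<in> carrier \<A>"
  shows "EV scale e (\<lambda>k. \<iota> (a k)) Q v \<Longrightarrow> a \<in> expr_dom \<A> Q \<and> v = \<iota> (expr_eval \<A> Q a)"
proof -
  have "EV scale e (\<lambda>k. \<iota> (a k)) Q v \<Longrightarrow> a \<in> expr_dom \<A> Q" for v
  proof (induction Q arbitrary: v)
    case (Inv Q)
    then obtain u where u: "EV scale e (\<lambda>k. \<iota> (a k)) Q u" "corner e v" "u * v = e" "v * u = e" by auto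
    have dom: "a \<in> expr_dom \<A> Q" by (rule Inv.IH[OF u(1)])
    note E = EV_of_dom[OF dom]
    then have ue: "u = \<iota> (expr_eval \<A> Q a)" using EV_unique[OF ee u(1)] by blast
    obtain y where y: "y \<in> carrier \<A>" "\<iota> y = v" using emb_surj[OF u(2)] by blast
    have "expr_eval \<A> Q a \<in> Units \<A>"
      by (rule inv_emb(1)[of _ y]) (use E y u ue in auto)
    then show ?case using dom by simp
  qed (use a in auto)
  then show "EV scale e (\<lambda>k. \<iota> (a k)) Q v \<Longrightarrow> a \<in> expr_dom \<A> Q \<and> v = \<iota> (expr_eval \<A> Q a)"
    using EV_of_dom EV_unique[OF ee] by blast
qed

end

text \<open>The numbering \<open>\<phi>\<close> is kept arbitrary because the same matrices occur on
  initial segments and on sets of encoded pairs.\<close>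

lemma alg_embedding_mat:
  fixes \<phi> :: "nat \<Rightarrow> nat"
  assumes inj: "inj_on \<phi> {..<n}"
  shows "alg_embedding (matrix_algebra n) (of_mat \<phi> \<phi>) (mscale (*) :: 'k :: field \<Rightarrow> _) (idm (\<phi> ` {..<n}) 1)"
proof (rule alg_embedding.intro)
  interpret abelian_group "matrix_algebra n" by (rule abelian_group_mat)
  show "abelian_monoid (module_mat TYPE('k) n n)" by (rule abelian_monoid_axioms)
  show "\<exists>x\<in>carrier (module_mat TYPE('k) n n). of_mat \<phi> \<phi> x = z" if "corner (idm (\<phi> ` {..<n}) 1) z" for z
    by (rule bexI[of _ "to_mat n n \<phi> \<phi> z"], rule of_mat_to_mat[OF inj inj])
      (use that in \<open>auto simp: module_mat_def corner_idm_iff\<close>)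
  show "inj_on (of_mat \<phi> \<phi>) (carrier (module_mat TYPE('k) n n))"
    by (rule inj_onI) (simp add: module_mat_def of_mat_inject[OF _ _ inj inj])
  show "of_mat \<phi> \<phi> \<zero>\<^bsub>module_mat TYPE('k) n n\<^esub> = 0"
    by (simp add: module_mat_def of_mat_def)
  show "of_mat \<phi> \<phi> (c \<odot>\<^bsub>module_mat TYPE('k) n n\<^esub> x) = mscale (*) c (of_mat \<phi> \<phi> x)"
    if "x \<in> carrier (module_mat TYPE('k) n n)" for c x
  proof -
    have x: "x \<in> carrier_mat n n" using that by (simp add: module_mat_def)
    show ?thesis
      by (rule finmat_eq_of_matI[symmetric, of _ n n])
        (use x in \<open>auto simp: module_mat_def inj field_alg.entry_mscale entry_of_mat[OF x inj inj] entry_of_mat_outside[OF x]\<close>)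
  qed
qed (auto simp: module_mat_def of_mat_one[OF inj] of_mat_mult[OF _ _ inj] of_mat_add of_mat_corner
    idm_mult field_alg1.kalg_axioms)

lemma alg_embedding_type:
  assumes "unital_algebra (scale :: 'k :: field \<Rightarrow> 'a :: ring_1 \<Rightarrow> 'a)"
  shows "alg_embedding (type_algebra scale) (\<lambda>x. x) scale 1"
proof (rule alg_embedding.intro)
  interpret unital_algebra scale by (rule assms)
  show "kalg scale"
    by unfold_locales (simp_all add: scale_right_distrib scale_left_distrib scale_mult_left scale_mult_right)
  show "abelian_monoid (type_algebra scale)"
    by (rule abelian_monoidI) (auto simp: type_algebra_def ac_simps)
qed (auto simp: type_algebra_def corner_def)

section \<open>Fornasini--Marchesini realizations with a scalar centre\<close>

text \<open>A realization centred at an \<open>s \<times> s\<close> matrix point has a scalar centre in terms of the variables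
  \<open>g = (k, i, j)\<close>, one for each entry of each coordinate.\<close>

definition fm_value ::
  "('k :: field \<Rightarrow> 'b :: ring \<Rightarrow> 'b) \<Rightarrow> 'b \<Rightarrow> 'g set \<Rightarrow> nat set \<Rightarrow> ('g \<Rightarrow> 'k finmat) \<Rightarrow> ('g \<Rightarrow> 'k finmat) \<Rightarrow>
    'k finmat \<Rightarrow> 'k finmat \<Rightarrow> ('g \<Rightarrow> 'b) \<Rightarrow> 'b finmat \<Rightarrow> bool" where
  "fm_value scale e G L A B C D x v \<longleftrightarrow>
    (\<exists>S. corner (idm L e) S \<and> (idm L e - (\<Sum>g\<in>G. tens scale (A g) (x g))) * S = idm L e \<and>
      S * (idm L e - (\<Sum>g\<in>G. tens scale (A g) (x g))) = idm L e \<and>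
      v = tens scale D e + tens scale C e * (S * (\<Sum>g\<in>G. tens scale (B g) (x g))))"

definition fm_index :: "nat \<Rightarrow> ('d :: finite \<times> nat \<times> nat) set" where
  "fm_index s = UNIV \<times> {..<s} \<times> {..<s}"

text \<open>A linear map is determined by its values on matrix units; these values are the
  coefficients of the scalar variables \<open>(k, i, j)\<close>.\<close>

definition map_entries :: "nat \<Rightarrow> ('d \<Rightarrow> 'k mat \<Rightarrow> 'k mat) \<Rightarrow> 'd \<times> nat \<times> nat \<Rightarrow> 'k :: field finmat" where
  "map_entries s F g = of_mat (\<lambda>i. i) (\<lambda>i. i) (F (fst g) (matrix_unit s (fst (snd g)) (snd (snd g))))"

lemma matrix_unit_carrier [simp]: "matrix_unit s a b \<in> carrier_mat s s"
  by (simp add: matrix_unit_def)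

lemma linear_mat_map_carrier: "linear_mat_map s p q T \<Longrightarrow> M \<in> carrier_mat s s \<Longrightarrow> T M \<in> carrier_mat p q"
  unfolding linear_mat_map_def by blast

lemma entry_of_mat_id:
  assumes "M \<in> carrier_mat p q"
  shows "entry (of_mat (\<lambda>i. i) (\<lambda>i. i) M) i j = (if i < p \<and> j < q then M $$ (i, j) else 0)"
  using entry_of_mat[OF assms, of "\<lambda>i. i" "\<lambda>i. i" i j] entry_of_mat_outside[OF assms, of i "\<lambda>i. i" j "\<lambda>i. i"]
  by auto

text \<open>Induction on the set of positions at which the entries of \<open>M\<close> are kept
  while all others are replaced by zero.\<close>

lemma linear_mat_map_sum:
  assumes T: "linear_mat_map s p q T" and M: "M \<in> carrier_mat s s" and ij: "i < p" "j < q"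
  shows "T M $$ (i, j) = (\<Sum>a<s. \<Sum>b<s. M $$ (a, b) * T (matrix_unit s a b) $$ (i, j))"
proof -
  have c: "T N \<in> carrier_mat p q" if "N \<in> carrier_mat s s" for N
    using T that unfolding linear_mat_map_def by blast
  have add: "T (N + N') = T N + T N'" if "N \<in> carrier_mat s s" "N' \<in> carrier_mat s s" for N N'
    using T that unfolding linear_mat_map_def by blast
  have smult: "T (c \<cdot>\<^sub>m N) = c \<cdot>\<^sub>m T N" if "N \<in> carrier_mat s s" for N c
    using T that unfolding linear_mat_map_def by blast
  let ?M = "\<lambda>F. mat s s (\<lambda>ab. if ab \<in> F then M $$ ab else 0)"
  have u: "matrix_unit s a b \<in> carrier_mat s s" for a b by (simp add: matrix_unit_def)
  have "T (?M F) $$ (i, j) = (\<Sum>ab\<in>F. M $$ ab * T (matrix_unit s (fst ab) (snd ab)) $$ (i, j))"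
    if "finite F" "F \<subseteq> {..<s} \<times> {..<s}" for F
    using that
  proof (induction F)
    case empty
    have "?M {} = 0 \<cdot>\<^sub>m M" by (rule eq_matI) (use M in auto)
    then show ?case using smult[OF M, of 0] c[OF M] ij by auto
  next
    case (insert x F)
    have eq: "?M (insert x F) = M $$ x \<cdot>\<^sub>m matrix_unit s (fst x) (snd x) + ?M F"
      by (rule eq_matI) (use insert.hyps in \<open>auto simp: matrix_unit_def\<close>)
    have "T (M $$ x \<cdot>\<^sub>m matrix_unit s (fst x) (snd x) + ?M F) = T (M $$ x \<cdot>\<^sub>m matrix_unit s (fst x) (snd x)) + T (?M F)"
      by (rule add) (simp_all add: u)
    then have "T (?M (insert x F)) = M $$ x \<cdot>\<^sub>m T (matrix_unit s (fst x) (snd x)) + T (?M F)"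
      unfolding eq smult[OF u] .
    moreover have "T (?M F) \<in> carrier_mat p q" by (rule c) simp
    moreover have "T (matrix_unit s (fst x) (snd x)) \<in> carrier_mat p q" by (rule c[OF u])
    ultimately have "T (?M (insert x F)) $$ (i, j) =
        M $$ x * T (matrix_unit s (fst x) (snd x)) $$ (i, j) + T (?M F) $$ (i, j)"
      using ij by simp
    then show ?case using insert by simp
  qed
  from this[of "{..<s} \<times> {..<s}"]
  have "T (?M ({..<s} \<times> {..<s})) $$ (i, j) = (\<Sum>(a, b)\<in>{..<s} \<times> {..<s}. M $$ (a, b) * T (matrix_unit s a b) $$ (i, j))"
    by (simp add: case_prod_beta)
  moreover have "?M ({..<s} \<times> {..<s}) = M" by (rule eq_matI) (use M in auto)
  ultimately show ?thesis by (simp add: sum.cartesian_product)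
qed

text \<open>For position \<open>q\<close> in a matrix of blocks of size \<open>d\<close>, the index
  inside the block becomes the outer level and the number of the block, renamed by \<open>h\<close>,
  the inner one. This reverses the tensor order of block matrices, in which the block number comes
  first.\<close>

definition block_index :: "nat \<Rightarrow> (nat \<Rightarrow> nat) \<Rightarrow> nat \<Rightarrow> nat" where
  "block_index d h q = prod_encode (q mod d, h (q div d))"

lemma inj_block_index:
  assumes "inj_on h {..<m}"
  shows "inj_on (block_index d h) {..<m * d}"
proof (rule inj_onI)
  fix x y assume xy: "x \<in> {..<m * d}" "y \<in> {..<m * d}" "block_index d h x = block_index d h y"
  then have "x mod d = y mod d" "h (x div d) = h (y div d)"
    by (auto simp: block_index_def inj_eq[OF inj_prod_encode])
  moreover have "x div d < m" "y div d < m" using xy by (auto simp: less_mult_imp_div_less)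
  ultimately have "x mod d = y mod d" "x div d = y div d" using assms by (auto dest: inj_onD)
  then show "x = y" by (metis div_mult_mod_eq)
qed

lemma block_index_image: "block_index d h ` {..<m * d} = prod_encode ` ({..<d} \<times> h ` {..<m})"
proof (intro equalityI subsetI)
  fix y assume "y \<in> block_index d h ` {..<m * d}"
  then obtain x where x: "x < m * d" "y = block_index d h x" by auto
  then have "x mod d < d" "x div d < m" by (auto simp: less_mult_imp_div_less) (metis mod_less_divisor mult_0_right not_gr_zero not_less0)
  then show "y \<in> prod_encode ` ({..<d} \<times> h ` {..<m})" using x by (auto simp: block_index_def)
next
  fix y assume "y \<in> prod_encode ` ({..<d} \<times> h ` {..<m})"
  then obtain i j where ij: "i < d" "j < m" "y = prod_encode (i, h j)" by auto
  have "(j * d + i) mod d = i" "(j * d + i) div d = j" using ij by auto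
  moreover have "j * d + i < m * d"
  proof -
    have "Suc j * d \<le> m * d" using ij(2) by (intro mult_le_mono1) simp
    then show ?thesis using ij(1) by simp
  qed
  ultimately show "y \<in> block_index d h ` {..<m * d}" using ij
    by (intro image_eqI[of _ _ "j * d + i"]) (auto simp: block_index_def)
qed

text \<open>Expanding every block in matrix units turns the blockwise extension into a sum of tensor
  products: the value of \<open>T\<close> on a matrix unit, times the matrix that collects the
  entries of all blocks at the corresponding position.\<close>

lemma of_mat_ext_block:
  fixes T :: "'k :: field mat \<Rightarrow> 'k mat"
  assumes T: "linear_mat_map s p q T" and h: "inj_on h {..<m}"
  shows "of_mat (block_index p h) (block_index q h) (ext_block s p q T m X) =
    flatten (\<Sum>(i, j)\<in>{..<s} \<times> {..<s}. tens (mscale (*)) (of_mat (\<lambda>i. i) (\<lambda>i. i) (T (matrix_unit s i j)))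
      (of_mat h h (mat m m (\<lambda>(\<mu>, \<nu>). X $$ (\<mu> * s + i, \<nu> * s + j)))))"
    (is "_ = flatten ?R")
proof (rule finmat_eq_of_matI[symmetric])
  have u: "T (matrix_unit s a b) \<in> carrier_mat p q" for a b
    by (rule linear_mat_map_carrier[OF T]) simp
  have mm: "mat m m f \<in> carrier_mat m m" for f :: "nat \<times> nat \<Rightarrow> 'k" by simp
  show "ext_block s p q T m X \<in> carrier_mat (m * p) (m * q)" by (simp add: ext_block_def)
  show "inj_on (block_index p h) {..<m * p}" "inj_on (block_index q h) {..<m * q}"
    by (rule inj_block_index[OF h])+
  show "entry (flatten ?R) (block_index p h i) (block_index q h j) = ext_block s p q T m X $$ (i, j)"
    if ij: "i < m * p" "j < m * q" for i j
  proof -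
    have d: "i div p < m" "j div q < m" "i mod p < p" "j mod q < q"
      using ij by (auto simp: less_mult_imp_div_less) (metis mod_less_divisor mult_0_right not_gr_zero not_less0)+
    have "entry (flatten ?R) (block_index p h i) (block_index q h j) =
      (\<Sum>(a, b)\<in>{..<s} \<times> {..<s}. T (matrix_unit s a b) $$ (i mod p, j mod q) * X $$ (i div p * s + a, j div q * s + b))"
      using d by (simp add: entry_flatten block_index_def case_prod_beta field_alg1.entry_tens field_alg.entry_mscale
          entry_of_mat_id[OF u] entry_of_mat[OF mm h h])
    also have "\<dots> = T (block s X (i div p) (j div q)) $$ (i mod p, j mod q)"
      by (subst linear_mat_map_sum[OF T _ d(3,4)])
        (auto simp: block_def sum.cartesian_product mult.commute intro!: sum.cong)
    finally show ?thesis using ij by (simp add: ext_block_def)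
  qed
  show "entry (flatten ?R) a b = 0" if ab: "a \<notin> block_index p h ` {..<m * p} \<or> b \<notin> block_index q h ` {..<m * q}" for a b
  proof -
    obtain i x j y where e: "a = prod_encode (i, x)" "b = prod_encode (j, y)" by (metis prod_decode_inverse surj_pair)
    have "(i \<notin> {..<p} \<or> x \<notin> h ` {..<m}) \<or> (j \<notin> {..<q} \<or> y \<notin> h ` {..<m})"
      using ab unfolding block_index_image e by (auto simp: inj_image_mem_iff[OF inj_prod_encode])
    then have "entry (of_mat (\<lambda>i. i) (\<lambda>i. i) (T (matrix_unit s c d))) i j = 0 \<or> entry (of_mat h h (mat m m f)) x y = 0" for c d and f :: "nat \<times> nat \<Rightarrow> 'k"
    proof (cases "i < p \<and> j < q")
      case True
      assume "(i \<notin> {..<p} \<or> x \<notin> h ` {..<m}) \<or> (j \<notin> {..<q} \<or> y \<notin> h ` {..<m})"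
      with True have "x \<notin> h ` {..<m} \<or> y \<notin> h ` {..<m}" by auto
      then have "entry (of_mat h h (mat m m f)) x y = 0" by (rule entry_of_mat_outside[OF mm])
      then show ?thesis ..
    next
      case False
      then show ?thesis by (intro disjI1) (subst entry_of_mat_id[OF u], auto)
    qed
    then show ?thesis
      by (auto simp: entry_flatten e case_prod_beta field_alg1.entry_tens field_alg.entry_mscale intro!: sum.neutral)
  qed
qed

lemma of_mat_kronecker_one:
  fixes M :: "'k :: field mat"
  assumes M: "M \<in> carrier_mat p q" and h: "inj_on h {..<m}"
  shows "of_mat (block_index p h) (block_index q h) (kronecker (1\<^sub>m m) M) =
    flatten (tens (mscale (*)) (of_mat (\<lambda>i. i) (\<lambda>i. i) M) (idm (h ` {..<m}) 1))"
    (is "_ = flatten ?R")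
proof (rule finmat_eq_of_matI[symmetric])
  show "kronecker (1\<^sub>m m) M \<in> carrier_mat (m * p) (m * q)" using M by (simp add: kronecker_def)
  show "inj_on (block_index p h) {..<m * p}" "inj_on (block_index q h) {..<m * q}"
    by (rule inj_block_index[OF h])+
  show "entry (flatten ?R) (block_index p h i) (block_index q h j) = kronecker (1\<^sub>m m) M $$ (i, j)"
    if ij: "i < m * p" "j < m * q" for i j
  proof -
    have d: "i div p < m" "j div q < m" "i mod p < p" "j mod q < q"
      using ij by (auto simp: less_mult_imp_div_less) (metis mod_less_divisor mult_0_right not_gr_zero not_less0)+
    have "h (i div p) = h (j div q) \<longleftrightarrow> i div p = j div q" using h d by (auto dest: inj_onD)
    then show ?thesis
      using d ij M by (simp add: entry_flatten block_index_def field_alg1.entry_tens field_alg.entry_mscale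
          entry_of_mat_id[OF M] entry_idm kronecker_def)
  qed
  show "entry (flatten ?R) a b = 0" if ab: "a \<notin> block_index p h ` {..<m * p} \<or> b \<notin> block_index q h ` {..<m * q}" for a b
  proof -
    obtain i x j y where e: "a = prod_encode (i, x)" "b = prod_encode (j, y)" by (metis prod_decode_inverse surj_pair)
    have "(i \<notin> {..<p} \<or> x \<notin> h ` {..<m}) \<or> (j \<notin> {..<q} \<or> y \<notin> h ` {..<m})"
      using ab unfolding block_index_image e by (auto simp: inj_image_mem_iff[OF inj_prod_encode])
    then show ?thesis
      using entry_of_mat_outside[OF M, of i "\<lambda>i. i" j "\<lambda>i. i"]
      by (auto simp: entry_flatten e field_alg1.entry_tens field_alg.entry_mscale entry_idm)
  qed
qed

definition fm_arg :: "('k :: field \<Rightarrow> 'b :: ring \<Rightarrow> 'b) \<Rightarrow> 'b \<Rightarrow> ('d \<Rightarrow> 'k mat) \<Rightarrow> ('d \<Rightarrow> 'b finmat) \<Rightarrow> 'd \<times> nat \<times> nat \<Rightarrow> 'b" where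
  "fm_arg scale e Y X g = entry (X (fst g)) (fst (snd g)) (snd (snd g)) - scale (Y (fst g) $$ (snd g)) e"

definition realization_value ::
  "('k :: field \<Rightarrow> 'b :: ring \<Rightarrow> 'b) \<Rightarrow> 'b \<Rightarrow> nat \<Rightarrow> ('d :: finite \<Rightarrow> 'k mat) \<Rightarrow> ('d, 'k) fm \<Rightarrow> ('d \<Rightarrow> 'b finmat) \<Rightarrow> 'b finmat \<Rightarrow> bool" where
  "realization_value scale e s Y \<R> X v \<longleftrightarrow>
    fm_value scale e (fm_index s) {..<fm_dim \<R>} (map_entries s (fm_A \<R>)) (map_entries s (fm_B \<R>))
      (of_mat (\<lambda>i. i) (\<lambda>i. i) (fm_C \<R>)) (of_mat (\<lambda>i. i) (\<lambda>i. i) (fm_D \<R>)) (fm_arg scale e Y X) v"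

lemma sum_fm_index: "(\<Sum>g\<in>fm_index s. f g) = (\<Sum>k\<in>UNIV. \<Sum>(i, j)\<in>{..<s} \<times> {..<s}. f (k, i, j))"
  unfolding fm_index_def by (simp add: sum.cartesian_product case_prod_beta)

lemma of_mat_sum_mats:
  assumes "\<And>k. k \<in> I \<Longrightarrow> f k \<in> carrier_mat p q"
  shows "of_mat \<phi> \<psi> (sum_mats p q f I) = (\<Sum>k\<in>I. of_mat \<phi> \<psi> (f k))"
proof -
  have "of_mat \<phi> \<psi> (sum_mats p q f I) = (\<Sum>i<p. \<Sum>j<q. \<Sum>k\<in>I. single (\<phi> i) (\<psi> j) (f k $$ (i, j)))"
    unfolding of_mat_def sum_mats_def by (simp add: single_sum)
  also have "\<dots> = (\<Sum>k\<in>I. \<Sum>i<p. \<Sum>j<q. single (\<phi> i) (\<psi> j) (f k $$ (i, j)))"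
    by (simp add: sum.swap[of _ I])
  also have "\<dots> = (\<Sum>k\<in>I. of_mat \<phi> \<psi> (f k))"
    unfolding of_mat_def using assms by (intro sum.cong refl) auto
  finally show ?thesis .
qed

lemma inv_module_mat:
  fixes M :: "'a :: ring_1 mat"
  assumes M: "M \<in> carrier_mat n n" and N: "N \<in> carrier_mat n n" "M * N = 1\<^sub>m n" "N * M = 1\<^sub>m n"
  shows "inv\<^bsub>module_mat TYPE('a) n n\<^esub> M = N"
  unfolding m_inv_def
proof (rule the_equality)
  fix N' assume *: "N' \<in> carrier (module_mat TYPE('a) n n) \<and>
    M \<otimes>\<^bsub>module_mat TYPE('a) n n\<^esub> N' = \<one>\<^bsub>module_mat TYPE('a) n n\<^esub> \<and>
    N' \<otimes>\<^bsub>module_mat TYPE('a) n n\<^esub> M = \<one>\<^bsub>module_mat TYPE('a) n n\<^esub>"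
  then have N': "N' \<in> carrier_mat n n" "M * N' = 1\<^sub>m n" by (simp_all add: module_mat_def)
  have "N' = N * M * N'" using N N' by simp
  also have "\<dots> = N * (M * N')" by (rule assoc_mult_mat[OF N(1) M N'(1)])
  finally show "N' = N" using N N' by simp
qed (use N in \<open>simp add: module_mat_def\<close>)

lemma kalg_value_unique:
  assumes "kalg scale" and fin: "finite L" and ee: "e * e = e"
    and v: "fm_value scale e G L A B C D x v" "fm_value scale e G L A B C D x w"
  shows "v = w"
proof -
  let ?P = "idm L e - (\<Sum>g\<in>G. tens scale (A g) (x g))"
  obtain S T where S: "corner (idm L e) S" "?P * S = idm L e" "S * ?P = idm L e"
      "v = tens scale D e + tens scale C e * (S * (\<Sum>g\<in>G. tens scale (B g) (x g)))"
    and T: "corner (idm L e) T" "?P * T = idm L e" "T * ?P = idm L e"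
      "w = tens scale D e + tens scale C e * (T * (\<Sum>g\<in>G. tens scale (B g) (x g)))"
    using v unfolding fm_value_def by blast
  have "S = S * (?P * T)" using S(1) T(2) by (simp add: corner_def)
  also have "\<dots> = T" using S(3) T(1) by (simp add: corner_def flip: mult.assoc)
  finally show ?thesis using S(4) T(4) by simp
qed

section \<open>Domain and value of a realization at matrix points\<close>

locale fm_matrix =
  fixes s m :: nat and Y :: "'d :: finite \<Rightarrow> 'k :: field mat" and \<R> :: "('d, 'k) fm" and X :: "'d \<Rightarrow> 'k mat" and h :: "nat \<Rightarrow> nat"
  assumes real: "fm_realization s \<R>" and Y: "\<And>k. Y k \<in> carrier_mat s s"
    and X: "\<And>k. X k \<in> carrier_mat (s * m) (s * m)" and h: "inj_on h {..<m}"
begin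

abbreviation "e \<equiv> idm (h ` {..<m}) (1 :: 'k)"
abbreviation "L \<equiv> fm_dim \<R>"
abbreviation "bi d \<equiv> block_index d h"

definition Xf :: "'d \<Rightarrow> 'k finmat finmat" where
  "Xf k = unflatten (of_mat (bi s) (bi s) (X k))"

abbreviation "x \<equiv> fm_arg (mscale (*)) e Y Xf"
abbreviation "P \<equiv> idm {..<L} e - (\<Sum>g\<in>fm_index s. tens (mscale (*)) (map_entries s (fm_A \<R>) g) (x g))"

lemma dims:
  "linear_mat_map s L L (fm_A \<R> k)" "linear_mat_map s L s (fm_B \<R> k)"
  "fm_D \<R> \<in> carrier_mat s s" "fm_C \<R> \<in> carrier_mat s L"
  using real unfolding fm_realization_def by auto

lemma inj: "inj_on (bi d) {..<m * d}" "inj_on (bi d) {..<d * m}"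
  using inj_block_index[OF h, of d] by (simp_all add: mult.commute)

lemma arg_eq:
  assumes "i < s" "j < s"
  shows "x (k, i, j) = of_mat h h (mat m m (\<lambda>(\<mu>, \<nu>). (X k - kronecker (1\<^sub>m m) (Y k)) $$ (\<mu> * s + i, \<nu> * s + j)))"
proof (rule finmat_eq_of_matI)
  have lt: "\<mu> * s + i < s * m" if "i < s" "\<mu> < m" for \<mu> i
  proof -
    have "Suc \<mu> * s \<le> m * s" using that(2) by (intro mult_le_mono1) simp
    then show ?thesis using that(1) by (simp add: mult.commute)
  qed
  have en: "prod_encode (i, h \<mu>) = bi s (\<mu> * s + i)" if "i < s" for i \<mu>
    using that by (simp add: block_index_def)
  show "entry (x (k, i, j)) (h \<mu>) (h \<nu>) = mat m m (\<lambda>(\<mu>, \<nu>). (X k - kronecker (1\<^sub>m m) (Y k)) $$ (\<mu> * s + i, \<nu> * s + j)) $$ (\<mu>, \<nu>)"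
    if "\<mu> < m" "\<nu> < m" for \<mu> \<nu>
  proof -
    have "h \<mu> = h \<nu> \<longleftrightarrow> \<mu> = \<nu>" using h that by (auto dest: inj_onD)
    moreover have "entry (of_mat (bi s) (bi s) (X k)) (bi s (\<mu> * s + i)) (bi s (\<nu> * s + j)) = X k $$ (\<mu> * s + i, \<nu> * s + j)"
      by (rule entry_of_mat[OF X inj(2) inj(2)]) (use lt assms that in auto)
    ultimately show ?thesis
      using that assms lt[OF assms(1) that(1)] lt[OF assms(2) that(2)] X[of k] Y[of k]
      by (simp add: fm_arg_def Xf_def entry_unflatten en field_alg.entry_mscale entry_idm kronecker_def mult.commute)
  qed
  show "entry (x (k, i, j)) a b = 0" if ab: "a \<notin> h ` {..<m} \<or> b \<notin> h ` {..<m}" for a b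
  proof -
    have "prod_encode (i, a) \<notin> bi s ` {..<s * m} \<or> prod_encode (j, b) \<notin> bi s ` {..<s * m}"
      using ab unfolding mult.commute[of s m] block_index_image by (auto simp: inj_image_mem_iff[OF inj_prod_encode])
    then have "entry (of_mat (bi s) (bi s) (X k)) (prod_encode (i, a)) (prod_encode (j, b)) = 0"
      by (rule entry_of_mat_outside[OF X])
    then show ?thesis
      using ab by (auto simp: fm_arg_def Xf_def entry_unflatten field_alg.entry_mscale entry_idm)
  qed
qed (use h in simp_all)

lemma linear_part:
  assumes F: "\<And>k. linear_mat_map s p q (F k)"
  shows "of_mat (bi p) (bi q) (sum_mats (p * m) (q * m) (\<lambda>k. ext_block s p q (F k) m (X k - kronecker (1\<^sub>m m) (Y k))) UNIV) =
    flatten (\<Sum>g\<in>fm_index s. tens (mscale (*)) (map_entries s F g) (x g))"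
proof -
  have "of_mat (bi p) (bi q) (sum_mats (p * m) (q * m) (\<lambda>k. ext_block s p q (F k) m (X k - kronecker (1\<^sub>m m) (Y k))) UNIV) =
      (\<Sum>k\<in>UNIV. of_mat (bi p) (bi q) (ext_block s p q (F k) m (X k - kronecker (1\<^sub>m m) (Y k))))"
    by (rule of_mat_sum_mats) (simp add: ext_block_def mult.commute)
  also have "\<dots> = (\<Sum>k\<in>UNIV. flatten (\<Sum>(i, j)\<in>{..<s} \<times> {..<s}. tens (mscale (*)) (map_entries s F (k, i, j)) (x (k, i, j))))"
    unfolding of_mat_ext_block[OF F h]
    by (intro sum.cong refl arg_cong[of _ _ flatten]) (auto simp: map_entries_def arg_eq)
  also have "\<dots> = flatten (\<Sum>g\<in>fm_index s. tens (mscale (*)) (map_entries s F g) (x g))"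
    unfolding sum_fm_index by (simp add: ring_map_sum[OF ring_map_flatten])
  finally show ?thesis .
qed

lemma pencil_carrier: "fm_pencil s Y \<R> m X \<in> carrier_mat (L * m) (L * m)"
  unfolding fm_pencil_def Let_def by (rule minus_carrier_mat) (simp add: sum_mats_def)

lemma pencil_eq: "of_mat (bi L) (bi L) (fm_pencil s Y \<R> m X) = flatten P"
proof -
  have "bi L ` {..<L * m} = prod_encode ` ({..<L} \<times> h ` {..<m})"
    using block_index_image[of L h m] by (simp add: mult.commute)
  then have one: "of_mat (bi L) (bi L) (1\<^sub>m (L * m)) = flatten (idm {..<L} e)"
    by (simp add: of_mat_one[OF inj(2)] flatten_idm)
  have "of_mat (bi L) (bi L) (fm_pencil s Y \<R> m X) = of_mat (bi L) (bi L) (1\<^sub>m (L * m)) -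
      of_mat (bi L) (bi L) (sum_mats (L * m) (L * m) (\<lambda>k. ext_block s L L (fm_A \<R> k) m (X k - kronecker (1\<^sub>m m) (Y k))) UNIV)"
    unfolding fm_pencil_def Let_def by (rule of_mat_diff[of _ "L * m" "L * m"]) (simp_all add: sum_mats_def)
  then show ?thesis
    unfolding one linear_part[OF dims(1)] by (simp add: ring_map_diff[OF ring_map_flatten])
qed

lemma eval_eq:
  assumes N: "N \<in> carrier_mat (L * m) (L * m)" "fm_pencil s Y \<R> m X * N = 1\<^sub>m (L * m)" "N * fm_pencil s Y \<R> m X = 1\<^sub>m (L * m)"
  shows "realization_value (mscale (*)) e s Y \<R> Xf (unflatten (of_mat (bi s) (bi s) (fm_eval s Y \<R> m X)))"
    "fm_eval s Y \<R> m X \<in> carrier_mat (s * m) (s * m)"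
proof -
  have "bi L ` {..<L * m} = prod_encode ` ({..<L} \<times> h ` {..<m})"
    using block_index_image[of L h m] by (simp add: mult.commute)
  then have one: "of_mat (bi L) (bi L) (1\<^sub>m (L * m)) = flatten (idm {..<L} e)"
    by (simp add: of_mat_one[OF inj(2)] flatten_idm)
  have inv: "inv\<^bsub>matrix_algebra (L * m)\<^esub> (fm_pencil s Y \<R> m X) = N"
    by (rule inv_module_mat[OF pencil_carrier N])
  let ?b = "sum_mats (L * m) (s * m) (\<lambda>k. ext_block s L s (fm_B \<R> k) m (X k - kronecker (1\<^sub>m m) (Y k))) UNIV"
  let ?C = "kronecker (1\<^sub>m m) (fm_C \<R>)" and ?D = "kronecker (1\<^sub>m m) (fm_D \<R>)"
  have c: "?b \<in> carrier_mat (L * m) (s * m)" "?C \<in> carrier_mat (s * m) (L * m)" "?D \<in> carrier_mat (s * m) (s * m)"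
    using dims(3,4) by (simp_all add: sum_mats_def kronecker_def mult.commute)
  have ev: "fm_eval s Y \<R> m X = ?D + ?C * N * ?b" unfolding fm_eval_def Let_def inv ..
  show "fm_eval s Y \<R> m X \<in> carrier_mat (s * m) (s * m)" unfolding ev using c N by auto
  define S where "S = unflatten (of_mat (bi L) (bi L) N)"
  have fS: "flatten S = of_mat (bi L) (bi L) N" by (simp add: S_def)
  note fm = ring_map_mult[OF ring_map_flatten]
  have "flatten (P * S) = flatten (idm {..<L} e)" "flatten (S * P) = flatten (idm {..<L} e)"
    unfolding fm fS pencil_eq[symmetric] of_mat_mult[OF pencil_carrier N(1) inj(2)] of_mat_mult[OF N(1) pencil_carrier inj(2)] N(2,3)
    by (rule one)+
  then have PS: "P * S = idm {..<L} e" "S * P = idm {..<L} e" by (simp_all only: flatten_inject)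
  have "flatten (idm {..<L} e * S) = flatten S" "flatten (S * idm {..<L} e) = flatten S"
    unfolding fm fS one[symmetric] of_mat_mult[OF one_carrier_mat N(1) inj(2)] of_mat_mult[OF N(1) one_carrier_mat inj(2)]
    using N(1) by simp_all
  then have Sc: "corner (idm {..<L} e) S" by (simp only: flatten_inject corner_def)
  let ?T = "tens (mscale (*)) (of_mat (\<lambda>i. i) (\<lambda>i. i) (fm_D \<R>)) e +
      tens (mscale (*)) (of_mat (\<lambda>i. i) (\<lambda>i. i) (fm_C \<R>)) e *
        (S * (\<Sum>g\<in>fm_index s. tens (mscale (*)) (map_entries s (fm_B \<R>) g) (x g)))"
  have "of_mat (bi s) (bi s) (?D + ?C * N * ?b) = of_mat (bi s) (bi s) ?D + of_mat (bi s) (bi s) (?C * N * ?b)"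
    by (rule of_mat_add[OF c(3) mult_carrier_mat[OF mult_carrier_mat[OF c(2) N(1)] c(1)]])
  also have "of_mat (bi s) (bi s) (?C * N * ?b) = of_mat (bi s) (bi L) (?C * N) * of_mat (bi L) (bi s) ?b"
    by (rule of_mat_mult[OF mult_carrier_mat[OF c(2) N(1)] c(1) inj(2), symmetric])
  also have "of_mat (bi s) (bi L) (?C * N) = of_mat (bi s) (bi L) ?C * of_mat (bi L) (bi L) N"
    by (rule of_mat_mult[OF c(2) N(1) inj(2), symmetric])
  also have "of_mat (bi s) (bi s) ?D = flatten (tens (mscale (*)) (of_mat (\<lambda>i. i) (\<lambda>i. i) (fm_D \<R>)) e)"
    by (rule of_mat_kronecker_one[OF dims(3) h])
  also have "of_mat (bi s) (bi L) ?C = flatten (tens (mscale (*)) (of_mat (\<lambda>i. i) (\<lambda>i. i) (fm_C \<R>)) e)"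
    by (rule of_mat_kronecker_one[OF dims(4) h])
  also have "of_mat (bi L) (bi s) ?b = flatten (\<Sum>g\<in>fm_index s. tens (mscale (*)) (map_entries s (fm_B \<R>) g) (x g))"
    by (rule linear_part[OF dims(2)])
  also have "of_mat (bi L) (bi L) N = flatten S" by (rule fS[symmetric])
  also have "flatten (tens (mscale (*)) (of_mat (\<lambda>i. i) (\<lambda>i. i) (fm_D \<R>)) e) +
      flatten (tens (mscale (*)) (of_mat (\<lambda>i. i) (\<lambda>i. i) (fm_C \<R>)) e) * flatten S *
        flatten (\<Sum>g\<in>fm_index s. tens (mscale (*)) (map_entries s (fm_B \<R>) g) (x g)) = flatten ?T"
    by (simp only: fm ring_map_add[OF ring_map_flatten] mult.assoc)
  finally have "unflatten (of_mat (bi s) (bi s) (fm_eval s Y \<R> m X)) = ?T"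
    unfolding ev by simp
  then show "realization_value (mscale (*)) e s Y \<R> Xf (unflatten (of_mat (bi s) (bi s) (fm_eval s Y \<R> m X)))"
    unfolding realization_value_def fm_value_def using Sc PS by blast
qed

lemma value_of_DOM:
  assumes "X \<in> fm_DOM s Y \<R> m"
  shows "realization_value (mscale (*)) e s Y \<R> Xf (unflatten (of_mat (bi s) (bi s) (fm_eval s Y \<R> m X)))"
    "fm_eval s Y \<R> m X \<in> carrier_mat (s * m) (s * m)"
proof -
  have "det (fm_pencil s Y \<R> m X) \<noteq> 0" using assms by (simp add: fm_DOM_def)
  from det_non_zero_imp_unit[OF pencil_carrier this]
  obtain N where "N \<in> carrier_mat (L * m) (L * m)" "fm_pencil s Y \<R> m X * N = 1\<^sub>m (L * m)" "N * fm_pencil s Y \<R> m X = 1\<^sub>m (L * m)"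
    unfolding Units_def ring_mat_def by auto
  from eval_eq[OF this] show "realization_value (mscale (*)) e s Y \<R> Xf (unflatten (of_mat (bi s) (bi s) (fm_eval s Y \<R> m X)))"
    "fm_eval s Y \<R> m X \<in> carrier_mat (s * m) (s * m)" .
qed

lemma DOM_of_value:
  assumes v: "realization_value (mscale (*)) e s Y \<R> Xf v"
  shows "X \<in> fm_DOM s Y \<R> m" "flatten v = of_mat (bi s) (bi s) (fm_eval s Y \<R> m X)"
proof -
  obtain S where S: "corner (idm {..<L} e) S" "P * S = idm {..<L} e" "S * P = idm {..<L} e"
    using v unfolding realization_value_def fm_value_def by blast
  have im: "bi L ` {..<L * m} = prod_encode ` ({..<L} \<times> h ` {..<m})"
    using block_index_image[of L h m] by (simp add: mult.commute)
  then have one: "of_mat (bi L) (bi L) (1\<^sub>m (L * m)) = flatten (idm {..<L} e)"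
    by (simp add: of_mat_one[OF inj(2)] flatten_idm)
  define N where "N = to_mat (L * m) (L * m) (bi L) (bi L) (flatten S)"
  have N: "N \<in> carrier_mat (L * m) (L * m)" by (simp add: N_def)
  have "corner (idm (prod_encode ` ({..<L} \<times> h ` {..<m})) 1) (flatten S)"
    using ring_map_corner[OF ring_map_flatten S(1)] by (simp add: flatten_idm)
  then have "entry (flatten S) a b = 0" if "a \<notin> bi L ` {..<L * m} \<or> b \<notin> bi L ` {..<L * m}" for a b
    using that unfolding im by (subst (asm) corner_idm_iff) auto
  then have fN: "of_mat (bi L) (bi L) N = flatten S"
    unfolding N_def by (rule of_mat_to_mat[OF inj(2) inj(2)])
  have "of_mat (bi L) (bi L) (fm_pencil s Y \<R> m X * N) = of_mat (bi L) (bi L) (1\<^sub>m (L * m))"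
    using of_mat_mult[OF pencil_carrier N inj(2), of "bi L" "bi L"] S(2)
    unfolding pencil_eq fN one ring_map_mult[OF ring_map_flatten, symmetric] by simp
  then have 1: "fm_pencil s Y \<R> m X * N = 1\<^sub>m (L * m)"
    using of_mat_inject[OF mult_carrier_mat[OF pencil_carrier N] one_carrier_mat inj(2) inj(2)] by simp
  then have 2: "N * fm_pencil s Y \<R> m X = 1\<^sub>m (L * m)"
    by (rule mat_mult_left_right_inverse[OF pencil_carrier N])
  have "det (fm_pencil s Y \<R> m X) * det N = 1"
    using det_mult[OF pencil_carrier N] 1 by simp
  then have "det (fm_pencil s Y \<R> m X) \<noteq> 0" by auto
  then show "X \<in> fm_DOM s Y \<R> m" using X by (simp add: fm_DOM_def)
  have "v = unflatten (of_mat (bi s) (bi s) (fm_eval s Y \<R> m X))"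
    using kalg_value_unique[OF field_alg1.kalg_axioms _ _ v[unfolded realization_value_def] eval_eq(1)[OF N 1 2, unfolded realization_value_def]]
    by (simp add: idm_mult)
  then show "flatten v = of_mat (bi s) (bi s) (fm_eval s Y \<R> m X)" by simp
qed

end

section \<open>Minimal realizations\<close>

text \<open>Restriction to the invariant subspace spanned by the columns of \<open>v\<close>, which
  contains the columns of every \<open>B g\<close>. The compressed inverse \<open>U S V\<close> is
  first a left inverse of the restricted pencil; finiteness makes it two-sided.\<close>

lemma (in kalg) fm_value_right:
  fixes L :: "nat set" and r :: nat
  assumes L: "finite L" and e: "sfin_all e" and x: "\<And>g. g \<in> G \<Longrightarrow> corner e (x g)"
    and v: "idm L 1 * v = v" "v * idm {..<r} 1 = v" and u: "idm {..<r} 1 * u = u" "u * idm L 1 = u"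
    and uv: "u * v = idm {..<r} 1"
    and a: "\<And>g. g \<in> G \<Longrightarrow> A g * v = v * a g" "\<And>g. g \<in> G \<Longrightarrow> corner (idm {..<r} 1) (a g)"
    and b: "\<And>g. g \<in> G \<Longrightarrow> B g = v * b g"
    and w: "fm_value scale e G L A B C D x w"
  shows "fm_value scale e G {..<r} a b (C * v) D x w"
proof -
  let ?P = "idm L e - (\<Sum>g\<in>G. tens scale (A g) (x g))" and ?p = "idm {..<r} e - (\<Sum>g\<in>G. tens scale (a g) (x g))"
  have ee: "e * e = e" by (rule sfin_all_idem[OF e])
  define V U where "V = tens scale v e" and "U = tens scale u e"
  have I: "idm L e = tens scale (idm L 1) e" "idm {..<r} e = tens scale (idm {..<r} 1) e"
    using L by (simp_all add: tens_idm)
  have VU: "idm L e * V = V" "V * idm {..<r} e = V" "idm {..<r} e * U = U" "U * idm L e = U" "U * V = idm {..<r} e"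
    unfolding I V_def U_def tens_mult by (simp_all add: ee v u uv)
  obtain S where S: "corner (idm L e) S" "?P * S = idm L e" "S * ?P = idm L e"
      and wS: "w = tens scale D e + tens scale C e * (S * (\<Sum>g\<in>G. tens scale (B g) (x g)))"
    using w unfolding fm_value_def by blast
  have "(\<Sum>g\<in>G. tens scale (A g) (x g)) * V = V * (\<Sum>g\<in>G. tens scale (a g) (x g))"
    unfolding V_def sum_distrib_left sum_distrib_right tens_mult
    by (rule sum.cong) (use x a in \<open>auto simp: corner_def\<close>)
  then have PV: "?P * V = V * ?p" by (simp add: left_diff_distrib right_diff_distrib VU)
  define T where "T = U * (S * V)"
  have cT: "corner (idm {..<r} e) T"
    unfolding corner_def T_def by (simp only: mult.assoc VU(2) assoc_left[OF VU(3)] simp_thms)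
  have cp: "corner (idm {..<r} e) ?p"
    by (intro corner_diff corner_sum corner_self)
      (use x a(2) ee in \<open>auto simp: I tens_mult corner_def idm_mult\<close>)
  have Tp: "T * ?p = idm {..<r} e"
    unfolding T_def by (simp only: mult.assoc PV[symmetric] assoc_left[OF S(3)] VU)
  have pT: "?p * T = idm {..<r} e"
    by (rule sfinD[OF sfin_allD[OF e] cT cp Tp]) simp
  have "S * V = S * V * (?p * T)" unfolding pT by (simp only: mult.assoc VU)
  also have "\<dots> = S * ?P * (V * T)" by (simp only: mult.assoc assoc_left[OF PV[symmetric]])
  finally have SV: "S * V = V * T" unfolding S(3) by (simp only: assoc_left[OF VU(1)])
  have "(\<Sum>g\<in>G. tens scale (B g) (x g)) = V * (\<Sum>g\<in>G. tens scale (b g) (x g))"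
    unfolding V_def sum_distrib_left tens_mult
    by (rule sum.cong) (use x b in \<open>auto simp: corner_def\<close>)
  then have "tens scale C e * (S * (\<Sum>g\<in>G. tens scale (B g) (x g))) = tens scale C e * (V * (T * (\<Sum>g\<in>G. tens scale (b g) (x g))))"
    by (simp only: assoc_left[OF SV] mult.assoc)
  also have "\<dots> = tens scale (C * v) e * (T * (\<Sum>g\<in>G. tens scale (b g) (x g)))"
    unfolding V_def by (simp add: tens_mult ee flip: mult.assoc)
  finally show ?thesis unfolding fm_value_def using cT Tp pT wS by auto
qed

text \<open>The dual passage to the quotient by the kernel of \<open>v\<close>, which the
  \<open>A g\<close> preserve and on which \<open>C\<close> vanishes. Here \<open>V S U\<close> is
  first a right inverse.\<close>

lemma (in kalg) fm_value_left:
  fixes L :: "nat set" and r :: nat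
  assumes L: "finite L" and e: "sfin_all e" and x: "\<And>g. g \<in> G \<Longrightarrow> corner e (x g)"
    and v: "idm {..<r} 1 * v = v" "v * idm L 1 = v" and u: "idm L 1 * u = u" "u * idm {..<r} 1 = u"
    and vu: "v * u = idm {..<r} 1"
    and a: "\<And>g. g \<in> G \<Longrightarrow> v * A g = a g * v" "\<And>g. g \<in> G \<Longrightarrow> corner (idm {..<r} 1) (a g)"
    and c: "C = c * v"
    and w: "fm_value scale e G L A B C D x w"
  shows "fm_value scale e G {..<r} a (\<lambda>g. v * B g) c D x w"
proof -
  let ?P = "idm L e - (\<Sum>g\<in>G. tens scale (A g) (x g))" and ?p = "idm {..<r} e - (\<Sum>g\<in>G. tens scale (a g) (x g))"
  have ee: "e * e = e" by (rule sfin_all_idem[OF e])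
  define V U where "V = tens scale v e" and "U = tens scale u e"
  have I: "idm L e = tens scale (idm L 1) e" "idm {..<r} e = tens scale (idm {..<r} 1) e"
    using L by (simp_all add: tens_idm)
  have VU: "idm {..<r} e * V = V" "V * idm L e = V" "idm L e * U = U" "U * idm {..<r} e = U" "V * U = idm {..<r} e"
    unfolding I V_def U_def tens_mult by (simp_all add: ee v u vu)
  obtain S where S: "corner (idm L e) S" "?P * S = idm L e" "S * ?P = idm L e"
      and wS: "w = tens scale D e + tens scale C e * (S * (\<Sum>g\<in>G. tens scale (B g) (x g)))"
    using w unfolding fm_value_def by blast
  have "V * (\<Sum>g\<in>G. tens scale (A g) (x g)) = (\<Sum>g\<in>G. tens scale (a g) (x g)) * V"
    unfolding V_def sum_distrib_left sum_distrib_right tens_mult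
    by (rule sum.cong) (use x a in \<open>auto simp: corner_def\<close>)
  then have PV: "V * ?P = ?p * V" by (simp add: left_diff_distrib right_diff_distrib VU)
  define T where "T = V * (S * U)"
  have cT: "corner (idm {..<r} e) T"
    unfolding corner_def T_def by (simp only: mult.assoc VU(4) assoc_left[OF VU(1)] simp_thms)
  have cp: "corner (idm {..<r} e) ?p"
    by (intro corner_diff corner_sum corner_self)
      (use x a(2) ee in \<open>auto simp: I tens_mult corner_def idm_mult\<close>)
  have pT: "?p * T = idm {..<r} e"
    unfolding T_def by (simp only: assoc_left[OF PV[symmetric]] mult.assoc assoc_left[OF S(2)] VU)
  have Tp: "T * ?p = idm {..<r} e"
    by (rule sfinD[OF sfin_allD[OF e] cp cT pT]) simp
  have "V * S = T * ?p * (V * S)" unfolding Tp by (simp only: assoc_left[OF VU(1)])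
  also have "\<dots> = T * (V * (?P * S))" by (simp only: mult.assoc assoc_left[OF PV[symmetric]])
  finally have SV: "V * S = T * V" unfolding S(2) by (simp only: VU)
  have bx: "V * (\<Sum>g\<in>G. tens scale (B g) (x g)) = (\<Sum>g\<in>G. tens scale (v * B g) (x g))"
    unfolding V_def sum_distrib_left tens_mult
    by (rule sum.cong) (use x in \<open>auto simp: corner_def\<close>)
  have CV: "tens scale C e = tens scale c e * V" unfolding V_def c tens_mult ee ..
  have "tens scale C e * (S * (\<Sum>g\<in>G. tens scale (B g) (x g))) = tens scale c e * (T * (V * (\<Sum>g\<in>G. tens scale (B g) (x g))))"
    unfolding CV by (simp only: mult.assoc assoc_left[OF SV])
  then show ?thesis unfolding fm_value_def bx using cT Tp pT wS by auto
qed

text \<open>\<open>nc_realizes\<close> is \<^const>\<open>realizes\<close>, expressed by finitely supported matrices with \<open>s\<close> outer and \<open>card J\<close> inner indices.\<close>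

definition nc_realizes :: "nat \<Rightarrow> ('d :: finite \<Rightarrow> 'k :: field mat) \<Rightarrow> ('d, 'k) fm \<Rightarrow> ('d, 'k) nc_expr \<Rightarrow> bool" where
  "nc_realizes s Y \<R> R \<longleftrightarrow> (\<forall>J X v. finite J \<longrightarrow> J \<noteq> {} \<longrightarrow>
    EV (mscale (mscale (*))) (idm {..<s} (idm J 1)) X R v \<longrightarrow> realization_value (mscale (*)) (idm J 1) s Y \<R> X v)"

lemma (in kalg) flatten_mscale: "flatten (mscale (mscale scale) c y) = mscale scale c (flatten y)"
proof -
  interpret m: kalg "mscale scale" by (rule kalg_mscale)
  show ?thesis by (rule finmat_eqI) (simp add: entry_flatten entry_mscale m.entry_mscale)
qed

lemma unflatten_mscale: "unflatten (mscale (*) c x) = mscale (mscale (*)) (c :: 'k :: field) (unflatten x)"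
  by (subst flatten_inject[symmetric]) (simp add: field_alg.flatten_mscale)

lemma realizesI:
  fixes Y :: "'d :: finite \<Rightarrow> 'k :: field mat"
  assumes real: "fm_realization s \<R>" and Y: "\<And>k. Y k \<in> carrier_mat s s" and R: "nc_realizes s Y \<R> R"
  shows "realizes s Y \<R> R"
proof -
  have "X \<in> fm_DOM s Y \<R> m \<and> expr_eval (matrix_algebra (s * m)) R X = fm_eval s Y \<R> m X"
    if m: "m \<ge> 1" and XD: "X \<in> expr_dom (matrix_algebra (s * m)) R" for m X
  proof -
    let ?b = "block_index s id"
    have binj: "inj_on ?b {..<s * m}" using inj_block_index[of id m s] by (simp add: mult.commute)
    note emb = alg_embedding_mat[OF binj]
    have Xc: "X k \<in> carrier_mat (s * m) (s * m)" for k
      using alg_embedding.expr_dom_carrier[OF emb XD] by (simp add: module_mat_def)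
    interpret fm_matrix s m Y \<R> X id by unfold_locales (use real Y Xc in auto)
    note E = alg_embedding.EV_of_dom[OF emb XD]
    have im: "?b ` {..<s * m} = prod_encode ` ({..<s} \<times> {..<m})"
      using block_index_image[of s id m] by (simp add: mult.commute)
    have "unflatten (idm (?b ` {..<s * m}) 1) = idm {..<s} (idm {..<m} (1 :: 'k))"
      unfolding im by (simp flip: flatten_idm)
    then have EV: "EV (mscale (mscale (*))) (idm {..<s} (idm {..<m} 1)) Xf R (unflatten (of_mat ?b ?b (expr_eval (matrix_algebra (s * m)) R X)))"
      using EV_hom[OF ring_map_unflatten unflatten_mscale conjunct2[OF E]] by (simp add: Xf_def[abs_def])
    have v: "realization_value (mscale (*)) e s Y \<R> Xf (unflatten (of_mat ?b ?b (expr_eval (matrix_algebra (s * m)) R X)))"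
      using R[unfolded nc_realizes_def, rule_format, OF finite_lessThan _ EV] m by (simp add: lessThan_empty_iff)
    from DOM_of_value[OF v] have *: "X \<in> fm_DOM s Y \<R> m"
      "of_mat ?b ?b (expr_eval (matrix_algebra (s * m)) R X) = of_mat ?b ?b (fm_eval s Y \<R> m X)" by simp_all
    have "expr_eval (matrix_algebra (s * m)) R X = fm_eval s Y \<R> m X"
      using *(2) conjunct1[OF E] value_of_DOM(2)[OF *(1)]
      by (simp add: module_mat_def of_mat_inject[OF _ _ binj binj])
    with *(1) show ?thesis ..
  qed
  then show ?thesis unfolding realizes_def using real by blast
qed

text \<open>An index set \<open>J\<close> is numbered by a bijection with an initial segment, so
  that the point becomes a tuple of matrices of size \<open>s\<close> times \<open>card J\<close>,
  as the definition of a realization requires.\<close>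

lemma realizesD:
  fixes Y :: "'d :: finite \<Rightarrow> 'k :: field mat"
  assumes R: "realizes s Y \<R> R" and Y: "\<And>k. Y k \<in> carrier_mat s s"
  shows "nc_realizes s Y \<R> R"
  unfolding nc_realizes_def
proof (intro allI impI)
  fix J :: "nat set" and X v
  assume J: "finite J" "J \<noteq> {}" and v: "EV (mscale (mscale (*))) (idm {..<s} (idm J 1)) X R v"
  define m where "m = card J"
  obtain h where h: "bij_betw h {..<m} J"
    using J(1) ex_bij_betw_nat_finite unfolding m_def by (metis atLeast0LessThan)
  then have hJ: "h ` {..<m} = J" "inj_on h {..<m}" by (auto simp: bij_betw_def)
  have m: "m \<ge> 1" using J by (simp add: m_def Suc_leI card_gt_0_iff)
  let ?b = "block_index s h"
  have binj: "inj_on ?b {..<s * m}" using inj_block_index[OF hJ(2), of s] by (simp add: mult.commute)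
  have im: "?b ` {..<s * m} = prod_encode ` ({..<s} \<times> J)"
    using block_index_image[of s h m] hJ by (simp add: mult.commute)
  note emb = alg_embedding_mat[OF binj]
  define X' where "X' k = to_mat (s * m) (s * m) ?b ?b (flatten (X k))" for k
  have fv: "EV (mscale (*)) (idm (?b ` {..<s * m}) 1) (\<lambda>k. flatten (X k)) R (flatten v)"
    using EV_hom[OF ring_map_flatten field_alg.flatten_mscale v] J(1) by (simp add: flatten_idm im)
  have "corner (idm (?b ` {..<s * m}) 1) (flatten (X k))" for k by (rule field_alg1.EV_arg_corner[OF fv])
  then have X': "of_mat ?b ?b (X' k) = flatten (X k)" for k
    unfolding X'_def by (intro of_mat_to_mat binj) (auto simp: corner_idm_iff)
  have car: "X' k \<in> carrier (matrix_algebra (s * m))" for k by (simp add: X'_def module_mat_def)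
  have fv': "EV (mscale (*)) (idm (?b ` {..<s * m}) 1) (\<lambda>k. of_mat ?b ?b (X' k)) R (flatten v)"
    using fv by (simp only: X')
  have E: "X' \<in> expr_dom (matrix_algebra (s * m)) R" "flatten v = of_mat ?b ?b (expr_eval (matrix_algebra (s * m)) R X')"
    using alg_embedding.dom_of_EV[OF emb car fv'] by simp_all
  then have D: "X' \<in> fm_DOM s Y \<R> m" "expr_eval (matrix_algebra (s * m)) R X' = fm_eval s Y \<R> m X'"
    using R m unfolding realizes_def by auto
  interpret fm_matrix s m Y \<R> X' h
    by (rule fm_matrix.intro[OF conjunct1[OF R[unfolded realizes_def]] Y _ hJ(2)]) (simp add: X'_def)
  have "Xf = X" by (rule ext) (simp add: Xf_def X')
  then show "realization_value (mscale (*)) (idm J 1) s Y \<R> X v"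
    using value_of_DOM(1)[OF D(1)] by (simp add: hJ(1) flip: D(2) E(2))
qed

lemma fm_arg_corner:
  assumes "kalg scale" "e * e = e" and X: "corner (idm {..<s} e) (X (fst g))" and g: "g \<in> fm_index s"
  shows "corner e (fm_arg scale e Y X g)"
proof -
  interpret kalg scale by fact
  have "corner e (entry (X (fst g)) (fst (snd g)) (snd (snd g)))"
    using X g by (auto simp: corner_idm_iff fm_index_def)
  then show ?thesis unfolding fm_arg_def
    by (intro corner_diff corner_scale corner_self assms)
qed

lemma linear_mat_map_compose:
  assumes T: "linear_mat_map s p q T"
  shows "linear_mat_map s p' q' (\<lambda>M. to_mat p' q' (\<lambda>i. i) (\<lambda>i. i) (u * of_mat (\<lambda>i. i) (\<lambda>i. i) (T M) * v))"
proof -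
  have T': "T M \<in> carrier_mat p q" if "M \<in> carrier_mat s s" for M by (rule linear_mat_map_carrier[OF T that])
  have sm: "of_mat \<phi> \<psi> (c \<cdot>\<^sub>m M) = mscale (*) c (of_mat \<phi> \<psi> M)" if "M \<in> carrier_mat p q" for c \<phi> \<psi> and M :: "'a mat"
    by (rule finmat_eqI)
      (use that in \<open>auto simp: of_mat_def entry_sum field_alg.entry_mscale entry_single sum_distrib_left intro!: sum.cong\<close>)
  show ?thesis unfolding linear_mat_map_def
  proof (intro conjI ballI allI)
    fix M N :: "'a mat" assume MN: "M \<in> carrier_mat s s" "N \<in> carrier_mat s s"
    have "T (M + N) = T M + T N" using T MN by (simp add: linear_mat_map_def)
    then show "to_mat p' q' (\<lambda>i. i) (\<lambda>i. i) (u * of_mat (\<lambda>i. i) (\<lambda>i. i) (T (M + N)) * v) =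
      to_mat p' q' (\<lambda>i. i) (\<lambda>i. i) (u * of_mat (\<lambda>i. i) (\<lambda>i. i) (T M) * v) +
      to_mat p' q' (\<lambda>i. i) (\<lambda>i. i) (u * of_mat (\<lambda>i. i) (\<lambda>i. i) (T N) * v)"
      using MN by (intro eq_matI) (auto simp: to_mat_def of_mat_add[OF T' T'] distrib_left distrib_right)
  next
    fix c and M :: "'a mat" assume M: "M \<in> carrier_mat s s"
    have "T (c \<cdot>\<^sub>m M) = c \<cdot>\<^sub>m T M" using T M by (simp add: linear_mat_map_def)
    then show "to_mat p' q' (\<lambda>i. i) (\<lambda>i. i) (u * of_mat (\<lambda>i. i) (\<lambda>i. i) (T (c \<cdot>\<^sub>m M)) * v) =
      c \<cdot>\<^sub>m to_mat p' q' (\<lambda>i. i) (\<lambda>i. i) (u * of_mat (\<lambda>i. i) (\<lambda>i. i) (T M) * v)"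
      using M by (intro eq_matI)
        (auto simp: to_mat_def sm[OF T'] field_alg1.scale_mult_left field_alg1.scale_mult_right field_alg.entry_mscale)
  qed auto
qed

lemma of_mat_id_left: "M \<in> carrier_mat p q \<Longrightarrow> idm {..<p} 1 * of_mat (\<lambda>i. i) (\<lambda>i. i) M = of_mat (\<lambda>i. i) (\<lambda>i. i) (M :: 'k :: field mat)"
  by (rule idm_mult_iff[THEN iffD2]) (use entry_of_mat_outside[of M p q _ "\<lambda>i. i" _ "\<lambda>i. i"] in auto)

lemma of_mat_id_right: "M \<in> carrier_mat p q \<Longrightarrow> of_mat (\<lambda>i. i) (\<lambda>i. i) M * idm {..<q} 1 = of_mat (\<lambda>i. i) (\<lambda>i. i) (M :: 'k :: field mat)"
  by (rule mult_idm_iff[THEN iffD2]) (use entry_of_mat_outside[of M p q _ "\<lambda>i. i" _ "\<lambda>i. i"] in auto)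

lemma of_mat_to_mat_id:
  fixes F :: "'k :: field finmat"
  assumes "idm {..<p} 1 * F = F" "F * idm {..<q} 1 = F"
  shows "of_mat (\<lambda>i. i) (\<lambda>i. i) (to_mat p q (\<lambda>i. i) (\<lambda>i. i) F) = F"
  by (rule of_mat_to_mat) (use assms in \<open>auto simp: idm_mult_iff mult_idm_iff\<close>)

text \<open>Compressing a realization to an invariant subspace of its state space, or to the quotient by one.\<close>

definition compress :: "nat \<Rightarrow> ('d, 'k :: field) fm \<Rightarrow> nat \<Rightarrow> 'k finmat \<Rightarrow> 'k finmat \<Rightarrow> ('d, 'k) fm" where
  "compress s \<R> r u v = \<lparr>fm_dim = r, fm_D = fm_D \<R>,
     fm_C = to_mat s r (\<lambda>i. i) (\<lambda>i. i) (of_mat (\<lambda>i. i) (\<lambda>i. i) (fm_C \<R>) * v),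
     fm_A = (\<lambda>k M. to_mat r r (\<lambda>i. i) (\<lambda>i. i) (u * of_mat (\<lambda>i. i) (\<lambda>i. i) (fm_A \<R> k M) * v)),
     fm_B = (\<lambda>k M. to_mat r s (\<lambda>i. i) (\<lambda>i. i) (u * of_mat (\<lambda>i. i) (\<lambda>i. i) (fm_B \<R> k M) * idm {..<s} 1))\<rparr>"

lemma compress_realization: "fm_realization s \<R> \<Longrightarrow> fm_realization s (compress s \<R> r u v)"
  unfolding fm_realization_def compress_def by (auto intro: linear_mat_map_compose)

lemma map_entries_side:
  assumes "\<And>k. linear_mat_map s p q (F k)"
  shows "idm {..<p} 1 * map_entries s F g = map_entries s F g" "map_entries s F g * idm {..<q} 1 = map_entries s F g"
  unfolding map_entries_def
  by (rule of_mat_id_left[OF linear_mat_map_carrier[OF assms matrix_unit_carrier]],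
    rule of_mat_id_right[OF linear_mat_map_carrier[OF assms matrix_unit_carrier]])

lemma compress_entries:
  assumes real: "fm_realization s \<R>" and u: "idm {..<r} 1 * u = u" and v: "v * idm {..<r} 1 = v"
  shows "map_entries s (fm_A (compress s \<R> r u v)) g = u * map_entries s (fm_A \<R>) g * v"
    "map_entries s (fm_B (compress s \<R> r u v)) g = u * map_entries s (fm_B \<R>) g"
    "of_mat (\<lambda>i. i) (\<lambda>i. i) (fm_C (compress s \<R> r u v)) = of_mat (\<lambda>i. i) (\<lambda>i. i) (fm_C \<R>) * v"
proof -
  have l: "linear_mat_map s (fm_dim \<R>) s (fm_B \<R> k)" "fm_C \<R> \<in> carrier_mat s (fm_dim \<R>)" for k
    using real unfolding fm_realization_def by auto
  show "map_entries s (fm_A (compress s \<R> r u v)) g = u * map_entries s (fm_A \<R>) g * v"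
    unfolding map_entries_def compress_def fm.simps
    by (rule of_mat_to_mat_id) (simp_all only: mult.assoc assoc_left[OF u] v)
  show "map_entries s (fm_B (compress s \<R> r u v)) g = u * map_entries s (fm_B \<R>) g"
  proof -
    let ?M = "u * map_entries s (fm_B \<R>) g"
    have eq: "?M * idm {..<s} 1 = ?M" by (simp only: mult.assoc map_entries_side(2)[OF l(1)])
    have "of_mat (\<lambda>i. i) (\<lambda>i. i) (to_mat r s (\<lambda>i. i) (\<lambda>i. i) ?M) = ?M"
      by (rule of_mat_to_mat_id[OF _ eq]) (simp only: assoc_left[OF u])
    with eq show ?thesis by (simp add: map_entries_def compress_def)
  qed
  show "of_mat (\<lambda>i. i) (\<lambda>i. i) (fm_C (compress s \<R> r u v)) = of_mat (\<lambda>i. i) (\<lambda>i. i) (fm_C \<R>) * v"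
    unfolding compress_def fm.simps
    by (rule of_mat_to_mat_id) (simp_all only: mult.assoc assoc_left[OF of_mat_id_left[OF l(2)]] v)
qed

lemma sfin_all_field: "finite J \<Longrightarrow> sfin_all (idm J (1 :: 'k :: field))"
  by (rule sfin_all_idm[OF sfin_all_one[OF stably_finite_field]])

lemma nc_realizes_compress:
  fixes Y :: "'d :: finite \<Rightarrow> 'k :: field mat"
  assumes Y: "\<And>k. Y k \<in> carrier_mat s s" and real: "realizes s Y \<R> R"
    and imp: "\<And>e x w. sfin_all e \<Longrightarrow> (\<And>g :: 'd \<times> nat \<times> nat. g \<in> fm_index s \<Longrightarrow> corner e (x g)) \<Longrightarrow>
      fm_value (mscale (*)) e (fm_index s) {..<fm_dim \<R>} (map_entries s (fm_A \<R>)) (map_entries s (fm_B \<R>))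
        (of_mat (\<lambda>i. i) (\<lambda>i. i) (fm_C \<R>)) (of_mat (\<lambda>i. i) (\<lambda>i. i) (fm_D \<R>)) x w \<Longrightarrow>
      fm_value (mscale (*)) e (fm_index s) {..<r} (map_entries s (fm_A (compress s \<R> r u v))) (map_entries s (fm_B (compress s \<R> r u v)))
        (of_mat (\<lambda>i. i) (\<lambda>i. i) (fm_C (compress s \<R> r u v))) (of_mat (\<lambda>i. i) (\<lambda>i. i) (fm_D \<R>)) x w"
  shows "realizes s Y (compress s \<R> r u v) R"
proof (rule realizesI[OF compress_realization Y])
  show "fm_realization s \<R>" using real by (simp add: realizes_def)
  show "nc_realizes s Y (compress s \<R> r u v) R"
    unfolding nc_realizes_def
  proof (intro allI impI)
    fix J :: "nat set" and X w
    assume J: "finite J" "J \<noteq> {}" and w: "EV (mscale (mscale (*))) (idm {..<s} (idm J 1)) X R w"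
    have v: "realization_value (mscale (*)) (idm J 1) s Y \<R> X w"
      by (rule realizesD[OF real Y, unfolded nc_realizes_def, rule_format, OF J w])
    have "corner (idm J 1) (fm_arg (mscale (*)) (idm J 1) Y X g)" if "g \<in> fm_index s" for g
      by (rule fm_arg_corner[OF field_alg1.kalg_axioms _ field_alg2.EV_arg_corner[OF w] that]) (use J in \<open>simp add: idm_mult\<close>)
    from imp[OF sfin_all_field[OF J(1)] this v[unfolded realization_value_def]]
    show "realization_value (mscale (*)) (idm J 1) s Y (compress s \<R> r u v) X w"
      unfolding realization_value_def by (simp add: compress_def)
  qed
qed

lemma minimal_controllable:
  fixes Y :: "'d :: finite \<Rightarrow> 'k :: field mat"
  assumes Y: "\<And>k. Y k \<in> carrier_mat s s" and min: "minimal_realization s Y \<R> R"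
  shows "idm {..<fm_dim \<R>} 1 \<in> ctr (fm_index s) (map_entries s (fm_A \<R>)) (map_entries s (fm_B \<R>))"
proof -
  let ?L = "{..<fm_dim \<R>}" and ?A = "map_entries s (fm_A \<R>)" and ?B = "map_entries s (fm_B \<R>)"
  have real: "fm_realization s \<R>" "realizes s Y \<R> R" using min by (simp_all add: minimal_realization_def realizes_def)
  then have l: "linear_mat_map s (fm_dim \<R>) (fm_dim \<R>) (fm_A \<R> k)" "linear_mat_map s (fm_dim \<R>) s (fm_B \<R> k)" for k
    unfolding fm_realization_def by auto
  have V: "right_ideal (idm ?L 1) (ctr (fm_index s) ?A ?B)"
    by (rule right_ideal_ctr) (use map_entries_side[OF l(1)] map_entries_side[OF l(2)] in auto)
  obtain r v u where v: "v \<in> ctr (fm_index s) ?A ?B" "v * idm {..<r} 1 = v" and u: "idm {..<r} 1 * u = u" "u * idm ?L 1 = u"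
    and uv: "u * v = idm {..<r} 1" and vu: "\<And>x. x \<in> ctr (fm_index s) ?A ?B \<Longrightarrow> v * u * x = x"
    and r: "r \<le> card ?L" "r = card ?L \<Longrightarrow> v * u = idm ?L 1"
    by (rule right_ideal_basis[OF _ V]) auto
  have vL: "idm ?L 1 * v = v" by (rule right_idealD(2)[OF V v(1)])
  note ce = compress_entries[OF real(1) u(1) v(2)]
  have "realizes s Y (compress s \<R> r u v) R"
  proof (rule nc_realizes_compress[OF Y real(2)], unfold ce, rule field_alg1.fm_value_right[OF finite_lessThan _ _ vL v(2) u uv])
    fix g :: "'d \<times> nat \<times> nat" assume g: "g \<in> fm_index s"
    show "?A g * v = v * (u * ?A g * v)" using vu[OF ctr_step[OF g v(1)]] by (simp add: mult.assoc)
    show "?B g = v * (u * ?B g)" using vu[of "?B g"] ctr_gen[OF g, of ?B ?A] by (simp add: mult.assoc)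
    show "corner (idm {..<r} 1) (u * ?A g * v)"
      unfolding corner_def by (simp only: mult.assoc v assoc_left[OF u(1)] simp_thms)
  qed
  then have "fm_dim \<R> \<le> r" using min by (auto simp: minimal_realization_def compress_def)
  then have "v * u = idm ?L 1" using r by simp
  then show ?thesis using ctr_right[OF v(1), of u] by simp
qed

text \<open>The quotient by the unobservable subspace is used instead; the rows of \<open>v\<close>
  are a basis of the observations.\<close>

lemma minimal_observable:
  fixes Y :: "'d :: finite \<Rightarrow> 'k :: field mat"
  assumes Y: "\<And>k. Y k \<in> carrier_mat s s" and min: "minimal_realization s Y \<R> R"
  shows "idm {..<fm_dim \<R>} 1 \<in> obs (fm_index s) (map_entries s (fm_A \<R>)) (of_mat (\<lambda>i. i) (\<lambda>i. i) (fm_C \<R>))"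
proof -
  let ?L = "{..<fm_dim \<R>}" and ?A = "map_entries s (fm_A \<R>)" and ?C = "of_mat (\<lambda>i. i) (\<lambda>i. i) (fm_C \<R>)"
  let ?W = "obs (fm_index s) ?A ?C"
  have real: "fm_realization s \<R>" "realizes s Y \<R> R" using min by (simp_all add: minimal_realization_def realizes_def)
  then have l: "linear_mat_map s (fm_dim \<R>) (fm_dim \<R>) (fm_A \<R> k)" "fm_C \<R> \<in> carrier_mat s (fm_dim \<R>)" for k
    unfolding fm_realization_def by auto
  have V: "left_ideal (idm ?L 1) ?W"
    by (rule left_ideal_obs) (use map_entries_side[OF l(1)] of_mat_id_right[OF l(2)] in auto)
  obtain r v u where v: "v \<in> ?W" "idm {..<r} 1 * v = v" and u: "u * idm {..<r} 1 = u" "idm ?L 1 * u = u"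
    and vu: "v * u = idm {..<r} 1" and uv: "\<And>x. x \<in> ?W \<Longrightarrow> x * (u * v) = x"
    and r: "r \<le> card ?L" "r = card ?L \<Longrightarrow> u * v = idm ?L 1"
    by (rule left_ideal_basis[OF _ V]) auto
  have vL: "v * idm ?L 1 = v" by (rule left_idealD(2)[OF V v(1)])
  note ce = compress_entries[OF real(1) v(2) u(1)]
  have "realizes s Y (compress s \<R> r v u) R"
  proof (rule nc_realizes_compress[OF Y real(2)], unfold ce, rule field_alg1.fm_value_left[OF finite_lessThan _ _ v(2) vL u(2,1) vu])
    fix g :: "'d \<times> nat \<times> nat" assume g: "g \<in> fm_index s"
    show "v * ?A g = v * ?A g * u * v" using uv[OF obs_step[OF g v(1)]] by (simp add: mult.assoc)
    show "corner (idm {..<r} 1) (v * ?A g * u)"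
      unfolding corner_def by (simp only: mult.assoc u assoc_left[OF v(2)] simp_thms)
  next
    show "?C = ?C * u * v" using uv[OF obs_gen] by (simp add: mult.assoc)
  qed
  then have "fm_dim \<R> \<le> r" using min by (auto simp: minimal_realization_def compress_def)
  then have "u * v = idm ?L 1" using r by simp
  then show ?thesis using obs_left[OF v(1), of u] by simp
qed

section \<open>Moments\<close>

text \<open>Solving a block bidiagonal system multiplies the superdiagonal blocks, so the corner entry of the
  value of a realization at a block bidiagonal point is a moment.\<close>

definition bidiagonal :: "nat \<Rightarrow> 'a :: ring \<Rightarrow> (nat \<Rightarrow> 'a) \<Rightarrow> 'a finmat" where
  "bidiagonal n x W = idm {..n} x + (\<Sum>t<n. single t (Suc t) (W t))"

lemma entry_bidiagonal:
  "entry (bidiagonal n x W) a b = (if a \<le> n \<and> b = a then x else 0) + (if a < n \<and> b = Suc a then W a else 0)"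
proof -
  have "(\<Sum>t<n. entry (single t (Suc t) (W t)) a b) = (\<Sum>t<n. if t = a then (if b = Suc a then W a else 0) else 0)"
    by (rule sum.cong) (auto simp: entry_single)
  then show ?thesis by (simp add: bidiagonal_def entry_idm entry_sum)
qed

lemma mapm_bidiagonal:
  assumes "f 0 = 0"
  shows "mapm f (bidiagonal n x W) = bidiagonal n (f x) (\<lambda>t. f (W t))"
  by (rule finmat_eqI) (auto simp: entry_mapm entry_bidiagonal assms)

lemma sum_bidiagonal: "(\<Sum>g\<in>I. bidiagonal n (x g) (\<lambda>t. W t g)) = bidiagonal n (\<Sum>g\<in>I. x g) (\<lambda>t. \<Sum>g\<in>I. W t g)"
  by (rule finmat_eqI) (auto simp: entry_bidiagonal entry_sum)

text \<open>Back substitution in the last column. The bottom entry of the solution is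
  \<open>M \<beta>\<close>, the entry above it also receives \<open>K n\<close>, and each further
  step upwards multiplies by \<open>M (N t)\<close>. There are \<open>n + 2\<close> diagonal blocks
  and \<open>n + 1\<close> blocks above the diagonal.\<close>

lemma bidiagonal_solve:
  fixes M :: "'a :: ring"
  assumes M: "corner E M" "M * \<Lambda> = E"
    and S: "corner (idm {..Suc n} E) S" "bidiagonal (Suc n) \<Lambda> (\<lambda>t. - N t) * S = idm {..Suc n} E"
  shows "entry (S * bidiagonal (Suc n) \<beta> K) 0 (Suc n) =
    foldr (\<lambda>t h. M * (N t * h)) [0..<n] (M * (N n * (M * \<beta>) + K n))"
proof -
  let ?b = "bidiagonal (Suc n) \<beta> K"
  define h where "h t = entry (S * ?b) t (Suc n)" for t
  have *: "idm {..Suc n} E * (S * ?b) = S * ?b"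
    using S(1) by (simp add: corner_def flip: mult.assoc)
  have Eh: "E * h t = h t" if "t \<le> Suc n" for t
    using that arg_cong[OF *, of "\<lambda>y. entry y t (Suc n)"] unfolding entry_idm_mult[OF finite_atMost] h_def by simp
  have r1: "entry (bidiagonal (Suc n) \<Lambda> (\<lambda>t. - N t) * (S * ?b)) t (Suc n) = E * entry ?b t (Suc n)" if "t \<le> Suc n" for t
    using that by (simp add: assoc_left[OF S(2)] entry_idm_mult)
  have r2: "entry (bidiagonal (Suc n) \<Lambda> (\<lambda>t. - N t) * (S * ?b)) t (Suc n) = \<Lambda> * h t - (if t \<le> n then N t * h (Suc t) else 0)"
    if "t \<le> Suc n" for t
  proof -
    have "(\<Sum>i<Suc n. entry (single i (Suc i) (- N i) * (S * ?b)) t (Suc n)) =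
        (\<Sum>i<Suc n. if i = t then - N t * h (Suc t) else 0)"
      by (intro sum.cong refl) (auto simp add: entry_single_mult h_def)
    also have "\<dots> = (if t \<le> n then - N t * h (Suc t) else 0)" by (simp add: less_Suc_eq_le)
    finally show ?thesis
      using that unfolding bidiagonal_def[of _ \<Lambda>] distrib_right sum_distrib_right
      by (simp add: entry_sum entry_idm_mult h_def del: sum.lessThan_Suc)
  qed
  have rec: "\<Lambda> * h t = E * entry ?b t (Suc n) + (if t \<le> n then N t * h (Suc t) else 0)" if "t \<le> Suc n" for t
    using trans[OF sym[OF r2[OF that]] r1[OF that]] by (simp only: diff_eq_eq)
  have sol: "h t = M * (entry ?b t (Suc n) + (if t \<le> n then N t * h (Suc t) else 0))" if "t \<le> Suc n" for t
  proof -
    have "h t = M * (\<Lambda> * h t)" by (simp only: assoc_left[OF M(2)] Eh[OF that])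
    then show ?thesis using rec[OF that] M(1) by (simp add: distrib_left corner_right')
  qed
  have top: "h (Suc n) = M * \<beta>" using sol[of "Suc n"] by (simp add: entry_bidiagonal)
  have last: "h n = M * (N n * (M * \<beta>) + K n)" using sol[of n] by (simp add: entry_bidiagonal top add.commute)
  have "h t = foldr (\<lambda>t h. M * (N t * h)) [t..<n] (h n)" if "t \<le> n" for t
    using that
  proof (induction t rule: inc_induct)
    case (step t)
    then show ?case using sol[of t] by (simp add: entry_bidiagonal upt_conv_Cons)
  qed simp
  from this[of 0] show ?thesis by (simp add: h_def[of 0, symmetric] last)
qed

text \<open>Induction on the number of blocks: one more diagonal block and the entry above it form
  the second block column in \<open>EV_triangular\<close>.\<close>

lemma (in kalg) EV_bidiagonal:
  assumes e: "e * e = e" and v: "EV scale e X Q v" and W: "\<And>t k. corner e (W t k)"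
  shows "\<exists>V. EV (mscale scale) (idm {..n} e) (\<lambda>k. bidiagonal n (X k) (\<lambda>t. W t k)) Q V"
proof (induction n)
  case 0
  have "EV (mscale scale) (idm {..0} e) (\<lambda>k. idm {..0} (X k)) Q (idm {..0} v)"
    by (rule EV_hom[OF ring_map_idm _ v]) (auto intro!: finmat_eqI simp: entry_mscale entry_idm)
  then show ?case by (auto simp: bidiagonal_def)
next
  case (Suc n)
  then obtain V where V: "EV (mscale scale) (idm {..n} e) (\<lambda>k. bidiagonal n (X k) (\<lambda>t. W t k)) Q V" ..
  interpret m: kalg "mscale scale" by (rule kalg_mscale)
  let ?e = "single (Suc n) (Suc n) e"
  have v': "EV (mscale scale) ?e (\<lambda>k. single (Suc n) (Suc n) (X k)) Q (single (Suc n) (Suc n) v)"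
    by (rule EV_hom[OF ring_map_single _ v]) (auto intro!: finmat_eqI simp: entry_mscale entry_single)
  have o: "idm {..n} e * ?e = 0" "?e * idm {..n} e = 0"
    by (rule finmat_eqI, simp add: entry_idm_mult entry_mult_idm entry_single)+
  have w: "idm {..n} e * single n (Suc n) (W n k) = single n (Suc n) (W n k)"
    "single n (Suc n) (W n k) * ?e = single n (Suc n) (W n k)" for k
    using W[of n k] by (auto intro!: finmat_eqI simp: entry_idm entry_mult_single entry_single corner_def)
  have ee: "idm {..n} e * idm {..n} e = idm {..n} e" "?e * ?e = ?e" by (simp_all add: e idm_mult single_mult)
  from m.EV_triangular[where W = "\<lambda>k. single n (Suc n) (W n k)", OF ee o w V v'] obtain w where
    "EV (mscale scale) (idm {..n} e + ?e) (\<lambda>k. bidiagonal n (X k) (\<lambda>t. W t k) + single (Suc n) (Suc n) (X k) + single n (Suc n) (W n k)) Q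
      (V + single (Suc n) (Suc n) v + w)"
    by auto
  moreover have "idm {..n} e + ?e = idm {..Suc n} e"
    by (rule finmat_eqI) (auto simp: entry_idm entry_single)
  moreover have "bidiagonal n (X k) (\<lambda>t. W t k) + single (Suc n) (Suc n) (X k) + single n (Suc n) (W n k) = bidiagonal (Suc n) (X k) (\<lambda>t. W t k)" for k
    by (rule finmat_eqI) (auto simp: entry_bidiagonal entry_single)
  ultimately show ?case by auto
qed

lemma equivalent_EV:
  fixes X :: "'d \<Rightarrow> 'k :: field finmat"
  assumes eq: "evaluation_equivalent Q R" and H: "finite H" "H \<noteq> {}"
    and v: "EV (mscale (*)) (idm H 1) X Q v" and w: "EV (mscale (*)) (idm H 1) X R w"
  shows "v = w"
proof -
  define n where "n = card H"
  obtain h where h: "bij_betw h {..<n} H"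
    using H(1) ex_bij_betw_nat_finite unfolding n_def by (metis atLeast0LessThan)
  then have hH: "h ` {..<n} = H" and inj: "inj_on h {..<n}" by (auto simp: bij_betw_def)
  have n: "n \<ge> 1" using H by (simp add: n_def Suc_leI card_gt_0_iff)
  note emb = alg_embedding_mat[OF inj]
  define X' where "X' k = to_mat n n h h (X k)" for k
  have "corner (idm (h ` {..<n}) 1) (X k)" for k unfolding hH by (rule field_alg1.EV_arg_corner[OF v])
  then have X': "of_mat h h (X' k) = X k" for k
    unfolding X'_def by (intro of_mat_to_mat inj) (auto simp: corner_idm_iff)
  have car: "X' k \<in> carrier (matrix_algebra n)" for k by (simp add: X'_def module_mat_def)
  have "X' \<in> expr_dom (matrix_algebra n) T \<and> y = of_mat h h (expr_eval (matrix_algebra n) T X')"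
    if "EV (mscale (*)) (idm H 1) X T y" for T y
    by (rule alg_embedding.dom_of_EV[OF emb car]) (use that in \<open>simp only: X' hH\<close>)
  from this[OF v] this[OF w] show ?thesis
    using eq n unfolding evaluation_equivalent_def by auto
qed

section \<open>Rearranging the levels of tensor products\<close>

lemma swap_tens: "swap_levels (tens (mscale (*)) A x) = tens (mscale (*)) x (A :: 'k :: field finmat)"
  by (rule finmat_eqI, rule finmat_eqI)
    (simp add: entry_swap_levels field_alg1.entry_tens field_alg.entry_mscale mult.commute)

lemma unflatten_swap_tens:
  "unflatten (swap_levels (tens (mscale (*)) A (flatten \<xi>))) = tens2 (mscale (*)) \<xi> (A :: 'k :: field finmat)"
  unfolding swap_tens
  by (rule finmat_eqI, rule finmat_eqI)
    (simp add: entry_unflatten field_alg1.entry_tens field_alg1.entry_tens2 entry_flatten)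

lemma swap_tens_mscale:
  "swap_levels (tens (mscale (mscale (*))) F z) = mapm (\<lambda>x. tens (mscale (*)) F x) (z :: 'k :: field finmat finmat)"
  by (rule finmat_eqI, rule finmat_eqI)
    (simp add: entry_swap_levels field_alg1.entry_tens field_alg2.entry_tens field_alg1.entry_mscale entry_mapm)

lemma flatten_swap_hom:
  shows "ring_map (\<lambda>x. mapm flatten (swap_levels x))"
    "mapm flatten (swap_levels (mscale (mscale (mscale (*))) c y)) =
      mscale (mscale (*)) (c :: 'k :: field) (mapm flatten (swap_levels y))"
proof -
  show "ring_map (\<lambda>x. mapm flatten (swap_levels x))"
    by (rule ring_map_comp[OF ring_map_swap ring_map_mapm[OF ring_map_flatten]])
  have f0: "flatten 0 = 0" by (rule ring_map_zero[OF ring_map_flatten])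
  show "mapm flatten (swap_levels (mscale (mscale (mscale (*))) c y)) = mscale (mscale (*)) c (mapm flatten (swap_levels y))"
    by (rule finmat_eqI, rule finmat_eqI)
      (simp add: entry_mapm f0 entry_flatten entry_swap_levels field_alg.entry_mscale field_alg1.entry_mscale field_alg2.entry_mscale)
qed

lemma unflatten_swap_flatten_swap:
  "unflatten (swap_levels (mapm flatten (swap_levels V))) = mapm swap_levels (V :: 'a :: ring finmat finmat finmat)"
proof -
  have z: "flatten 0 = (0 :: 'a finmat)" "swap_levels 0 = (0 :: 'a finmat finmat)"
    by (rule ring_map_zero[OF ring_map_flatten], rule ring_map_zero[OF ring_map_swap])
  show ?thesis
    by (rule finmat_eqI, rule finmat_eqI, rule finmat_eqI)
      (simp add: entry_unflatten entry_swap_levels entry_mapm z entry_flatten)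
qed

lemma map_entries_corner:
  assumes "fm_realization s \<R>"
  shows "corner (idm {..<fm_dim \<R>} 1) (map_entries s (fm_A \<R>) g)"
    "idm {..<fm_dim \<R>} 1 * map_entries s (fm_B \<R>) g = map_entries s (fm_B \<R>) g"
    "map_entries s (fm_B \<R>) g * idm {..<s} 1 = map_entries s (fm_B \<R>) g"
    "of_mat (\<lambda>i. i) (\<lambda>i. i) (fm_C \<R>) * idm {..<fm_dim \<R>} 1 = of_mat (\<lambda>i. i) (\<lambda>i. i) (fm_C \<R>)"
    "idm {..<s} 1 * of_mat (\<lambda>i. i) (\<lambda>i. i) (fm_C \<R>) = of_mat (\<lambda>i. i) (\<lambda>i. i) (fm_C \<R>)"
proof -
  have l: "linear_mat_map s (fm_dim \<R>) (fm_dim \<R>) (fm_A \<R> k)" "linear_mat_map s (fm_dim \<R>) s (fm_B \<R> k)"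
    "fm_C \<R> \<in> carrier_mat s (fm_dim \<R>)" for k
    using assms unfolding fm_realization_def by auto
  show "corner (idm {..<fm_dim \<R>} 1) (map_entries s (fm_A \<R>) g)"
    using map_entries_side[where F = "fm_A \<R>", OF l(1)] by (simp add: corner_def)
  show "idm {..<fm_dim \<R>} 1 * map_entries s (fm_B \<R>) g = map_entries s (fm_B \<R>) g"
    "map_entries s (fm_B \<R>) g * idm {..<s} 1 = map_entries s (fm_B \<R>) g"
    by (rule map_entries_side[where F = "fm_B \<R>", OF l(2)])+
  show "of_mat (\<lambda>i. i) (\<lambda>i. i) (fm_C \<R>) * idm {..<fm_dim \<R>} 1 = of_mat (\<lambda>i. i) (\<lambda>i. i) (fm_C \<R>)"
    by (rule of_mat_id_right[OF l(3)])
  show "idm {..<s} 1 * of_mat (\<lambda>i. i) (\<lambda>i. i) (fm_C \<R>) = of_mat (\<lambda>i. i) (\<lambda>i. i) (fm_C \<R>)"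
    by (rule of_mat_id_left[OF l(3)])
qed

text \<open>The common point is \<open>PP = I\<^sub>s \<otimes> P0\<close>. For \<open>\<R>\<close> the indices \<open>p\<close> of \<open>P0\<close> are the outer ones, as in \<^locale>\<open>recentring\<close>;
  for the pencil \<open>q\<close> of \<open>Q\<close> the index sets \<open>{..<s}\<close> and \<open>p\<close> are merged into \<open>H\<close>.\<close>

locale comparison =
  fixes s :: nat and Y :: "'d :: finite \<Rightarrow> 'k :: field mat" and \<R> :: "('d, 'k) fm" and R R0 Q :: "('d, 'k) nc_expr"
    and p :: "nat set" and P0 :: "'d \<Rightarrow> 'k finmat" and z :: "'k finmat"
  assumes real: "fm_realization s \<R>" and nr: "nc_realizes s Y \<R> R" and s: "s \<ge> 1"
    and p: "finite p" "p \<noteq> {}"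
    and eq: "evaluation_equivalent R0 R" "evaluation_equivalent R0 Q"
    and EVz: "EV (mscale (*)) (idm p 1) P0 (Add R (Add R0 Q)) z"
begin

abbreviation "G \<equiv> fm_index s :: ('d \<times> nat \<times> nat) set"
abbreviation "A \<equiv> map_entries s (fm_A \<R>)"
abbreviation "B \<equiv> map_entries s (fm_B \<R>)"
abbreviation "C \<equiv> of_mat (\<lambda>i. i) (\<lambda>i. i) (fm_C \<R>)"
abbreviation "D \<equiv> of_mat (\<lambda>i. i) (\<lambda>i. i) (fm_D \<R>)"
abbreviation "L \<equiv> {..<fm_dim \<R>}"
abbreviation "ep \<equiv> idm p (1 :: 'k)"
abbreviation "Es \<equiv> idm {..<s} ep"
abbreviation "PP k \<equiv> idm {..<s} (P0 k)"
abbreviation "x \<equiv> fm_arg (mscale (*)) ep Y PP"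
abbreviation "E \<equiv> idm p (idm L (1 :: 'k))"
abbreviation "LL \<equiv> E - (\<Sum>g\<in>G. tens (mscale (*)) (x g) (A g))"
abbreviation "\<beta> \<equiv> \<Sum>g\<in>G. tens (mscale (*)) (x g) (B g)"
abbreviation "H \<equiv> prod_encode ` ({..<s} \<times> p)"
abbreviation "eH \<equiv> idm H (1 :: 'k)"
abbreviation "q \<equiv> pc_expr Q"
abbreviation "\<Gamma> \<equiv> pencil_at (mscale (*)) eH (\<lambda>k. flatten (PP k)) q"
abbreviation "\<beta>q \<equiv> tens (mscale (*)) (pc_in q) eH"
abbreviation "cq \<equiv> tens (mscale (*)) (pc_out q) eH"
abbreviation "Eq \<equiv> idm (pc_set q) eH"

lemma finH: "finite H" "H \<noteq> {}"
  using p s by (auto simp: lessThan_empty_iff)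

lemma finG: "finite G"
  unfolding fm_index_def by simp

lemma idem: "ep * ep = ep" "Es * Es = Es" "eH * eH = eH" "E * E = E"
  using p finH by (simp_all add: idm_mult)

text \<open>The values of \<open>R\<close> and \<open>Q\<close> are compared through that of
  \<open>R0\<close> at the same point. The map \<open>f\<close> puts the levels in an order in which
  flattening yields a plain matrix point, where evaluation equivalence applies; injectivity brings
  the equality back.\<close>

lemma common_value:
  assumes J: "finite J" "J \<noteq> {}" and f: "ring_map f" "\<And>c y. f (sc c y) = mscale (mscale (*)) c (f y)" "\<And>y y'. f y = f y' \<Longrightarrow> y = y'"
    and e: "f e = idm {..<s} (idm J (1 :: 'k))"
    and V: "EV sc e X (Add R (Add R0 Q)) V"
  obtains v where "EV sc e X R v" "EV sc e X Q v"
proof -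
  obtain v1 v2 v3 where v: "EV sc e X R v1" "EV sc e X R0 v2" "EV sc e X Q v3"
    using V by auto
  let ?H = "prod_encode ` ({..<s} \<times> J)"
  have H: "finite ?H" "?H \<noteq> {}" using J s by (auto simp: lessThan_empty_iff)
  have F: "EV (mscale (*)) (idm ?H 1) (\<lambda>k. flatten (f (X k))) T (flatten (f v))" if "EV sc e X T v" for T v
    using EV_hom[OF ring_map_flatten field_alg.flatten_mscale EV_hom[OF f(1,2) that, unfolded e]] J by (simp add: flatten_idm)
  have "flatten (f v2) = flatten (f v1)" "flatten (f v2) = flatten (f v3)"
    by (rule equivalent_EV[OF eq(1) H F[OF v(2)] F[OF v(1)]], rule equivalent_EV[OF eq(2) H F[OF v(2)] F[OF v(3)]])
  then have "v1 = v3" by (metis f(3) flatten_inject)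
  with v that show ?thesis by blast
qed

lemma P_EV: "EV (mscale (mscale (*))) Es PP (Add R (Add R0 Q)) (idm {..<s} z)"
  by (rule EV_hom[OF ring_map_idm _ EVz])
    (auto intro!: finmat_eqI simp: field_alg.entry_mscale field_alg1.entry_mscale entry_idm)

lemma x_corner: "g \<in> G \<Longrightarrow> corner ep (x g)"
  by (rule fm_arg_corner[OF field_alg1.kalg_axioms idem(1) field_alg2.EV_arg_corner[OF P_EV]])

lemma P_value:
  obtains v where "EV (mscale (mscale (*))) Es PP R v" "EV (mscale (mscale (*))) Es PP Q v"
  by (rule common_value[OF p, of "\<lambda>y. y", OF _ _ _ _ P_EV]) (auto simp: ring_map_def)

lemma realization_at_centre:
  assumes v: "EV (mscale (mscale (*))) Es PP R v"
  shows "\<exists>M. corner E M \<and> LL * M = E \<and> M * LL = E \<and> swap_levels v = idm p D + idm p C * (M * \<beta>)"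
proof -
  have "realization_value (mscale (*)) ep s Y \<R> PP v"
    using nr p v unfolding nc_realizes_def by blast
  then obtain S where S: "corner (idm L ep) S" "(idm L ep - (\<Sum>g\<in>G. tens (mscale (*)) (A g) (x g))) * S = idm L ep"
    "S * (idm L ep - (\<Sum>g\<in>G. tens (mscale (*)) (A g) (x g))) = idm L ep"
    "v = tens (mscale (*)) D ep + tens (mscale (*)) C ep * (S * (\<Sum>g\<in>G. tens (mscale (*)) (B g) (x g)))"
    unfolding realization_value_def fm_value_def by blast
  note r = ring_map_mult[OF ring_map_swap] ring_map_add[OF ring_map_swap] ring_map_diff[OF ring_map_swap] ring_map_sum[OF ring_map_swap]
  have i: "swap_levels (idm L ep) = E" using p by (simp add: swap_idm)
  have "LL * swap_levels S = E" "swap_levels S * LL = E"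
    using arg_cong[OF S(2), of swap_levels] arg_cong[OF S(3), of swap_levels]
    unfolding r swap_tens i by simp_all
  moreover have "corner E (swap_levels S)" using ring_map_corner[OF ring_map_swap S(1)] unfolding i .
  moreover have "swap_levels v = idm p D + idm p C * (swap_levels S * \<beta>)"
    unfolding S(4) r swap_tens field_alg1.tens_idm[OF p(1)] ..
  ultimately show ?thesis by blast
qed

lemma linearization_at_centre:
  assumes v: "EV (mscale (mscale (*))) Es PP Q v"
  shows "\<exists>S. corner Eq S \<and> \<Gamma> * S = Eq \<and> S * \<Gamma> = Eq \<and> cq * (S * \<beta>q) = single 0 0 (flatten v)"
proof -
  have "EV (mscale (*)) eH (\<lambda>k. flatten (PP k)) Q (flatten v)"
    using EV_hom[OF ring_map_flatten field_alg.flatten_mscale v] p by (simp add: flatten_idm)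
  from field_alg1.linearizes_expr[OF idem(3) this] show ?thesis unfolding linearizes_def .
qed

end

locale comparison_inverses = comparison s Y \<R> R R0 Q p P0 z
  for s :: nat and Y :: "'d :: finite \<Rightarrow> 'k :: field mat" and \<R> :: "('d, 'k) fm" and R R0 Q :: "('d, 'k) nc_expr"
    and p :: "nat set" and P0 :: "'d \<Rightarrow> 'k finmat" and z :: "'k finmat" +
  fixes M Gi :: "'k finmat finmat"
  assumes M: "corner E M" "LL * M = E" "M * LL = E"
    and Gi: "corner Eq Gi" "\<Gamma> * Gi = Eq" "Gi * \<Gamma> = Eq"
begin

abbreviation "u \<equiv> M * \<beta>"
abbreviation "G' \<equiv> G \<times> p \<times> p"

definition "A' = (\<lambda>(g, a, b). M * single a b (A g))"
text \<open>Perturbing the centre in the direction of an entry changes the solution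
  \<open>M \<beta>\<close> in two ways, through the input and through the pencil; hence two
  terms.\<close>

definition "B' = (\<lambda>(g, a, b). M * (single a b (B g) + single a b (A g) * u))"
text \<open>The coefficient of a direction in the pencil of \<open>Q\<close>. A direction is a
  variable \<open>k\<close> together with one entry of the point, its row \<open>(i, a)\<close> and
  column \<open>(j, b)\<close> being encoded as elements of \<open>H\<close>.\<close>

definition "lin = (\<lambda>((k, i, j), a, b). tens (mscale (*)) (pc_lin q k) (single (prod_encode (i, a)) (prod_encode (j, b)) (1 :: 'k)))"
text \<open>State matrices of the pencil of \<open>Q\<close> after recentring: factoring out its
  value \<open>\<Gamma>\<close> at the centre leaves the unit minus a combination of these.\<close>

definition "aq g = Gi * (- lin g)"
text \<open>With this input the recentred realization computes the increment of the solution over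
  its value \<open>Gi \<beta>q\<close> at the centre.\<close>

definition "bq g = aq g * (Gi * \<beta>q)"
text \<open>The direction as a tuple of matrices: a matrix unit in coordinate \<open>k\<close> and
  zero in the others.\<close>

definition "W = (\<lambda>((k :: 'd, i, j), a, b) k'. if k' = k then single i j (single a b (1 :: 'k)) else 0)"

lemma W_corner: "g \<in> G' \<Longrightarrow> corner Es (W g k)"
  using corner_self[of "1 :: 'k"] by (auto simp: W_def fm_index_def corner_idm_iff entry_single p)

lemma W_sum:
  assumes g: "(g, a, b) \<in> G'"
  shows "(\<Sum>h\<in>G. tens (mscale (*)) (entry (W (g, a, b) (fst h)) (fst (snd h)) (snd (snd h))) (F h)) = single a b (F g)"
proof -
  have "(\<Sum>h\<in>G. tens (mscale (*)) (entry (W (g, a, b) (fst h)) (fst (snd h)) (snd (snd h))) (F h)) =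
      (\<Sum>h\<in>G. if h = g then single a b (F g) else 0)"
    by (rule sum.cong) (auto simp: W_def entry_single field_alg1.tens_single field_alg1.scale_one split: prod.splits)
  then show ?thesis using g finG by simp
qed

lemma W_lin:
  assumes "g \<in> G'"
  shows "(\<Sum>k\<in>UNIV. tens (mscale (*)) (pc_lin q k) (flatten (W g k))) = lin g"
proof -
  obtain k i j a b where g: "g = ((k, i, j), a, b)" by (metis surj_pair)
  have "(\<Sum>k'\<in>UNIV. tens (mscale (*)) (pc_lin q k') (flatten (W g k'))) = (\<Sum>k'\<in>UNIV. if k' = k then lin g else 0)"
    by (rule sum.cong) (auto simp: g W_def lin_def flatten_single ring_map_zero[OF ring_map_flatten])
  then show ?thesis by simp
qed

text \<open>At a block bidiagonal point the pencil of the realization is block bidiagonal too, with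
  \<open>LL\<close> on the diagonal and the coefficients of the directions above it. Back
  substitution then spells the word in \<open>A'\<close> ending in \<open>B'\<close>; the constant
  term is diagonal and does not reach the upper right entry.\<close>

lemma realization_moment:
  assumes w: "\<And>t. w t \<in> G'"
    and v: "EV (mscale (mscale (mscale (*)))) (idm {..Suc n} Es) (\<lambda>k. bidiagonal (Suc n) (PP k) (\<lambda>t. W (w t) k)) R V"
  shows "swap_levels (entry V 0 (Suc n)) = idm p C * foldr (\<lambda>t h. A' (w t) * h) [0..<n] (B' (w n))"
proof -
  \<comment> \<open>The levels of the value are block index, \<open>s\<close> and \<open>p\<close>.
    The map \<open>?f\<close> regroups them as \<open>s\<close> and the pair of block index and
    \<open>p\<close>, where \<open>nc_realizes\<close> applies. Afterwards \<open>?\<Psi>\<close>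
    takes the state space with that pair to the order block index, \<open>p\<close>, state space, in
    which the system is bidiagonal.\<close>
  let ?N = "Suc n" and ?f = "\<lambda>y. mapm flatten (swap_levels y) :: 'k finmat finmat"
  let ?X = "\<lambda>k. bidiagonal ?N (PP k) (\<lambda>t. W (w t) k)" and ?\<Psi> = "\<lambda>y. unflatten (swap_levels y) :: 'k finmat finmat finmat"
  let ?J = "prod_encode ` ({..?N} \<times> p)"
  have J: "finite ?J" "?J \<noteq> {}" using p by auto
  have eJ: "idm ?J 1 = flatten (idm {..?N} ep)" using p by (simp add: flatten_idm)
  have fe: "?f (idm {..?N} Es) = idm {..<s} (idm ?J 1)"
    using p by (simp add: swap_idm mapm_idm ring_map_zero[OF ring_map_flatten] flatten_idm)
  have "EV (mscale (mscale (*))) (idm {..<s} (idm ?J 1)) (\<lambda>k. ?f (?X k)) R (?f V)"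
    using EV_hom[OF flatten_swap_hom v] unfolding fe .
  then have "realization_value (mscale (*)) (idm ?J 1) s Y \<R> (\<lambda>k. ?f (?X k)) (?f V)"
    using nr J unfolding nc_realizes_def by blast
  moreover define \<xi> where "\<xi> g = bidiagonal ?N (x g) (\<lambda>t. entry (W (w t) (fst g)) (fst (snd g)) (snd (snd g)))" for g :: "'d \<times> nat \<times> nat"
  have arg: "fm_arg (mscale (*)) (idm ?J 1) Y (\<lambda>k. ?f (?X k)) = (\<lambda>g. flatten (\<xi> g))"
  proof
    fix g :: "'d \<times> nat \<times> nat"
    obtain k i j where g: "g = (k, i, j)" by (metis surj_pair)
    have "entry (?f (?X k)) i j = flatten (entry (swap_levels (?X k)) i j)"
      by (rule entry_mapm) (rule ring_map_zero[OF ring_map_flatten])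
    moreover have "entry (swap_levels (?X k)) i j - mscale (mscale (*)) (Y k $$ (i, j)) (idm {..?N} ep) = \<xi> g"
      by (rule finmat_eqI)
        (auto simp: \<xi>_def g fm_arg_def entry_swap_levels entry_bidiagonal field_alg1.entry_mscale entry_idm)
    ultimately show "fm_arg (mscale (*)) (idm ?J 1) Y (\<lambda>k. ?f (?X k)) g = flatten (\<xi> g)"
      unfolding fm_arg_def eJ by (simp add: g flip: ring_map_diff[OF ring_map_flatten] field_alg.flatten_mscale)
  qed
  ultimately obtain S where S: "corner (idm L (idm ?J 1)) S"
    "(idm L (idm ?J 1) - (\<Sum>g\<in>G. tens (mscale (*)) (A g) (flatten (\<xi> g)))) * S = idm L (idm ?J 1)"
    "?f V = tens (mscale (*)) D (idm ?J 1) + tens (mscale (*)) C (idm ?J 1) * (S * (\<Sum>g\<in>G. tens (mscale (*)) (B g) (flatten (\<xi> g))))"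
    unfolding realization_value_def fm_value_def arg by blast
  have r: "ring_map ?\<Psi>" by (rule ring_map_comp[OF ring_map_swap ring_map_unflatten])
  note r' = ring_map_mult[OF r] ring_map_add[OF r] ring_map_diff[OF r] ring_map_sum[OF r]
  have i: "?\<Psi> (idm L (idm ?J 1)) = idm {..?N} E"
    unfolding swap_idm[OF finite_lessThan J(1)] by (subst flatten_idm[OF finite_atMost p(1), symmetric]) simp
  have I: "?\<Psi> (tens (mscale (*)) F (idm ?J 1)) = idm {..?N} (idm p F)" for F
    unfolding eJ unflatten_swap_tens using p by (simp add: field_alg1.tens2_idm field_alg1.tens_idm)
  have t: "(\<Sum>g\<in>G. ?\<Psi> (tens (mscale (*)) (F g) (flatten (\<xi> g)))) =
      bidiagonal ?N (\<Sum>g\<in>G. tens (mscale (*)) (x g) (F g)) (\<lambda>t. case w t of (g, a, b) \<Rightarrow> single a b (F g))" for F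
  proof -
    have "(\<Sum>g\<in>G. ?\<Psi> (tens (mscale (*)) (F g) (flatten (\<xi> g)))) = (\<Sum>g\<in>G. bidiagonal ?N (tens (mscale (*)) (x g) (F g))
        (\<lambda>t. tens (mscale (*)) (entry (W (w t) (fst g)) (fst (snd g)) (snd (snd g))) (F g)))"
      unfolding unflatten_swap_tens tens2_def \<xi>_def by (simp add: mapm_bidiagonal)
    also have "\<dots> = bidiagonal ?N (\<Sum>g\<in>G. tens (mscale (*)) (x g) (F g)) (\<lambda>t. \<Sum>g\<in>G.
        tens (mscale (*)) (entry (W (w t) (fst g)) (fst (snd g)) (snd (snd g))) (F g))"
      by (rule sum_bidiagonal)
    also have "(\<lambda>t. \<Sum>g\<in>G. tens (mscale (*)) (entry (W (w t) (fst g)) (fst (snd g)) (snd (snd g))) (F g)) =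
        (\<lambda>t. case w t of (g, a, b) \<Rightarrow> single a b (F g))"
    proof
      fix t
      obtain g a b where g: "w t = (g, a, b)" by (metis surj_pair)
      show "(\<Sum>g\<in>G. tens (mscale (*)) (entry (W (w t) (fst g)) (fst (snd g)) (snd (snd g))) (F g)) = (case w t of (g, a, b) \<Rightarrow> single a b (F g))"
        using W_sum[of g a b F] w[of t] unfolding g by simp
    qed
    finally show ?thesis .
  qed
  define N where "N t = (case w t of (g, a, b) \<Rightarrow> single a b (A g))" for t
  define K where "K t = (case w t of (g, a, b) \<Rightarrow> single a b (B g))" for t
  have d: "idm {..?N} E - bidiagonal ?N y N = bidiagonal ?N (E - y) (\<lambda>t. - N t)" for y
    by (rule finmat_eqI) (simp add: entry_idm entry_bidiagonal)
  have c: "corner (idm {..?N} E) (?\<Psi> S)" using ring_map_corner[OF r S(1)] unfolding i .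
  have inv: "bidiagonal ?N LL (\<lambda>t. - N t) * ?\<Psi> S = idm {..?N} E"
    using arg_cong[OF S(2), of ?\<Psi>] unfolding r' i t N_def[symmetric] d .
  have "mapm swap_levels V = idm {..?N} (idm p D) + idm {..?N} (idm p C) * (?\<Psi> S * bidiagonal ?N \<beta> K)"
    using arg_cong[OF S(3), of ?\<Psi>] unfolding unflatten_swap_flatten_swap r' I t K_def .
  from arg_cong[OF this, of "\<lambda>y. entry y 0 ?N"]
  have "swap_levels (entry V 0 ?N) = idm p C * entry (?\<Psi> S * bidiagonal ?N \<beta> K) 0 ?N"
    by (simp add: entry_mapm ring_map_zero[OF ring_map_swap] entry_idm entry_idm_mult)
  also have "entry (?\<Psi> S * bidiagonal ?N \<beta> K) 0 ?N = foldr (\<lambda>t h. M * (N t * h)) [0..<n] (M * (N n * (M * \<beta>) + K n))"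
    by (rule bidiagonal_solve[OF M(1,3) c inv])
  also have "M * (N n * (M * \<beta>) + K n) = B' (w n)"
    by (simp add: B'_def N_def K_def add.commute split: prod.splits)
  also have "(\<lambda>t h. M * (N t * h)) = (\<lambda>t h. A' (w t) * h)"
    by (intro ext) (simp add: A'_def N_def mult.assoc split: prod.splits)
  finally show ?thesis .
qed

text \<open>The corresponding computation for the pencil of \<open>Q\<close>. Its input is constant,
  so the right-hand side has nothing above the diagonal, and the final factor \<open>bq\<close>
  arises from the pencil alone.\<close>

lemma linearization_moment:
  assumes w: "\<And>t. w t \<in> G'"
    and v: "EV (mscale (mscale (mscale (*)))) (idm {..Suc n} Es) (\<lambda>k. bidiagonal (Suc n) (PP k) (\<lambda>t. W (w t) k)) Q V"
  shows "single 0 0 (flatten (entry V 0 (Suc n))) = cq * foldr (\<lambda>t h. aq (w t) * h) [0..<n] (bq (w n))"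
proof -
  let ?N = "Suc n" and ?X = "\<lambda>k. bidiagonal (Suc n) (PP k) (\<lambda>t. W (w t) k)"
  have f0: "flatten 0 = (0 :: 'k finmat)" by (rule ring_map_zero[OF ring_map_flatten])
  have fX: "mapm flatten (?X k) = bidiagonal ?N (flatten (PP k)) (\<lambda>t. flatten (W (w t) k))" for k
    by (rule mapm_bidiagonal[where f = flatten, OF f0])
  have fE: "mapm flatten (idm {..?N} Es) = idm {..?N} eH"
    using p by (simp add: mapm_idm f0 flatten_idm)
  have "mapm flatten (mscale (mscale (mscale (*))) c y) = mscale (mscale (*)) c (mapm flatten y)" for c and y :: "'k finmat finmat finmat"
    by (rule finmat_eqI) (simp add: entry_mapm f0 field_alg1.entry_mscale field_alg2.entry_mscale field_alg.flatten_mscale)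
  from EV_hom[OF ring_map_mapm[OF ring_map_flatten] this v]
  have "EV (mscale (mscale (*))) (idm {..?N} eH) (\<lambda>k. mapm flatten (?X k)) Q (mapm flatten V)" unfolding fE .
  note lin_def' = field_alg2.linearizes_expr[OF _ this, unfolded linearizes_def pencil_at_def fX]
  have "idm {..?N} eH * idm {..?N} eH = idm {..?N} eH" by (simp add: idm_mult idem)
  from lin_def'[OF this] obtain S where S: "corner (idm (pc_set q) (idm {..?N} eH)) S"
    "(tens (mscale (mscale (*))) (pc_const q) (idm {..?N} eH) +
      (\<Sum>k\<in>UNIV. tens (mscale (mscale (*))) (pc_lin q k) (bidiagonal ?N (flatten (PP k)) (\<lambda>t. flatten (W (w t) k))))) * S =
        idm (pc_set q) (idm {..?N} eH)"
    "tens (mscale (mscale (*))) (pc_out q) (idm {..?N} eH) * (S * tens (mscale (mscale (*))) (pc_in q) (idm {..?N} eH)) =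
      single 0 0 (mapm flatten V)"
    by blast
  note r' = ring_map_mult[OF ring_map_swap] ring_map_add[OF ring_map_swap] ring_map_sum[OF ring_map_swap]
  have fs: "finite (pc_set q)" using field_alg1.pencil_wf_expr[of Q] by (simp add: pencil_wf_def)
  have i: "swap_levels (idm (pc_set q) (idm {..?N} eH)) = idm {..?N} Eq"
    by (rule swap_idm[OF fs]) simp
  have I: "swap_levels (tens (mscale (mscale (*))) F (idm {..?N} eH)) = idm {..?N} (tens (mscale (*)) F eH)" for F
    unfolding swap_tens_mscale by (simp add: mapm_idm)
  have t: "(\<Sum>k\<in>UNIV. swap_levels (tens (mscale (mscale (*))) (pc_lin q k) (bidiagonal ?N (flatten (PP k)) (\<lambda>t. flatten (W (w t) k))))) =
      bidiagonal ?N (\<Sum>k\<in>UNIV. tens (mscale (*)) (pc_lin q k) (flatten (PP k))) (\<lambda>t. lin (w t))"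
    unfolding swap_tens_mscale by (simp add: mapm_bidiagonal sum_bidiagonal W_lin[OF w])
  have d: "idm {..?N} y + bidiagonal ?N y' (\<lambda>t. lin (w t)) = bidiagonal ?N (y + y') (\<lambda>t. - (- lin (w t)))" for y y'
    by (rule finmat_eqI) (simp add: entry_idm entry_bidiagonal)
  have c: "corner (idm {..?N} Eq) (swap_levels S)" using ring_map_corner[OF ring_map_swap S(1)] unfolding i .
  have inv: "bidiagonal ?N \<Gamma> (\<lambda>t. - (- lin (w t))) * swap_levels S = idm {..?N} Eq"
    using arg_cong[OF S(2), of swap_levels] unfolding r' i I t d pencil_at_def .
  have b: "idm {..?N} \<beta>q = bidiagonal ?N \<beta>q (\<lambda>t. 0)" by (rule finmat_eqI) (simp add: entry_idm entry_bidiagonal)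
  have "swap_levels (single 0 0 (mapm flatten V)) = mapm (single 0 0) (mapm flatten V)"
    by (rule finmat_eqI, rule finmat_eqI) (simp add: entry_swap_levels entry_single entry_mapm f0)
  then have "mapm (single 0 0) (mapm flatten V) = idm {..?N} cq * (swap_levels S * bidiagonal ?N \<beta>q (\<lambda>t. 0))"
    using arg_cong[OF S(3), of swap_levels] unfolding r' I b by simp
  from arg_cong[OF this, of "\<lambda>y. entry y 0 ?N"]
  have "single 0 0 (flatten (entry V 0 ?N)) = cq * entry (swap_levels S * bidiagonal ?N \<beta>q (\<lambda>t. 0)) 0 ?N"
    by (simp add: entry_mapm f0 entry_idm_mult)
  also have "entry (swap_levels S * bidiagonal ?N \<beta>q (\<lambda>t. 0)) 0 ?N =
      foldr (\<lambda>t h. Gi * (- lin (w t) * h)) [0..<n] (Gi * (- lin (w n) * (Gi * \<beta>q) + 0))"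
    by (rule bidiagonal_solve[OF Gi(1,3) c inv])
  also have "Gi * (- lin (w n) * (Gi * \<beta>q) + 0) = bq (w n)"
    unfolding bq_def aq_def by (simp only: mult.assoc add_0_right)
  also have "(\<lambda>t h. Gi * (- lin (w t) * h)) = (\<lambda>t h. aq (w t) * h)"
    by (intro ext) (simp only: aq_def mult.assoc)
  finally show ?thesis .
qed

text \<open>Both sides are the upper right entry of the common value of \<open>R\<close> and
  \<open>Q\<close> at one block bidiagonal point, whose entries above the diagonal spell the word
  \<open>ws\<close> followed by \<open>g\<close>.\<close>

lemma moments:
  assumes ws: "set ws \<subseteq> G'" and g: "g \<in> G'"
  shows "single 0 0 (flatten (swap_levels (idm p C * foldr (\<lambda>g x. A' g * x) ws (B' g)))) =
    cq * foldr (\<lambda>g x. aq g * x) ws (bq g)"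
proof -
  define n where "n = length ws"
  \<comment> \<open>Position \<open>n\<close> carries the input letter \<open>g\<close>; repeating
    it beyond \<open>n\<close> makes \<open>w\<close> total with all values in the index set of
    directions.\<close>
  define w where "w t = (if t < n then ws ! t else g)" for t
  have w: "w t \<in> G'" for t using ws g by (auto simp: w_def n_def)
  have wn: "w n = g" by (simp add: w_def)
  have ws': "ws = map w [0..<n]"
    by (rule nth_equalityI) (auto simp: w_def n_def)
  have fold: "foldr (\<lambda>g x. F g * x) ws y = foldr (\<lambda>t x. F (w t) * x) [0..<n] y" for F :: "_ \<Rightarrow> 'k finmat finmat" and y
    unfolding ws' foldr_map by (simp add: o_def)
  obtain V where V: "EV (mscale (mscale (mscale (*)))) (idm {..Suc n} Es) (\<lambda>k. bidiagonal (Suc n) (PP k) (\<lambda>t. W (w t) k)) (Add R (Add R0 Q)) V"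
    using field_alg2.EV_bidiagonal[where W = "\<lambda>t k. W (w t) k" and n = "Suc n", OF idem(2) P_EV W_corner[OF w]] ..
  let ?J = "prod_encode ` ({..Suc n} \<times> p)"
  have J: "finite ?J" "?J \<noteq> {}" using p by auto
  have fe: "mapm flatten (swap_levels (idm {..Suc n} Es)) = idm {..<s} (idm ?J 1)"
    using p by (simp add: swap_idm mapm_idm ring_map_zero[OF ring_map_flatten] flatten_idm)
  have inj: "y = y'" if "mapm flatten (swap_levels y) = mapm flatten (swap_levels y')" for y y' :: "'k finmat finmat finmat"
  proof (rule finmat_eqI, rule finmat_eqI)
    fix t t' i j
    have *: "entry (mapm flatten (swap_levels v)) i j = flatten (entry (swap_levels v) i j)" for v :: "'k finmat finmat finmat"
      by (rule entry_mapm) (rule ring_map_zero[OF ring_map_flatten])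
    have "entry (swap_levels y) i j = entry (swap_levels y') i j"
      using arg_cong[OF that, of "\<lambda>v. entry v i j"] unfolding * flatten_inject .
    from arg_cong[OF this, of "\<lambda>v. entry v t t'"]
    show "entry (entry y t t') i j = entry (entry y' t t') i j" by (simp only: entry_swap_levels)
  qed
  obtain v where v: "EV (mscale (mscale (mscale (*)))) (idm {..Suc n} Es) (\<lambda>k. bidiagonal (Suc n) (PP k) (\<lambda>t. W (w t) k)) R v"
    "EV (mscale (mscale (mscale (*)))) (idm {..Suc n} Es) (\<lambda>k. bidiagonal (Suc n) (PP k) (\<lambda>t. W (w t) k)) Q v"
    by (rule common_value[OF J flatten_swap_hom inj fe V])
  show ?thesis
    unfolding fold wn[symmetric] realization_moment[OF w v(1), symmetric] swap_swap
    by (rule linearization_moment[OF w v(2)])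
qed

end

section \<open>The main comparison\<close>

text \<open>The pencil of \<open>Q\<close> delivers its value as a single outer entry over the
  merged index set \<open>H\<close>. Multiplication by \<open>scatter\<close> on the left and
  \<open>gather\<close> on the right redistributes it to outer level \<open>p\<close> and inner
  level \<open>s\<close>, the shape of the value of the realization.\<close>

definition scatter :: "nat \<Rightarrow> nat set \<Rightarrow> 'b :: ring \<Rightarrow> 'b finmat finmat" where
  "scatter s p e = (\<Sum>y\<in>{..<s} \<times> p. single (snd y) 0 (single (fst y) (prod_encode y) e))"

definition gather :: "nat \<Rightarrow> nat set \<Rightarrow> 'b :: ring \<Rightarrow> 'b finmat finmat" where
  "gather s p e = (\<Sum>y\<in>{..<s} \<times> p. single 0 (snd y) (single (prod_encode y) (fst y) e))"

lemma corner_idm2_iff: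
  assumes "finite I" "finite J"
  shows "corner (idm I (idm J e)) v \<longleftrightarrow> (\<forall>i j a b. (i \<in> I \<and> j \<in> I \<and> a \<in> J \<and> b \<in> J \<longrightarrow> corner e (entry (entry v i j) a b)) \<and>
    (i \<notin> I \<or> j \<notin> I \<or> a \<notin> J \<or> b \<notin> J \<longrightarrow> entry (entry v i j) a b = 0))"
proof -
  have z: "m = 0 \<longleftrightarrow> (\<forall>a b. entry m a b = 0)" for m :: "'a finmat" by (auto intro: finmat_eqI)
  show ?thesis
    unfolding corner_idm_iff[OF assms(1)] corner_idm_iff[OF assms(2)] z by blast
qed

lemma scatter_gather:
  fixes e :: "'b :: ring"
  assumes p: "finite p" and v: "corner (idm {..<s} (idm p e)) v"
  shows "scatter s p e * single 0 0 (flatten v) * gather s p e = swap_levels v"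
proof (rule finmat_eqI, rule finmat_eqI)
  fix a a' i i'
  let ?T = "{..<s} \<times> p"
  have sg: "scatter s p e * single 0 0 (flatten v) * gather s p e =
      (\<Sum>y'\<in>?T. \<Sum>y\<in>?T. single (snd y) (snd y') (single (fst y) (prod_encode y) e * flatten v * single (prod_encode y') (fst y') e))"
    unfolding scatter_def gather_def by (simp add: sum_distrib_left sum_distrib_right single_mult)
  have "entry (entry (scatter s p e * single 0 0 (flatten v) * gather s p e) a a') i i' =
      (\<Sum>y'\<in>?T. \<Sum>y\<in>?T. entry (entry (single (snd y) (snd y') (single (fst y) (prod_encode y) e * flatten v * single (prod_encode y') (fst y') e)) a a') i i')"
    unfolding sg by (simp only: entry_sum)
  also have "\<dots> = (\<Sum>y'\<in>?T. if y' = (i', a') then (\<Sum>y\<in>?T. if y = (i, a) then e * entry (entry v i i') a a' * e else 0) else 0)"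
  proof (rule sum.cong[OF refl])
    fix y' assume "y' \<in> ?T"
    show "(\<Sum>y\<in>?T. entry (entry (single (snd y) (snd y') (single (fst y) (prod_encode y) e * flatten v * single (prod_encode y') (fst y') e)) a a') i i') =
        (if y' = (i', a') then (\<Sum>y\<in>?T. if y = (i, a) then e * entry (entry v i i') a a' * e else 0) else 0)"
    proof (cases "y' = (i', a')")
      case True
      then show ?thesis
        by (auto intro!: sum.cong simp: entry_single entry_mult_single entry_single_mult entry_flatten)
    next
      case False
      then have "entry (entry (single (snd y) (snd y') (single (fst y) (prod_encode y) e * flatten v * single (prod_encode y') (fst y') e)) a a') i i' = 0" for y
        by (cases y') (auto simp: entry_single entry_mult_single)
      then show ?thesis using False by simp
    qed
  qed
  also have "\<dots> = entry (entry (swap_levels v) a a') i i'"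
    using v p unfolding corner_idm2_iff[OF finite_lessThan p] entry_swap_levels
    by (auto simp: corner_def)
  finally show "entry (entry (scatter s p e * single 0 0 (flatten v) * gather s p e) a a') i i' = entry (entry (swap_levels v) a a') i i'" .
qed

lemma entry_sum_singles:
  assumes "finite I" "finite J"
  shows "entry (\<Sum>(i, j)\<in>I \<times> J. single i j (f i j)) a b = (if a \<in> I \<and> b \<in> J then f a b else 0)"
proof -
  have "entry (\<Sum>(i, j)\<in>I \<times> J. single i j (f i j)) a b = (\<Sum>y\<in>I \<times> J. if y = (a, b) then f a b else 0)"
    unfolding entry_sum by (rule sum.cong) (auto simp: entry_single split: if_splits)
  then show ?thesis using assms by simp
qed

section \<open>Levels of scalar matrices tensored with the target algebra\<close>

context kalg
begin

lemma tens2_tens: "tens2 scale (tens (mscale (*)) F y) z = tens (mscale scale) F (tens scale y z)"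
proof -
  interpret m: kalg "mscale scale" by (rule kalg_mscale)
  show ?thesis
    by (rule finmat_eqI, rule finmat_eqI)
      (simp add: entry_tens2 entry_tens m.entry_tens entry_mscale field_alg1.entry_tens field_alg.entry_mscale scale_scale)
qed

lemma flatten_tens2: "flatten (tens2 scale y z) = tens scale (flatten y) z"
  by (rule finmat_eqI) (simp add: entry_flatten entry_tens2 entry_tens)

lemma swap_tens2: "swap_levels (tens2 scale y z) = tens2 scale (swap_levels y) z"
  by (rule finmat_eqI, rule finmat_eqI) (simp add: entry_swap_levels entry_tens2 entry_tens)

lemma tens2_scatter: "tens2 scale (scatter s p 1) e = scatter s p e" "tens2 scale (gather s p 1) e = gather s p e"
  unfolding scatter_def gather_def by (simp_all add: tens2_sum_left tens2_single tens_single scale_one)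

lemma tens_scale_right: "tens scale F (scale c y) = mscale scale c (tens scale F y)"
  by (rule finmat_eqI) (simp add: entry_tens entry_mscale scale_scale mult.commute)

end

context comparison_inverses
begin

lemma wfq: "finite (pc_set q)" "corner (idm (pc_set q) 1) (pc_lin q k)"
    "pc_out q * idm (pc_set q) 1 = pc_out q" "idm (pc_set q) 1 * pc_in q = pc_in q"
  using field_alg1.pencil_wf_expr[of Q] by (simp_all add: pencil_wf_def)

lemma Eq_tens: "Eq = tens (mscale (*)) (idm (pc_set q) 1) eH"
  by (simp add: field_alg1.tens_idm wfq)

lemma recentring: "recentring G A B C L p x M LL E u A' B' G'"
  by (rule recentring.intro)
    (use finG p M x_corner map_entries_corner[OF real] in \<open>auto simp: A'_def B'_def\<close>)

lemma aq_corner: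
  assumes "g \<in> G'"
  shows "corner Eq (aq g)"
proof -
  obtain k i j a b where g: "g = ((k, i, j), a, b)" "j < s" "b \<in> p" using assms by (auto simp: fm_index_def)
  have "single (prod_encode (i, a)) (prod_encode (j, b)) 1 * eH = single (prod_encode (i, a)) (prod_encode (j, b)) 1"
    by (rule mult_idm_eqI) (use g p in \<open>auto simp: entry_single\<close>)
  then have "lin g * Eq = lin g"
    unfolding Eq_tens g lin_def using corner_right[OF wfq(2)] by (simp add: field_alg1.tens_mult)
  then show ?thesis
    unfolding corner_def aq_def using Gi(1)
    by (simp add: mult.assoc corner_left' flip: minus_mult_left) 
qed

lemma bq_left: "g \<in> G' \<Longrightarrow> Eq * (bq g * y) = bq g * y"
  unfolding bq_def by (simp only: mult.assoc assoc_left[OF corner_left[OF aq_corner]])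

lemma cq_right: "cq * Eq = cq"
  unfolding Eq_tens by (simp add: field_alg1.tens_mult wfq idem)

lemma moments_corner:
  assumes g: "g \<in> G'"
  shows "corner (idm p (idm {..<s} 1)) (idm p C * foldr (\<lambda>g x. A' g * x) ws (B' g))"
proof -
  note me = map_entries_corner[OF real]
  obtain h a b where h: "g = (h, a, b)" "b \<in> p" using g by auto
  have "\<beta> * idm p (idm {..<s} 1) = \<beta>"
    unfolding field_alg1.tens_idm[OF p(1), symmetric] sum_distrib_right field_alg1.tens_mult me(3)
    by (intro sum.cong refl) (simp add: corner_right[OF x_corner])
  moreover have "single a b (B h) * idm p (idm {..<s} 1) = single a b (B h)"
    by (rule mult_idm_eqI) (use h p me(3) in \<open>auto simp: entry_single\<close>)
  ultimately have "B' g * idm p (idm {..<s} 1) = B' g"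
    unfolding h B'_def by (simp add: distrib_left distrib_right mult.assoc)
  then have "foldr (\<lambda>g x. A' g * x) ws (B' g) * idm p (idm {..<s} 1) = foldr (\<lambda>g x. A' g * x) ws (B' g)"
    by (simp flip: foldr_mult_right)
  moreover have "idm p (idm {..<s} 1) * idm p C = idm p C" using p me(5) by (simp add: idm_mult)
  ultimately show ?thesis unfolding corner_def by (simp add: mult.assoc flip: mult.assoc[of "idm p (idm {..<s} 1)"])
qed

text \<open>Realization and pencil, both recentred at the common scalar point, are compared by
  \<open>subquotient\<close> at the point \<open>X0\<close> tensored with the unit on
  \<open>p\<close>, which has the size of the centre. Undoing the recentring and taking one diagonal
  entry over \<open>p\<close> gives the statement at \<open>X0\<close> itself.\<close>

lemma comparison_value:
  fixes scale :: "'k \<Rightarrow> 'b :: ring \<Rightarrow> 'b"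
  assumes "kalg scale" and e: "sfin_all e" and v0: "EV (mscale scale) (idm {..<s} e) X0 Q v0"
    and ctr: "idm L 1 \<in> ctr G A B" and obs: "idm L 1 \<in> obs G A C"
    and vP: "EV (mscale (mscale (*))) Es PP Q vP"
    and sP: "swap_levels vP = idm p D + idm p C * u" and lP: "cq * (Gi * \<beta>q) = single 0 0 (flatten vP)"
  shows "realization_value scale e s Y \<R> X0 v0"
proof -
  interpret kalg scale by fact
  interpret m: kalg "mscale scale" by (rule kalg_mscale)
  interpret mm: kalg "mscale (mscale scale)" by (rule m.kalg_mscale)
  let ?t = "tens2 scale" and ?X = "\<lambda>k. mapm (idm p) (X0 k)"
  note ee = sfin_all_idem[OF e]
  define y where "y = fm_arg scale e Y X0"
  \<comment> \<open>Coordinates of the point relative to the new centre. Both \<open>y\<close> and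
    \<open>x\<close> are differences from \<open>Y\<close>, which cancels.\<close>
  define z where "z = (\<lambda>(g, a, b). (if a = b then y g else 0) - scale (entry (x g) a b) e)"
  have y: "corner e (y g)" if "g \<in> G" for g
    unfolding y_def by (rule fm_arg_corner[OF kalg_axioms ee m.EV_arg_corner[OF v0] that])
  then have z: "corner e (z g)" if "g \<in> G'" for g
    using that by (auto simp: z_def intro!: corner_diff corner_scale corner_self ee)
  have ez: "e * z g = z g" "z g * e = z g" if "g \<in> G'" for g using z[OF that] by (auto simp: corner_def)
  have idp0: "idm p 0 = (0 :: 'b finmat)" by (rule finmat_eqI) (simp add: entry_idm p)
  have X0c: "corner (idm {..<s} e) (X0 k)" for k by (rule m.EV_arg_corner[OF v0])
  have P0c: "corner ep (P0 k)" for k by (rule field_alg1.EV_arg_corner[OF EVz])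
  define eb where "eb = idm H e"
  have eb: "tens scale eH e = eb" "eb * eb = eb" unfolding eb_def using finH by (simp_all add: tens_idm idm_mult ee)
  let ?Eb = "idm (pc_set q) eb"
  have Eb: "?t Eq e = ?Eb" by (simp only: tens2_idm[OF wfq(1)] eb)
  define vX where "vX = mapm (idm p) v0"
  have h: "mapm (idm p) (mscale scale c w) = mscale (mscale scale) c (mapm (idm p) w)" for c w
    by (rule finmat_eqI, rule finmat_eqI)
      (auto simp: entry_mapm idp0 entry_mscale m.entry_mscale entry_idm p)
  have "EV (mscale (mscale scale)) (mapm (idm p) (idm {..<s} e)) ?X Q vX"
    unfolding vX_def by (rule EV_hom[OF ring_map_mapm[OF ring_map_idm[OF p(1)]] h v0])
  from EV_hom[OF ring_map_flatten flatten_mscale this]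
  have "EV (mscale scale) (flatten (mapm (idm p) (idm {..<s} e))) (\<lambda>k. flatten (?X k)) Q (flatten vX)" .
  moreover have "flatten (mapm (idm p) (idm {..<s} e)) = eb"
    unfolding eb_def using p by (simp add: mapm_idm idp0 flatten_idm)
  ultimately have EVX: "EV (mscale scale) eb (\<lambda>k. flatten (?X k)) Q (flatten vX)" by simp
  from m.linearizes_expr[OF eb(2) this] obtain Sx where Sx: "corner ?Eb Sx"
    "pencil_at (mscale scale) eb (\<lambda>k. flatten (?X k)) q * Sx = ?Eb" "Sx * pencil_at (mscale scale) eb (\<lambda>k. flatten (?X k)) q = ?Eb"
    "tens (mscale scale) (pc_out q) eb * (Sx * tens (mscale scale) (pc_in q) eb) = single 0 0 (flatten vX)"
    unfolding linearizes_def by blast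
  define GX where "GX = pencil_at (mscale scale) eb (\<lambda>k. flatten (?X k)) q"
  define Gb gi bb cb where "Gb = ?t \<Gamma> e" and "gi = ?t Gi e" and "bb = ?t \<beta>q e" and "cb = ?t cq e"
  define ZL where "ZL = (\<Sum>g\<in>G'. ?t (lin g) (z g))"
  have \<Delta>: "(\<Sum>(i, j)\<in>{..<s} \<times> {..<s}. \<Sum>(a, b)\<in>p \<times> p. single (prod_encode (i, a)) (prod_encode (j, b)) (z ((k, i, j), a, b))) =
      flatten (?X k) - tens scale (flatten (PP k)) e" for k
  proof -
    have "(\<Sum>(i, j)\<in>{..<s} \<times> {..<s}. single i j (\<Sum>(a, b)\<in>p \<times> p. single a b (z ((k, i, j), a, b)))) = ?X k - ?t (PP k) e"
    proof (rule finmat_eqI, rule finmat_eqI)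
      fix i j a b
      have "entry (entry (\<Sum>(i, j)\<in>{..<s} \<times> {..<s}. single i j (\<Sum>(a, b)\<in>p \<times> p. single a b (z ((k, i, j), a, b)))) i j) a b =
          (if i < s \<and> j < s \<and> a \<in> p \<and> b \<in> p then z ((k, i, j), a, b) else 0)"
        by (auto simp: entry_sum_singles p simp del: entry_sum)
      moreover have "entry (entry (?X k - ?t (PP k) e) i j) a b =
          (if a = b \<and> a \<in> p then entry (X0 k) i j else 0) - (if i = j \<and> i < s then scale (entry (P0 k) a b) e else 0)"
        by (auto simp: entry_mapm idp0 entry_tens2 entry_tens entry_idm p)
      moreover have "z ((k, i, j), a, b) = (if a = b then entry (X0 k) i j else 0) - (if i = j then scale (entry (P0 k) a b) e else 0)"
        if "i < s" "j < s" "a \<in> p" "b \<in> p"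
        using that by (auto simp: z_def y_def fm_arg_def entry_idm p field_alg.entry_mscale scale_diff_left)
      moreover have "entry (X0 k) i j = 0" if "\<not> i < s \<or> \<not> j < s"
        using X0c[of k] that by (auto simp: corner_idm_iff)
      moreover have "entry (P0 k) a b = 0" if "a \<notin> p \<or> b \<notin> p"
        using P0c[of k] that by (auto simp: corner_idm_iff p)
      ultimately show "entry (entry (\<Sum>(i, j)\<in>{..<s} \<times> {..<s}. single i j (\<Sum>(a, b)\<in>p \<times> p. single a b (z ((k, i, j), a, b)))) i j) a b =
          entry (entry (?X k - ?t (PP k) e) i j) a b"
        by auto
    qed
    from arg_cong[OF this, of flatten] show ?thesis
      by (simp add: ring_map_sum[OF ring_map_flatten] ring_map_diff[OF ring_map_flatten] flatten_tens2
        single_sum flatten_single case_prod_beta)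
  qed
  have "ZL = (\<Sum>k\<in>UNIV. tens (mscale scale) (pc_lin q k) (flatten (?X k) - tens scale (flatten (PP k)) e))"
  proof -
    have "ZL = (\<Sum>g\<in>G. \<Sum>h\<in>p \<times> p. ?t (lin (g, h)) (z (g, h)))"
      unfolding ZL_def by (simp add: sum.cartesian_product case_prod_beta)
    also have "\<dots> = (\<Sum>k\<in>UNIV. \<Sum>(i, j)\<in>{..<s} \<times> {..<s}. \<Sum>h\<in>p \<times> p. ?t (lin ((k, i, j), h)) (z ((k, i, j), h)))"
      by (rule sum_fm_index)
    also have "\<dots> = (\<Sum>k\<in>UNIV. tens (mscale scale) (pc_lin q k) (flatten (?X k) - tens scale (flatten (PP k)) e))"
      unfolding \<Delta>[symmetric] m.tens_sum_right
      by (intro sum.cong refl)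
        (auto simp: lin_def tens2_tens tens_single scale_one m.tens_sum_right case_prod_beta intro!: sum.cong)
    finally show ?thesis .
  qed
  then have GX: "GX = Gb + ZL"
    unfolding GX_def Gb_def pencil_at_def
    by (simp add: tens2_add_left tens2_sum_left tens2_tens eb m.tens_diff_right sum_subtractf)
  have gG: "gi * Gb = ?Eb" "Gb * gi = ?Eb" unfolding gi_def Gb_def tens2_mult Gi ee Eb by rule+
  have "corner Eq \<Gamma>"
    by (rule field_alg1.pencil_at_corner[OF field_alg1.pencil_wf_expr idem(3)])
      (rule field_alg1.EV_arg_corner[OF EV_hom[OF ring_map_flatten field_alg.flatten_mscale vP, unfolded flatten_idm[OF finite_lessThan p(1)]]])
  then have cGb: "corner ?Eb Gb" "corner ?Eb gi"
    using Gi(1) unfolding Eb[symmetric] Gb_def gi_def corner_def tens2_mult by (simp_all add: ee)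
  have cGX: "corner ?Eb GX"
    unfolding GX_def
    by (rule m.pencil_at_corner[OF m.pencil_wf_expr eb(2)])
      (rule m.EV_arg_corner[OF EVX])
  note Sx = Sx[folded GX_def]
  have aq: "(\<Sum>g\<in>G'. ?t (aq g) (z g)) = - (gi * ZL)"
  proof -
    have "?t (aq g) (z g) = - (gi * ?t (lin g) (z g))" if "g \<in> G'" for g
      unfolding gi_def tens2_mult aq_def by (simp add: ez[OF that] tens2_uminus_left)
    then have "(\<Sum>g\<in>G'. ?t (aq g) (z g)) = (\<Sum>g\<in>G'. - (gi * ?t (lin g) (z g)))"
      by (rule sum.cong[OF refl])
    then show ?thesis unfolding ZL_def by (simp add: sum_distrib_left sum_negf)
  qed
  \<comment> \<open>The recentred pencil of \<open>Q\<close> is its actual pencil \<open>GX\<close>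
    multiplied by the inverse at the centre. So \<open>Q\<close> being defined at the point provides
    the inverse \<open>RR\<close> that \<open>subquotient\<close> asks for.\<close>
  have PA: "?t Eq e - (\<Sum>g\<in>G'. ?t (aq g) (z g)) = gi * GX"
    unfolding aq Eb GX by (simp add: distrib_left gG)
  define RR where "RR = Sx * Gb"
  have EEb: "?Eb * ?Eb = ?Eb" using wfq(1) eb(2) by (simp add: idm_mult)
  have cR: "corner ?Eb RR" unfolding RR_def by (rule corner_mult[OF Sx(1) cGb(1)])
  have R1: "gi * GX * RR = ?Eb"
    unfolding RR_def by (simp only: mult.assoc assoc_left[OF Sx(2)] corner_left[OF cGb(1)] gG)
  have R2: "RR * (gi * GX) = ?Eb"
    unfolding RR_def by (simp only: mult.assoc assoc_left[OF gG(2)] corner_left[OF cGX] Sx)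
  let ?ga = "gather s p (1 :: 'k)" and ?sc = "scatter s p (1 :: 'k)"
  interpret rec: recentring G A B C L p x M LL E u A' B' G' by (rule recentring)
  have mom: "idm p C * foldr (\<lambda>g x. A' g * x) ws (B' g) = ?sc * cq * foldr (\<lambda>g x. aq g * x) ws (bq g * ?ga)"
    if "set ws \<subseteq> G'" "g \<in> G'" for ws g
  proof -
    let ?U = "idm p C * foldr (\<lambda>g x. A' g * x) ws (B' g)"
    have "corner (idm {..<s} ep) (swap_levels ?U)"
      using ring_map_corner[OF ring_map_swap moments_corner[OF that(2)]] p by (simp add: swap_idm)
    from scatter_gather[OF p(1) this] have "?U = ?sc * single 0 0 (flatten (swap_levels ?U)) * ?ga" by simp
    then show ?thesis unfolding moments[OF that] foldr_mult_right by (simp only: mult.assoc)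
  qed
  have "\<exists>S. corner (?t E e) S \<and> (?t E e - (\<Sum>g\<in>G'. ?t (A' g) (z g))) * S = ?t E e \<and>
      S * (?t E e - (\<Sum>g\<in>G'. ?t (A' g) (z g))) = ?t E e \<and>
      ?t (idm p C) e * (S * (\<Sum>g\<in>G'. ?t (B' g) (z g))) = ?t (?sc * cq) e * (RR * (\<Sum>g\<in>G'. ?t (bq g * ?ga) (z g)))"
  proof (rule subquotient[where A = A' and B = B' and C = "idm p C" and a = aq and b = "\<lambda>g. bq g * ?ga" and c = "?sc * cq"
        and G = G' and z = z and R = RR, OF p(1) finite_lessThan wfq(1) finH(1) rec.A'_corner rec.B'_left _ aq_corner bq_left _
        rec.controllable_recentred[OF ctr] rec.observable_recentred[OF obs] mom e z])
    show "idm p C * E = idm p C" using p map_entries_corner(4)[OF real] by (simp add: idm_mult)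
    show "?sc * cq * Eq = ?sc * cq" by (simp only: mult.assoc cq_right)
    show "corner (?t Eq e) RR" unfolding Eb by (rule cR)
    show "(?t Eq e - (\<Sum>g\<in>G'. ?t (aq g) (z g))) * RR = ?t Eq e" unfolding PA R1 by (rule Eb[symmetric])
    show "RR * (?t Eq e - (\<Sum>g\<in>G'. ?t (aq g) (z g))) = ?t Eq e" unfolding PA R2 by (rule Eb[symmetric])
  qed
  then obtain S where S: "corner (?t E e) S" "(?t E e - (\<Sum>g\<in>G'. ?t (A' g) (z g))) * S = ?t E e"
      "S * (?t E e - (\<Sum>g\<in>G'. ?t (A' g) (z g))) = ?t E e"
      and Sv: "?t (idm p C) e * (S * (\<Sum>g\<in>G'. ?t (B' g) (z g))) = ?t (?sc * cq) e * (RR * (\<Sum>g\<in>G'. ?t (bq g * ?ga) (z g)))"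
    by blast
  \<comment> \<open>Replacing the sum of the \<open>aq\<close> by the unit minus
    \<open>gi GX\<close> makes the solution telescope: what remains is the solution at the point
    minus the one at the centre.\<close>
  have "(\<Sum>g\<in>G'. ?t (bq g * ?ga) (z g)) = (\<Sum>g\<in>G'. ?t (aq g) (z g)) * (gi * (bb * gather s p e))"
  proof -
    have "?t (bq g * ?ga) (z g) = ?t (aq g) (z g) * (gi * (bb * gather s p e))" if "g \<in> G'" for g
      unfolding gi_def bb_def tens2_scatter[symmetric] tens2_mult bq_def by (simp add: ee ez[OF that] mult.assoc)
    then show ?thesis unfolding sum_distrib_right by (rule sum.cong[OF refl])
  qed
  also have "(\<Sum>g\<in>G'. ?t (aq g) (z g)) = ?Eb - gi * GX" using PA[unfolded Eb] by (simp add: algebra_simps)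
  finally have "RR * (\<Sum>g\<in>G'. ?t (bq g * ?ga) (z g)) = (RR * ?Eb - RR * (gi * GX)) * (gi * (bb * gather s p e))"
    by (simp only: mult.assoc right_diff_distrib left_diff_distrib)
  also have "\<dots> = (Sx * bb - gi * bb) * gather s p e"
    unfolding R2 corner_right[OF cR] unfolding RR_def left_diff_distrib
    by (simp only: mult.assoc assoc_left[OF gG(2)] assoc_left[OF corner_left[OF cGb(2)]] assoc_left[OF corner_right[OF Sx(1)]])
  finally have "?t (?sc * cq) e * (RR * (\<Sum>g\<in>G'. ?t (bq g * ?ga) (z g))) =
      scatter s p e * (cb * (Sx * bb) - cb * (gi * bb)) * gather s p e"
    unfolding cb_def tens2_scatter[symmetric] by (simp add: ee mult.assoc left_diff_distrib right_diff_distrib flip: tens2_mult[where y = e and z = e, unfolded ee])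
  also have "cb * (Sx * bb) = single 0 0 (flatten vX)"
    unfolding cb_def bb_def tens2_tens eb by (rule Sx(4))
  also have "cb * (gi * bb) = single 0 0 (flatten (?t vP e))"
    using arg_cong[OF lP, of "\<lambda>w. ?t w e"] unfolding cb_def gi_def bb_def tens2_mult ee tens2_single flatten_tens2 .
  also have "scatter s p e * (single 0 0 (flatten vX) - single 0 0 (flatten (?t vP e))) * gather s p e = swap_levels vX - swap_levels (?t vP e)"
  proof -
    have "corner (idm {..<s} (idm p e)) vX"
      using ring_map_corner[OF ring_map_mapm[OF ring_map_idm[OF p(1)]] m.EV_corner[OF _ v0]] ee
      unfolding vX_def by (simp add: mapm_idm idp0 idm_mult)
    note sX = scatter_gather[OF p(1) this]
    have "corner (idm {..<s} (idm p e)) (?t vP e)"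
      using field_alg2.EV_corner[OF idem(2) vP] p
      by (simp add: corner_def tens2_mult ee flip: tens_idm tens2_idm)
    from scatter_gather[OF p(1) this] show ?thesis
      by (simp only: left_diff_distrib right_diff_distrib sX)
  qed
  also have "swap_levels vX = idm p v0"
    by (rule finmat_eqI, rule finmat_eqI) (auto simp: vX_def entry_swap_levels entry_mapm idp0 entry_idm p)
  also have "swap_levels (?t vP e) = idm p (tens scale D e) + idm p (tens scale C e) * ?t u e"
    unfolding swap_tens2 sP tens2_add_left
    by (simp add: tens2_idm p ee flip: tens2_mult[where y = e and z = e, unfolded ee])
  finally have val: "idm p (tens scale C e) * (S * (\<Sum>g\<in>G'. ?t (B' g) (z g))) =
      idm p v0 - (idm p (tens scale D e) + idm p (tens scale C e) * ?t u e)"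
    using Sv p by (simp add: tens2_idm)
  define LX where "LX = idm L e - (\<Sum>g\<in>G. tens scale (A g) (y g))"
  define bX where "bX = (\<Sum>g\<in>G. tens scale (B g) (y g))"
  define LLb Mb where "LLb = ?t LL e" and "Mb = ?t M e"
  have Eb1: "?t E e = idm p (idm L e)" using p by (simp add: tens2_idm tens_idm)
  have K: "(\<Sum>(g, a, b)\<in>G'. single a b (tens scale (F g) (z (g, a, b)))) =
      idm p (\<Sum>g\<in>G. tens scale (F g) (y g)) - ?t (\<Sum>g\<in>G. tens (mscale (*)) (x g) (F g)) e" for F
  proof -
    have "(\<Sum>(a, b)\<in>p \<times> p. single a b (tens scale (F g) (z (g, a, b)))) =
        idm p (tens scale (F g) (y g)) - ?t (tens (mscale (*)) (x g) (F g)) e" if "g \<in> G" for g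
    proof (rule finmat_eqI)
      fix a b
      have m: "tens scale (mscale (*) c (F g)) e = mscale scale c (tens scale (F g) e)" for c
        by (rule finmat_eqI) (simp add: entry_tens entry_mscale field_alg.entry_mscale scale_scale)
      have "entry (\<Sum>(a, b)\<in>p \<times> p. single a b (tens scale (F g) (z (g, a, b)))) a b =
          (if a \<in> p \<and> b \<in> p then tens scale (F g) (z (g, a, b)) else 0)"
        by (rule entry_sum_singles[OF p(1) p(1)])
      moreover have "entry (idm p (tens scale (F g) (y g)) - ?t (tens (mscale (*)) (x g) (F g)) e) a b =
          (if a = b \<and> a \<in> p then tens scale (F g) (y g) else 0) - mscale scale (entry (x g) a b) (tens scale (F g) e)"
        by (simp add: entry_idm p entry_tens2 field_alg1.entry_tens m)
      moreover have "tens scale (F g) (z (g, a, b)) =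
          (if a = b then tens scale (F g) (y g) else 0) - mscale scale (entry (x g) a b) (tens scale (F g) e)"
        by (simp add: z_def tens_diff_right tens_scale_right)
      moreover have "entry (x g) a b = 0" if "a \<notin> p \<or> b \<notin> p"
        using x_corner[OF \<open>g \<in> G\<close>] that by (auto simp: corner_idm_iff p)
      ultimately show "entry (\<Sum>(a, b)\<in>p \<times> p. single a b (tens scale (F g) (z (g, a, b)))) a b =
          entry (idm p (tens scale (F g) (y g)) - ?t (tens (mscale (*)) (x g) (F g)) e) a b"
        by auto
    qed
    then have "(\<Sum>g\<in>G. \<Sum>(a, b)\<in>p \<times> p. single a b (tens scale (F g) (z (g, a, b)))) =
        (\<Sum>g\<in>G. idm p (tens scale (F g) (y g)) - ?t (tens (mscale (*)) (x g) (F g)) e)"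
      by (rule sum.cong[OF refl])
    then show ?thesis
      by (simp add: sum.cartesian_product case_prod_beta sum_subtractf tens2_sum_left ring_map_sum[OF ring_map_idm[OF p(1)]])
  qed
  have tz: "?t (w * single a b F) (z (g, a, b)) = ?t w e * single a b (tens scale F (z (g, a, b)))" if "(g, a, b) \<in> G'" for w a b F g
    by (simp only: tens2_single[symmetric] tens2_mult ez[OF that])
  have MLb: "Mb * LLb = idm p (idm L e)" "LLb * Mb = idm p (idm L e)"
    unfolding Mb_def LLb_def tens2_mult M ee Eb1 by rule+
  have A'z: "(\<Sum>g\<in>G'. ?t (A' g) (z g)) = Mb * (\<Sum>(g, a, b)\<in>G'. single a b (tens scale (A g) (z (g, a, b))))"
    unfolding sum_distrib_left Mb_def by (rule sum.cong) (auto simp: A'_def tz)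
  have cMb: "corner (idm p (idm L e)) Mb" "corner (idm p (idm L e)) LLb"
    using M(1) rec.LL_corner unfolding Mb_def LLb_def corner_def Eb1[symmetric] tens2_mult ee by simp_all
  have "LLb - (\<Sum>(g, a, b)\<in>G'. single a b (tens scale (A g) (z (g, a, b)))) = idm p LX"
    unfolding K LX_def LLb_def by (simp add: tens2_diff_left Eb1 ring_map_diff[OF ring_map_idm[OF p(1)]])
  moreover have "LLb * (\<Sum>g\<in>G'. ?t (A' g) (z g)) = (\<Sum>(g, a, b)\<in>G'. single a b (tens scale (A g) (z (g, a, b))))"
  proof -
    have "idm p (idm L e) * (\<Sum>(g, a, b)\<in>G'. single a b (tens scale (A g) (z (g, a, b)))) =
        (\<Sum>(g, a, b)\<in>G'. single a b (tens scale (A g) (z (g, a, b))))"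
      unfolding sum_distrib_left
    proof (rule sum.cong[OF refl])
      fix w assume w: "w \<in> G'"
      obtain g a b where g: "w = (g, a, b)" by (metis surj_pair)
      have "E * single a b (A g) = single a b (A g)"
        by (rule finmat_eqI)
          (use w g p corner_left[OF map_entries_corner(1)[OF real, of g]] in \<open>auto simp: entry_idm_mult entry_single\<close>)
      then show "idm p (idm L e) * (case w of (g, a, b) \<Rightarrow> single a b (tens scale (A g) (z (g, a, b)))) =
          (case w of (g, a, b) \<Rightarrow> single a b (tens scale (A g) (z (g, a, b))))"
        using tz[of g a b E "A g"] w g by (simp add: Eb1 tens2_single)
    qed
    then show ?thesis unfolding A'z by (simp add: assoc_left[OF MLb(2)])
  qed
  \<comment> \<open>Multiplication by the pencil at the scalar centre turns the recentred pencil of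
    the realization into copies of its original pencil at \<open>X0\<close>, one for each index in
    \<open>p\<close>.\<close>
  ultimately have LA: "LLb * (idm p (idm L e) - (\<Sum>g\<in>G'. ?t (A' g) (z g))) = idm p LX"
    by (simp add: right_diff_distrib corner_right[OF cMb(2)])
  note S = S[unfolded Eb1]
  define S2 where "S2 = S * Mb"
  have S2: "corner (idm p (idm L e)) S2" "idm p LX * S2 = idm p (idm L e)" "S2 * idm p LX = idm p (idm L e)"
    unfolding S2_def LA[symmetric]
    by (rule corner_mult[OF S(1) cMb(1)])
      (simp_all only: mult.assoc assoc_left[OF S(2)] assoc_left[OF MLb(1)] corner_left[OF cMb(1)] MLb
        assoc_left[OF corner_right[OF S(1)]] S(3))
  \<comment> \<open>The matrix \<open>idm p LX\<close> is diagonal over \<open>p\<close>, so any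
    diagonal entry of its inverse inverts \<open>LX\<close>.\<close>
  obtain a0 where a0: "a0 \<in> p" using p by blast
  define T where "T = entry S2 a0 a0"
  have T: "corner (idm L e) T" "LX * T = idm L e" "T * LX = idm L e"
    using S2(1) arg_cong[OF S2(2), of "\<lambda>w. entry w a0 a0"] arg_cong[OF S2(3), of "\<lambda>w. entry w a0 a0"] a0 p
    by (auto simp: T_def corner_idm_iff[OF p(1)] entry_idm_mult entry_mult_idm entry_idm)
  have B'z: "(\<Sum>g\<in>G'. ?t (B' g) (z g)) = Mb * (idm p bX - ?t \<beta> e) + (\<Sum>g\<in>G'. ?t (A' g) (z g)) * ?t u e"
  proof -
    have "?t (B' w) (z w) = Mb * (case w of (g, a, b) \<Rightarrow> single a b (tens scale (B g) (z (g, a, b)))) + ?t (A' w) (z w) * ?t u e"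
      if w: "w \<in> G'" for w
    proof -
      obtain g a b where g: "w = (g, a, b)" by (metis surj_pair)
      have Bw: "B' w = M * single a b (B g) + A' w * u"
        unfolding g B'_def A'_def by (simp add: distrib_left mult.assoc)
      have "?t (A' w * u) (z w) = ?t (A' w) (z w) * ?t u e" by (simp only: tens2_mult ez(2)[OF w])
      moreover have "?t (M * single a b (B g)) (z w) = Mb * single a b (tens scale (B g) (z (g, a, b)))"
        using tz[of g a b M "B g"] w unfolding g Mb_def by simp
      ultimately show ?thesis unfolding Bw tens2_add_left by (simp only: g prod.case)
    qed
    then have "(\<Sum>g\<in>G'. ?t (B' g) (z g)) = (\<Sum>w\<in>G'. Mb * (case w of (g, a, b) \<Rightarrow> single a b (tens scale (B g) (z (g, a, b)))) + ?t (A' w) (z w) * ?t u e)"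
      by (rule sum.cong[OF refl])
    then show ?thesis unfolding bX_def K[symmetric] by (simp add: sum.distrib sum_distrib_left sum_distrib_right)
  qed
  have uE: "?t u e = Mb * ?t \<beta> e" unfolding Mb_def tens2_mult ee ..
  have "S * (\<Sum>g\<in>G'. ?t (A' g) (z g)) = S - idm p (idm L e)"
    using S(3) by (simp add: right_diff_distrib corner_right[OF S(1)] algebra_simps)
  then have "S * (\<Sum>g\<in>G'. ?t (B' g) (z g)) = S2 * (idm p bX - ?t \<beta> e) + (S - idm p (idm L e)) * ?t u e"
    unfolding B'z S2_def by (simp only: distrib_left mult.assoc[symmetric])
  also have "\<dots> = S2 * idm p bX - ?t u e"
    unfolding uE S2_def left_diff_distrib right_diff_distrib mult.assoc assoc_left[OF corner_left[OF cMb(1)]] by simp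
  finally have Sm: "S * (\<Sum>g\<in>G'. ?t (B' g) (z g)) = S2 * idm p bX - ?t u e" .
  \<comment> \<open>Both sides of \<open>val\<close> are increments over the centre. Adding the
    value at the centre, on which both sides agree, leaves the values at the point.\<close>
  have solve: "v = d + r" if "r - c = v - (d + c)" for v d r c :: "'b finmat finmat"
    using that by (simp add: algebra_simps)
  have "idm p v0 = idm p (tens scale D e) + idm p (tens scale C e) * (S2 * idm p bX)"
    by (rule solve[OF val[unfolded Sm right_diff_distrib]])
  from arg_cong[OF this, of "\<lambda>w. entry w a0 a0"]
  have "v0 = tens scale D e + tens scale C e * (T * bX)"
    using a0 p by (simp add: entry_idm entry_idm_mult entry_mult_idm T_def)
  then show ?thesis
    unfolding realization_value_def fm_value_def using T unfolding LX_def bX_def y_def by blast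
qed

end

section \<open>Values at matrix points and over algebras\<close>

lemma nondegenerate_EV:
  fixes R :: "('d, 'k :: field) nc_expr"
  assumes "nondegenerate R"
  obtains J X v where "finite J" "J \<noteq> {}" "EV (mscale (*)) (idm J 1) X R v"
proof -
  obtain n X where n: "n \<ge> 1" "X \<in> expr_dom (matrix_algebra n) R"
    using assms unfolding nondegenerate_def by blast
  have "EV (mscale (*)) (idm ((\<lambda>i. i) ` {..<n}) 1) (\<lambda>k. of_mat (\<lambda>i. i) (\<lambda>i. i) (X k)) R (of_mat (\<lambda>i. i) (\<lambda>i. i) (expr_eval (matrix_algebra n) R X))"
    using alg_embedding.EV_of_dom[OF alg_embedding_mat[of "\<lambda>i. i" n] n(2)] by simp
  then show ?thesis using n(1) by (intro that[of "{..<n}"]) (auto simp: lessThan_empty_iff)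
qed

text \<open>Nondegeneracy provides one point for each of the three expressions, possibly of
  different sizes; two applications of \<open>common_point\<close> merge them into a point of all
  three domains, which becomes the new centre.\<close>

lemma minimal_value:
  fixes scale :: "'k :: field \<Rightarrow> 'b :: ring \<Rightarrow> 'b" and Y :: "'d :: finite \<Rightarrow> 'k mat"
  assumes min: "minimal_realization s Y \<R> R" and Y: "\<And>k. Y k \<in> carrier_mat s s" and s: "s \<ge> 1"
    and nd: "nondegenerate R" "nondegenerate R0" "nondegenerate Q"
    and eq: "evaluation_equivalent R0 R" "evaluation_equivalent R0 Q"
    and "kalg scale" "sfin_all e" and v: "EV (mscale scale) (idm {..<s} e) X Q v"
  shows "realization_value scale e s Y \<R> X v"
proof -
  obtain J1 X1 v1 J2 X2 v2 J3 X3 v3 where J: "finite J1" "J1 \<noteq> {}" "finite J2" "J2 \<noteq> {}" "finite J3" "J3 \<noteq> {}"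
    and ev: "EV (mscale (*)) (idm J1 1) X1 R v1" "EV (mscale (*)) (idm J2 1) X2 R0 v2" "EV (mscale (*)) (idm J3 1) X3 Q v3"
    using nd by (elim nondegenerate_EV)
  obtain J4 X4 v4 where J4: "finite J4" "J4 \<noteq> {}" "EV (mscale (*)) (idm J4 1) X4 (Add R0 Q) v4"
    by (rule common_point[OF J(3,5,4,6) ev(2,3)])
  obtain p P z where p: "finite p" "p \<noteq> {}" "EV (mscale (*)) (idm p 1) P (Add R (Add R0 Q)) z"
    by (rule common_point[OF J(1) J4(1) J(2) J4(2) ev(1) J4(3)])
  have real: "fm_realization s \<R>" "realizes s Y \<R> R" using min by (auto simp: minimal_realization_def realizes_def)
  interpret comparison s Y \<R> R R0 Q p P z
    by (rule comparison.intro[OF real(1) realizesD[OF real(2) Y] s p(1,2) eq p(3)])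
  obtain vP where vP: "EV (mscale (mscale (*))) Es PP R vP" "EV (mscale (mscale (*))) Es PP Q vP" by (rule P_value)
  obtain M where Mi: "corner E M" "LL * M = E" "M * LL = E" "swap_levels vP = idm p D + idm p C * (M * \<beta>)"
    using realization_at_centre[OF vP(1)] by blast
  obtain Gi where Gii: "corner Eq Gi" "\<Gamma> * Gi = Eq" "Gi * \<Gamma> = Eq" "cq * (Gi * \<beta>q) = single 0 0 (flatten vP)"
    using linearization_at_centre[OF vP(2)] by blast
  interpret comparison_inverses s Y \<R> R R0 Q p P z M Gi
    by unfold_locales (rule Mi Gii)+
  show ?thesis
    by (rule comparison_value[OF assms(9,10) v minimal_controllable[OF Y min] minimal_observable[OF Y min] vP(2) Mi(4) Gii(4)])
qed

text \<open>Matrix rings over a field are stably finite, so \<open>minimal_value\<close> applies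
  with all of them as targets.\<close>

lemma minimal_realizes:
  fixes Y :: "'d :: finite \<Rightarrow> 'k :: field mat"
  assumes min: "minimal_realization s Y \<R> R" and Y: "\<And>k. Y k \<in> carrier_mat s s" and s: "s \<ge> 1"
    and nd: "nondegenerate R" "nondegenerate R0" "nondegenerate Q"
    and eq: "evaluation_equivalent R0 R" "evaluation_equivalent R0 Q"
  shows "realizes s Y \<R> Q"
proof (rule realizesI[OF _ Y])
  show "fm_realization s \<R>" using min by (auto simp: minimal_realization_def realizes_def)
  show "nc_realizes s Y \<R> Q"
    unfolding nc_realizes_def
    using minimal_value[OF min Y s nd eq field_alg1.kalg_axioms sfin_all_field] by blast
qed

text \<open>In the numbering by \<open>block_index\<close>, the map sending \<open>F\<close> to
  \<open>s\<close> diagonal copies of \<open>F\<close> is a tensor product with a unit, hence a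
  homomorphism that transports domains and values.\<close>

lemma kronecker_one_dom:
  fixes Q :: "('d, 'k :: field) nc_expr"
  assumes Z: "Z \<in> expr_dom (matrix_algebra n) Q"
  shows "(\<lambda>k. kronecker (1\<^sub>m s) (Z k)) \<in> expr_dom (matrix_algebra (s * n)) Q"
    "expr_eval (matrix_algebra (s * n)) Q (\<lambda>k. kronecker (1\<^sub>m s) (Z k)) = kronecker (1\<^sub>m s) (expr_eval (matrix_algebra n) Q Z)"
proof -
  let ?i = "\<lambda>i :: nat. i" and ?e = "idm (id ` {..<s}) (1 :: 'k)"
  let ?b = "block_index n id" and ?f = "\<lambda>x. flatten (tens (mscale (*)) x ?e)"
  have inj: "inj_on ?b {..<s * n}" by (rule inj_block_index) simp
  have Zc: "Z k \<in> carrier_mat n n" for k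
    using alg_embedding.expr_dom_carrier[OF alg_embedding_mat[of ?i n] Z] by (simp add: module_mat_def)
  have E: "expr_eval (matrix_algebra n) Q Z \<in> carrier_mat n n"
    "EV (mscale (*)) (idm (?i ` {..<n}) 1) (\<lambda>k. of_mat ?i ?i (Z k)) Q (of_mat ?i ?i (expr_eval (matrix_algebra n) Q Z))"
    using alg_embedding.EV_of_dom[OF alg_embedding_mat[of ?i n] Z] by (simp_all add: module_mat_def)
  have f: "ring_map ?f"
    by (rule ring_map_comp[OF _ ring_map_flatten])
      (simp add: ring_map_def field_alg1.tens_mult field_alg1.tens_add_left idm_mult)
  have sc: "?f (mscale (*) c x) = mscale (*) c (?f x)" for c x
    by (rule finmat_eqI) (simp add: entry_flatten field_alg1.entry_tens field_alg.entry_mscale)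
  have kr: "of_mat ?b ?b (kronecker (1\<^sub>m s) F) = ?f (of_mat ?i ?i F)" if "F \<in> carrier_mat n n" for F :: "'k mat"
    by (rule of_mat_kronecker_one[OF that]) simp
  have one: "?f (idm (?i ` {..<n}) 1) = idm (?b ` {..<s * n}) 1"
    unfolding block_index_image by (simp add: field_alg1.tens_idm flatten_idm)
  have k: "kronecker (1\<^sub>m s) F \<in> carrier_mat (s * n) (s * n)" if "F \<in> carrier_mat n n" for F :: "'k mat"
    using that by (simp add: kronecker_def)
  have "EV (mscale (*)) (idm (?b ` {..<s * n}) 1) (\<lambda>k. of_mat ?b ?b (kronecker (1\<^sub>m s) (Z k))) Q (?f (of_mat ?i ?i (expr_eval (matrix_algebra n) Q Z)))"
    using EV_hom[where f = ?f, OF f sc E(2)] unfolding one kr[OF Zc] .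
  moreover have "kronecker (1\<^sub>m s) (Z k) \<in> carrier (matrix_algebra (s * n))" for k
    using k[OF Zc] by (simp add: module_mat_def)
  ultimately
  have *: "(\<lambda>k. kronecker (1\<^sub>m s) (Z k)) \<in> expr_dom (matrix_algebra (s * n)) Q"
    "?f (of_mat ?i ?i (expr_eval (matrix_algebra n) Q Z)) = of_mat ?b ?b (expr_eval (matrix_algebra (s * n)) Q (\<lambda>k. kronecker (1\<^sub>m s) (Z k)))"
    using alg_embedding.dom_of_EV[OF alg_embedding_mat[OF inj], where a = "\<lambda>k. kronecker (1\<^sub>m s) (Z k)"] by blast+
  show "(\<lambda>k. kronecker (1\<^sub>m s) (Z k)) \<in> expr_dom (matrix_algebra (s * n)) Q" by (rule *(1))
  have "expr_eval (matrix_algebra (s * n)) Q (\<lambda>k. kronecker (1\<^sub>m s) (Z k)) \<in> carrier_mat (s * n) (s * n)"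
    using alg_embedding.EV_of_dom[OF alg_embedding_mat[OF inj] *(1)] by (simp add: module_mat_def)
  then show "expr_eval (matrix_algebra (s * n)) Q (\<lambda>k. kronecker (1\<^sub>m s) (Z k)) = kronecker (1\<^sub>m s) (expr_eval (matrix_algebra n) Q Z)"
    using *(2) unfolding kr[OF E(1), symmetric] by (subst (asm) of_mat_inject[OF k[OF E(1)] _ inj inj]) simp_all
qed

text \<open>The upper left block of the Kronecker product is the second factor itself.\<close>

lemma kronecker_one_inject:
  assumes "F \<in> carrier_mat n n" "F' \<in> carrier_mat n n" "s \<ge> 1" "kronecker (1\<^sub>m s) F = kronecker (1\<^sub>m s) F'"
  shows "F = F'"
proof (rule eq_matI)
  fix i j assume ij: "i < dim_row F'" "j < dim_col F'"
  have "n \<le> s * n" using assms(3) by simp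
  moreover have "i < n" "j < n" using ij assms(2) by auto
  ultimately have "i < s * n" "j < s * n" by (simp_all only: less_le_trans)
  moreover have "0 < s" using assms(3) by simp
  ultimately show "F $$ (i, j) = F' $$ (i, j)"
    using arg_cong[OF assms(4), of "\<lambda>M. M $$ (i, j)"] ij assms(1,2) by (auto simp add: kronecker_def)
qed (use assms in auto)

lemma of_mat_tensor_elem:
  fixes scale :: "'k :: field \<Rightarrow> 'a :: ring_1 \<Rightarrow> 'a"
  assumes "kalg scale"
  shows "of_mat \<phi> \<psi> (tensor_elem scale F a) = tens scale (of_mat \<phi> \<psi> F) a"
proof -
  interpret kalg scale by fact
  show ?thesis
    unfolding of_mat_def tensor_elem_def
    by (simp add: tens_sum_left tens_single)
qed

text \<open>Coordinates with respect to matrix units are already the form in which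
  \<open>ext_algebra\<close> is defined, so the translation only has to place the matrices over the
  algebra into the ring of finite matrices.\<close>

lemma algebra_value:
  fixes scale :: "'k :: field \<Rightarrow> 'a :: ring_1 \<Rightarrow> 'a" and Y :: "'d :: finite \<Rightarrow> 'k mat"
  assumes sc: "kalg scale" and real: "fm_realization s \<R>" and Y: "\<And>k. Y k \<in> carrier_mat s s" and X: "\<And>k. X k \<in> carrier_mat s s"
    and w: "realization_value scale 1 s Y \<R> (\<lambda>k. of_mat (\<lambda>i. i) (\<lambda>i. i) (X k)) w"
  shows "X \<in> fm_DOM_alg scale s Y \<R>" "fm_eval_alg scale s Y \<R> X \<in> carrier_mat s s"
    "of_mat (\<lambda>i. i) (\<lambda>i. i) (fm_eval_alg scale s Y \<R> X) = w"
proof -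
  interpret kalg scale by fact
  let ?i = "\<lambda>i :: nat. i" and ?L = "fm_dim \<R>" and ?G = "fm_index s :: ('d \<times> nat \<times> nat) set"
  let ?x = "fm_arg scale 1 Y (\<lambda>k. of_mat (\<lambda>i. i) (\<lambda>i. i) (X k))"
  have ii: "inj_on ?i I" for I by simp
  have l: "linear_mat_map s ?L ?L (fm_A \<R> k)" "linear_mat_map s ?L s (fm_B \<R> k)"
    "fm_C \<R> \<in> carrier_mat s ?L" "fm_D \<R> \<in> carrier_mat s s" for k
    using real unfolding fm_realization_def by auto
  have x: "?x (k, i, j) = (X k - tensor_elem scale (Y k) 1) $$ (i, j)" if "i < s" "j < s" for k i j
    using that X[of k] Y[of k] entry_of_mat[OF X[of k] ii ii that] by (simp add: fm_arg_def tensor_elem_def)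
  have lin: "of_mat ?i ?i (sum_mats p q (\<lambda>k. ext_algebra scale s p q (F k) (X k - tensor_elem scale (Y k) 1)) UNIV) =
      (\<Sum>g\<in>?G. tens scale (map_entries s F g) (?x g))"
    if F: "\<And>k. linear_mat_map s p q (F k)" for F and p q :: nat
  proof -
    have T: "tensor_elem scale (F k (matrix_unit s i j)) y \<in> carrier_mat p q" for k i j y
      using linear_mat_map_carrier[OF F, of "matrix_unit s i j" k] by (simp add: tensor_elem_def)
    have "of_mat ?i ?i (sum_mats p q (\<lambda>k. ext_algebra scale s p q (F k) (X k - tensor_elem scale (Y k) 1)) UNIV) =
        (\<Sum>k\<in>UNIV. of_mat ?i ?i (ext_algebra scale s p q (F k) (X k - tensor_elem scale (Y k) 1)))"
      by (rule of_mat_sum_mats) (simp add: ext_algebra_def sum_mats_def)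
    also have "\<dots> = (\<Sum>k\<in>UNIV. \<Sum>(i, j)\<in>{..<s} \<times> {..<s}. tens scale (map_entries s F (k, i, j)) (?x (k, i, j)))"
    proof (rule sum.cong[OF refl])
      fix k
      have "of_mat ?i ?i (ext_algebra scale s p q (F k) (X k - tensor_elem scale (Y k) 1)) =
          (\<Sum>y\<in>{..<s} \<times> {..<s}. of_mat ?i ?i (case y of (i, j) \<Rightarrow> tensor_elem scale (F k (matrix_unit s i j)) ((X k - tensor_elem scale (Y k) 1) $$ (i, j))))"
        unfolding ext_algebra_def by (rule of_mat_sum_mats) (auto intro: T)
      also have "\<dots> = (\<Sum>(i, j)\<in>{..<s} \<times> {..<s}. tens scale (map_entries s F (k, i, j)) (?x (k, i, j)))"
        by (rule sum.cong[OF refl]) (auto simp only: x of_mat_tensor_elem[OF sc] map_entries_def fst_conv snd_conv prod.case mem_Times_iff lessThan_iff)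
      finally show "of_mat ?i ?i (ext_algebra scale s p q (F k) (X k - tensor_elem scale (Y k) 1)) =
          (\<Sum>(i, j)\<in>{..<s} \<times> {..<s}. tens scale (map_entries s F (k, i, j)) (?x (k, i, j)))" .
    qed
    also have "\<dots> = (\<Sum>g\<in>?G. tens scale (map_entries s F g) (?x g))" by (rule sum_fm_index[symmetric])
    finally show ?thesis .
  qed
  let ?P = "fm_pencil_alg scale s Y \<R> X" and ?Pf = "idm {..<?L} 1 - (\<Sum>g\<in>?G. tens scale (map_entries s (fm_A \<R>) g) (?x g))"
  let ?b = "sum_mats ?L s (\<lambda>k. ext_algebra scale s ?L s (fm_B \<R> k) (X k - tensor_elem scale (Y k) 1)) UNIV"
  let ?bf = "\<Sum>g\<in>?G. tens scale (map_entries s (fm_B \<R>) g) (?x g)"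
  have P: "?P \<in> carrier_mat ?L ?L"
    unfolding fm_pencil_alg_def Let_def by (rule minus_carrier_mat) (simp add: sum_mats_def)
  have one: "of_mat ?i ?i (1\<^sub>m ?L) = idm {..<?L} (1 :: 'a)" using of_mat_one[of ?i ?L] by simp
  have Pf: "of_mat ?i ?i ?P = ?Pf"
    unfolding fm_pencil_alg_def Let_def
    unfolding lin[OF l(1), symmetric] one[symmetric]
    by (rule of_mat_diff[of _ ?L ?L]) (simp_all add: sum_mats_def)
  obtain S where S: "corner (idm {..<?L} 1) S" "?Pf * S = idm {..<?L} 1" "S * ?Pf = idm {..<?L} 1"
    "w = tens scale (of_mat ?i ?i (fm_D \<R>)) 1 + tens scale (of_mat ?i ?i (fm_C \<R>)) 1 * (S * ?bf)"
    using w unfolding realization_value_def fm_value_def by blast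
  define N where "N = to_mat ?L ?L ?i ?i S"
  have N: "N \<in> carrier_mat ?L ?L" by (simp add: N_def)
  have Nf: "of_mat ?i ?i N = S"
    unfolding N_def by (rule of_mat_to_mat) (use S(1) in \<open>auto simp: corner_idm_iff\<close>)
  have "of_mat ?i ?i (?P * N) = of_mat ?i ?i (1\<^sub>m ?L)" "of_mat ?i ?i (N * ?P) = of_mat ?i ?i (1\<^sub>m ?L)"
    unfolding of_mat_mult[OF P N ii, symmetric] of_mat_mult[OF N P ii, symmetric] Nf Pf one by (rule S)+
  then have PN: "?P * N = 1\<^sub>m ?L" "N * ?P = 1\<^sub>m ?L"
    using of_mat_inject[OF mult_carrier_mat[OF P N] one_carrier_mat ii ii]
      of_mat_inject[OF mult_carrier_mat[OF N P] one_carrier_mat ii ii] by simp_all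
  then show "X \<in> fm_DOM_alg scale s Y \<R>"
    unfolding fm_DOM_alg_def Units_def using X P N by (auto simp: module_mat_def)
  have ev: "fm_eval_alg scale s Y \<R> X = tensor_elem scale (fm_D \<R>) 1 + tensor_elem scale (fm_C \<R>) 1 * N * ?b"
    unfolding fm_eval_alg_def Let_def inv_module_mat[OF P N PN] ..
  have c: "tensor_elem scale (fm_D \<R>) 1 \<in> carrier_mat s s" "tensor_elem scale (fm_C \<R>) 1 \<in> carrier_mat s ?L" "?b \<in> carrier_mat ?L s"
    using l(3,4) by (simp_all add: tensor_elem_def sum_mats_def)
  note cN = mult_carrier_mat[OF c(2) N]
  show "fm_eval_alg scale s Y \<R> X \<in> carrier_mat s s"
    unfolding ev by (rule add_carrier_mat[OF mult_carrier_mat[OF cN c(3)]])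
  show "of_mat ?i ?i (fm_eval_alg scale s Y \<R> X) = w"
    unfolding ev of_mat_add[OF c(1) mult_carrier_mat[OF cN c(3)]] of_mat_mult[OF cN c(3) ii, symmetric]
      of_mat_mult[OF c(2) N ii, symmetric] Nf lin[OF l(2)] of_mat_tensor_elem[OF sc] S(4)
    by (simp only: mult.assoc)
qed

text \<open>The definite description requires that all representatives defined at the point agree.
  In the theorem this agreement comes from the realization, whose value does not depend on the
  representative.\<close>

lemma fun_eval_eq:
  assumes "Q \<in> \<RR>" "a \<in> expr_dom \<A> Q"
    and "\<And>Q'. Q' \<in> \<RR> \<Longrightarrow> a \<in> expr_dom \<A> Q' \<Longrightarrow> expr_eval \<A> Q' a = expr_eval \<A> Q a"
  shows "fun_eval \<A> \<RR> a = expr_eval \<A> Q a"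
  unfolding fun_eval_def
proof (rule the_equality)
  show "\<exists>R\<in>\<RR>. a \<in> expr_dom \<A> R \<and> expr_eval \<A> Q a = expr_eval \<A> R a" using assms(1,2) by blast
next
  fix v assume "\<exists>R\<in>\<RR>. a \<in> expr_dom \<A> R \<and> v = expr_eval \<A> R a"
  then obtain Q' where "Q' \<in> \<RR>" "a \<in> expr_dom \<A> Q'" "v = expr_eval \<A> Q' a" by blast
  then show "v = expr_eval \<A> Q a" using assms(3)[of Q'] by (simp only:)
qed

theorem theorem3p3:
  fixes \<RR> :: "('d :: finite, 'k :: field) nc_expr set"
    and R :: "('d, 'k) nc_expr"
    and s :: nat
    and Y :: "'d \<Rightarrow> 'k mat"
    and \<R> :: "('d, 'k) fm"
    and scale :: "'k \<Rightarrow> 'a :: ring_1 \<Rightarrow> 'a"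
  assumes "\<RR> \<in> nc_rational_functions"
    and "R \<in> \<RR>"
    and "s \<ge> 1"
    and "Y \<in> fun_dom (matrix_algebra s) \<RR>"
    and "minimal_realization s Y \<R> R"
    and "unital_algebra scale"
    and "stably_finite TYPE('a)"
  shows "(\<forall>n\<ge>1. \<forall>Z \<in> fun_dom (matrix_algebra n) \<RR>.
            (\<lambda>k. kronecker (1\<^sub>m s) (Z k)) \<in> fm_DOM s Y \<R> n \<and>
            kronecker (1\<^sub>m s) (fun_eval (matrix_algebra n) \<RR> Z) =
              fm_eval s Y \<R> n (\<lambda>k. kronecker (1\<^sub>m s) (Z k))) \<and>
         (\<forall>n\<ge>1. s dvd n \<longrightarrow>
            fun_dom (matrix_algebra n) \<RR> \<subseteq> fm_DOM s Y \<R> (n div s) \<and>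
            (\<forall>Z \<in> fun_dom (matrix_algebra n) \<RR>.
               fun_eval (matrix_algebra n) \<RR> Z = fm_eval s Y \<R> (n div s) Z)) \<and>
         (\<forall>a \<in> fun_dom (type_algebra scale) \<RR>.
            (\<lambda>k. tensor_elem scale (1\<^sub>m s) (a k)) \<in> fm_DOM_alg scale s Y \<R> \<and>
            tensor_elem scale (1\<^sub>m s) (fun_eval (type_algebra scale) \<RR> a) =
              fm_eval_alg scale s Y \<R> (\<lambda>k. tensor_elem scale (1\<^sub>m s) (a k)))"
proof -
  \<comment> \<open>A class is the set of expressions related to one representative
    \<open>R0\<close>; this gives the equivalence of \<open>R0\<close> with each member, which is
    what the comparison uses.\<close>
  obtain R0 where R0: "nondegenerate R0" "\<And>Q. Q \<in> \<RR> \<Longrightarrow> nondegenerate Q \<and> evaluation_equivalent R0 Q"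
    using assms(1) unfolding nc_rational_functions_def by (auto elim!: quotientE)
  have Y: "Y k \<in> carrier_mat s s" for k
  proof -
    obtain Q where "Y \<in> expr_dom (matrix_algebra s) Q" using assms(4) unfolding fun_dom_def by blast
    from alg_embedding.expr_dom_carrier[OF alg_embedding_mat[of "\<lambda>i. i" s] this]
    show ?thesis by (simp add: module_mat_def)
  qed
  note hyps = conjunct1[OF R0(2)[OF assms(2)]] R0(1)
  have real: "realizes s Y \<R> Q" if "Q \<in> \<RR>" for Q
    by (rule minimal_realizes[OF assms(5) Y assms(3) hyps]) (use R0(2) assms(2) that in auto)
  have mat: "X \<in> fm_DOM s Y \<R> m" "expr_eval (matrix_algebra (s * m)) Q X = fm_eval s Y \<R> m X"
    if "Q \<in> \<RR>" "m \<ge> 1" "X \<in> expr_dom (matrix_algebra (s * m)) Q" for Q m X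
    using real[OF that(1)] that(2,3) unfolding realizes_def by auto
  have ev_carrier: "expr_eval (matrix_algebra n) Q Z \<in> carrier_mat n n" if "Z \<in> expr_dom (matrix_algebra n) Q" for Z n and Q :: "('d, 'k) nc_expr"
    using alg_embedding.EV_of_dom[OF alg_embedding_mat[of "\<lambda>i. i" n] that] by (simp add: module_mat_def)
  have 1: "(\<lambda>k. kronecker (1\<^sub>m s) (Z k)) \<in> fm_DOM s Y \<R> n \<and>
      kronecker (1\<^sub>m s) (fun_eval (matrix_algebra n) \<RR> Z) = fm_eval s Y \<R> n (\<lambda>k. kronecker (1\<^sub>m s) (Z k))"
    if n: "n \<ge> 1" and Z: "Z \<in> fun_dom (matrix_algebra n) \<RR>" for n Z
  proof -
    have K: "(\<lambda>k. kronecker (1\<^sub>m s) (Z k)) \<in> fm_DOM s Y \<R> n"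
      "kronecker (1\<^sub>m s) (expr_eval (matrix_algebra n) Q Z) = fm_eval s Y \<R> n (\<lambda>k. kronecker (1\<^sub>m s) (Z k))"
      if "Q \<in> \<RR>" "Z \<in> expr_dom (matrix_algebra n) Q" for Q
      using mat[OF that(1) n kronecker_one_dom(1)[OF that(2)]] unfolding kronecker_one_dom(2)[OF that(2)] by auto
    obtain Q where Q: "Q \<in> \<RR>" "Z \<in> expr_dom (matrix_algebra n) Q" using Z unfolding fun_dom_def by blast
    have "fun_eval (matrix_algebra n) \<RR> Z = expr_eval (matrix_algebra n) Q Z"
    proof (rule fun_eval_eq[OF Q])
      fix Q' assume Q': "Q' \<in> \<RR>" "Z \<in> expr_dom (matrix_algebra n) Q'"
      show "expr_eval (matrix_algebra n) Q' Z = expr_eval (matrix_algebra n) Q Z"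
        by (rule kronecker_one_inject[OF ev_carrier[OF Q'(2)] ev_carrier[OF Q(2)] assms(3)]) (simp only: K(2)[OF Q] K(2)[OF Q'])
    qed
    then show ?thesis using K[OF Q] by simp
  qed
  have 2: "Z \<in> fm_DOM s Y \<R> (n div s) \<and> fun_eval (matrix_algebra n) \<RR> Z = fm_eval s Y \<R> (n div s) Z"
    if n: "n \<ge> 1" "s dvd n" and Z: "Z \<in> fun_dom (matrix_algebra n) \<RR>" for n Z
  proof -
    obtain m where m: "n = s * m" using n(2) by blast
    have m': "m \<ge> 1" "n div s = m" using n(1) m assms(3) by (cases m; auto)+
    obtain Q where Q: "Q \<in> \<RR>" "Z \<in> expr_dom (matrix_algebra n) Q" using Z unfolding fun_dom_def by blast
    have "fun_eval (matrix_algebra n) \<RR> Z = expr_eval (matrix_algebra n) Q Z"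
      using Q m'(1) by (intro fun_eval_eq) (auto simp: m mat(2))
    then show ?thesis using mat[OF Q(1) m'(1), of Z] Q(2) by (simp add: m'(2)) (simp add: m)
  qed
  have emb: "alg_embedding (type_algebra scale) (\<lambda>x. x) scale 1" by (rule alg_embedding_type[OF assms(6)])
  interpret kalg scale by (rule alg_embedding.kalg[OF emb])
  have o: "of_mat (\<lambda>i. i) (\<lambda>i. i) (1\<^sub>m s) = idm {..<s} (1 :: 'k)" using of_mat_one[of "\<lambda>i. i" s] by simp
  have ti: "of_mat (\<lambda>i. i) (\<lambda>i. i) (tensor_elem scale (1\<^sub>m s) y) = idm {..<s} y" for y
    unfolding of_mat_tensor_elem[OF kalg_axioms] o by (simp add: tens_idm)
  have tc: "tensor_elem scale (1\<^sub>m s) y \<in> carrier_mat s s" for y by (simp add: tensor_elem_def)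
  have 3: "(\<lambda>k. tensor_elem scale (1\<^sub>m s) (a k)) \<in> fm_DOM_alg scale s Y \<R> \<and>
      tensor_elem scale (1\<^sub>m s) (fun_eval (type_algebra scale) \<RR> a) = fm_eval_alg scale s Y \<R> (\<lambda>k. tensor_elem scale (1\<^sub>m s) (a k))"
    if a: "a \<in> fun_dom (type_algebra scale) \<RR>" for a
  proof -
    have K: "(\<lambda>k. tensor_elem scale (1\<^sub>m s) (a k)) \<in> fm_DOM_alg scale s Y \<R>"
      "tensor_elem scale (1\<^sub>m s) (expr_eval (type_algebra scale) Q a) = fm_eval_alg scale s Y \<R> (\<lambda>k. tensor_elem scale (1\<^sub>m s) (a k))"
      if Q: "Q \<in> \<RR>" "a \<in> expr_dom (type_algebra scale) Q" for Q
    proof -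
      let ?v = "expr_eval (type_algebra scale) Q a"
      have "EV scale 1 a Q ?v" using alg_embedding.EV_of_dom[OF emb Q(2)] by simp
      \<comment> \<open>Diagonal copies of the point bring it to the size of the centre; by
        homomorphy the value is copied in the same way.\<close>
      then have "EV (mscale scale) (idm {..<s} 1) (\<lambda>k. idm {..<s} (a k)) Q (idm {..<s} ?v)"
        by (rule EV_hom[OF ring_map_idm[OF finite_lessThan], rotated]) (auto intro!: finmat_eqI simp: entry_mscale entry_idm)
      then have "realization_value scale 1 s Y \<R> (\<lambda>k. idm {..<s} (a k)) (idm {..<s} ?v)"
        by (rule minimal_value[OF assms(5) Y assms(3) hyps, rotated -1])
          (use R0(2) assms(2) Q(1) sfin_all_one[OF assms(7)] kalg_axioms in auto)
      then have "realization_value scale 1 s Y \<R> (\<lambda>k. of_mat (\<lambda>i. i) (\<lambda>i. i) (tensor_elem scale (1\<^sub>m s) (a k))) (idm {..<s} ?v)"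
        by (simp only: ti)
      note av = algebra_value[OF kalg_axioms _ Y tc this]
      have fr: "fm_realization s \<R>" using real[OF Q(1)] by (simp add: realizes_def)
      show "(\<lambda>k. tensor_elem scale (1\<^sub>m s) (a k)) \<in> fm_DOM_alg scale s Y \<R>" by (rule av(1)[OF fr])
      show "tensor_elem scale (1\<^sub>m s) ?v = fm_eval_alg scale s Y \<R> (\<lambda>k. tensor_elem scale (1\<^sub>m s) (a k))"
        using av(3)[OF fr] unfolding ti[symmetric] by (subst (asm) of_mat_inject[OF av(2)[OF fr] tc]) simp_all
    qed
    obtain Q where Q: "Q \<in> \<RR>" "a \<in> expr_dom (type_algebra scale) Q" using a unfolding fun_dom_def by blast
    have "fun_eval (type_algebra scale) \<RR> a = expr_eval (type_algebra scale) Q a"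
    proof (rule fun_eval_eq[OF Q])
      fix Q' assume Q': "Q' \<in> \<RR>" "a \<in> expr_dom (type_algebra scale) Q'"
      have t: "tensor_elem scale (1\<^sub>m s) y $$ (0, 0) = y" for y
        using assms(3) by (simp add: tensor_elem_def scale_one)
      show "expr_eval (type_algebra scale) Q' a = expr_eval (type_algebra scale) Q a"
        using arg_cong[OF trans[OF K(2)[OF Q'] K(2)[OF Q, symmetric]], of "\<lambda>M. M $$ (0, 0)"] unfolding t .
    qed
    then show ?thesis using K[OF Q] by simp
  qed
  show ?thesis using 1 2 3 by blast
qed

end
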